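(* Let $(M,g_L)$ be a Lorentzian manifold, $U$ a timelike Killing vector field on $M$ and $\overline{M}$ a compact lightlike hypersurface of $M$. Let $\lambda=|U|$ and $E=U/\lambda$, and take a lightlike vector field $\xi\in\mathfrak{X}(\overline{M})$ with $g_L(\xi,E)=\frac{1}{\sqrt2}$. Let $X_0$ be the orthogonal projection of $\xi$ onto $E^\perp$ and let $N$ be the symmetric of $-\xi$ with respect to $E$. If (i) $H_L-g_L(\nabla\ln\lambda,\xi)$ has sign on $\overline{M}$ (i.e. it is everywhere $\ge0$ or everywhere $\le0$), and (ii) $0\leq Ric_L(N,\xi)+\triangle\ln\lambda-4\,g_L(\nabla^L_{X_0}E,\nabla^L_{X_0}E)$ on $\overline{M}$, then $\overline{M}$ is totally geodesic.
   Context: Lorentzian metrics have signature $(-,+,\dots,+)$. $|U|=\sqrt{-g_L(U,U)}$. $\nabla^L$ and $Ric_L$ are the Levi-Civita connection and Ricci tensor of $g_L$, with $Ric_L(V,V)=\sum_i\epsilon_i g_L(R_{e_iV}V,e_i)$ for an orthonormal frame, $\epsilon_i=g_L(e_i,e_i)$, $R_{UV}W=\nabla^L_U\nabla^L_VW-\nabla^L_V\nabla^L_UW-\nabla^L_{[U,V]}W$. $\nabla\ln\lambda$ is the $g_L$-gradient and $\triangle=\mathrm{div}\,\nabla$ the $g_L$-Laplacian on $M$. The symmetric with respect to $E$ of $v=\alpha E+Y$, $Y\perp E$, is $\alpha E-Y$; since $\xi=-\frac1{\sqrt2}E+X_0$, one has $N=\frac1{\sqrt2}E+X_0=\sqrt2E+\xi$.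 A lightlike hypersurface is a hypersurface on which the induced metric is degenerate. Its second fundamental form (with respect to $\xi$) is $B(V,W)=-g_L(\nabla^L_V\xi,W)$ for $V,W\in\mathfrak{X}(\overline{M})$; $\overline{M}$ is totally geodesic if $B=0$. The screen distribution is $\mathcal{S}=T\overline{M}\cap E^\perp$, and the lightlike mean curvature is $H_L=\sum_{i=1}^{n-2}B(e_i,e_i)$, where $n=\dim M$ and $\{e_1,\dots,e_{n-2}\}$ is an orthonormal basis of $\mathcal{S}$. *)

theory Defs
  imports "HOL-Analysis.Analysis"
begin

section \<open>Smooth manifolds\<close>

text \<open>The predicates on maps between Euclidean spaces are meant for open sets \<open>S\<close>.\<close>

primrec C_k_on :: "nat \<Rightarrow> 'e::real_normed_vector set \<Rightarrow> ('e \<Rightarrow> 'f::real_normed_vector) \<Rightarrow> bool" where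
  "C_k_on 0 S f \<longleftrightarrow> continuous_on S f"
| "C_k_on (Suc k) S f \<longleftrightarrow>
     (\<forall>x\<in>S. f differentiable (at x)) \<and> (\<forall>v. C_k_on k S (\<lambda>x. frechet_derivative f (at x) v))"

definition C_infinity_on :: "'e::real_normed_vector set \<Rightarrow> ('e \<Rightarrow> 'f::real_normed_vector) \<Rightarrow> bool" where
  "C_infinity_on S f \<longleftrightarrow> (\<forall>k. C_k_on k S f)"

text \<open>A chart is a pair of its domain and its coordinate map; the values of the coordinate map
  outside of the domain are irrelevant. The manifold is the whole type \<open>'a\<close>, its dimension
  is \<open>DIM('e)\<close>.\<close>

type_synonym ('a, 'e) chart = "'a set \<times> ('a \<Rightarrow> 'e)"

definition is_chart :: "('a::topological_space, 'e::euclidean_space) chart \<Rightarrow> bool" where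
  "is_chart = (\<lambda>(U, \<phi>). open U \<and> open (\<phi> ` U) \<and> homeomorphism U (\<phi> ` U) \<phi> (inv_into U \<phi>))"

definition compatible :: "('a::topological_space, 'e::euclidean_space) chart \<Rightarrow> ('a, 'e) chart \<Rightarrow> bool" where
  "compatible = (\<lambda>(U, \<phi>) (V, \<psi>).
     C_infinity_on (\<phi> ` (U \<inter> V)) (\<psi> \<circ> inv_into U \<phi>) \<and>
     C_infinity_on (\<psi> ` (U \<inter> V)) (\<phi> \<circ> inv_into V \<psi>))"

definition smooth_atlas :: "('a::{t2_space, second_countable_topology}, 'e::euclidean_space) chart set \<Rightarrow> bool" where
  "smooth_atlas A \<longleftrightarrow>
     (\<forall>c\<in>A. is_chart c) \<and> (\<Union>c\<in>A. fst c) = UNIV \<and> (\<forall>c\<in>A. \<forall>d\<in>A. compatible c d)"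

definition maximal_atlas :: "('a::topological_space, 'e::euclidean_space) chart set \<Rightarrow> ('a, 'e) chart set" where
  "maximal_atlas A = {c. is_chart c \<and> (\<forall>d\<in>A. compatible c d)}"

definition smooth_functions :: "('a::topological_space, 'e::euclidean_space) chart set \<Rightarrow> ('a \<Rightarrow> real) set" where
  "smooth_functions A = {f. \<forall>(U, \<phi>)\<in>A. C_infinity_on (\<phi> ` U) (f \<circ> inv_into U \<phi>)}"


section \<open>Tangent vectors and vector fields\<close>

text \<open>Tangent vectors at \<open>p\<close> are the derivations at \<open>p\<close> of the algebra of smooth functions. They
  are extended by \<open>0\<close> to non-smooth functions, so that equality of derivations is equality in HOL.\<close>

type_synonym 'a tvec = "('a \<Rightarrow> real) \<Rightarrow> real"
type_synonym 'a vfield = "'a \<Rightarrow> 'a tvec"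

definition tzero :: "'a tvec" where
  "tzero = (\<lambda>f. 0)"

definition tadd :: "'a tvec \<Rightarrow> 'a tvec \<Rightarrow> 'a tvec" where
  "tadd v w = (\<lambda>f. v f + w f)"

definition tdiff :: "'a tvec \<Rightarrow> 'a tvec \<Rightarrow> 'a tvec" where
  "tdiff v w = (\<lambda>f. v f - w f)"

definition tscale :: "real \<Rightarrow> 'a tvec \<Rightarrow> 'a tvec" where
  "tscale c v = (\<lambda>f. c * v f)"

definition tangent_space :: "('a::topological_space, 'e::euclidean_space) chart set \<Rightarrow> 'a \<Rightarrow> 'a tvec set" where
  "tangent_space A p = {v.
     (\<forall>f\<in>smooth_functions A. \<forall>h\<in>smooth_functions A. \<forall>a b.
        v (\<lambda>x. a * f x + b * h x) = a * v f + b * v h) \<and>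
     (\<forall>f\<in>smooth_functions A. \<forall>h\<in>smooth_functions A.
        v (\<lambda>x. f x * h x) = f p * v h + h p * v f) \<and>
     (\<forall>f. f \<notin> smooth_functions A \<longrightarrow> v f = 0)}"

definition vector_fields :: "('a::topological_space, 'e::euclidean_space) chart set \<Rightarrow> 'a vfield set" where
  "vector_fields A = {X. (\<forall>p. X p \<in> tangent_space A p) \<and>
     (\<forall>f\<in>smooth_functions A. (\<lambda>p. X p f) \<in> smooth_functions A)}"

definition lie_bracket :: "'a vfield \<Rightarrow> 'a vfield \<Rightarrow> 'a vfield" where
  "lie_bracket X Y = (\<lambda>p f. X p (\<lambda>q. Y q f) - Y p (\<lambda>q. X q f))"

definition extend_vector :: "('a::topological_space, 'e::euclidean_space) chart set \<Rightarrow> 'a \<Rightarrow> 'a tvec \<Rightarrow> 'a vfield" where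
  "extend_vector A p v = (SOME V. V \<in> vector_fields A \<and> V p = v)"


section \<open>Lorentzian metrics\<close>

type_synonym 'a metric = "'a \<Rightarrow> 'a tvec \<Rightarrow> 'a tvec \<Rightarrow> real"

definition orthonormal_basis :: "('a tvec \<Rightarrow> 'a tvec \<Rightarrow> real) \<Rightarrow> 'a tvec set \<Rightarrow> 'a tvec set \<Rightarrow> bool" where
  "orthonormal_basis b W B \<longleftrightarrow>
     finite B \<and> B \<subseteq> W \<and>
     (\<forall>e\<in>B. b e e = 1 \<or> b e e = -1) \<and>
     (\<forall>e\<in>B. \<forall>e'\<in>B. e \<noteq> e' \<longrightarrow> b e e' = 0) \<and>
     (\<forall>w\<in>W. \<exists>c. w = (\<lambda>f. \<Sum>e\<in>B. c e * e f))"

definition lorentzian_metric :: "('a::topological_space, 'e::euclidean_space) chart set \<Rightarrow> 'a metric \<Rightarrow> bool" where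
  "lorentzian_metric A g \<longleftrightarrow>
     (\<forall>p. \<forall>u\<in>tangent_space A p. \<forall>v\<in>tangent_space A p. \<forall>w\<in>tangent_space A p. \<forall>a b.
        g p (tadd (tscale a u) (tscale b v)) w = a * g p u w + b * g p v w) \<and>
     (\<forall>p. \<forall>u\<in>tangent_space A p. \<forall>v\<in>tangent_space A p. g p u v = g p v u) \<and>
     (\<forall>X\<in>vector_fields A. \<forall>Y\<in>vector_fields A. (\<lambda>p. g p (X p) (Y p)) \<in> smooth_functions A) \<and>
     (\<forall>p. \<exists>B. orthonormal_basis (g p) (tangent_space A p) B \<and> card {e\<in>B. g p e e = -1} = 1)"

definition lorentzian_manifold ::
    "('a::{t2_space, second_countable_topology}, 'e::euclidean_space) chart set \<Rightarrow> 'a metric \<Rightarrow> bool" where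
  "lorentzian_manifold A g \<longleftrightarrow> smooth_atlas A \<and> lorentzian_metric A g"

text \<open>The trace of a bilinear form \<open>T\<close> on the tangent space at \<open>p\<close> with respect to the metric;
  it does not depend on the chosen frame.\<close>

definition metric_trace ::
    "('a::topological_space, 'e::euclidean_space) chart set \<Rightarrow> 'a metric \<Rightarrow> 'a \<Rightarrow>
     ('a tvec \<Rightarrow> 'a tvec \<Rightarrow> real) \<Rightarrow> real" where
  "metric_trace A g p T =
     (\<Sum>e\<in>(SOME B. orthonormal_basis (g p) (tangent_space A p) B). g p e e * T e e)"

text \<open>Orthogonal projection onto \<open>e\<^sup>\<bottom>\<close> and symmetry with respect to \<open>e\<close>, for \<open>b e e = -1\<close>: in the
  decomposition \<open>v = \<alpha> e + y\<close> with \<open>y \<bottom> e\<close> one has \<open>\<alpha> = - b v e\<close>.\<close>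

definition perp_part :: "('a tvec \<Rightarrow> 'a tvec \<Rightarrow> real) \<Rightarrow> 'a tvec \<Rightarrow> 'a tvec \<Rightarrow> 'a tvec" where
  "perp_part b e v = tdiff v (tscale (- b v e) e)"

definition symmetric_wrt :: "('a tvec \<Rightarrow> 'a tvec \<Rightarrow> real) \<Rightarrow> 'a tvec \<Rightarrow> 'a tvec \<Rightarrow> 'a tvec" where
  "symmetric_wrt b e v = tdiff (tscale (- b v e) e) (perp_part b e v)"

text \<open>\<open>L\<^sub>U g = 0\<close> for the Lie derivative.\<close>

definition killing_field ::
    "('a::topological_space, 'e::euclidean_space) chart set \<Rightarrow> 'a metric \<Rightarrow> 'a vfield \<Rightarrow> bool" where
  "killing_field A g U \<longleftrightarrow> U \<in> vector_fields A \<and>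
     (\<forall>X\<in>vector_fields A. \<forall>Y\<in>vector_fields A. \<forall>p.
        U p (\<lambda>q. g q (X q) (Y q)) - g p (lie_bracket U X p) (Y p) - g p (X p) (lie_bracket U Y p) = 0)"

definition timelike :: "'a metric \<Rightarrow> 'a vfield \<Rightarrow> bool" where
  "timelike g U \<longleftrightarrow> (\<forall>p. g p (U p) (U p) < 0)"


section \<open>Levi-Civita connection and curvature\<close>

type_synonym 'a connection = "'a vfield \<Rightarrow> 'a vfield \<Rightarrow> 'a vfield"

definition affine_connection ::
    "('a::topological_space, 'e::euclidean_space) chart set \<Rightarrow> 'a connection \<Rightarrow> bool" where
  "affine_connection A D \<longleftrightarrow>
     (\<forall>X\<in>vector_fields A. \<forall>Y\<in>vector_fields A. D X Y \<in> vector_fields A) \<and>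
     (\<forall>X\<in>vector_fields A. \<forall>Y\<in>vector_fields A. \<forall>Z\<in>vector_fields A.
        \<forall>f\<in>smooth_functions A. \<forall>h\<in>smooth_functions A. \<forall>p.
        D (\<lambda>q. tadd (tscale (f q) (X q)) (tscale (h q) (Y q))) Z p =
          tadd (tscale (f p) (D X Z p)) (tscale (h p) (D Y Z p))) \<and>
     (\<forall>X\<in>vector_fields A. \<forall>Y\<in>vector_fields A. \<forall>Z\<in>vector_fields A. \<forall>p.
        D X (\<lambda>q. tadd (Y q) (Z q)) p = tadd (D X Y p) (D X Z p)) \<and>
     (\<forall>X\<in>vector_fields A. \<forall>Y\<in>vector_fields A. \<forall>f\<in>smooth_functions A. \<forall>p.
        D X (\<lambda>q. tscale (f q) (Y q)) p = tadd (tscale (X p f) (Y p)) (tscale (f p) (D X Y p)))"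

text \<open>\<open>D\<close> is determined by this on smooth vector fields only; its values on other arguments are
  arbitrary and never used.\<close>

definition levi_civita_connection ::
    "('a::topological_space, 'e::euclidean_space) chart set \<Rightarrow> 'a metric \<Rightarrow> 'a connection \<Rightarrow> bool" where
  "levi_civita_connection A g D \<longleftrightarrow> affine_connection A D \<and>
     (\<forall>X\<in>vector_fields A. \<forall>Y\<in>vector_fields A. \<forall>p.
        tdiff (D X Y p) (D Y X p) = lie_bracket X Y p) \<and>
     (\<forall>X\<in>vector_fields A. \<forall>Y\<in>vector_fields A. \<forall>Z\<in>vector_fields A. \<forall>p.
        X p (\<lambda>q. g q (Y q) (Z q)) = g p (D X Y p) (Z p) + g p (Y p) (D X Z p))"

text \<open>The following two are tensorial in the tangent vectors, so the choice of the extensions is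
  irrelevant.\<close>

definition cov_deriv ::
    "('a::topological_space, 'e::euclidean_space) chart set \<Rightarrow> 'a connection \<Rightarrow> 'a \<Rightarrow>
     'a tvec \<Rightarrow> 'a vfield \<Rightarrow> 'a tvec" where
  "cov_deriv A D p v Y = D (extend_vector A p v) Y p"

definition curvature ::
    "('a::topological_space, 'e::euclidean_space) chart set \<Rightarrow> 'a connection \<Rightarrow> 'a \<Rightarrow>
     'a tvec \<Rightarrow> 'a tvec \<Rightarrow> 'a tvec \<Rightarrow> 'a tvec" where
  "curvature A D p u v w =
     (let X = extend_vector A p u; Y = extend_vector A p v; Z = extend_vector A p w
      in tdiff (tdiff (D X (D Y Z) p) (D Y (D X Z) p)) (D (lie_bracket X Y) Z p))"

definition ricci ::
    "('a::topological_space, 'e::euclidean_space) chart set \<Rightarrow> 'a metric \<Rightarrow> 'a connection \<Rightarrow> 'a \<Rightarrow>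
     'a tvec \<Rightarrow> 'a tvec \<Rightarrow> real" where
  "ricci A g D p v w = metric_trace A g p (\<lambda>e e'. g p (curvature A D p e v w) e')"

definition gradient ::
    "('a::topological_space, 'e::euclidean_space) chart set \<Rightarrow> 'a metric \<Rightarrow> ('a \<Rightarrow> real) \<Rightarrow> 'a vfield" where
  "gradient A g f = (\<lambda>p. THE v. v \<in> tangent_space A p \<and> (\<forall>w\<in>tangent_space A p. g p v w = w f))"

definition divergence ::
    "('a::topological_space, 'e::euclidean_space) chart set \<Rightarrow> 'a metric \<Rightarrow> 'a connection \<Rightarrow>
     'a vfield \<Rightarrow> 'a \<Rightarrow> real" where
  "divergence A g D X p = metric_trace A g p (\<lambda>e e'. g p (cov_deriv A D p e X) e')"

definition laplacian ::
    "('a::topological_space, 'e::euclidean_space) chart set \<Rightarrow> 'a metric \<Rightarrow> 'a connection \<Rightarrow>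
     ('a \<Rightarrow> real) \<Rightarrow> 'a \<Rightarrow> real" where
  "laplacian A g D f = divergence A g D (gradient A g f)"


section \<open>Lightlike hypersurfaces\<close>

text \<open>Embedded submanifolds of codimension one, by slice charts.\<close>

definition hypersurface :: "('a::topological_space, 'e::euclidean_space) chart set \<Rightarrow> 'a set \<Rightarrow> bool" where
  "hypersurface A S \<longleftrightarrow>
     (\<forall>p\<in>S. \<exists>(U, \<phi>)\<in>maximal_atlas A. p \<in> U \<and>
        (\<exists>b. b \<noteq> 0 \<and> \<phi> ` (U \<inter> S) = \<phi> ` U \<inter> {x. b \<bullet> x = 0}))"

text \<open>The tangent space of an embedded submanifold \<open>S\<close>, as a subspace of the tangent space of the
  ambient manifold, consists of the derivations that annihilate the smooth functions vanishing
  on \<open>S\<close>.\<close>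

definition tangent_space_of :: "('a::topological_space, 'e::euclidean_space) chart set \<Rightarrow> 'a set \<Rightarrow> 'a \<Rightarrow> 'a tvec set" where
  "tangent_space_of A S p =
     {v \<in> tangent_space A p. \<forall>f\<in>smooth_functions A. (\<forall>q\<in>S. f q = 0) \<longrightarrow> v f = 0}"

definition smooth_functions_of :: "('a::topological_space, 'e::euclidean_space) chart set \<Rightarrow> 'a set \<Rightarrow> ('a \<Rightarrow> real) set" where
  "smooth_functions_of A S =
     {h. \<forall>p\<in>S. \<exists>W f. open W \<and> p \<in> W \<and> f \<in> smooth_functions A \<and> (\<forall>q\<in>S \<inter> W. h q = f q)}"

text \<open>Vector fields on \<open>S\<close> are represented by functions on the ambient manifold whose values
  outside of \<open>S\<close> are irrelevant.\<close>

definition vector_fields_of :: "('a::topological_space, 'e::euclidean_space) chart set \<Rightarrow> 'a set \<Rightarrow> 'a vfield set" where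
  "vector_fields_of A S = {X. (\<forall>p\<in>S. X p \<in> tangent_space_of A S p) \<and>
     (\<forall>f\<in>smooth_functions A. (\<lambda>p. X p f) \<in> smooth_functions_of A S)}"

definition lightlike_hypersurface ::
    "('a::topological_space, 'e::euclidean_space) chart set \<Rightarrow> 'a metric \<Rightarrow> 'a set \<Rightarrow> bool" where
  "lightlike_hypersurface A g S \<longleftrightarrow> hypersurface A S \<and>
     (\<forall>p\<in>S. \<exists>v\<in>tangent_space_of A S p. v \<noteq> tzero \<and> (\<forall>w\<in>tangent_space_of A S p. g p v w = 0))"

text \<open>The derivative of a vector field on \<open>S\<close> in a direction tangent to \<open>S\<close>, by means of an
  extension to the ambient manifold. For closed \<open>S\<close> an extension exists, and the value is
  independent of it.\<close>

definition cov_deriv_along ::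
    "('a::topological_space, 'e::euclidean_space) chart set \<Rightarrow> 'a connection \<Rightarrow> 'a set \<Rightarrow> 'a \<Rightarrow>
     'a tvec \<Rightarrow> 'a vfield \<Rightarrow> 'a tvec" where
  "cov_deriv_along A D S p v \<xi> =
     cov_deriv A D p v (SOME X. X \<in> vector_fields A \<and> (\<forall>q\<in>S. X q = \<xi> q))"

definition second_fundamental_form ::
    "('a::topological_space, 'e::euclidean_space) chart set \<Rightarrow> 'a metric \<Rightarrow> 'a connection \<Rightarrow> 'a set \<Rightarrow>
     'a vfield \<Rightarrow> 'a vfield \<Rightarrow> 'a vfield \<Rightarrow> 'a \<Rightarrow> real" where
  "second_fundamental_form A g D S \<xi> V W p = - g p (cov_deriv_along A D S p (V p) \<xi>) (W p)"

definition screen ::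
    "('a::topological_space, 'e::euclidean_space) chart set \<Rightarrow> 'a metric \<Rightarrow> 'a set \<Rightarrow> 'a vfield \<Rightarrow>
     'a \<Rightarrow> 'a tvec set" where
  "screen A g S E p = {v \<in> tangent_space_of A S p. g p v (E p) = 0}"

text \<open>The second fundamental form is evaluated at tangent vectors \<open>e\<close> through the constant
  function \<open>\<lambda>_. e\<close>, as only the value at \<open>p\<close> enters.\<close>

definition lightlike_mean_curvature ::
    "('a::topological_space, 'e::euclidean_space) chart set \<Rightarrow> 'a metric \<Rightarrow> 'a connection \<Rightarrow> 'a set \<Rightarrow>
     'a vfield \<Rightarrow> 'a vfield \<Rightarrow> 'a \<Rightarrow> real" where
  "lightlike_mean_curvature A g D S E \<xi> p =
     (\<Sum>e\<in>(SOME B. orthonormal_basis (g p) (screen A g S E p) B).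
        second_fundamental_form A g D S \<xi> (\<lambda>_. e) (\<lambda>_. e) p)"

definition totally_geodesic ::
    "('a::topological_space, 'e::euclidean_space) chart set \<Rightarrow> 'a metric \<Rightarrow> 'a connection \<Rightarrow> 'a set \<Rightarrow>
     'a vfield \<Rightarrow> bool" where
  "totally_geodesic A g D S \<xi> \<longleftrightarrow>
     (\<forall>V\<in>vector_fields_of A S. \<forall>W\<in>vector_fields_of A S. \<forall>p\<in>S.
        second_fundamental_form A g D S \<xi> V W p = 0)"

end

theory Submission
  imports Defs "HOL-Library.Function_Algebras"
begin

text \<open>Rescale the null field to \<open>k = \<xi> / \<lambda>\<close>, where \<open>\<lambda> = \<bar>U\<bar>\<close>. The tangent spaces of the hypersurface \<open>S\<close> are the
  orthogonal complements of \<open>k\<close> (\<open>lightlike_tangent_space\<close>), the Killing field \<open>U\<close> is transversal to \<open>S\<close>, and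
  \<open>c = g(U,k)\<close> is constant on \<open>S\<close>. The field \<open>k\<close> extends to the manifold with \<open>[U,k] = 0\<close> along \<open>S\<close>
  (\<open>adapted_null_field\<close>). At the points of \<open>S\<close>, the endomorphism \<open>\<nabla>k\<close> is then self-adjoint and annihilates \<open>k\<close>
  (\<open>cov_k_symmetric\<close>, \<open>cov_k_geodesic\<close>). Hence \<open>tr (\<nabla>k)\<^sup>2\<close> is the sum of the numbers \<open>g(\<nabla>\<^sub>e k, \<nabla>\<^sub>e k) \<ge> 0\<close> over an
  orthonormal basis of the screen. If this sum vanishes, then every \<open>\<nabla>\<^sub>e k\<close> is null and orthogonal to \<open>k\<close>,
  hence a multiple of \<open>k\<close>, and \<open>S\<close> is totally geodesic.

  Contraction with \<open>U\<close> turns the volume form of the manifold into a volume form on \<open>S\<close>. The divergence of a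
  field \<open>X\<close> tangent to \<open>S\<close> with respect to it is \<open>div\<^sub>S X = div X - U (g(X,k)) / c\<close>. By Stokes' theorem on the
  compact \<open>S\<close>, the function \<open>div\<^sub>S X\<close> vanishes if it is nonnegative (\<open>divS_nonneg_imp_zero\<close>). To see this without
  integration on \<open>S\<close>, let \<open>F\<close> be a defining function of \<open>S\<close>. The field \<open>(U F) X - (X F) U\<close> is tangent to all level
  sets of \<open>F\<close>, and its divergence on \<open>S\<close> is \<open>(U F) div\<^sub>S X\<close>. Cut it off to a thin slab \<open>\<bar>F\<bar> < \<epsilon>\<close>; the divergence
  theorem on the manifold, divided by \<open>\<epsilon>\<close>, gives the claim as \<open>\<epsilon>\<close> tends to \<open>0\<close> (\<open>Stokes_positivity\<close>).

  This is used twice; put \<open>\<psi> = ln \<lambda>\<close>. First, \<open>div\<^sub>S (\<lambda> k) = \<lambda> (div k + k \<psi>)\<close> is up to its sign the function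
  \<open>H\<^sub>L - g(\<nabla>\<psi>, \<xi>)\<close>. As the latter has a sign, \<open>div k = - k \<psi>\<close> on \<open>S\<close> (\<open>expansion_zero\<close>). Second, let
  \<open>X = \<lambda>\<^sup>2 (k \<psi>) k + \<surd>2 \<nabla>\<^sub>k U + (\<nabla>\<psi> - (k \<psi> / c) U)\<close>. Two instances of the Bochner formula, namely
  Raychaudhuri's equation \<open>k (div k) + tr (\<nabla>k)\<^sup>2 + Ric(k,k) = 0\<close> (\<open>Raychaudhuri\<close>) and
  \<open>div (\<nabla>\<^sub>k U) = Ric(k,U)\<close> (\<open>dv_cov_k_U\<close>), together with \<open>N = \<surd>2 E + \<xi>\<close> lead to
  \<open>div\<^sub>S X = \<lambda>\<^sup>2 (k \<psi>)\<^sup>2 + \<lambda>\<^sup>2 tr (\<nabla>k)\<^sup>2 + Ric(N,\<xi>) + \<triangle>\<psi>\<close>. The last two terms are at least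
  \<open>4 g(\<nabla>\<^sub>X\<^sub>0 E, \<nabla>\<^sub>X\<^sub>0 E)\<close>, which is nonnegative because \<open>\<nabla>\<^sub>X\<^sub>0 E\<close> is orthogonal to the timelike \<open>E\<close>. So
  \<open>div\<^sub>S X \<ge> 0\<close>, hence \<open>div\<^sub>S X = 0\<close>, and \<open>tr (\<nabla>k)\<^sup>2\<close> vanishes on \<open>S\<close> (\<open>totally_geodesic_null_field\<close>).\<close>

section \<open>Calculus of smooth maps between Euclidean spaces\<close>

lemma differentiable_frechet:
  "f differentiable F \<Longrightarrow> (f has_derivative frechet_derivative f F) F"
  using frechet_derivative_works by blast

lemma C_k_on_subset: "C_k_on k S f \<Longrightarrow> T \<subseteq> S \<Longrightarrow> C_k_on k T f"
  by (induction k arbitrary: f) (auto intro: continuous_on_subset)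

lemma C_k_on_cong:
  assumes "open S" "\<And>x. x \<in> S \<Longrightarrow> f x = g x"
  shows "C_k_on k S f \<longleftrightarrow> C_k_on k S g"
  using assms(2)
proof (induction k arbitrary: f g)
  case 0
  then show ?case by (simp cong: continuous_on_cong)
next
  case (Suc k)
  have *: "C_k_on (Suc k) S g" if C: "C_k_on (Suc k) S f" and eq: "\<And>x. x \<in> S \<Longrightarrow> f x = g x"
    for f g :: "'a \<Rightarrow> 'b"
  proof -
    have d: "f differentiable (at x)" if "x \<in> S" for x
      using that C by simp
    have fr: "frechet_derivative f (at x) = frechet_derivative g (at x)" if "x \<in> S" for x
      using frechet_derivative_transform_within_open[OF d[OF that] assms(1) that eq] .
    have d': "g differentiable (at x)" if "x \<in> S" for x
      using has_derivative_transform_within_open[OF differentiable_frechet[OF d[OF that]] assms(1) that eq]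
      by (rule differentiableI)
    have "C_k_on k S (\<lambda>x. frechet_derivative g (at x) v)" for v
    proof -
      have "C_k_on k S (\<lambda>x. frechet_derivative f (at x) v) \<longleftrightarrow>
            C_k_on k S (\<lambda>x. frechet_derivative g (at x) v)"
        by (rule Suc.IH) (simp add: fr)
      then show ?thesis using C by simp
    qed
    then show ?thesis using d' by simp
  qed
  show ?case using *[of f g] *[of g f] Suc.prems by metis
qed

lemma C_k_on_local:
  assumes "\<And>x. x \<in> S \<Longrightarrow> \<exists>T. open T \<and> x \<in> T \<and> C_k_on k T f"
  shows "C_k_on k S f"
  using assms
proof (induction k arbitrary: f)
  case 0
  have "isCont f x" if "x \<in> S" for x
    using 0[OF that] continuous_on_eq_continuous_at by auto
  then show ?case by (simp add: continuous_at_imp_continuous_on)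
next
  case (Suc k)
  have "f differentiable (at x)" if "x \<in> S" for x
    using Suc.prems[OF that] by auto
  moreover have "C_k_on k S (\<lambda>x. frechet_derivative f (at x) v)" for v
  proof (rule Suc.IH)
    fix x assume "x \<in> S"
    from Suc.prems[OF this] show "\<exists>T. open T \<and> x \<in> T \<and> C_k_on k T (\<lambda>x. frechet_derivative f (at x) v)"
      by auto
  qed
  ultimately show ?case by simp
qed

lemma C_k_on_SucD: "C_k_on (Suc k) S f \<Longrightarrow> C_k_on k S f"
proof (induction k arbitrary: f)
  case 0
  then show ?case
    by (auto intro!: continuous_at_imp_continuous_on differentiable_imp_continuous_within)
next
  case (Suc k)
  then show ?case by (metis C_k_on.simps(2))
qed

lemma C_k_on_const [simp]: "C_k_on k S (\<lambda>x. c)"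
  by (induction k arbitrary: c) auto

lemma C_k_on_bounded_linear: "bounded_linear L \<Longrightarrow> C_k_on k S L"
  using bounded_linear_imp_differentiable[of L] has_derivative_bounded_linear
  by (cases k) (auto simp: frechet_derivative_at[OF bounded_linear_imp_has_derivative, symmetric]
    intro!: linear_continuous_on)

lemma C_k_on_bounded_linear_comp:
  assumes "open S" "bounded_linear L" "C_k_on k S f"
  shows "C_k_on k S (\<lambda>x. L (f x))"
  using assms(3)
proof (induction k arbitrary: f)
  case 0
  then show ?case using bounded_linear.continuous_on[OF assms(2)] by simp
next
  case (Suc k)
  have d: "((\<lambda>x. L (f x)) has_derivative (\<lambda>v. L (frechet_derivative f (at x) v))) (at x)"
    if "x \<in> S" for x
    using Suc.prems that by (auto intro!: bounded_linear.has_derivative[OF assms(2)] differentiable_frechet)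
  have "C_k_on k S (\<lambda>x. frechet_derivative (\<lambda>x. L (f x)) (at x) v)" for v
  proof -
    have "C_k_on k S (\<lambda>x. L (frechet_derivative f (at x) v))"
      using Suc.prems by (intro Suc.IH) simp
    then show ?thesis
      by (subst C_k_on_cong[OF assms(1)]) (auto simp: frechet_derivative_at[OF d, symmetric])
  qed
  moreover have "(\<lambda>x. L (f x)) differentiable (at x)" if "x \<in> S" for x
    using d[OF that] unfolding differentiable_def by blast
  ultimately show ?case by simp
qed

lemma C_k_on_add:
  assumes "open S" "C_k_on k S f" "C_k_on k S g"
  shows "C_k_on k S (\<lambda>x. f x + g x)"
  using assms(2,3)
proof (induction k arbitrary: f g)
  case 0
  then show ?case by (simp add: continuous_on_add)
next
  case (Suc k)
  have d: "((\<lambda>x. f x + g x) has_derivative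
      (\<lambda>v. frechet_derivative f (at x) v + frechet_derivative g (at x) v)) (at x)" if "x \<in> S" for x
    using Suc.prems that by (auto intro!: has_derivative_add differentiable_frechet)
  have "C_k_on k S (\<lambda>x. frechet_derivative (\<lambda>x. f x + g x) (at x) v)" for v
  proof -
    have "C_k_on k S (\<lambda>x. frechet_derivative f (at x) v + frechet_derivative g (at x) v)"
      using Suc.prems by (intro Suc.IH) simp_all
    then show ?thesis
      by (subst C_k_on_cong[OF assms(1)]) (auto simp: frechet_derivative_at[OF d, symmetric])
  qed
  then show ?case using Suc.prems by (simp add: differentiable_add)
qed

lemma C_k_on_sum:
  assumes "open S" "\<And>i. i \<in> I \<Longrightarrow> C_k_on k S (f i)"
  shows "C_k_on k S (\<lambda>x. \<Sum>i\<in>I. f i x)"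
  using assms(2) by (induction I rule: infinite_finite_induct) (auto intro: C_k_on_add[OF assms(1)])

lemma C_k_on_scaleR:
  assumes "open S" "C_k_on k S f" "C_k_on k S g"
  shows "C_k_on k S (\<lambda>x. f x *\<^sub>R g x)"
  using assms(2,3)
proof (induction k arbitrary: f g)
  case 0
  then show ?case by (simp add: continuous_on_scaleR)
next
  case (Suc k)
  have d: "((\<lambda>x. f x *\<^sub>R g x) has_derivative
      (\<lambda>v. f x *\<^sub>R frechet_derivative g (at x) v + frechet_derivative f (at x) v *\<^sub>R g x)) (at x)" if "x \<in> S" for x
    using Suc.prems that by (auto intro!: has_derivative_scaleR differentiable_frechet)
  have "C_k_on k S (\<lambda>x. frechet_derivative (\<lambda>x. f x *\<^sub>R g x) (at x) v)" for v
  proof -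
    have "C_k_on k S (\<lambda>x. f x *\<^sub>R frechet_derivative g (at x) v + frechet_derivative f (at x) v *\<^sub>R g x)"
      using Suc.prems C_k_on_SucD[OF Suc.prems(1)] C_k_on_SucD[OF Suc.prems(2)]
      by (intro C_k_on_add[OF assms(1)] Suc.IH) simp_all
    then show ?thesis
      by (subst C_k_on_cong[OF assms(1)]) (auto simp: frechet_derivative_at[OF d, symmetric])
  qed
  moreover have "(\<lambda>x. f x *\<^sub>R g x) differentiable (at x)" if "x \<in> S" for x
    using d[OF that] unfolding differentiable_def by blast
  ultimately show ?case by simp
qed

text \<open>By the chain rule a directional derivative of the composition is a sum, over the basis of the
  intermediate space, of products of derivatives of the two maps; induction applies to the factors.\<close>

lemma C_k_on_compose:
  fixes f :: "'a::euclidean_space \<Rightarrow> 'b::euclidean_space" and g :: "'b \<Rightarrow> 'c::real_normed_vector"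
  assumes "open S" "open T" "f ` S \<subseteq> T" "C_k_on k S f" "C_k_on k T g"
  shows "C_k_on k S (\<lambda>x. g (f x))"
  using assms(4,5)
proof (induction k arbitrary: g)
  case 0
  then show ?case using continuous_on_compose2[of T g S f] assms(3) by simp
next
  case (Suc k)
  have Df: "(f has_derivative frechet_derivative f (at x)) (at x)" if "x \<in> S" for x
    using Suc.prems that by (auto intro!: differentiable_frechet)
  have Dg: "(g has_derivative frechet_derivative g (at y)) (at y)" if "y \<in> T" for y
    using Suc.prems that by (auto intro!: differentiable_frechet)
  have d: "((\<lambda>x. g (f x)) has_derivative
      (\<lambda>v. frechet_derivative g (at (f x)) (frechet_derivative f (at x) v))) (at x)" if "x \<in> S" for x
    using has_derivative_compose[OF Df[OF that] Dg] that assms(3) by auto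
  have eq: "frechet_derivative (\<lambda>x. g (f x)) (at x) v =
      (\<Sum>i\<in>Basis. (frechet_derivative f (at x) v \<bullet> i) *\<^sub>R frechet_derivative g (at (f x)) i)" if "x \<in> S" for x v
  proof -
    have lin: "linear (frechet_derivative g (at (f x)))"
      using Dg that assms(3) has_derivative_linear by blast
    have "frechet_derivative (\<lambda>x. g (f x)) (at x) v =
        frechet_derivative g (at (f x)) (\<Sum>i\<in>Basis. (frechet_derivative f (at x) v \<bullet> i) *\<^sub>R i)"
      by (simp add: euclidean_representation frechet_derivative_at[OF d[OF that], symmetric])
    then show ?thesis by (simp add: linear_sum[OF lin] linear_scale[OF lin])
  qed
  have "C_k_on k S (\<lambda>x. frechet_derivative (\<lambda>x. g (f x)) (at x) v)" for v
  proof -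
    have "C_k_on k S (\<lambda>x. \<Sum>i\<in>Basis. (frechet_derivative f (at x) v \<bullet> i) *\<^sub>R frechet_derivative g (at (f x)) i)"
      using Suc.prems C_k_on_SucD[OF Suc.prems(1)]
      by (intro C_k_on_sum C_k_on_scaleR assms(1) Suc.IH
          C_k_on_bounded_linear_comp[OF assms(1) bounded_linear_inner_left]) simp_all
    then show ?thesis
      by (subst C_k_on_cong[OF assms(1)]) (auto simp: eq)
  qed
  moreover have "(\<lambda>x. g (f x)) differentiable (at x)" if "x \<in> S" for x
    using d[OF that] unfolding differentiable_def by blast
  ultimately show ?case by simp
qed

lemma C_infinity_on_frechet:
  "C_infinity_on S f \<Longrightarrow> C_infinity_on S (\<lambda>x. frechet_derivative f (at x) v)"
  unfolding C_infinity_on_def by (metis C_k_on.simps(2))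

lemma C_infinity_on_has_derivative:
  "C_infinity_on S f \<Longrightarrow> x \<in> S \<Longrightarrow> (f has_derivative frechet_derivative f (at x)) (at x)"
  unfolding C_infinity_on_def by (metis C_k_on.simps(2) differentiable_frechet)

lemma C_infinity_on_continuous_on: "C_infinity_on S f \<Longrightarrow> continuous_on S f"
  unfolding C_infinity_on_def by (metis C_k_on.simps(1))

lemma C_infinity_on_compose:
  fixes f :: "'a::euclidean_space \<Rightarrow> 'b::euclidean_space" and g :: "'b \<Rightarrow> 'c::real_normed_vector"
  assumes "open S" "open T" "f ` S \<subseteq> T" "C_infinity_on S f" "C_infinity_on T g"
  shows "C_infinity_on S (\<lambda>x. g (f x))"
  using assms C_k_on_compose unfolding C_infinity_on_def by blast

lemma C_infinity_on_add:
  "open S \<Longrightarrow> C_infinity_on S f \<Longrightarrow> C_infinity_on S g \<Longrightarrow> C_infinity_on S (\<lambda>x. f x + g x)"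
  unfolding C_infinity_on_def by (blast intro: C_k_on_add)

lemma C_infinity_on_scaleR:
  "open S \<Longrightarrow> C_infinity_on S f \<Longrightarrow> C_infinity_on S g \<Longrightarrow> C_infinity_on S (\<lambda>x. f x *\<^sub>R g x)"
  unfolding C_infinity_on_def by (blast intro: C_k_on_scaleR)

lemma C_infinity_on_mult:
  fixes f g :: "_ \<Rightarrow> real"
  shows "open S \<Longrightarrow> C_infinity_on S f \<Longrightarrow> C_infinity_on S g \<Longrightarrow> C_infinity_on S (\<lambda>x. f x * g x)"
  using C_infinity_on_scaleR[of S f g] by simp

lemma C_infinity_on_const [simp]: "C_infinity_on S (\<lambda>x. c)"
  unfolding C_infinity_on_def by simp

lemma C_infinity_on_sum:
  "open S \<Longrightarrow> (\<And>i. i \<in> I \<Longrightarrow> C_infinity_on S (f i)) \<Longrightarrow> C_infinity_on S (\<lambda>x. \<Sum>i\<in>I. f i x)"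
  unfolding C_infinity_on_def by (blast intro: C_k_on_sum)

lemma C_infinity_on_bounded_linear: "bounded_linear L \<Longrightarrow> C_infinity_on S L"
  unfolding C_infinity_on_def by (blast intro: C_k_on_bounded_linear)

lemma C_infinity_on_subset: "C_infinity_on S f \<Longrightarrow> T \<subseteq> S \<Longrightarrow> C_infinity_on T f"
  unfolding C_infinity_on_def by (blast intro: C_k_on_subset)

lemma C_infinity_on_cong:
  "open S \<Longrightarrow> (\<And>x. x \<in> S \<Longrightarrow> f x = g x) \<Longrightarrow> C_infinity_on S f \<longleftrightarrow> C_infinity_on S g"
  unfolding C_infinity_on_def using C_k_on_cong by blast

lemma C_infinity_on_local:
  assumes "\<And>x. x \<in> S \<Longrightarrow> \<exists>T. open T \<and> x \<in> T \<and> C_infinity_on T f"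
  shows "C_infinity_on S f"
  unfolding C_infinity_on_def
proof
  fix k show "C_k_on k S f"
    by (rule C_k_on_local) (use assms in \<open>auto simp: C_infinity_on_def\<close>)
qed

text \<open>On the real line the directional derivatives are multiples of the ordinary derivative.\<close>

lemma C_k_on_Suc_real:
  fixes f :: "real \<Rightarrow> real"
  assumes "open S" "\<And>x. x \<in> S \<Longrightarrow> (f has_real_derivative f' x) (at x)" "C_k_on k S f'"
  shows "C_k_on (Suc k) S f"
proof -
  have d: "frechet_derivative f (at x) v = v *\<^sub>R f' x" if "x \<in> S" for x v
  proof -
    have "(f has_derivative (\<lambda>v. f' x * v)) (at x)"
      using assms(2)[OF that] by (simp add: has_field_derivative_def)
    from frechet_derivative_at[OF this] show ?thesis by (metis mult.commute real_scaleR_def)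
  qed
  have "C_k_on k S (\<lambda>x. frechet_derivative f (at x) v)" for v
    using C_k_on_scaleR[OF assms(1) C_k_on_const[of k S v] assms(3)]
    by (subst C_k_on_cong[OF assms(1)]) (auto simp: d)
  then show ?thesis
    using assms(2) by (auto simp: real_differentiable_def)
qed

lemma C_infinity_on_inverse: "C_infinity_on {x::real. x > 0} inverse"
proof -
  have o: "open {x::real. x > 0}" by (simp add: open_Collect_less)
  have "C_k_on k {x::real. x > 0} inverse" for k
  proof (induction k)
    case 0
    then show ?case by (auto intro!: continuous_intros)
  next
    case (Suc k)
    have "C_k_on k {x::real. x > 0} (\<lambda>x. (- 1) *\<^sub>R (inverse x *\<^sub>R inverse x))"
      by (intro C_k_on_scaleR o Suc C_k_on_const)
    then show ?case
      by (rule C_k_on_Suc_real[OF o, rotated]) (auto intro!: derivative_eq_intros)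
  qed
  then show ?thesis by (simp add: C_infinity_on_def)
qed

lemma C_infinity_on_ln: "C_infinity_on {x::real. x > 0} ln"
  unfolding C_infinity_on_def
proof
  fix k
  show "C_k_on k {x::real. x > 0} ln"
  proof (cases k)
    case 0
    then show ?thesis by (auto intro!: continuous_intros)
  next
    case (Suc m)
    then show ?thesis
      using C_infinity_on_inverse
      by (auto intro!: C_k_on_Suc_real[where f' = inverse] derivative_eq_intros open_Collect_less
          simp: C_infinity_on_def field_simps simp del: C_k_on.simps)
  qed
qed

lemma C_infinity_on_exp: "C_infinity_on UNIV (exp :: real \<Rightarrow> real)"
proof -
  have "C_k_on k UNIV (exp :: real \<Rightarrow> real)" for k
  proof (induction k)
    case 0
    show ?case by (simp add: continuous_on_exp)
  next
    case (Suc k)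
    then show ?case
      by (rule C_k_on_Suc_real[OF open_UNIV, rotated]) (auto intro!: derivative_eq_intros)
  qed
  then show ?thesis by (simp add: C_infinity_on_def)
qed

section \<open>Smooth cut-off functions\<close>

text \<open>The family \<open>x\<^sup>-\<^sup>n exp (-1/x)\<close> is closed under differentiation up to linear combinations, so
  all its members are smooth at once.\<close>

definition flat :: "nat \<Rightarrow> real \<Rightarrow> real" where
  "flat n x = (if x \<le> 0 then 0 else inverse x ^ n * exp (- inverse x))"

lemma flat_tendsto_0: "(flat n \<longlongrightarrow> 0) (at 0)"
proof -
  have l: "(flat n \<longlongrightarrow> 0) (at_left 0)"
    by (rule tendsto_eventually) (auto simp: flat_def eventually_at_filter)
  have "((\<lambda>x::real. inverse x ^ n / exp (inverse x)) \<longlongrightarrow> 0) (at_right 0)"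
    by (rule filterlim_compose[OF tendsto_power_div_exp_0 filterlim_inverse_at_top_right])
  then have r: "(flat n \<longlongrightarrow> 0) (at_right 0)"
    by (rule Lim_transform_eventually)
      (auto simp: flat_def eventually_at_filter exp_minus divide_inverse)
  show ?thesis using filterlim_split_at_real[OF l r] .
qed

lemma flat_has_derivative:
  "(flat n has_real_derivative (flat (n + 2) x - real n * flat (n + 1) x)) (at x)"
proof -
  consider "x < 0" | "x = 0" | "x > 0" by linarith
  then show ?thesis
  proof cases
    case 1
    have "((\<lambda>x. 0) has_real_derivative 0) (at x)" by simp
    then have "(flat n has_real_derivative 0) (at x)"
      by (rule has_field_derivative_transform_within_open[where S = "{..<0}"])
        (use 1 in \<open>auto simp: flat_def\<close>)
    then show ?thesis using 1 by (simp add: flat_def)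
  next
    case 2
    have "((\<lambda>h. (flat n (0 + h) - flat n 0) / h) \<longlongrightarrow> 0) (at 0)"
      by (rule Lim_transform_eventually[OF flat_tendsto_0[of "Suc n"]])
        (auto simp: flat_def eventually_at_filter divide_inverse)
    then show ?thesis using 2 by (simp add: DERIV_def flat_def)
  next
    case 3
    let ?y = "inverse x"
    have "((\<lambda>x. inverse x ^ n * exp (- inverse x)) has_real_derivative
        ?y ^ n * (exp (- ?y) * ?y\<^sup>2) - real n * ?y ^ (n - 1) * ?y\<^sup>2 * exp (- ?y)) (at x)"
      using 3 by (auto intro!: derivative_eq_intros simp: power2_eq_square algebra_simps)
    moreover have "?y ^ n * (exp (- ?y) * ?y\<^sup>2) - real n * ?y ^ (n - 1) * ?y\<^sup>2 * exp (- ?y) =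
        flat (n + 2) x - real n * flat (n + 1) x"
      using 3 by (cases n) (auto simp: flat_def power2_eq_square algebra_simps)
    ultimately have "((\<lambda>x. inverse x ^ n * exp (- inverse x)) has_real_derivative
        (flat (n + 2) x - real n * flat (n + 1) x)) (at x)"
      by simp
    then show ?thesis
      by (rule has_field_derivative_transform_within_open[where S = "{0<..}"])
        (use 3 in \<open>auto simp: flat_def\<close>)
  qed
qed

lemma C_infinity_on_flat: "C_infinity_on UNIV (flat n)"
proof -
  have "C_k_on k UNIV (flat n)" for k
  proof (induction k arbitrary: n)
    case 0
    have "isCont (flat n) x" for x
      using flat_has_derivative DERIV_isCont by blast
    then show ?case by (simp add: continuous_at_imp_continuous_on)
  next
    case (Suc k)
    have "C_k_on k UNIV (\<lambda>x. flat (n + 2) x + (- real n) *\<^sub>R flat (n + 1) x)"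
      by (intro C_k_on_add C_k_on_scaleR C_k_on_const Suc open_UNIV)
    then have "C_k_on k UNIV (\<lambda>x. flat (n + 2) x - real n * flat (n + 1) x)"
      by simp
    then show ?case
      by (rule C_k_on_Suc_real[OF open_UNIV flat_has_derivative])
  qed
  then show ?thesis by (simp add: C_infinity_on_def)
qed

definition smooth_step :: "real \<Rightarrow> real" where
  "smooth_step x = flat 0 x * inverse (flat 0 x + flat 0 (1 - x))"

lemma smooth_step_denominator: "flat 0 x + flat 0 (1 - x) > 0"
  by (auto simp: flat_def add_pos_pos)

lemma C_infinity_on_smooth_step: "C_infinity_on UNIV smooth_step"
proof -
  have "C_infinity_on UNIV (\<lambda>x::real. 1 + (- 1) *\<^sub>R x)"
    by (intro C_infinity_on_add C_infinity_on_scaleR C_infinity_on_const open_UNIV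
        C_infinity_on_bounded_linear bounded_linear_ident)
  from C_infinity_on_compose[OF open_UNIV open_UNIV _ this C_infinity_on_flat[of 0]]
  have 1: "C_infinity_on UNIV (\<lambda>x. flat 0 (1 + (- 1) *\<^sub>R x))" by simp
  have 2: "C_infinity_on UNIV (\<lambda>x. flat 0 x + flat 0 (1 + (- 1) *\<^sub>R x))"
    by (intro C_infinity_on_add 1 C_infinity_on_flat open_UNIV)
  have "C_infinity_on UNIV (\<lambda>x. inverse (flat 0 x + flat 0 (1 + (- 1) *\<^sub>R x)))"
    by (rule C_infinity_on_compose[OF open_UNIV _ _ 2 C_infinity_on_inverse])
      (use smooth_step_denominator in \<open>auto simp: open_Collect_less\<close>)
  then have "C_infinity_on UNIV (\<lambda>x. flat 0 x *\<^sub>R inverse (flat 0 x + flat 0 (1 + (- 1) *\<^sub>R x)))"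
    by (intro C_infinity_on_scaleR C_infinity_on_flat open_UNIV)
  then show ?thesis by (simp add: smooth_step_def[abs_def])
qed

lemma smooth_step_0: "x \<le> 0 \<Longrightarrow> smooth_step x = 0"
  by (simp add: smooth_step_def flat_def)

lemma smooth_step_1: "x \<ge> 1 \<Longrightarrow> smooth_step x = 1"
  by (simp add: smooth_step_def flat_def)

lemma flat_nonneg: "flat n x \<ge> 0"
  by (simp add: flat_def)

lemma smooth_step_bounds: "0 \<le> smooth_step x" "smooth_step x \<le> 1"
  using smooth_step_denominator[of x] flat_nonneg[of 0 x] flat_nonneg[of 0 "1 - x"]
  by (auto simp: smooth_step_def field_simps)

text \<open>The reciprocal is cut off below \<open>\<delta>\<close> so as to be smooth on the whole line. Composed with a sum of
  bumps, it normalizes a partition of unity wherever that sum is at least \<open>\<delta>\<close>.\<close>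

lemma smooth_reciprocal_exists:
  assumes "\<delta> > 0"
  obtains q :: "real \<Rightarrow> real" where "C_infinity_on UNIV q" "\<And>x. x \<ge> \<delta> \<Longrightarrow> q x = inverse x"
    "\<And>x. q x \<ge> 0"
proof
  let ?q = "\<lambda>x. if x \<le> \<delta> / 2 then 0 else smooth_step (2 / \<delta> * x - 1) * inverse x"
  have *: "2 / \<delta> * x - 1 \<ge> 1 \<longleftrightarrow> x \<ge> \<delta>" "2 / \<delta> * x - 1 \<le> 0 \<longleftrightarrow> x \<le> \<delta> / 2" for x
    using assms by (auto simp: field_simps)
  show "?q x = inverse x" if "x \<ge> \<delta>" for x
    using that assms *[of x] by (auto simp: smooth_step_1)
  show "?q x \<ge> 0" for x
    using smooth_step_bounds assms by auto
  show "C_infinity_on UNIV ?q"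
  proof (rule C_infinity_on_local)
    fix x :: real
    have aff: "C_infinity_on S (\<lambda>x::real. (2 / \<delta>) *\<^sub>R x + (- 1))" if "open S" for S
      using that by (intro C_infinity_on_add C_infinity_on_scaleR C_infinity_on_const
          C_infinity_on_bounded_linear bounded_linear_ident)
    have st: "C_infinity_on S (\<lambda>x::real. smooth_step ((2 / \<delta>) *\<^sub>R x + (- 1)))" if "open S" for S
      by (rule C_infinity_on_compose[OF that open_UNIV _ aff C_infinity_on_smooth_step])
        (use that in auto)
    consider "x < \<delta> / 2" | "x > \<delta> / 4" using assms by fastforce
    then show "\<exists>T. open T \<and> x \<in> T \<and> C_infinity_on T ?q"
    proof cases
      case 1
      have "C_infinity_on {..<\<delta>/2} ?q"
        by (subst C_infinity_on_cong[where g = "\<lambda>x. 0"]) auto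
      then show ?thesis using 1 by (intro exI[of _ "{..<\<delta>/2}"]) auto
    next
      case 2
      have "C_infinity_on {\<delta>/4<..} inverse"
        using C_infinity_on_inverse by (rule C_infinity_on_subset) (use assms in auto)
      then have "C_infinity_on {\<delta>/4<..} (\<lambda>x. smooth_step ((2 / \<delta>) *\<^sub>R x + (- 1)) *\<^sub>R inverse x)"
        by (intro C_infinity_on_scaleR st) auto
      then have "C_infinity_on {\<delta>/4<..} ?q"
        by (subst C_infinity_on_cong[where g = "\<lambda>x. smooth_step ((2 / \<delta>) *\<^sub>R x + (- 1)) *\<^sub>R inverse x"])
          (use * in \<open>auto simp: smooth_step_0\<close>)
      then show ?thesis using 2 by (intro exI[of _ "{\<delta>/4<..}"]) auto
    qed
  qed
qed

text \<open>The factor \<open>4/3\<close> puts the value \<open>1\<close> of the argument on the sphere of radius \<open>r / 2\<close>.\<close>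

definition bump :: "'e::euclidean_space \<Rightarrow> real \<Rightarrow> 'e \<Rightarrow> real" where
  "bump c r x = smooth_step (4 / 3 * (1 - (norm (x - c))\<^sup>2 / r\<^sup>2))"

lemma C_infinity_on_bump: "C_infinity_on UNIV (bump c r)"
proof -
  have c: "C_infinity_on UNIV (\<lambda>x::'a. (x - c) \<bullet> i)" for i
  proof -
    have "C_infinity_on UNIV (\<lambda>x::'a. x \<bullet> i + (- (c \<bullet> i)))"
      by (intro C_infinity_on_add open_UNIV C_infinity_on_const C_infinity_on_bounded_linear
          bounded_linear_inner_left)
    then show ?thesis by (simp add: inner_diff_left)
  qed
  have "C_infinity_on UNIV (\<lambda>x::'a. 4 / 3 + (- 4 / 3 / r\<^sup>2) *\<^sub>R (\<Sum>i\<in>Basis. ((x - c) \<bullet> i) *\<^sub>R ((x - c) \<bullet> i)))"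
    by (intro C_infinity_on_add C_infinity_on_scaleR C_infinity_on_sum c C_infinity_on_const open_UNIV)
  moreover have "(\<Sum>i\<in>Basis. ((x - c) \<bullet> i) *\<^sub>R ((x - c) \<bullet> i)) = (norm (x - c))\<^sup>2" for x
    by (simp add: power2_norm_eq_inner euclidean_inner[of "x - c" "x - c"])
  ultimately have "C_infinity_on UNIV (\<lambda>x::'a. 4 / 3 * (1 - (norm (x - c))\<^sup>2 / r\<^sup>2))"
    by (simp add: algebra_simps)
  from C_infinity_on_compose[OF open_UNIV open_UNIV _ this C_infinity_on_smooth_step]
  show ?thesis by (simp add: bump_def[abs_def])
qed

lemma bump_bounds: "0 \<le> bump c r x" "bump c r x \<le> 1"
  by (auto simp: bump_def smooth_step_bounds)

lemma bump_eq_1: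
  assumes "r > 0" "dist c x \<le> r / 2" shows "bump c r x = 1"
proof -
  have "(norm (x - c))\<^sup>2 \<le> (r / 2)\<^sup>2"
    using assms by (intro power_mono) (auto simp: dist_norm norm_minus_commute)
  then show ?thesis
    using assms by (auto simp: bump_def field_simps power2_eq_square intro!: smooth_step_1)
qed

lemma bump_eq_0:
  assumes "r > 0" "x \<notin> cball c r" shows "bump c r x = 0"
proof -
  have "r\<^sup>2 \<le> (norm (x - c))\<^sup>2"
    using assms by (intro power_mono) (auto simp: dist_norm norm_minus_commute)
  then show ?thesis
    using assms by (auto simp: bump_def field_simps intro!: smooth_step_0)
qed

section \<open>Smooth functions on a manifold\<close>

locale smooth_manifold =
  fixes A :: "('a::{t2_space, second_countable_topology}, 'e::euclidean_space) chart set"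
  assumes smooth_atlas: "smooth_atlas A"
begin

abbreviation smooth :: "('a \<Rightarrow> real) \<Rightarrow> bool" where
  "smooth f \<equiv> f \<in> smooth_functions A"

lemma is_chart_maximal: "c \<in> maximal_atlas A \<Longrightarrow> is_chart c"
  by (simp add: maximal_atlas_def)

lemma atlas_subset_maximal: "c \<in> A \<Longrightarrow> c \<in> maximal_atlas A"
  using smooth_atlas by (simp add: smooth_atlas_def maximal_atlas_def)

lemma chart_covers: obtains V \<psi> where "(V, \<psi>) \<in> A" "p \<in> V"
proof -
  have "p \<in> (\<Union>c\<in>A. fst c)" using smooth_atlas by (simp add: smooth_atlas_def)
  then obtain c where "c \<in> A" "p \<in> fst c" by blast
  then show ?thesis using that[of "fst c" "snd c"] by simp
qed

lemma chart_props:
  assumes "(V, \<psi>) \<in> maximal_atlas A"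
  shows chart_open: "open V" and chart_open_image: "open (\<psi> ` V)"
    and chart_inj: "inj_on \<psi> V"
    and chart_cont: "continuous_on V \<psi>" and chart_inv_cont: "continuous_on (\<psi> ` V) (inv_into V \<psi>)"
proof -
  have "is_chart (V, \<psi>)" using assms is_chart_maximal by blast
  then show "open V" "open (\<psi> ` V)" "continuous_on V \<psi>" "continuous_on (\<psi> ` V) (inv_into V \<psi>)"
    "inj_on \<psi> V"
    by (auto simp: is_chart_def homeomorphism_def intro: inj_on_inverseI)
qed

lemma chart_inv [simp]:
  assumes "(V, \<psi>) \<in> maximal_atlas A"
  shows "p \<in> V \<Longrightarrow> inv_into V \<psi> (\<psi> p) = p"
  using chart_inj[OF assms] by simp

lemma chart_open_subset_image:
  assumes "(V, \<psi>) \<in> maximal_atlas A" "open W" "W \<subseteq> V"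
  shows "open (\<psi> ` W)"
proof -
  have "\<psi> ` W = \<psi> ` V \<inter> inv_into V \<psi> -` W"
    using assms by (force simp: chart_inv[OF assms(1)])
  then show ?thesis
    using openin_open_trans[OF continuous_openin_preimage_gen[OF chart_inv_cont[OF assms(1)] assms(2)]
      chart_open_image[OF assms(1)]] by simp
qed

lemma chart_open_preimage:
  assumes "(V, \<psi>) \<in> maximal_atlas A" "open T"
  shows "open (V \<inter> \<psi> -` T)"
  by (rule openin_open_trans[OF continuous_openin_preimage_gen[OF chart_cont[OF assms(1)] assms(2)]
        chart_open[OF assms(1)]])

lemma chart_compact_preimage:
  assumes "(V, \<psi>) \<in> maximal_atlas A" "compact K" "K \<subseteq> \<psi> ` V"
  shows "compact (inv_into V \<psi> ` K)" "inv_into V \<psi> ` K \<subseteq> V"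
proof -
  show "compact (inv_into V \<psi> ` K)"
    by (rule compact_continuous_image[OF continuous_on_subset[OF chart_inv_cont[OF assms(1)] assms(3)] assms(2)])
  show "inv_into V \<psi> ` K \<subseteq> V"
    using inv_into_into[of _ \<psi> V] assms(3) by blast
qed

lemma smooth_iff: "smooth f \<longleftrightarrow> (\<forall>V \<phi>. (V, \<phi>) \<in> A \<longrightarrow> C_infinity_on (\<phi> ` V) (\<lambda>x. f (inv_into V \<phi> x)))"
  by (auto simp: smooth_functions_def comp_def)

lemma smooth_local:
  assumes "\<And>p. \<exists>W f'. open W \<and> p \<in> W \<and> smooth f' \<and> (\<forall>q\<in>W. f q = f' q)"
  shows "smooth f"
  unfolding smooth_iff
proof (intro allI impI C_infinity_on_local)
  fix V \<phi> x assume c: "(V, \<phi>) \<in> A" and x: "x \<in> \<phi> ` V"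
  note mc = atlas_subset_maximal[OF c]
  obtain W f' where W: "open W" "inv_into V \<phi> x \<in> W" "smooth f'" "\<And>q. q \<in> W \<Longrightarrow> f q = f' q"
    using assms by meson
  let ?T = "\<phi> ` (V \<inter> W)"
  have o: "open ?T"
    using W chart_open[OF mc] by (intro chart_open_subset_image[OF mc]) auto
  have "C_infinity_on ?T (\<lambda>x. f' (inv_into V \<phi> x))"
    using W(3) c unfolding smooth_iff by (blast intro: C_infinity_on_subset)
  then have "C_infinity_on ?T (\<lambda>x. f (inv_into V \<phi> x))"
    by (subst C_infinity_on_cong[OF o, where g = "\<lambda>x. f' (inv_into V \<phi> x)"])
      (use W(4) chart_inv[OF mc] in auto)
  moreover have "x \<in> ?T"
    using x W(2) by (auto simp: chart_inv[OF mc])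
  ultimately show "\<exists>T. open T \<and> x \<in> T \<and> C_infinity_on T (\<lambda>x. f (inv_into V \<phi> x))"
    using o by blast
qed

lemma smooth_const [simp]: "smooth (\<lambda>x. c)"
  by (simp add: smooth_iff)

lemma smooth_add: "smooth f \<Longrightarrow> smooth h \<Longrightarrow> smooth (\<lambda>x. f x + h x)"
  unfolding smooth_iff by (auto intro!: C_infinity_on_add chart_open_image atlas_subset_maximal)

lemma smooth_mult: "smooth f \<Longrightarrow> smooth h \<Longrightarrow> smooth (\<lambda>x. f x * h x)"
  unfolding smooth_iff by (auto intro!: C_infinity_on_mult chart_open_image atlas_subset_maximal)

lemma smooth_uminus: "smooth f \<Longrightarrow> smooth (\<lambda>x. - f x)"
  using smooth_mult[OF smooth_const[of "-1"], of f] by simp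

lemma smooth_diff: "smooth f \<Longrightarrow> smooth h \<Longrightarrow> smooth (\<lambda>x. f x - h x)"
  using smooth_add[OF _ smooth_uminus, of f h] by simp

lemma smooth_sum: "(\<And>i. i \<in> I \<Longrightarrow> smooth (f i)) \<Longrightarrow> smooth (\<lambda>x. \<Sum>i\<in>I. f i x)"
  by (induction I rule: infinite_finite_induct) (auto intro: smooth_add)

lemma smooth_compose:
  assumes "smooth f" "open T" "range f \<subseteq> T" "C_infinity_on T (h :: real \<Rightarrow> real)"
  shows "smooth (\<lambda>x. h (f x))"
  unfolding smooth_iff
proof (intro allI impI)
  fix V \<phi> assume c: "(V, \<phi>) \<in> A"
  show "C_infinity_on (\<phi> ` V) (\<lambda>x. h (f (inv_into V \<phi> x)))"
    by (rule C_infinity_on_compose[OF chart_open_image[OF atlas_subset_maximal[OF c]] assms(2) _ _ assms(4)])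
      (use assms c in \<open>auto simp: smooth_iff\<close>)
qed

lemma smooth_continuous: "smooth f \<Longrightarrow> continuous_on UNIV f"
proof (rule continuous_at_imp_continuous_on, rule ballI)
  fix p assume f: "smooth f"
  obtain V \<phi> where c: "(V, \<phi>) \<in> A" "p \<in> V" using chart_covers .
  note mc = atlas_subset_maximal[OF c(1)]
  have "continuous_on (\<phi> ` V) (\<lambda>x. f (inv_into V \<phi> x))"
    using f c by (auto simp: smooth_iff intro: C_infinity_on_continuous_on)
  from continuous_on_compose2[OF this chart_cont[OF mc]]
  have "continuous_on V (\<lambda>x. f (inv_into V \<phi> (\<phi> x)))" by simp
  then have "continuous_on V f"
    by (rule continuous_on_eq) (simp add: chart_inv[OF mc])
  then show "isCont f p" using chart_open[OF mc] c(2) by (simp add: continuous_on_eq_continuous_at)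
qed

text \<open>Near each point, factor through a chart of the atlas and a smooth change of coordinates.\<close>

lemma smooth_in_chart:
  assumes "smooth f" and mc: "(V, \<psi>) \<in> maximal_atlas A"
  shows "C_infinity_on (\<psi> ` V) (\<lambda>x. f (inv_into V \<psi> x))"
proof (rule C_infinity_on_local)
  fix x assume "x \<in> \<psi> ` V"
  then obtain p where p: "p \<in> V" "x = \<psi> p" by blast
  obtain W \<phi> where d: "(W, \<phi>) \<in> A" "p \<in> W" using chart_covers .
  note md = atlas_subset_maximal[OF d(1)]
  let ?T = "\<psi> ` (V \<inter> W)"
  have o: "open ?T"
    using chart_open[OF mc] chart_open[OF md] by (intro chart_open_subset_image[OF mc]) auto
  have t: "C_infinity_on ?T (\<lambda>x. \<phi> (inv_into V \<psi> x))"
    using mc d(1) unfolding maximal_atlas_def compatible_def by (auto simp: comp_def)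
  have "C_infinity_on ?T (\<lambda>x. f (inv_into W \<phi> (\<phi> (inv_into V \<psi> x))))"
    by (rule C_infinity_on_compose[OF o chart_open_image[OF md] _ t])
      (use assms(1) d(1) in \<open>auto simp: smooth_iff chart_inv[OF mc]\<close>)
  then have "C_infinity_on ?T (\<lambda>x. f (inv_into V \<psi> x))"
    by (subst C_infinity_on_cong[OF o, where g = "\<lambda>x. f (inv_into W \<phi> (\<phi> (inv_into V \<psi> x)))"])
      (auto simp: chart_inv[OF mc] chart_inv[OF md])
  then show "\<exists>T. open T \<and> x \<in> T \<and> C_infinity_on T (\<lambda>x. f (inv_into V \<psi> x))"
    using o p d by blast
qed

text \<open>Because the manifold is Hausdorff, the preimage of \<open>K\<close> is closed. Its complement is an open set on
  which the extension vanishes, and together with the chart domain it covers the manifold.\<close>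

lemma smooth_extend_by_zero:
  assumes mc: "(V, \<psi>) \<in> maximal_atlas A" and O: "open T" "T \<subseteq> \<psi> ` V"
    and G: "C_infinity_on T G" and K: "compact K" "K \<subseteq> T" "\<And>x. x \<in> T - K \<Longrightarrow> G x = (0::real)"
  shows "smooth (\<lambda>q. if q \<in> V \<and> \<psi> q \<in> T then G (\<psi> q) else 0)" (is "smooth ?f")
  unfolding smooth_iff
proof (intro allI impI C_infinity_on_local)
  fix W \<phi> x assume d: "(W, \<phi>) \<in> A" and "x \<in> \<phi> ` W"
  then obtain p where p: "p \<in> W" "x = \<phi> p" by blast
  note md = atlas_subset_maximal[OF d]
  show "\<exists>T. open T \<and> x \<in> T \<and> C_infinity_on T (\<lambda>x. ?f (inv_into W \<phi> x))"
  proof (cases "p \<in> V \<and> \<psi> p \<in> T")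
    case True
    let ?Q = "\<phi> ` (W \<inter> (V \<inter> \<psi> -` T))"
    have o: "open ?Q"
      using chart_open[OF md] chart_open_preimage[OF mc O(1)]
      by (intro chart_open_subset_image[OF md]) auto
    have "C_infinity_on (\<phi> ` (V \<inter> W)) (\<lambda>x. \<psi> (inv_into W \<phi> x))"
      using mc d unfolding maximal_atlas_def compatible_def by (auto simp: comp_def)
    then have t: "C_infinity_on ?Q (\<lambda>x. \<psi> (inv_into W \<phi> x))"
      by (rule C_infinity_on_subset) auto
    have "C_infinity_on ?Q (\<lambda>x. G (\<psi> (inv_into W \<phi> x)))"
      by (rule C_infinity_on_compose[OF o O(1) _ t G]) (auto simp: chart_inv[OF md])
    then have "C_infinity_on ?Q (\<lambda>x. ?f (inv_into W \<phi> x))"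
      by (subst C_infinity_on_cong[OF o, where g = "\<lambda>x. G (\<psi> (inv_into W \<phi> x))"])
        (auto simp: chart_inv[OF md])
    then show ?thesis using o p True by blast
  next
    case False
    let ?K = "inv_into V \<psi> ` K"
    have "closed ?K"
      using chart_compact_preimage[OF mc K(1)] K(2) O(2) compact_imp_closed by blast
    then have oW: "open (W - ?K)" using chart_open[OF md] by (simp add: open_Diff)
    let ?Q = "\<phi> ` (W - ?K)"
    have o: "open ?Q" using oW by (intro chart_open_subset_image[OF md]) auto
    have "p \<notin> ?K"
    proof
      assume "p \<in> ?K"
      then obtain y where y: "y \<in> K" "p = inv_into V \<psi> y" by blast
      then have "p \<in> V" "\<psi> p = y" using K(2) O(2) by (auto intro: inv_into_into f_inv_into_f)
      then show False using False y K by blast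
    qed
    have z: "?f q = 0" if "q \<in> W - ?K" for q
    proof (cases "q \<in> V \<and> \<psi> q \<in> T")
      case True
      then have "\<psi> q \<notin> K" using that chart_inv[OF mc] by (metis DiffD2 imageI)
      then show ?thesis using True K(3) by auto
    qed auto
    have "?f (inv_into W \<phi> x) = 0" if x: "x \<in> ?Q" for x
    proof -
      obtain q where q: "q \<in> W - ?K" "x = \<phi> q" using x by blast
      then have "inv_into W \<phi> x = q" using chart_inv[OF md] by auto
      then show ?thesis using z[OF q(1)] by (simp only:)
    qed
    then have "C_infinity_on ?Q (\<lambda>x. ?f (inv_into W \<phi> x))"
      using C_infinity_on_cong[OF o, of "\<lambda>x. ?f (inv_into W \<phi> x)" "\<lambda>x. 0"] by simp
    then show ?thesis using o p \<open>p \<notin> ?K\<close> by blast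
  qed
qed

lemma chart_ball:
  assumes mc: "(V, \<psi>) \<in> maximal_atlas A" and p: "p \<in> V" "p \<in> W" "open W"
  obtains r where "r > 0" "cball (\<psi> p) r \<subseteq> \<psi> ` (V \<inter> W)"
proof -
  have "open (\<psi> ` (V \<inter> W))"
    using chart_open[OF mc] p by (intro chart_open_subset_image[OF mc]) auto
  then show ?thesis using that p open_contains_cball by (metis IntI imageI)
qed

lemma bump_exists:
  assumes mc: "(V, \<psi>) \<in> maximal_atlas A" and p: "p \<in> V" "p \<in> W" "open W"
  obtains \<eta> N K where "smooth \<eta>" "\<And>q. 0 \<le> \<eta> q" "\<And>q. \<eta> q \<le> 1" "open N" "p \<in> N" "N \<subseteq> K"
    "\<And>q. q \<in> N \<Longrightarrow> \<eta> q = 1" "compact K" "K \<subseteq> V \<inter> W" "\<And>q. q \<notin> K \<Longrightarrow> \<eta> q = 0"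
proof -
  obtain r where r: "r > 0" "cball (\<psi> p) r \<subseteq> \<psi> ` (V \<inter> W)"
    using chart_ball[OF assms] .
  let ?T = "\<psi> ` (V \<inter> W)" and ?B = "bump (\<psi> p) r"
  have o: "open ?T" using chart_open[OF mc] p by (intro chart_open_subset_image[OF mc]) auto
  let ?\<eta> = "\<lambda>q. if q \<in> V \<and> \<psi> q \<in> ?T then ?B (\<psi> q) else 0"
  let ?K = "inv_into V \<psi> ` cball (\<psi> p) r"
  let ?N = "V \<inter> \<psi> -` ball (\<psi> p) (r/2)"
  have sub: "cball (\<psi> p) r \<subseteq> \<psi> ` V" using r by auto
  have "smooth ?\<eta>"
  proof (rule smooth_extend_by_zero[OF mc o _ _ compact_cball r(2)])
    show "C_infinity_on ?T ?B" using C_infinity_on_bump C_infinity_on_subset by blast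
    show "?B x = 0" if "x \<in> ?T - cball (\<psi> p) r" for x
      using that r bump_eq_0 by blast
  qed auto
  moreover have "?K \<subseteq> V \<inter> W"
  proof
    fix q assume "q \<in> ?K"
    then obtain y where y: "y \<in> cball (\<psi> p) r" "q = inv_into V \<psi> y" by blast
    then obtain q' where "q' \<in> V \<inter> W" "y = \<psi> q'" using r by blast
    then show "q \<in> V \<inter> W" using y by (simp add: chart_inv[OF mc])
  qed
  moreover have "?N \<subseteq> ?K"
  proof
    fix q assume "q \<in> ?N"
    then have "q = inv_into V \<psi> (\<psi> q)" "\<psi> q \<in> cball (\<psi> p) r"
      using r by (auto simp: chart_inv[OF mc])
    then show "q \<in> ?K" by blast
  qed
  moreover have "?\<eta> q = 1" if "q \<in> ?N" for q
  proof -
    have "\<psi> q \<in> cball (\<psi> p) r" using that r by auto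
    then have "\<psi> q \<in> ?T" using r by blast
    then show ?thesis using that r bump_eq_1[of r "\<psi> p" "\<psi> q"] by auto
  qed
  moreover have "?\<eta> q = 0" if "q \<notin> ?K" for q
  proof (cases "q \<in> V \<and> \<psi> q \<in> ?T")
    case True
    then have "\<psi> q \<notin> cball (\<psi> p) r" using that chart_inv[OF mc] by (metis imageI)
    then show ?thesis using r bump_eq_0 by auto
  qed auto
  moreover have "open ?N" using chart_open_preimage[OF mc] by simp
  moreover have "p \<in> ?N" using p r by simp
  moreover have "0 \<le> ?\<eta> q" "?\<eta> q \<le> 1" for q by (auto simp: bump_bounds)
  moreover note chart_compact_preimage(1)[OF mc compact_cball sub]
  ultimately show ?thesis by (intro that[of ?\<eta> ?N ?K])
qed

lemma bump_exists':
  assumes "p \<in> W" "open W"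
  obtains \<eta> N K where "smooth \<eta>" "\<And>q. 0 \<le> \<eta> q" "\<And>q. \<eta> q \<le> 1" "open N" "p \<in> N" "N \<subseteq> K"
    "\<And>q. q \<in> N \<Longrightarrow> \<eta> q = 1" "compact K" "K \<subseteq> W" "\<And>q. q \<notin> K \<Longrightarrow> \<eta> q = 0"
proof -
  obtain V \<psi> where c: "(V, \<psi>) \<in> A" "p \<in> V" using chart_covers .
  show ?thesis
  proof (rule bump_exists[OF atlas_subset_maximal[OF c(1)] c(2) assms])
    fix \<eta> N K
    assume *: "smooth \<eta>" "\<And>q. 0 \<le> \<eta> q" "\<And>q. \<eta> q \<le> 1" "open N" "p \<in> N" "N \<subseteq> K"
      "\<And>q. q \<in> N \<Longrightarrow> \<eta> q = 1" "compact K" "K \<subseteq> V \<inter> W" "\<And>q. q \<notin> K \<Longrightarrow> \<eta> q = 0"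
    then have "K \<subseteq> W" by blast
    with * show thesis by (intro that)
  qed
qed

text \<open>Multiplication with a bump makes the function vanish outside of a compact set, so that it can be
  extended by \<open>0\<close>.\<close>

lemma smooth_germ_in_chart:
  assumes mc: "(V, \<psi>) \<in> maximal_atlas A" and p: "p \<in> V" and O: "open T" "\<psi> p \<in> T"
    and G: "C_infinity_on T (G :: 'e \<Rightarrow> real)"
  obtains f W where "smooth f" "open W" "p \<in> W" "W \<subseteq> V" "\<psi> ` W \<subseteq> T" "\<And>q. q \<in> W \<Longrightarrow> f q = G (\<psi> q)"
proof -
  obtain r where r: "r > 0" "cball (\<psi> p) r \<subseteq> \<psi> ` (V \<inter> (V \<inter> \<psi> -` T))"
    using chart_ball[OF mc p, of "V \<inter> \<psi> -` T"] p O chart_open_preimage[OF mc O(1)] by blast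
  let ?T = "\<psi> ` V \<inter> T" and ?G = "\<lambda>x. bump (\<psi> p) r x * G x"
  let ?f = "\<lambda>q. if q \<in> V \<and> \<psi> q \<in> ?T then ?G (\<psi> q) else 0"
  let ?W = "V \<inter> \<psi> -` ball (\<psi> p) (r/2)"
  have o: "open ?T" using chart_open_image[OF mc] O by auto
  have "smooth ?f"
  proof (rule smooth_extend_by_zero[OF mc o _ _ compact_cball])
    show "C_infinity_on ?T ?G"
      using C_infinity_on_bump G
      by (intro C_infinity_on_mult o) (auto intro: C_infinity_on_subset)
    show "?G x = 0" if "x \<in> ?T - cball (\<psi> p) r" for x
      using that r bump_eq_0[of r x "\<psi> p"] by auto
    show "cball (\<psi> p) r \<subseteq> ?T" using r by auto
  qed auto
  moreover have W: "q \<in> V" "\<psi> q \<in> T" "dist (\<psi> p) (\<psi> q) < r / 2" if "q \<in> ?W" for q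
  proof -
    show 1: "q \<in> V" and 2: "dist (\<psi> p) (\<psi> q) < r / 2" using that by auto
    have "\<psi> q \<in> cball (\<psi> p) r" using 2 r(1) by simp
    then show "\<psi> q \<in> T" using r(2) by auto
  qed
  moreover have "?f q = G (\<psi> q)" if "q \<in> ?W" for q
    using W[OF that] r bump_eq_1[of r "\<psi> p" "\<psi> q"] by auto
  moreover have "open ?W" using chart_open_preimage[OF mc] by simp
  moreover have "p \<in> ?W" using p r by simp
  ultimately show ?thesis using that[of ?f ?W] by blast
qed

text \<open>Normalize finitely many bumps by their sum \<open>b\<close>. The cut-off \<open>\<theta>\<close> is a function of \<open>b\<close>; it produces
  fields whose support lies in the region where the partition sums up to \<open>1\<close>, and such fields can be
  integrated chart by chart.\<close>

lemma partition_of_unity: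
  assumes "compact S" and W: "\<And>p. p \<in> S \<Longrightarrow> open (W p)" "\<And>p. p \<in> S \<Longrightarrow> p \<in> W p"
  obtains P \<eta> \<theta> N N' K' where "finite P" "P \<subseteq> S"
    "\<And>p. p \<in> P \<Longrightarrow> smooth (\<eta> p)" "\<And>p q. p \<in> P \<Longrightarrow> 0 \<le> \<eta> p q"
    "\<And>p. p \<in> P \<Longrightarrow> \<exists>K. compact K \<and> K \<subseteq> W p \<and> (\<forall>q. q \<notin> K \<longrightarrow> \<eta> p q = 0)"
    "open N" "\<And>q. q \<in> N \<Longrightarrow> (\<Sum>p\<in>P. \<eta> p q) = 1"
    "smooth \<theta>" "\<And>q. 0 \<le> \<theta> q" "\<And>q. \<theta> q \<le> 1" "open N'" "S \<subseteq> N'" "\<And>q. q \<in> N' \<Longrightarrow> \<theta> q = 1"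
    "compact K'" "K' \<subseteq> N" "\<And>q. q \<notin> K' \<Longrightarrow> \<theta> q = 0"
proof -
  have "\<forall>p\<in>S. \<exists>\<beta> N K. smooth \<beta> \<and> (\<forall>q. 0 \<le> \<beta> q) \<and> open N \<and> p \<in> N \<and> (\<forall>q\<in>N. \<beta> q = 1) \<and>
      compact K \<and> K \<subseteq> W p \<and> (\<forall>q. q \<notin> K \<longrightarrow> \<beta> q = 0)"
  proof
    fix p assume "p \<in> S"
    show "\<exists>\<beta> N K. smooth \<beta> \<and> (\<forall>q. 0 \<le> \<beta> q) \<and> open N \<and> p \<in> N \<and> (\<forall>q\<in>N. \<beta> q = 1) \<and>
      compact K \<and> K \<subseteq> W p \<and> (\<forall>q. q \<notin> K \<longrightarrow> \<beta> q = 0)"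
      using bump_exists'[OF W(2) W(1), OF \<open>p \<in> S\<close> \<open>p \<in> S\<close>] by metis
  qed
  then obtain \<beta> M K where *: "\<forall>p\<in>S. smooth (\<beta> p) \<and> (\<forall>q. 0 \<le> \<beta> p q) \<and> open (M p) \<and> p \<in> M p \<and>
      (\<forall>q\<in>M p. \<beta> p q = 1) \<and> compact (K p) \<and> K p \<subseteq> W p \<and> (\<forall>q. q \<notin> K p \<longrightarrow> \<beta> p q = 0)"
    unfolding bchoice_iff by (elim exE)
  have \<beta>: "\<And>p. p \<in> S \<Longrightarrow> smooth (\<beta> p)" "\<And>p q. p \<in> S \<Longrightarrow> 0 \<le> \<beta> p q"
    "\<And>p. p \<in> S \<Longrightarrow> open (M p)" "\<And>p. p \<in> S \<Longrightarrow> p \<in> M p" "\<And>p q. p \<in> S \<Longrightarrow> q \<in> M p \<Longrightarrow> \<beta> p q = 1"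
    "\<And>p. p \<in> S \<Longrightarrow> compact (K p)" "\<And>p. p \<in> S \<Longrightarrow> K p \<subseteq> W p" "\<And>p q. p \<in> S \<Longrightarrow> q \<notin> K p \<Longrightarrow> \<beta> p q = 0"
    using * by blast+
  obtain P where P: "P \<subseteq> S" "finite P" "S \<subseteq> (\<Union>p\<in>P. M p)"
    using compactE_image[OF assms(1), of S M] \<beta>(3,4) by blast
  define b where "b = (\<lambda>q. \<Sum>p\<in>P. \<beta> p q)"
  have b: "smooth b" unfolding b_def using \<beta>(1) P by (intro smooth_sum) auto
  have b1: "b q \<ge> 1" if q: "q \<in> (\<Union>p\<in>P. M p)" for q
  proof -
    from q obtain p where p: "p \<in> P" "q \<in> M p" by blast
    have "\<beta> p q \<le> b q"
      unfolding b_def using P \<beta>(2) p by (intro member_le_sum) auto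
    then show ?thesis using \<beta>(5)[of p q] p P by auto
  qed
  obtain rec where rec: "C_infinity_on UNIV rec" "\<And>x::real. x \<ge> 1/4 \<Longrightarrow> rec x = inverse x" "\<And>x. rec x \<ge> 0"
    using smooth_reciprocal_exists[of "1/4"] by auto
  have sr: "smooth (\<lambda>q. rec (b q))" by (rule smooth_compose[OF b open_UNIV _ rec(1)]) simp
  have bc: "continuous_on UNIV b" using smooth_continuous[OF b] .
  \<comment> \<open>The thresholds satisfy \<open>1/4 < 1/2 < 1\<close>, and \<open>b \<ge> 1\<close> near \<open>S\<close>.\<close>
  define N where "N = {q. 1/4 < b q}"
  define N' where "N' = (\<Union>p\<in>P. M p)"
  define K' where "K' = {q. 1/2 \<le> b q}"
  define \<theta> where "\<theta> = (\<lambda>q. smooth_step (2 * b q - 1))"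
  have aff: "smooth (\<lambda>q. 2 * b q - 1)"
    using b by (intro smooth_diff smooth_mult) auto
  show ?thesis
  proof (rule that[of P "\<lambda>p q. \<beta> p q * rec (b q)" N \<theta> N' K'])
    show "finite P" "P \<subseteq> S" using P by auto
    show "smooth (\<lambda>q. \<beta> p q * rec (b q))" if "p \<in> P" for p
      using that P \<beta>(1) sr by (intro smooth_mult) auto
    show "0 \<le> \<beta> p q * rec (b q)" if "p \<in> P" for p q
      using that P \<beta>(2) rec(3) by auto
    show "\<exists>K. compact K \<and> K \<subseteq> W p \<and> (\<forall>q. q \<notin> K \<longrightarrow> \<beta> p q * rec (b q) = 0)" if "p \<in> P" for p
    proof -
      have "p \<in> S" using that P by blast
      then show ?thesis using \<beta>(6)[of p] \<beta>(7)[of p] \<beta>(8)[of p] by (intro exI[of _ "K p"]) auto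
    qed
    show "open N" unfolding N_def using bc by (intro open_Collect_less continuous_on_const)
    show "(\<Sum>p\<in>P. \<beta> p q * rec (b q)) = 1" if "q \<in> N" for q
    proof -
      have "(\<Sum>p\<in>P. \<beta> p q * rec (b q)) = b q * rec (b q)" by (simp add: b_def sum_distrib_right)
      then show ?thesis using that by (simp add: N_def rec(2))
    qed
    show "smooth \<theta>" unfolding \<theta>_def
      by (rule smooth_compose[OF aff open_UNIV _ C_infinity_on_smooth_step]) simp
    show "0 \<le> \<theta> q" "\<theta> q \<le> 1" for q by (auto simp: \<theta>_def smooth_step_bounds)
    show "open N'" using P \<beta>(3) by (auto simp: N'_def)
    show "S \<subseteq> N'" using P by (simp add: N'_def)
    show "\<theta> q = 1" if "q \<in> N'" for q
      using that b1[of q] by (auto simp: \<theta>_def N'_def intro!: smooth_step_1)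
    have "K' \<subseteq> (\<Union>p\<in>P. K p)"
    proof
      fix q assume q: "q \<in> K'"
      then have "b q \<noteq> 0" by (auto simp: K'_def)
      then obtain p where "p \<in> P" "\<beta> p q \<noteq> 0" unfolding b_def by (meson sum.neutral)
      then show "q \<in> (\<Union>p\<in>P. K p)" using \<beta>(8) P by blast
    qed
    moreover have "compact (\<Union>p\<in>P. K p)" using P \<beta>(6) by (intro compact_UN) auto
    moreover have "closed K'" unfolding K'_def using bc by (intro closed_Collect_le continuous_on_const)
    ultimately show "compact K'" by (metis compact_Int_closed inf.absorb_iff2)
    show "K' \<subseteq> N" by (auto simp: K'_def N_def)
    show "\<theta> q = 0" if "q \<notin> K'" for q
      using that by (auto simp: \<theta>_def K'_def intro!: smooth_step_0)
  qed
qed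

end

section \<open>Tangent vectors in coordinates\<close>

text \<open>Differentiation under the integral sign reproduces integrals of this form with a higher power of
  \<open>t\<close>, so that smoothness follows for all powers simultaneously. The case \<open>m = 0\<close> gives the coefficients in
  Hadamard's lemma.\<close>

lemma radial_integral_has_derivative:
  fixes h :: "'e::euclidean_space \<Rightarrow> real"
  assumes h: "C_k_on (Suc 0) (ball a r) h" and x0: "x0 \<in> ball a r"
  shows "((\<lambda>x. integral {0..1} (\<lambda>t. t ^ m * h (a + t *\<^sub>R (x - a)))) has_derivative
    (\<lambda>v. integral {0..1} (\<lambda>t. t ^ Suc m * frechet_derivative h (at (a + t *\<^sub>R (x0 - a))) v))) (at x0)"
proof -
  let ?U = "ball a r"
  have in_U: "a + t *\<^sub>R (x - a) \<in> ?U" if "x \<in> ?U" "t \<in> {0..1}" for x t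
  proof -
    have "norm (t *\<^sub>R (x - a)) \<le> norm (x - a)"
      using that by (simp add: mult_left_le_one_le)
    then show ?thesis using that by (simp add: dist_norm norm_minus_commute)
  qed
  have Dh: "(h has_derivative frechet_derivative h (at y)) (at y)" if "y \<in> ?U" for y
    using h that by (simp add: differentiable_frechet)
  have ch: "continuous_on ?U h"
    using C_k_on_SucD[OF h] by simp
  have cp: "continuous_on ?U (\<lambda>y. frechet_derivative h (at y) v)" for v
    using h by simp
  define fx :: "'e \<Rightarrow> real \<Rightarrow> 'e \<Rightarrow>\<^sub>L real" where
    "fx = (\<lambda>x t. \<Sum>i\<in>Basis. (t ^ Suc m * frechet_derivative h (at (a + t *\<^sub>R (x - a))) i) *\<^sub>R blinfun_inner_left i)"
  have fx: "blinfun_apply (fx x t) v = t ^ Suc m * frechet_derivative h (at (a + t *\<^sub>R (x - a))) v"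
    if "x \<in> ?U" "t \<in> {0..1}" for x t v
  proof -
    have lin: "linear (frechet_derivative h (at (a + t *\<^sub>R (x - a))))"
      using Dh[OF in_U[OF that]] has_derivative_linear by blast
    have "frechet_derivative h (at (a + t *\<^sub>R (x - a))) v =
        frechet_derivative h (at (a + t *\<^sub>R (x - a))) (\<Sum>i\<in>Basis. (v \<bullet> i) *\<^sub>R i)"
      by (simp add: euclidean_representation)
    also have "\<dots> = (\<Sum>i\<in>Basis. (v \<bullet> i) * frechet_derivative h (at (a + t *\<^sub>R (x - a))) i)"
      by (simp add: linear_sum[OF lin] linear_scale[OF lin])
    finally show ?thesis
      by (simp add: fx_def blinfun.sum_left blinfun.scaleR_left sum_distrib_left algebra_simps inner_commute)
  qed
  have cont_line: "continuous_on (?U \<times> {0..1}) (\<lambda>z. a + snd z *\<^sub>R (fst z - a))"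
    by (intro continuous_intros)
  have line: "(\<lambda>z. a + snd z *\<^sub>R (fst z - a)) ` (?U \<times> {0..1}) \<subseteq> ?U"
    using in_U by auto
  have "((\<lambda>x. integral (cbox 0 1) (\<lambda>t. t ^ m * h (a + t *\<^sub>R (x - a)))) has_derivative
      blinfun_apply (integral (cbox 0 1) (fx x0))) (at x0 within ?U)"
  proof (rule leibniz_rule[OF _ _ _ x0 convex_ball])
    fix x t assume x: "x \<in> ?U" and "t \<in> cbox 0 (1::real)"
    then have t: "t \<in> {0..1}" by simp
    have "((\<lambda>x. h (a + t *\<^sub>R (x - a))) has_derivative
        (\<lambda>v. frechet_derivative h (at (a + t *\<^sub>R (x - a))) (t *\<^sub>R v))) (at x within ?U)"
      by (rule has_derivative_compose[where f = "\<lambda>x. a + t *\<^sub>R (x - a)" and g = h, OF _ Dh[OF in_U[OF x t]]])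
        (auto intro!: derivative_eq_intros)
    then have "((\<lambda>x. t ^ m * h (a + t *\<^sub>R (x - a))) has_derivative
        (\<lambda>v. t ^ m * frechet_derivative h (at (a + t *\<^sub>R (x - a))) (t *\<^sub>R v))) (at x within ?U)"
      by (rule has_derivative_mult_right)
    moreover have "t ^ m * frechet_derivative h (at (a + t *\<^sub>R (x - a))) (t *\<^sub>R v) = blinfun_apply (fx x t) v" for v
      using linear_scale[OF has_derivative_linear[OF Dh[OF in_U[OF x t]]]] by (simp add: fx[OF x t])
    ultimately show "((\<lambda>x. t ^ m * h (a + t *\<^sub>R (x - a))) has_derivative blinfun_apply (fx x t)) (at x within ?U)"
      by simp
  next
    fix x assume x: "x \<in> ?U"
    have "continuous_on {0..1} (\<lambda>t. h (a + t *\<^sub>R (x - a)))"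
      by (rule continuous_on_compose2[OF ch]) (use in_U[OF x] in \<open>auto intro!: continuous_intros\<close>)
    then show "(\<lambda>t. t ^ m * h (a + t *\<^sub>R (x - a))) integrable_on cbox 0 1"
      by (auto intro!: integrable_continuous_interval continuous_intros)
  next
    have "continuous_on (?U \<times> {0..1}) (\<lambda>z. frechet_derivative h (at (a + snd z *\<^sub>R (fst z - a))) i)" for i
      by (rule continuous_on_compose2[OF cp cont_line line])
    then show "continuous_on (?U \<times> cbox 0 1) (\<lambda>(x, t). fx x t)"
      unfolding fx_def case_prod_unfold cbox_interval by (intro continuous_intros)
  qed
  moreover have "blinfun_apply (integral (cbox 0 1) (fx x0)) v =
      integral {0..1} (\<lambda>t. t ^ Suc m * frechet_derivative h (at (a + t *\<^sub>R (x0 - a))) v)" for v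
  proof -
    have "continuous_on {0..1} (\<lambda>t. frechet_derivative h (at (a + t *\<^sub>R (x0 - a))) i)" for i
      by (rule continuous_on_compose2[OF cp]) (use in_U[OF x0] in \<open>auto intro!: continuous_intros\<close>)
    then have "continuous_on {0..1} (fx x0)"
      unfolding fx_def by (intro continuous_intros)
    then have "fx x0 integrable_on {0..1}" by (rule integrable_continuous_interval)
    then have "blinfun_apply (integral {0..1} (fx x0)) v = integral {0..1} (\<lambda>t. blinfun_apply (fx x0 t) v)"
      by (rule blinfun_apply_integral)
    also have "\<dots> = integral {0..1} (\<lambda>t. t ^ Suc m * frechet_derivative h (at (a + t *\<^sub>R (x0 - a))) v)"
      by (rule integral_cong) (rule fx[OF x0])
    finally show ?thesis by simp
  qed
  then have "blinfun_apply (integral (cbox 0 1) (fx x0)) =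
      (\<lambda>v. integral {0..1} (\<lambda>t. t ^ Suc m * frechet_derivative h (at (a + t *\<^sub>R (x0 - a))) v))"
    by (rule ext)
  ultimately show ?thesis
    by (simp only: at_within_open[OF x0 open_ball] cbox_interval)
qed

lemma C_infinity_on_radial_integral:
  fixes h :: "'e::euclidean_space \<Rightarrow> real"
  assumes "C_infinity_on (ball a r) h"
  shows "C_infinity_on (ball a r) (\<lambda>x. integral {0..1} (\<lambda>t. t ^ m * h (a + t *\<^sub>R (x - a))))"
proof -
  have "C_k_on k (ball a r) (\<lambda>x. integral {0..1} (\<lambda>t. t ^ m * h (a + t *\<^sub>R (x - a))))"
    if "C_infinity_on (ball a r) h" for k h m
    using that
  proof (induction k arbitrary: h m)
    case (0 h m)
    then have h: "C_k_on (Suc 0) (ball a r) h" unfolding C_infinity_on_def by blast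
    show ?case
      using radial_integral_has_derivative[OF h, of _ m]
      by (auto intro!: continuous_at_imp_continuous_on has_derivative_continuous)
  next
    case (Suc k h m)
    then have h: "C_k_on (Suc 0) (ball a r) h" unfolding C_infinity_on_def by blast
    note d = radial_integral_has_derivative[OF h, of _ m]
    have "C_k_on k (ball a r) (\<lambda>x. integral {0..1} (\<lambda>t. t ^ Suc m * frechet_derivative h (at (a + t *\<^sub>R (x - a))) v))" for v
      by (rule Suc.IH) (rule C_infinity_on_frechet[OF Suc.prems])
    then have "C_k_on k (ball a r) (\<lambda>x. frechet_derivative (\<lambda>x. integral {0..1} (\<lambda>t. t ^ m * h (a + t *\<^sub>R (x - a)))) (at x) v)" for v
      by (subst C_k_on_cong[OF open_ball]) (simp_all only: frechet_derivative_at[OF d, symmetric])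
    moreover have "(\<lambda>x. integral {0..1} (\<lambda>t. t ^ m * h (a + t *\<^sub>R (x - a)))) differentiable (at x)"
      if "x \<in> ball a r" for x
      using d[OF that] by (rule differentiableI)
    ultimately show ?case by simp
  qed
  then show ?thesis using assms by (simp add: C_infinity_on_def)
qed

text \<open>Integrate the derivative of \<open>G\<close> along the segment from \<open>a\<close> to \<open>x\<close>.\<close>

lemma Hadamard:
  fixes G :: "'e::euclidean_space \<Rightarrow> real"
  assumes G: "C_infinity_on (ball a r) G"
  obtains g where "\<And>i. C_infinity_on (ball a r) (g i)"
    "\<And>x. x \<in> ball a r \<Longrightarrow> G x = G a + (\<Sum>i\<in>Basis. ((x - a) \<bullet> i) * g i x)"
    "\<And>i. g i a = frechet_derivative G (at a) i"
proof
  let ?g = "\<lambda>i x. integral {0..1} (\<lambda>t. t ^ 0 * frechet_derivative G (at (a + t *\<^sub>R (x - a))) i)"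
  show "C_infinity_on (ball a r) (?g i)" for i
    by (rule C_infinity_on_radial_integral[OF C_infinity_on_frechet[OF G]])
  show "?g i a = frechet_derivative G (at a) i" for i by simp
  fix x assume x: "x \<in> ball a r"
  have in_U: "a + t *\<^sub>R (x - a) \<in> ball a r" if "t \<in> {0..1}" for t
  proof -
    have "norm (t *\<^sub>R (x - a)) \<le> norm (x - a)"
      using that by (simp add: mult_left_le_one_le)
    then show ?thesis using x by (simp add: dist_norm norm_minus_commute)
  qed
  have c: "continuous_on {0..1} (\<lambda>t. frechet_derivative G (at (a + t *\<^sub>R (x - a))) i)" for i
    by (rule continuous_on_compose2[OF C_infinity_on_continuous_on[OF C_infinity_on_frechet[OF G]]])
      (use in_U in \<open>auto intro!: continuous_intros\<close>)
  have "G (a + (x - a)) - G a = integral {0..1} (\<lambda>t. frechet_derivative G (at (a + t *\<^sub>R (x - a))) (x - a))"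
    by (rule mvt_integral[where S = "ball a r"])
      (use in_U C_infinity_on_has_derivative[OF G] in \<open>auto intro: has_derivative_at_withinI\<close>)
  also have "\<dots> = integral {0..1} (\<lambda>t. \<Sum>i\<in>Basis. ((x - a) \<bullet> i) * frechet_derivative G (at (a + t *\<^sub>R (x - a))) i)"
  proof (rule integral_cong)
    fix t :: real assume t: "t \<in> {0..1}"
    have lin: "linear (frechet_derivative G (at (a + t *\<^sub>R (x - a))))"
      using C_infinity_on_has_derivative[OF G in_U[OF t]] has_derivative_linear by blast
    have "frechet_derivative G (at (a + t *\<^sub>R (x - a))) (x - a) =
        frechet_derivative G (at (a + t *\<^sub>R (x - a))) (\<Sum>i\<in>Basis. ((x - a) \<bullet> i) *\<^sub>R i)"
      by (simp only: euclidean_representation)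
    then show "frechet_derivative G (at (a + t *\<^sub>R (x - a))) (x - a) =
        (\<Sum>i\<in>Basis. ((x - a) \<bullet> i) * frechet_derivative G (at (a + t *\<^sub>R (x - a))) i)"
      by (simp add: linear_sum[OF lin] linear_scale[OF lin])
  qed
  also have "\<dots> = (\<Sum>i\<in>Basis. integral {0..1} (\<lambda>t. ((x - a) \<bullet> i) * frechet_derivative G (at (a + t *\<^sub>R (x - a))) i))"
    using c by (intro integral_sum) (auto intro!: integrable_continuous_interval continuous_intros)
  finally show "G x = G a + (\<Sum>i\<in>Basis. ((x - a) \<bullet> i) * ?g i x)" by simp
qed

text \<open>Tangent vectors and vector fields are functions into the reals, so pointwise operations turn
  them into real vector spaces.\<close>

instantiation "fun" :: (type, scaleR) scaleR
begin
definition "scaleR r f = (\<lambda>x. r *\<^sub>R f x)"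
instance ..
end

lemma scaleR_fun_apply [simp]: "(r *\<^sub>R f) x = r *\<^sub>R f x"
  by (simp add: scaleR_fun_def)

instance "fun" :: (type, real_vector) real_vector
  by standard (auto simp: scaleR_fun_def fun_eq_iff scaleR_add_left scaleR_add_right)

lemma sum_fun_apply [simp]: "(\<Sum>i\<in>I. f i) x = (\<Sum>i\<in>I. f i x)"
  by (induction I rule: infinite_finite_induct) auto

lemma tvec_ops:
  "tadd v w = v + w" "tdiff v w = v - w" "tscale c v = c *\<^sub>R v" "tzero = 0"
  by (auto simp: tadd_def tdiff_def tscale_def tzero_def fun_eq_iff)

definition fscale :: "('a \<Rightarrow> real) \<Rightarrow> 'a vfield \<Rightarrow> 'a vfield" (infixr "\<odot>" 75) where
  "f \<odot> X = (\<lambda>q. f q *\<^sub>R X q)"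

lemma fscale_apply [simp]: "(f \<odot> X) q = f q *\<^sub>R X q"
  by (simp add: fscale_def)

context smooth_manifold
begin

lemma tangent_spaceI:
  assumes "\<And>f h a b. smooth f \<Longrightarrow> smooth h \<Longrightarrow> v (\<lambda>x. a * f x + b * h x) = a * v f + b * v h"
    "\<And>f h. smooth f \<Longrightarrow> smooth h \<Longrightarrow> v (\<lambda>x. f x * h x) = f p * v h + h p * v f"
    "\<And>f. \<not> smooth f \<Longrightarrow> v f = 0"
  shows "v \<in> tangent_space A p"
  using assms by (simp add: tangent_space_def)

lemma tangent_lin: "v \<in> tangent_space A p \<Longrightarrow> smooth f \<Longrightarrow> smooth h \<Longrightarrow> v (\<lambda>x. a * f x + b * h x) = a * v f + b * v h"
  by (simp add: tangent_space_def)

lemma tangent_mult: "v \<in> tangent_space A p \<Longrightarrow> smooth f \<Longrightarrow> smooth h \<Longrightarrow> v (\<lambda>x. f x * h x) = f p * v h + h p * v f"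
  by (simp add: tangent_space_def)

lemma tangent_nonsmooth: "v \<in> tangent_space A p \<Longrightarrow> \<not> smooth f \<Longrightarrow> v f = 0"
  by (simp add: tangent_space_def)

lemma tangent_add: "v \<in> tangent_space A p \<Longrightarrow> smooth f \<Longrightarrow> smooth h \<Longrightarrow> v (\<lambda>x. f x + h x) = v f + v h"
  using tangent_lin[of v p f h 1 1] by simp

lemma tangent_diff: "v \<in> tangent_space A p \<Longrightarrow> smooth f \<Longrightarrow> smooth h \<Longrightarrow> v (\<lambda>x. f x - h x) = v f - v h"
  using tangent_lin[of v p f h 1 "-1"] by simp

lemma tangent_scale: "v \<in> tangent_space A p \<Longrightarrow> smooth f \<Longrightarrow> v (\<lambda>x. a * f x) = a * v f"
  using tangent_lin[of v p f f a 0] by simp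

lemma tangent_const [simp]: "v \<in> tangent_space A p \<Longrightarrow> v (\<lambda>x. c) = 0"
  using tangent_mult[of v p "\<lambda>x. 1" "\<lambda>x. 1"] tangent_scale[of v p "\<lambda>x. 1" c] by simp

lemma tangent_sum:
  "v \<in> tangent_space A p \<Longrightarrow> (\<And>i. i \<in> I \<Longrightarrow> smooth (f i)) \<Longrightarrow> v (\<lambda>x. \<Sum>i\<in>I. f i x) = (\<Sum>i\<in>I. v (f i))"
proof (induction I rule: infinite_finite_induct)
  case (insert i I)
  then show ?case
    using tangent_add[OF insert.prems(1), of "f i" "\<lambda>x. \<Sum>i\<in>I. f i x"] by (simp add: smooth_sum)
qed auto

text \<open>A bump with value \<open>1\<close> at \<open>p\<close> and support in \<open>W\<close> annihilates \<open>f - h\<close>; apply the Leibniz rule to the product.\<close>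

lemma tangent_local:
  assumes v: "v \<in> tangent_space A p" and f: "smooth f" "smooth h"
    and W: "open W" "p \<in> W" "\<And>q. q \<in> W \<Longrightarrow> f q = h q"
  shows "v f = v h"
proof -
  obtain \<eta> N K where \<eta>: "smooth \<eta>" "p \<in> N" "\<And>q. q \<in> N \<Longrightarrow> \<eta> q = 1" "K \<subseteq> W" "\<And>q. q \<notin> K \<Longrightarrow> \<eta> q = (0::real)"
    using bump_exists'[OF W(2,1)] by metis
  have "(\<lambda>q. \<eta> q * (f q - h q)) = (\<lambda>q. 0)"
    using \<eta>(4,5) W(3) by fastforce
  then have "v (\<lambda>q. \<eta> q * (f q - h q)) = 0" using v by simp
  then show ?thesis
    using tangent_mult[OF v \<eta>(1) smooth_diff[OF f]] tangent_diff[OF v f] \<eta>(2,3) W(2,3) by simp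
qed

lemma tangent_space_add: "v \<in> tangent_space A p \<Longrightarrow> w \<in> tangent_space A p \<Longrightarrow> v + w \<in> tangent_space A p"
  by (rule tangent_spaceI) (auto simp: tangent_lin tangent_mult tangent_nonsmooth algebra_simps)

lemma tangent_space_scale: "v \<in> tangent_space A p \<Longrightarrow> c *\<^sub>R v \<in> tangent_space A p"
  by (rule tangent_spaceI) (auto simp: tangent_lin tangent_mult tangent_nonsmooth algebra_simps)

lemma tangent_space_0 [simp]: "0 \<in> tangent_space A p"
  by (rule tangent_spaceI) auto

lemma tangent_space_uminus: "v \<in> tangent_space A p \<Longrightarrow> - v \<in> tangent_space A p"
  using tangent_space_scale[of v p "-1"] by simp

lemma tangent_space_diff: "v \<in> tangent_space A p \<Longrightarrow> w \<in> tangent_space A p \<Longrightarrow> v - w \<in> tangent_space A p"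
  using tangent_space_add[of v p "- w"] tangent_space_uminus[of w p] by simp

lemma tangent_space_sum: "(\<And>i. i \<in> I \<Longrightarrow> v i \<in> tangent_space A p) \<Longrightarrow> (\<Sum>i\<in>I. v i) \<in> tangent_space A p"
  by (induction I rule: infinite_finite_induct) (auto simp: tangent_space_add)

definition coord_vec :: "'a set \<Rightarrow> ('a \<Rightarrow> 'e) \<Rightarrow> 'a \<Rightarrow> 'e \<Rightarrow> 'a tvec" where
  "coord_vec V \<psi> p w =
    (\<lambda>f. if smooth f then frechet_derivative (\<lambda>x. f (inv_into V \<psi> x)) (at (\<psi> p)) w else 0)"

lemma smooth_in_chart_has_derivative:
  assumes "smooth f" "(V, \<psi>) \<in> maximal_atlas A" "p \<in> V"
  shows "((\<lambda>x. f (inv_into V \<psi> x)) has_derivative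
    frechet_derivative (\<lambda>x. f (inv_into V \<psi> x)) (at (\<psi> p))) (at (\<psi> p))"
  using C_infinity_on_has_derivative[OF smooth_in_chart[OF assms(1,2)]] assms(3) by blast

lemma coord_vec_eq:
  assumes "smooth f" "(V, \<psi>) \<in> maximal_atlas A" "p \<in> V"
    "((\<lambda>x. f (inv_into V \<psi> x)) has_derivative D) (at (\<psi> p))"
  shows "coord_vec V \<psi> p w f = D w"
  using frechet_derivative_at[OF assms(4)] assms(1) by (simp add: coord_vec_def)

lemma coord_vec_tangent:
  assumes mc: "(V, \<psi>) \<in> maximal_atlas A" and p: "p \<in> V"
  shows "coord_vec V \<psi> p w \<in> tangent_space A p"
proof (rule tangent_spaceI)
  fix f h a b assume f: "smooth f" and h: "smooth h"
  let ?D = "\<lambda>f. frechet_derivative (\<lambda>x. f (inv_into V \<psi> x)) (at (\<psi> p))"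
  note df = smooth_in_chart_has_derivative[OF f mc p] and dh = smooth_in_chart_has_derivative[OF h mc p]
  have "((\<lambda>x. a * f (inv_into V \<psi> x) + b * h (inv_into V \<psi> x)) has_derivative
      (\<lambda>w. a * ?D f w + b * ?D h w)) (at (\<psi> p))"
    by (intro has_derivative_add has_derivative_mult_right df dh)
  from coord_vec_eq[OF _ mc p this] f h
  show "coord_vec V \<psi> p w (\<lambda>x. a * f x + b * h x) = a * coord_vec V \<psi> p w f + b * coord_vec V \<psi> p w h"
    by (simp add: smooth_add smooth_mult coord_vec_def)
  have "((\<lambda>x. f (inv_into V \<psi> x) * h (inv_into V \<psi> x)) has_derivative
      (\<lambda>w. f (inv_into V \<psi> (\<psi> p)) * ?D h w + ?D f w * h (inv_into V \<psi> (\<psi> p)))) (at (\<psi> p))"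
    by (intro has_derivative_mult df dh)
  from coord_vec_eq[OF _ mc p this] f h
  show "coord_vec V \<psi> p w (\<lambda>x. f x * h x) = f p * coord_vec V \<psi> p w h + h p * coord_vec V \<psi> p w f"
    by (simp add: smooth_mult coord_vec_def chart_inv[OF mc p])
qed (simp add: coord_vec_def)

lemma coord_vec_linear:
  assumes mc: "(V, \<psi>) \<in> maximal_atlas A" and p: "p \<in> V"
  shows "linear (coord_vec V \<psi> p)"
proof (rule linearI)
  have lin: "linear (frechet_derivative (\<lambda>x. f (inv_into V \<psi> x)) (at (\<psi> p)))" if "smooth f" for f
    using has_derivative_linear[OF smooth_in_chart_has_derivative[OF that mc p]] .
  show "coord_vec V \<psi> p (a + b) = coord_vec V \<psi> p a + coord_vec V \<psi> p b" for a b
    using linear_add[OF lin] by (auto simp: coord_vec_def fun_eq_iff)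
  show "coord_vec V \<psi> p (c *\<^sub>R a) = c *\<^sub>R coord_vec V \<psi> p a" for a c
    using linear_scale[OF lin] by (auto simp: coord_vec_def fun_eq_iff)
qed

text \<open>Every derivation is a directional derivative: apply it to the Hadamard expansion.\<close>

lemma tangent_coord:
  assumes mc: "(V, \<psi>) \<in> maximal_atlas A" and W: "open W" "p \<in> W" "W \<subseteq> V"
    and y: "\<And>i. i \<in> Basis \<Longrightarrow> smooth (y i)" "\<And>i q. i \<in> Basis \<Longrightarrow> q \<in> W \<Longrightarrow> y i q = \<psi> q \<bullet> i"
    and v: "v \<in> tangent_space A p"
  shows "v = (\<Sum>i\<in>Basis. v (y i) *\<^sub>R coord_vec V \<psi> p i)"
proof
  fix f
  show "v f = (\<Sum>i\<in>Basis. v (y i) *\<^sub>R coord_vec V \<psi> p i) f"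
  proof (cases "smooth f")
    case False
    then show ?thesis using v by (simp add: tangent_nonsmooth coord_vec_def)
  next
    case f: True
    let ?a = "\<psi> p" and ?G = "\<lambda>x. f (inv_into V \<psi> x)"
    have p: "p \<in> V" using W by auto
    obtain r where r: "r > 0" "ball ?a r \<subseteq> \<psi> ` V"
      using chart_open_image[OF mc] p by (meson imageI openE)
    have "\<exists>g. (\<forall>i. C_infinity_on (ball ?a r) (g i)) \<and>
        (\<forall>x\<in>ball ?a r. ?G x = ?G ?a + (\<Sum>i\<in>Basis. ((x - ?a) \<bullet> i) * g i x)) \<and>
        (\<forall>i. g i ?a = frechet_derivative ?G (at ?a) i)"
      by (rule Hadamard[OF C_infinity_on_subset[OF smooth_in_chart[OF f mc] r(2)]]) blast
    then obtain g where g: "\<And>i. C_infinity_on (ball ?a r) (g i)"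
      "\<And>x. x \<in> ball ?a r \<Longrightarrow> ?G x = ?G ?a + (\<Sum>i\<in>Basis. ((x - ?a) \<bullet> i) * g i x)"
      "\<And>i. g i ?a = frechet_derivative ?G (at ?a) i"
      by blast
    have "\<exists>k M. smooth k \<and> open M \<and> p \<in> M \<and> M \<subseteq> V \<and> \<psi> ` M \<subseteq> ball ?a r \<and> (\<forall>q\<in>M. k q = g i (\<psi> q))" for i
      by (rule smooth_germ_in_chart[OF mc p open_ball _ g(1)[of i]]) (use r in simp, blast)
    then obtain k M where k: "\<And>i. smooth (k i)" "\<And>i. open (M i)" "\<And>i. p \<in> M i" "\<And>i. M i \<subseteq> V"
      "\<And>i q. q \<in> M i \<Longrightarrow> k i q = g i (\<psi> q)"
      by metis
    define Q where "Q = W \<inter> (V \<inter> \<psi> -` ball ?a r) \<inter> (\<Inter>i\<in>Basis. M i)"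
    have "open (\<Inter>i\<in>Basis. M i)" using k(2) by (intro open_INT) auto
    then have "open Q"
      unfolding Q_def using W(1) chart_open_preimage[OF mc open_ball[of ?a r]] by (metis open_Int)
    moreover have "p \<in> Q"
      unfolding Q_def using W r p k(3) by auto
    ultimately have Q: "open Q" "p \<in> Q" by auto
    define F where "F = (\<lambda>q. \<Sum>i\<in>Basis. (y i q - ?a \<bullet> i) * k i q)"
    have s: "smooth (\<lambda>q. (y i q - ?a \<bullet> i) * k i q)" if "i \<in> Basis" for i
      using that y(1) k(1) by (intro smooth_mult smooth_diff) auto
    have sF: "smooth F" unfolding F_def by (rule smooth_sum) (rule s)
    have "f q = f p + F q" if q: "q \<in> Q" for q
    proof -
      have "?G (\<psi> q) = ?G ?a + (\<Sum>i\<in>Basis. ((\<psi> q - ?a) \<bullet> i) * g i (\<psi> q))"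
        using q by (intro g(2)) (auto simp: Q_def)
      then show ?thesis
        using q p y(2) k(5) by (auto simp: Q_def F_def chart_inv[OF mc] inner_diff_left intro!: sum.cong)
    qed
    then have "v f = v (\<lambda>q. f p + F q)"
      by (intro tangent_local[OF v f _ Q(1,2)] smooth_add sF) auto
    also have "\<dots> = v F" using tangent_add[OF v smooth_const sF] v by simp
    also have "\<dots> = (\<Sum>i\<in>Basis. v (\<lambda>q. (y i q - ?a \<bullet> i) * k i q))"
      unfolding F_def by (rule tangent_sum[OF v s])
    also have "\<dots> = (\<Sum>i\<in>Basis. v (y i) * g i ?a)"
    proof (rule sum.cong[OF refl])
      fix i :: 'e assume i: "i \<in> Basis"
      have "v (\<lambda>q. y i q - ?a \<bullet> i) = v (y i)"
        using tangent_diff[OF v y(1)[OF i] smooth_const] v by simp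
      then show "v (\<lambda>q. (y i q - ?a \<bullet> i) * k i q) = v (y i) * g i ?a"
        using tangent_mult[OF v smooth_diff[OF y(1)[OF i] smooth_const] k(1), of "?a \<bullet> i" i]
          y(2)[OF i W(2)] k(5)[OF k(3), of i] by simp
    qed
    finally show ?thesis using f by (simp add: g(3) coord_vec_def)
  qed
qed

lemma vector_fieldsI:
  "(\<And>p. X p \<in> tangent_space A p) \<Longrightarrow> (\<And>f. smooth f \<Longrightarrow> smooth (\<lambda>p. X p f)) \<Longrightarrow> X \<in> vector_fields A"
  by (simp add: vector_fields_def)

lemma vf_tangent: "X \<in> vector_fields A \<Longrightarrow> X p \<in> tangent_space A p"
  by (simp add: vector_fields_def)

lemma vf_smooth: "X \<in> vector_fields A \<Longrightarrow> smooth f \<Longrightarrow> smooth (\<lambda>p. X p f)"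
  by (simp add: vector_fields_def)

lemma vf_add: "X \<in> vector_fields A \<Longrightarrow> Y \<in> vector_fields A \<Longrightarrow> X + Y \<in> vector_fields A"
  by (rule vector_fieldsI) (auto simp: vf_tangent vf_smooth tangent_space_add smooth_add)

lemma vf_fscale: "smooth f \<Longrightarrow> X \<in> vector_fields A \<Longrightarrow> f \<odot> X \<in> vector_fields A"
  by (rule vector_fieldsI) (auto simp: vf_tangent vf_smooth tangent_space_scale smooth_mult)

lemma vf_scale: "X \<in> vector_fields A \<Longrightarrow> c *\<^sub>R X \<in> vector_fields A"
  by (rule vector_fieldsI) (auto simp: vf_tangent vf_smooth tangent_space_scale smooth_mult)

lemma vf_diff: "X \<in> vector_fields A \<Longrightarrow> Y \<in> vector_fields A \<Longrightarrow> X - Y \<in> vector_fields A"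
  using vf_add[of X "(-1) *\<^sub>R Y"] vf_scale[of Y "-1"] by simp

lemma vf_0: "0 \<in> vector_fields A"
  by (rule vector_fieldsI) auto

lemma vf_sum: "(\<And>i. i \<in> I \<Longrightarrow> X i \<in> vector_fields A) \<Longrightarrow> (\<Sum>i\<in>I. X i) \<in> vector_fields A"
  by (induction I rule: infinite_finite_induct) (auto simp: vf_0 vf_add)

lemma cutoff_coord_field:
  assumes mc: "(V, \<psi>) \<in> maximal_atlas A" and \<eta>: "smooth \<eta>" "compact K" "K \<subseteq> V" "\<And>q. q \<notin> K \<Longrightarrow> \<eta> q = 0"
  shows "(\<lambda>q. if q \<in> V then \<eta> q *\<^sub>R coord_vec V \<psi> q w else 0) \<in> vector_fields A" (is "?X \<in> _")
proof (rule vector_fieldsI)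
  show "?X p \<in> tangent_space A p" for p
    by (auto simp: coord_vec_tangent[OF mc] tangent_space_scale)
next
  fix f assume f: "smooth f"
  show "smooth (\<lambda>p. ?X p f)"
  proof (rule smooth_local)
    fix p
    show "\<exists>W f'. open W \<and> p \<in> W \<and> smooth f' \<and> (\<forall>q\<in>W. ?X q f = f' q)"
    proof (cases "p \<in> V")
      case True
      let ?G = "\<lambda>x. frechet_derivative (\<lambda>x. f (inv_into V \<psi> x)) (at x) w"
      have "\<exists>k W. smooth k \<and> open W \<and> p \<in> W \<and> W \<subseteq> V \<and> (\<forall>q\<in>W. k q = ?G (\<psi> q))"
        by (rule smooth_germ_in_chart[OF mc True chart_open_image[OF mc] _
            C_infinity_on_frechet[OF smooth_in_chart[OF f mc], of w]]) (use True in simp, blast)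
      then obtain k W where k: "smooth k" "open W" "p \<in> W" "W \<subseteq> V"
        "\<And>q. q \<in> W \<Longrightarrow> k q = ?G (\<psi> q)"
        by blast
      show ?thesis
        using k f \<eta>(1) by (intro exI[of _ W] exI[of _ "\<lambda>q. \<eta> q * k q"])
          (auto simp: smooth_mult coord_vec_def)
    next
      case False
      have "closed K" using \<eta>(2) compact_imp_closed by blast
      then show ?thesis
        using \<eta> False by (intro exI[of _ "- K"] exI[of _ "\<lambda>q. 0"]) auto
    qed
  qed
qed

text \<open>The functions \<open>y\<close> serve as the coordinates of the frame: differentiating them reads off the
  coefficients of a vector. Both are globally defined, so that they can be inserted into connections
  and brackets.\<close>

definition frame_on :: "'a set \<Rightarrow> ('e \<Rightarrow> 'a \<Rightarrow> real) \<Rightarrow> ('e \<Rightarrow> 'a vfield) \<Rightarrow> bool" where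
  "frame_on W y e \<longleftrightarrow> open W \<and> (\<forall>i\<in>Basis. smooth (y i) \<and> e i \<in> vector_fields A) \<and>
    (\<forall>q\<in>W. \<forall>i\<in>Basis. \<forall>j\<in>Basis. e i q (y j) = (if i = j then 1 else 0)) \<and>
    (\<forall>q\<in>W. \<forall>v\<in>tangent_space A q. v = (\<Sum>i\<in>Basis. v (y i) *\<^sub>R e i q))"

text \<open>Multiply the coordinates and the coordinate fields with a bump that is \<open>1\<close> near the point.\<close>

lemma chart_frame_exists:
  assumes mc: "(V, \<psi>) \<in> maximal_atlas A" and p: "p \<in> V"
  shows "\<exists>W y e. p \<in> W \<and> W \<subseteq> V \<and> frame_on W y e \<and> (\<forall>i\<in>Basis. \<forall>q\<in>W. y i q = \<psi> q \<bullet> i) \<and>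
    (\<forall>i\<in>Basis. \<forall>q\<in>W. e i q = coord_vec V \<psi> q i)"
proof -
  obtain \<eta> N K where \<eta>: "smooth \<eta>" "open N" "p \<in> N" "N \<subseteq> K" "\<And>q. q \<in> N \<Longrightarrow> \<eta> q = 1"
    "compact K" "K \<subseteq> V \<inter> V" "\<And>q. q \<notin> K \<Longrightarrow> \<eta> q = (0::real)"
    using bump_exists[OF mc p p chart_open[OF mc]] by metis
  have "\<exists>k M. smooth k \<and> open M \<and> p \<in> M \<and> M \<subseteq> V \<and> \<psi> ` M \<subseteq> UNIV \<and> (\<forall>q\<in>M. k q = \<psi> q \<bullet> i)" for i
    by (rule smooth_germ_in_chart[OF mc p open_UNIV _ C_infinity_on_bounded_linear[OF bounded_linear_inner_left[of i]]]) (simp, blast)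
  then obtain y M where y: "\<And>i. smooth (y i)" "\<And>i. open (M i)" "\<And>i. p \<in> M i" "\<And>i. M i \<subseteq> V"
    "\<And>i q. q \<in> M i \<Longrightarrow> y i q = \<psi> q \<bullet> i"
    by metis
  define W where "W = N \<inter> (\<Inter>i\<in>Basis. M i)"
  define e where "e = (\<lambda>i q. if q \<in> V then \<eta> q *\<^sub>R coord_vec V \<psi> q i else 0)"
  have W: "open W" "p \<in> W" "W \<subseteq> V"
    unfolding W_def using \<eta> y by (auto intro!: open_Int open_INT)
  have yW: "y i q = \<psi> q \<bullet> i" if "i \<in> Basis" "q \<in> W" for i q
    using that y(5) by (auto simp: W_def)
  have e: "e i \<in> vector_fields A" for i
    unfolding e_def using \<eta> by (intro cutoff_coord_field[OF mc]) auto
  have eW: "e i q = coord_vec V \<psi> q i" if "q \<in> W" for i q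
    using that W(3) \<eta>(5) by (auto simp: e_def W_def)
  have ey: "e i q (y j) = (if i = j then 1 else 0)" if "i \<in> Basis" "j \<in> Basis" "q \<in> W" for i j q
  proof -
    have q: "q \<in> V" using that W by auto
    have o: "open (\<psi> ` W)" using W by (intro chart_open_subset_image[OF mc]) auto
    have "((\<lambda>x. x \<bullet> j) has_derivative (\<lambda>x. x \<bullet> j)) (at (\<psi> q))"
      by (rule bounded_linear_imp_has_derivative) (rule bounded_linear_inner_left)
    then have "((\<lambda>x. y j (inv_into V \<psi> x)) has_derivative (\<lambda>x. x \<bullet> j)) (at (\<psi> q))"
    proof (rule has_derivative_transform_within_open[OF _ o])
      show "\<psi> q \<in> \<psi> ` W" using that by blast
      fix x assume "x \<in> \<psi> ` W"
      then obtain q' where "q' \<in> W" "x = \<psi> q'" by blast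
      then show "x \<bullet> j = y j (inv_into V \<psi> x)"
        using W(3) yW[OF that(2)] chart_inv[OF mc, of q'] by auto
    qed
    from coord_vec_eq[OF y(1) mc q this, of i] show ?thesis
      using that by (simp add: eW inner_Basis)
  qed
  have "v = (\<Sum>i\<in>Basis. v (y i) *\<^sub>R e i q)" if "q \<in> W" "v \<in> tangent_space A q" for q v
    using tangent_coord[OF mc W(1) that(1) W(3) y(1) yW that(2)] by (simp add: eW[OF that(1)])
  with W(1) y(1) e ey have "frame_on W y e" unfolding frame_on_def by simp
  then show ?thesis
    using W(2,3) yW eW by (intro exI[of _ W] exI[of _ y] exI[of _ e] conjI ballI) simp_all
qed

lemma frame_exists: obtains W y e where "p \<in> W" "frame_on W y e"
proof -
  obtain V \<psi> where c: "(V, \<psi>) \<in> A" "p \<in> V" using chart_covers .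
  show ?thesis
    using chart_frame_exists[OF atlas_subset_maximal[OF c(1)] c(2)] by (elim exE conjE) (rule that)
qed

lemma frame_onD:
  assumes "frame_on W y e"
  shows "open W" "\<And>i. i \<in> Basis \<Longrightarrow> smooth (y i)" "\<And>i. i \<in> Basis \<Longrightarrow> e i \<in> vector_fields A"
    "\<And>q i j. q \<in> W \<Longrightarrow> i \<in> Basis \<Longrightarrow> j \<in> Basis \<Longrightarrow> e i q (y j) = (if i = j then 1 else 0)"
    "\<And>q v. q \<in> W \<Longrightarrow> v \<in> tangent_space A q \<Longrightarrow> v = (\<Sum>i\<in>Basis. v (y i) *\<^sub>R e i q)"
  using assms unfolding frame_on_def by blast+

lemma extend_vector:
  assumes "v \<in> tangent_space A p"
  shows "extend_vector A p v \<in> vector_fields A" "extend_vector A p v p = v"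
proof -
  obtain W y e where p: "p \<in> W" and fr: "frame_on W y e" by (rule frame_exists)
  let ?X = "\<Sum>i\<in>Basis. v (y i) *\<^sub>R e i"
  have "?X \<in> vector_fields A" using frame_onD(3)[OF fr] by (intro vf_sum vf_scale)
  moreover have "?X p = v" using frame_onD(5)[OF fr p assms] by simp
  ultimately have "\<exists>X. X \<in> vector_fields A \<and> X p = v" by blast
  from someI_ex[OF this] show "extend_vector A p v \<in> vector_fields A" "extend_vector A p v p = v"
    by (simp_all add: extend_vector_def)
qed

end

section \<open>Levi-Civita connection and curvature as tensors\<close>

locale lorentz_manifold = smooth_manifold A
  for A :: "('a::{t2_space, second_countable_topology}, 'e::euclidean_space) chart set" +
  fixes g :: "'a metric" and D :: "'a connection"
  assumes metric: "lorentzian_metric A g" and levi_civita: "levi_civita_connection A g D"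
begin

lemmas tang [simp] = vf_tangent tangent_space_add tangent_space_scale tangent_space_diff
  tangent_space_uminus tangent_space_sum

abbreviation T where "T \<equiv> tangent_space A"
abbreviation VF where "VF \<equiv> vector_fields A"

lemma g_lin: "u \<in> T p \<Longrightarrow> v \<in> T p \<Longrightarrow> w \<in> T p \<Longrightarrow> g p (a *\<^sub>R u + b *\<^sub>R v) w = a * g p u w + b * g p v w"
  using metric unfolding lorentzian_metric_def tvec_ops by blast

lemma g_sym: "u \<in> T p \<Longrightarrow> v \<in> T p \<Longrightarrow> g p u v = g p v u"
  using metric unfolding lorentzian_metric_def by blast

lemma g_add: "u \<in> T p \<Longrightarrow> v \<in> T p \<Longrightarrow> w \<in> T p \<Longrightarrow> g p (u + v) w = g p u w + g p v w"
  using g_lin[of u p v w 1 1] by simp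

lemma g_scale: "u \<in> T p \<Longrightarrow> w \<in> T p \<Longrightarrow> g p (a *\<^sub>R u) w = a * g p u w"
  using g_lin[of u p u w a 0] by simp

lemma g_uminus: "u \<in> T p \<Longrightarrow> w \<in> T p \<Longrightarrow> g p (- u) w = - g p u w"
  using g_scale[of u p w "-1"] by simp

lemma g_diff: "u \<in> T p \<Longrightarrow> v \<in> T p \<Longrightarrow> w \<in> T p \<Longrightarrow> g p (u - v) w = g p u w - g p v w"
  using g_lin[of u p v w 1 "-1"] by simp

lemma g_0: "w \<in> T p \<Longrightarrow> g p 0 w = 0"
  using g_scale[of 0 p w 0] by simp

lemma g_sum: "(\<And>i. i \<in> I \<Longrightarrow> u i \<in> T p) \<Longrightarrow> w \<in> T p \<Longrightarrow> g p (\<Sum>i\<in>I. u i) w = (\<Sum>i\<in>I. g p (u i) w)"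
  by (induction I rule: infinite_finite_induct) (auto simp: g_0 g_add)

lemma g_right:
  assumes "w \<in> T p"
  shows "u \<in> T p \<Longrightarrow> v \<in> T p \<Longrightarrow> g p w (u + v) = g p w u + g p w v"
    "u \<in> T p \<Longrightarrow> v \<in> T p \<Longrightarrow> g p w (u - v) = g p w u - g p w v"
    "u \<in> T p \<Longrightarrow> g p w (a *\<^sub>R u) = a * g p w u"
    "u \<in> T p \<Longrightarrow> g p w (- u) = - g p w u"
    "g p w 0 = 0"
    "(\<And>i. i \<in> I \<Longrightarrow> b i \<in> T p) \<Longrightarrow> g p w (\<Sum>i\<in>I. b i) = (\<Sum>i\<in>I. g p w (b i))"
  using assms g_sym[OF assms] by (simp_all add: g_add g_diff g_scale g_uminus g_0 g_sum)

lemmas g_bilinear = g_add g_diff g_scale g_uminus g_0 g_sum g_right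

lemma g_smooth: "X \<in> VF \<Longrightarrow> Y \<in> VF \<Longrightarrow> smooth (\<lambda>p. g p (X p) (Y p))"
  using metric by (simp add: lorentzian_metric_def)

lemma orthonormal_basis_tangent_exists:
  "\<exists>B. orthonormal_basis (g p) (T p) B \<and> card {e\<in>B. g p e e = -1} = 1"
  using metric by (simp add: lorentzian_metric_def)

text \<open>Pairing any expansion of \<open>v\<close> with a basis vector isolates its coefficient.\<close>

lemma orthonormal_expansion:
  assumes B: "orthonormal_basis (g p) W B" and W: "W \<subseteq> T p" and v: "v \<in> W"
  shows "v = (\<Sum>e\<in>B. (g p e e * g p v e) *\<^sub>R e)"
proof -
  have B1: "finite B" "B \<subseteq> T p" and B2: "\<And>e. e \<in> B \<Longrightarrow> g p e e * g p e e = 1"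
    and B3: "\<And>e e'. e \<in> B \<Longrightarrow> e' \<in> B \<Longrightarrow> e \<noteq> e' \<Longrightarrow> g p e e' = 0"
    using B W by (auto simp: orthonormal_basis_def)
  have "\<exists>c. v = (\<lambda>f. \<Sum>e\<in>B. c e * e f)"
    using B v unfolding orthonormal_basis_def by blast
  moreover have "(\<lambda>f. \<Sum>e\<in>B. c e * e f) = (\<Sum>e\<in>B. c e *\<^sub>R e)" for c
    by (simp add: fun_eq_iff)
  ultimately obtain c where c: "v = (\<Sum>e\<in>B. c e *\<^sub>R e)" by auto
  have "g p v e = c e * g p e e" if e: "e \<in> B" for e
  proof -
    have "g p v e = (\<Sum>e'\<in>B. c e' * g p e' e)"
      unfolding c using B1 e by (subst g_sum) (auto simp: g_scale subset_iff)
    also have "\<dots> = (\<Sum>e'\<in>B. if e' = e then c e * g p e e else 0)"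
      using B3 e by (intro sum.cong) auto
    finally show ?thesis using B1 e by simp
  qed
  then have "g p e e * g p v e = c e" if "e \<in> B" for e
    using B2[OF that] that by (simp add: algebra_simps)
  then have "(\<Sum>e\<in>B. (g p e e * g p v e) *\<^sub>R e) = (\<Sum>e\<in>B. c e *\<^sub>R e)"
    by (intro sum.cong refl) (simp only:)
  with c show ?thesis by (simp only:)
qed

lemma nondegenerate:
  assumes v: "v \<in> T p" and 0: "\<And>w. w \<in> T p \<Longrightarrow> g p v w = 0"
  shows "v = 0"
proof -
  obtain B where B: "orthonormal_basis (g p) (T p) B"
    using orthonormal_basis_tangent_exists by blast
  have "B \<subseteq> T p" using B by (simp add: orthonormal_basis_def)
  then have "(g p e e * g p v e) *\<^sub>R e = 0" if "e \<in> B" for e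
    using 0[of e] that by auto
  then have "(\<Sum>e\<in>B. (g p e e * g p v e) *\<^sub>R e) = 0" by (rule sum.neutral[OF ballI])
  then show ?thesis using orthonormal_expansion[OF B subset_refl v] by simp
qed

lemma affine: "affine_connection A D"
  using levi_civita by (simp add: levi_civita_connection_def)

lemma D_vf [simp]: "X \<in> VF \<Longrightarrow> Y \<in> VF \<Longrightarrow> D X Y \<in> VF"
  using affine by (simp add: affine_connection_def)

lemma D_lin_left: "X \<in> VF \<Longrightarrow> Y \<in> VF \<Longrightarrow> Z \<in> VF \<Longrightarrow> smooth f \<Longrightarrow> smooth h \<Longrightarrow>
   D (f \<odot> X + h \<odot> Y) Z = f \<odot> D X Z + h \<odot> D Y Z"
proof
  fix p assume *: "X \<in> VF" "Y \<in> VF" "Z \<in> VF" "smooth f" "smooth h"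
  have "f \<odot> X + h \<odot> Y = (\<lambda>q. tadd (tscale (f q) (X q)) (tscale (h q) (Y q)))"
    by (simp add: tvec_ops fscale_def plus_fun_def)
  then show "D (f \<odot> X + h \<odot> Y) Z p = (f \<odot> D X Z + h \<odot> D Y Z) p"
    using affine * by (simp add: affine_connection_def tvec_ops)
qed

lemma fscale_1: "(\<lambda>q. 1) \<odot> X = X" and fscale_0: "(\<lambda>q. 0) \<odot> X = 0"
  and fscale_const: "(\<lambda>q. c) \<odot> X = c *\<^sub>R X"
  by (auto simp: fscale_def fun_eq_iff)

lemma D_fscale_left: "X \<in> VF \<Longrightarrow> Z \<in> VF \<Longrightarrow> smooth f \<Longrightarrow> D (f \<odot> X) Z = f \<odot> D X Z"
  using D_lin_left[of X X Z f "\<lambda>q. 0"] by (simp add: fscale_0)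

lemma D_add_left: "X \<in> VF \<Longrightarrow> Y \<in> VF \<Longrightarrow> Z \<in> VF \<Longrightarrow> D (X + Y) Z = D X Z + D Y Z"
  using D_lin_left[of X Y Z "\<lambda>q. 1" "\<lambda>q. 1"] by (simp add: fscale_1)

lemma D_diff_left: "X \<in> VF \<Longrightarrow> Y \<in> VF \<Longrightarrow> Z \<in> VF \<Longrightarrow> D (X - Y) Z = D X Z - D Y Z"
  using D_lin_left[of X Y Z "\<lambda>q. 1" "\<lambda>q. -1"] by (simp add: fscale_1 fscale_const)

lemma D_0_left: "Z \<in> VF \<Longrightarrow> D 0 Z = 0"
  using D_fscale_left[of 0 Z "\<lambda>q. 0"] by (simp add: fscale_0 vf_0)

lemma D_sum_left: "(\<And>i. i \<in> I \<Longrightarrow> X i \<in> VF) \<Longrightarrow> Z \<in> VF \<Longrightarrow> D (\<Sum>i\<in>I. X i) Z = (\<Sum>i\<in>I. D (X i) Z)"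
  by (induction I rule: infinite_finite_induct) (auto simp: D_add_left D_0_left vf_sum)

lemma D_add_right: "X \<in> VF \<Longrightarrow> Y \<in> VF \<Longrightarrow> Z \<in> VF \<Longrightarrow> D X (Y + Z) = D X Y + D X Z"
proof
  fix p assume *: "X \<in> VF" "Y \<in> VF" "Z \<in> VF"
  have "Y + Z = (\<lambda>q. tadd (Y q) (Z q))" by (simp add: tvec_ops plus_fun_def)
  then show "D X (Y + Z) p = (D X Y + D X Z) p"
    using affine * by (simp add: affine_connection_def tvec_ops)
qed

lemma D_fscale_right: "X \<in> VF \<Longrightarrow> Y \<in> VF \<Longrightarrow> smooth f \<Longrightarrow>
   D X (f \<odot> Y) = (\<lambda>q. X q f) \<odot> Y + f \<odot> D X Y"
proof
  fix p assume *: "X \<in> VF" "Y \<in> VF" "smooth f"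
  have "f \<odot> Y = (\<lambda>q. tscale (f q) (Y q))" by (simp add: tvec_ops fscale_def)
  then show "D X (f \<odot> Y) p = ((\<lambda>q. X q f) \<odot> Y + f \<odot> D X Y) p"
    using affine * by (simp add: affine_connection_def tvec_ops)
qed

lemma D_scale_right: "X \<in> VF \<Longrightarrow> Y \<in> VF \<Longrightarrow> D X (c *\<^sub>R Y) = c *\<^sub>R D X Y"
  using D_fscale_right[of X Y "\<lambda>q. c"] by (auto simp: fscale_const fun_eq_iff tangent_const[OF vf_tangent])

lemma D_diff_right: "X \<in> VF \<Longrightarrow> Y \<in> VF \<Longrightarrow> Z \<in> VF \<Longrightarrow> D X (Y - Z) = D X Y - D X Z"
  using D_add_right[of X Y "(-1) *\<^sub>R Z"] D_scale_right[of X Z "-1"] vf_scale[of Z "-1"] by simp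

lemma D_0_right: "X \<in> VF \<Longrightarrow> D X 0 = 0"
  using D_scale_right[of X 0 0] by (simp add: vf_0)

lemma D_sum_right: "X \<in> VF \<Longrightarrow> (\<And>i. i \<in> I \<Longrightarrow> Y i \<in> VF) \<Longrightarrow> D X (\<Sum>i\<in>I. Y i) = (\<Sum>i\<in>I. D X (Y i))"
  by (induction I rule: infinite_finite_induct) (auto simp: D_add_right D_0_right vf_sum)

lemma torsion_free: "X \<in> VF \<Longrightarrow> Y \<in> VF \<Longrightarrow> lie_bracket X Y = D X Y - D Y X"
  using levi_civita by (auto simp: levi_civita_connection_def tvec_ops fun_eq_iff)

lemma lie_bracket_vf [simp]: "X \<in> VF \<Longrightarrow> Y \<in> VF \<Longrightarrow> lie_bracket X Y \<in> VF"
  by (simp add: torsion_free vf_diff)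

lemma metric_compatible: "X \<in> VF \<Longrightarrow> Y \<in> VF \<Longrightarrow> Z \<in> VF \<Longrightarrow>
    X p (\<lambda>q. g q (Y q) (Z q)) = g p (D X Y p) (Z p) + g p (Y p) (D X Z p)"
  using levi_civita by (simp add: levi_civita_connection_def)

lemma lie_bracket_apply: "lie_bracket X Y p f = X p (\<lambda>q. Y q f) - Y p (\<lambda>q. X q f)"
  by (simp add: lie_bracket_def)

text \<open>Multiplying a field by a cut-off turns its local expansion in a frame into a global one; since
  the cut-off has value \<open>1\<close> and vanishing differential at \<open>p\<close>, it disappears from all formulas at \<open>p\<close>.\<close>

lemma expansion:
  assumes fr: "frame_on W y e" and p: "p \<in> W"
  shows "\<exists>\<eta>. smooth \<eta> \<and> \<eta> p = 1 \<and> (\<forall>v\<in>T p. v \<eta> = 0) \<and>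
    (\<forall>Z\<in>VF. \<eta> \<odot> Z = (\<Sum>i\<in>Basis. (\<lambda>q. \<eta> q * Z q (y i)) \<odot> e i))"
proof -
  obtain \<eta> N K where \<eta>: "smooth \<eta>" "open N" "p \<in> N" "\<And>q. q \<in> N \<Longrightarrow> \<eta> q = (1::real)"
    "K \<subseteq> W" "\<And>q. q \<notin> K \<Longrightarrow> \<eta> q = 0"
    using bump_exists'[OF p frame_onD(1)[OF fr]] by metis
  have 1: "\<eta> p = 1" using \<eta> by auto
  have 2: "v \<eta> = 0" if "v \<in> T p" for v
    using tangent_local[OF that \<eta>(1) smooth_const \<eta>(2,3), of 1] \<eta>(4) tangent_const[OF that] by auto
  have 3: "\<eta> \<odot> Z = (\<Sum>i\<in>Basis. (\<lambda>q. \<eta> q * Z q (y i)) \<odot> e i)" if Z: "Z \<in> VF" for Z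
  proof
    fix q
    show "(\<eta> \<odot> Z) q = (\<Sum>i\<in>Basis. (\<lambda>q. \<eta> q * Z q (y i)) \<odot> e i) q"
    proof (cases "q \<in> W")
      case True
      from frame_onD(5)[OF fr True vf_tangent[OF Z]]
      have "\<eta> q *\<^sub>R Z q = \<eta> q *\<^sub>R (\<Sum>i\<in>Basis. Z q (y i) *\<^sub>R e i q)" by (rule arg_cong)
      then show ?thesis by (simp add: scaleR_sum_right)
    next
      case False
      then have "\<eta> q = 0" using \<eta>(5,6) by blast
      then show ?thesis by simp
    qed
  qed
  show ?thesis
    by (intro exI[of _ \<eta>] conjI ballI \<eta>(1) 1) (erule 2, erule 3)
qed

lemma D_left_expansion:
  assumes fr: "frame_on W y e" and p: "p \<in> W" and Z: "Z \<in> VF" and Y: "Y \<in> VF"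
  shows "D Z Y p = (\<Sum>i\<in>Basis. Z p (y i) *\<^sub>R D (e i) Y p)"
proof -
  obtain \<eta> where \<eta>': "smooth \<eta>" "\<eta> p = 1"
    "\<forall>Z\<in>VF. \<eta> \<odot> Z = (\<Sum>i\<in>Basis. (\<lambda>q. \<eta> q * Z q (y i)) \<odot> e i)"
    using expansion[OF fr p] by (elim exE conjE) (rule that)
  note \<eta> = \<eta>'(1,2) \<eta>'(3)[rule_format]
  note f = frame_onD[OF fr]
  have s: "smooth (\<lambda>q. \<eta> q * Z q (y i))" if "i \<in> Basis" for i
    by (rule smooth_mult[OF \<eta>(1) vf_smooth[OF Z f(2)[OF that]]])
  have "D Z Y p = (\<eta> \<odot> D Z Y) p" using \<eta>(2) by simp
  also have "\<dots> = D (\<Sum>i\<in>Basis. (\<lambda>q. \<eta> q * Z q (y i)) \<odot> e i) Y p"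
    by (simp only: D_fscale_left[OF Z Y \<eta>(1), symmetric] \<eta>(3)[OF Z])
  also have "\<dots> = (\<Sum>i\<in>Basis. D ((\<lambda>q. \<eta> q * Z q (y i)) \<odot> e i) Y p)"
    by (subst D_sum_left) (auto simp: s f Y vf_fscale)
  also have "\<dots> = (\<Sum>i\<in>Basis. Z p (y i) *\<^sub>R D (e i) Y p)"
    using \<eta>(2) by (intro sum.cong) (auto simp: D_fscale_left s f Y)
  finally show ?thesis .
qed

lemma D_right_expansion:
  assumes fr: "frame_on W y e" and p: "p \<in> W" and Z: "Z \<in> VF" and X: "X \<in> VF"
  shows "D X Z p = (\<Sum>i\<in>Basis. X p (\<lambda>q. Z q (y i)) *\<^sub>R e i p + Z p (y i) *\<^sub>R D X (e i) p)"
proof -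
  obtain \<eta> where \<eta>': "smooth \<eta>" "\<eta> p = 1" "\<forall>v\<in>T p. v \<eta> = 0"
    "\<forall>Z\<in>VF. \<eta> \<odot> Z = (\<Sum>i\<in>Basis. (\<lambda>q. \<eta> q * Z q (y i)) \<odot> e i)"
    using expansion[OF fr p] by (elim exE conjE) (rule that)
  note \<eta> = \<eta>'(1,2) \<eta>'(3,4)[rule_format]
  note f = frame_onD[OF fr]
  have s: "smooth (\<lambda>q. Z q (y i))" "smooth (\<lambda>q. \<eta> q * Z q (y i))" if "i \<in> Basis" for i
    using vf_smooth[OF Z f(2)[OF that]] smooth_mult[OF \<eta>(1)] by blast+
  have "D X Z p = D X (\<eta> \<odot> Z) p"
    using \<eta>(2) \<eta>(3)[OF vf_tangent[OF X]] by (simp add: D_fscale_right[OF X Z \<eta>(1)])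
  also have "\<dots> = (\<Sum>i\<in>Basis. D X ((\<lambda>q. \<eta> q * Z q (y i)) \<odot> e i) p)"
    unfolding \<eta>(4)[OF Z] by (subst D_sum_right) (auto simp: s f X vf_fscale)
  also have "\<dots> = (\<Sum>i\<in>Basis. X p (\<lambda>q. Z q (y i)) *\<^sub>R e i p + Z p (y i) *\<^sub>R D X (e i) p)"
  proof (rule sum.cong[OF refl])
    fix i :: 'e assume i: "i \<in> Basis"
    have "X p (\<lambda>q. \<eta> q * Z q (y i)) = X p (\<lambda>q. Z q (y i))"
      using tangent_mult[OF vf_tangent[OF X] \<eta>(1) s(1)[OF i], of p] \<eta>(2,3) X by simp
    then show "D X ((\<lambda>q. \<eta> q * Z q (y i)) \<odot> e i) p = X p (\<lambda>q. Z q (y i)) *\<^sub>R e i p + Z p (y i) *\<^sub>R D X (e i) p"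
      using \<eta>(2) by (simp add: D_fscale_right s(2)[OF i] f(3)[OF i] X)
  qed
  finally show ?thesis .
qed

lemma D_tensorial:
  assumes "X \<in> VF" "X' \<in> VF" "Y \<in> VF" "X p = X' p"
  shows "D X Y p = D X' Y p"
proof -
  obtain W y e where p: "p \<in> W" and fr: "frame_on W y e" by (rule frame_exists)
  show ?thesis
    using D_left_expansion[OF fr p assms(1,3)] D_left_expansion[OF fr p assms(2,3)] assms(4) by simp
qed

abbreviation cov :: "'a \<Rightarrow> 'a tvec \<Rightarrow> 'a vfield \<Rightarrow> 'a tvec" where
  "cov \<equiv> cov_deriv A D"

lemma cov_eq: "X \<in> VF \<Longrightarrow> Y \<in> VF \<Longrightarrow> cov p (X p) Y = D X Y p"
  unfolding cov_deriv_def by (rule D_tensorial) (auto simp: extend_vector)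

lemma cov_tangent [simp]: "v \<in> T p \<Longrightarrow> Y \<in> VF \<Longrightarrow> cov p v Y \<in> T p"
  unfolding cov_deriv_def by (simp add: extend_vector)

lemma cov_expansion:
  assumes fr: "frame_on W y e" and p: "p \<in> W" and v: "v \<in> T p" and Y: "Y \<in> VF"
  shows "cov p v Y = (\<Sum>i\<in>Basis. v (y i) *\<^sub>R D (e i) Y p)"
  using D_left_expansion[OF fr p extend_vector(1)[OF v] Y] unfolding cov_deriv_def by (simp add: extend_vector(2)[OF v])

lemma cov_lin:
  assumes "u \<in> T p" "v \<in> T p" "Y \<in> VF"
  shows "cov p (a *\<^sub>R u + b *\<^sub>R v) Y = a *\<^sub>R cov p u Y + b *\<^sub>R cov p v Y"
proof -
  obtain W y e where p: "p \<in> W" and fr: "frame_on W y e" by (rule frame_exists)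
  have "a *\<^sub>R u + b *\<^sub>R v \<in> T p" using assms by simp
  from cov_expansion[OF fr p this assms(3)] show ?thesis
    by (simp add: cov_expansion[OF fr p] assms scaleR_sum_right sum.distrib scaleR_add_left)
qed

lemma cov_add: "u \<in> T p \<Longrightarrow> v \<in> T p \<Longrightarrow> Y \<in> VF \<Longrightarrow> cov p (u + v) Y = cov p u Y + cov p v Y"
  using cov_lin[of u p v Y 1 1] by simp

lemma cov_scale: "u \<in> T p \<Longrightarrow> Y \<in> VF \<Longrightarrow> cov p (a *\<^sub>R u) Y = a *\<^sub>R cov p u Y"
  using cov_lin[of u p u Y a 0] by simp

lemma cov_diff: "u \<in> T p \<Longrightarrow> v \<in> T p \<Longrightarrow> Y \<in> VF \<Longrightarrow> cov p (u - v) Y = cov p u Y - cov p v Y"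
  using cov_lin[of u p v Y 1 "-1"] by simp

lemma cov_0: "Y \<in> VF \<Longrightarrow> cov p 0 Y = 0"
  using cov_scale[of 0 p Y 0] by simp

lemma cov_sum: "(\<And>i. i \<in> I \<Longrightarrow> u i \<in> T p) \<Longrightarrow> Y \<in> VF \<Longrightarrow> cov p (\<Sum>i\<in>I. u i) Y = (\<Sum>i\<in>I. cov p (u i) Y)"
  by (induction I rule: infinite_finite_induct) (auto simp: cov_0 cov_add)

lemma cov_field_fscale: "v \<in> T p \<Longrightarrow> Y \<in> VF \<Longrightarrow> smooth f \<Longrightarrow> cov p v (f \<odot> Y) = v f *\<^sub>R Y p + f p *\<^sub>R cov p v Y"
  unfolding cov_deriv_def by (simp add: extend_vector D_fscale_right)

lemma cov_metric:
  assumes "v \<in> T p" "Y \<in> VF" "Z \<in> VF"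
  shows "v (\<lambda>q. g q (Y q) (Z q)) = g p (cov p v Y) (Z p) + g p (Y p) (cov p v Z)"
  using metric_compatible[OF extend_vector(1)[OF assms(1)] assms(2,3), of p]
  unfolding cov_deriv_def by (simp add: extend_vector assms(1))

text \<open>In a frame, \<open>\<nabla>\<^sub>v Y\<close> depends only on the value of \<open>Y\<close> at \<open>p\<close> and on the derivatives of its
  coefficients in the direction of \<open>v\<close>. If \<open>v\<close> is tangent to a submanifold, these are determined by the
  values of \<open>Y\<close> there.\<close>

lemma cov_local:
  assumes "v \<in> T p" "Y \<in> VF" "Z \<in> VF" "Y p = Z p"
    and "\<And>f. smooth f \<Longrightarrow> v (\<lambda>q. Y q f) = v (\<lambda>q. Z q f)"
  shows "cov p v Y = cov p v Z"
proof -
  obtain W y e where p: "p \<in> W" and fr: "frame_on W y e" by (rule frame_exists)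
  show ?thesis
    using D_right_expansion[OF fr p assms(2) extend_vector(1)[OF assms(1)]]
      D_right_expansion[OF fr p assms(3) extend_vector(1)[OF assms(1)]] assms frame_onD(2)[OF fr]
    unfolding cov_deriv_def by (simp add: extend_vector)
qed

lemma bracket_fscale_left:
  assumes "X \<in> VF" "Y \<in> VF" "smooth f"
  shows "lie_bracket (f \<odot> X) Y = f \<odot> lie_bracket X Y - (\<lambda>q. Y q f) \<odot> X"
  using assms by (simp add: torsion_free vf_fscale D_fscale_left D_fscale_right fun_eq_iff algebra_simps)

lemma bracket_fscale_right:
  assumes "X \<in> VF" "Y \<in> VF" "smooth f"
  shows "lie_bracket X (f \<odot> Y) = f \<odot> lie_bracket X Y + (\<lambda>q. X q f) \<odot> Y"
  using assms by (simp add: torsion_free vf_fscale D_fscale_left D_fscale_right fun_eq_iff algebra_simps)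

lemma bracket_add_right: "X \<in> VF \<Longrightarrow> Y \<in> VF \<Longrightarrow> Z \<in> VF \<Longrightarrow> lie_bracket X (Y + Z) = lie_bracket X Y + lie_bracket X Z"
  by (simp add: torsion_free vf_add D_add_left D_add_right)

text \<open>The curvature operator of vector fields. It is function-linear in each argument, so its value at a
  point is the curvature of the values of the fields.\<close>

definition Rm :: "'a vfield \<Rightarrow> 'a vfield \<Rightarrow> 'a vfield \<Rightarrow> 'a vfield" where
  "Rm X Y Z = D X (D Y Z) - D Y (D X Z) - D (lie_bracket X Y) Z"

lemma Rm_vf [simp]: "X \<in> VF \<Longrightarrow> Y \<in> VF \<Longrightarrow> Z \<in> VF \<Longrightarrow> Rm X Y Z \<in> VF"
  by (simp add: Rm_def vf_diff)

lemma Rm_antisym: "X \<in> VF \<Longrightarrow> Y \<in> VF \<Longrightarrow> Z \<in> VF \<Longrightarrow> Rm X Y Z = - Rm Y X Z"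
  by (simp add: Rm_def torsion_free D_diff_left)

lemma Rm_add1: "X \<in> VF \<Longrightarrow> X' \<in> VF \<Longrightarrow> Y \<in> VF \<Longrightarrow> Z \<in> VF \<Longrightarrow> Rm (X + X') Y Z = Rm X Y Z + Rm X' Y Z"
  by (simp add: Rm_def torsion_free D_diff_left D_add_left D_add_right vf_add)

lemma Rm_fscale1:
  assumes "X \<in> VF" "Y \<in> VF" "Z \<in> VF" "smooth f"
  shows "Rm (f \<odot> X) Y Z = f \<odot> Rm X Y Z"
  using assms vf_smooth[OF assms(2,4)]
  by (simp add: Rm_def bracket_fscale_left D_fscale_left D_fscale_right D_diff_left vf_fscale fun_eq_iff algebra_simps)

lemma Rm_add3: "X \<in> VF \<Longrightarrow> Y \<in> VF \<Longrightarrow> Z \<in> VF \<Longrightarrow> Z' \<in> VF \<Longrightarrow> Rm X Y (Z + Z') = Rm X Y Z + Rm X Y Z'"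
  by (simp add: Rm_def D_add_right vf_add)

lemma Rm_fscale3:
  assumes "X \<in> VF" "Y \<in> VF" "Z \<in> VF" "smooth f"
  shows "Rm X Y (f \<odot> Z) = f \<odot> Rm X Y Z"
  using assms vf_smooth[OF assms(1,4)] vf_smooth[OF assms(2,4)]
  by (simp add: Rm_def D_fscale_right D_add_right vf_fscale fun_eq_iff lie_bracket_apply algebra_simps)

text \<open>An additive and function-linear map of fields is pointwise: expand the argument in a frame, after
  multiplication with a cut-off.\<close>

lemma tensorial_slot:
  assumes add: "\<And>X Y. X \<in> VF \<Longrightarrow> Y \<in> VF \<Longrightarrow> R (X + Y) = (R X + R Y :: 'a vfield)"
    and fs: "\<And>f X. smooth f \<Longrightarrow> X \<in> VF \<Longrightarrow> R (f \<odot> X) = f \<odot> R X"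
    and X: "X \<in> VF" "X' \<in> VF" "X p = X' p"
  shows "R X p = R X' p"
proof -
  obtain W y e where p: "p \<in> W" and fr: "frame_on W y e" by (rule frame_exists)
  note f = frame_onD[OF fr]
  have R0: "R 0 = 0" using fs[of "\<lambda>q. 0" 0] by (simp add: fscale_0 vf_0)
  have sum: "R (\<Sum>i\<in>I. Y i) = (\<Sum>i\<in>I. R (Y i))" if "\<And>i. i \<in> I \<Longrightarrow> Y i \<in> VF" for I and Y :: "'e \<Rightarrow> 'a vfield"
    using that by (induction I rule: infinite_finite_induct) (auto simp: R0 add vf_sum)
  have "R Z p = (\<Sum>i\<in>Basis. Z p (y i) *\<^sub>R R (e i) p)" if Z: "Z \<in> VF" for Z
  proof -
    obtain \<eta> where \<eta>': "smooth \<eta>" "\<eta> p = 1"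
      "\<forall>Z\<in>VF. \<eta> \<odot> Z = (\<Sum>i\<in>Basis. (\<lambda>q. \<eta> q * Z q (y i)) \<odot> e i)"
      using expansion[OF fr p] by (elim exE conjE) (rule that)
    note \<eta> = \<eta>'(1,2) \<eta>'(3)[rule_format]
    have s: "smooth (\<lambda>q. \<eta> q * Z q (y i))" if "i \<in> Basis" for i
      by (rule smooth_mult[OF \<eta>(1) vf_smooth[OF Z f(2)[OF that]]])
    have "R Z p = (\<eta> \<odot> R Z) p" using \<eta>(2) by simp
    also have "\<dots> = R (\<Sum>i\<in>Basis. (\<lambda>q. \<eta> q * Z q (y i)) \<odot> e i) p"
      by (simp only: fs[OF \<eta>(1) Z, symmetric] \<eta>(3)[OF Z])
    also have "\<dots> = (\<Sum>i\<in>Basis. Z p (y i) *\<^sub>R R (e i) p)"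
      using \<eta>(2) by (subst sum) (auto simp: vf_fscale s f fs intro!: sum.cong)
    finally show ?thesis .
  qed
  then show ?thesis using X by simp
qed

lemma Rm_tensorial:
  assumes "X \<in> VF" "Y \<in> VF" "Z \<in> VF" "X' \<in> VF" "Y' \<in> VF" "Z' \<in> VF"
    and "X p = X' p" "Y p = Y' p" "Z p = Z' p"
  shows "Rm X Y Z p = Rm X' Y' Z' p"
proof -
  have "Rm X Y Z p = Rm X' Y Z p"
    by (rule tensorial_slot[where R = "\<lambda>X. Rm X Y Z"]) (use assms in \<open>auto simp: Rm_add1 Rm_fscale1\<close>)
  also have "\<dots> = - Rm Y X' Z p" using assms by (subst Rm_antisym) auto
  also have "Rm Y X' Z p = Rm Y' X' Z p"
    by (rule tensorial_slot[where R = "\<lambda>X. Rm X X' Z"]) (use assms in \<open>auto simp: Rm_add1 Rm_fscale1\<close>)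
  also have "- Rm Y' X' Z p = Rm X' Y' Z p" using assms by (subst Rm_antisym) auto
  also have "\<dots> = Rm X' Y' Z' p"
    by (rule tensorial_slot[where R = "\<lambda>Z. Rm X' Y' Z"]) (use assms in \<open>auto simp: Rm_add3 Rm_fscale3\<close>)
  finally show ?thesis .
qed

lemma curvature_eq:
  assumes "X \<in> VF" "Y \<in> VF" "Z \<in> VF"
  shows "curvature A D p (X p) (Y p) (Z p) = Rm X Y Z p"
proof -
  have "curvature A D p (X p) (Y p) (Z p) =
      Rm (extend_vector A p (X p)) (extend_vector A p (Y p)) (extend_vector A p (Z p)) p"
    by (simp add: curvature_def Rm_def tvec_ops Let_def)
  also have "\<dots> = Rm X Y Z p"
    using assms by (intro Rm_tensorial) (auto simp: extend_vector)
  finally show ?thesis .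
qed

lemma curvature_tangent [simp]: "u \<in> T p \<Longrightarrow> v \<in> T p \<Longrightarrow> w \<in> T p \<Longrightarrow> curvature A D p u v w \<in> T p"
  using curvature_eq[of "extend_vector A p u" "extend_vector A p v" "extend_vector A p w" p]
  by (simp add: extend_vector)

lemma curvature_lin1:
  assumes "u \<in> T p" "u' \<in> T p" "v \<in> T p" "w \<in> T p"
  shows "curvature A D p (a *\<^sub>R u + b *\<^sub>R u') v w = a *\<^sub>R curvature A D p u v w + b *\<^sub>R curvature A D p u' v w"
proof -
  let ?x = "extend_vector A p"
  have "(a *\<^sub>R ?x u + b *\<^sub>R ?x u') = (\<lambda>q. a) \<odot> ?x u + (\<lambda>q. b) \<odot> ?x u'" by (simp add: fscale_const)
  then have "Rm (a *\<^sub>R ?x u + b *\<^sub>R ?x u') (?x v) (?x w) = a *\<^sub>R Rm (?x u) (?x v) (?x w) + b *\<^sub>R Rm (?x u') (?x v) (?x w)"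
    using assms by (simp only: Rm_add1 Rm_fscale1 vf_fscale extend_vector smooth_const fscale_const[symmetric])
  then show ?thesis
    using curvature_eq[of "a *\<^sub>R ?x u + b *\<^sub>R ?x u'" "?x v" "?x w" p]
      curvature_eq[of "?x u" "?x v" "?x w" p] curvature_eq[of "?x u'" "?x v" "?x w" p] assms
    by (simp add: extend_vector vf_add vf_scale)
qed

end

section \<open>Traces, divergence and the Bochner formula\<close>

context lorentz_manifold
begin

definition lin_on :: "'a \<Rightarrow> ('a tvec \<Rightarrow> 'c::real_vector) \<Rightarrow> bool" where
  "lin_on p L \<longleftrightarrow> (\<forall>u\<in>T p. \<forall>v\<in>T p. \<forall>a b. L (a *\<^sub>R u + b *\<^sub>R v) = a *\<^sub>R L u + b *\<^sub>R L v)"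

text \<open>A finite family \<open>b\<close> together with functionals \<open>\<beta>\<close> that reproduce every vector. Such a
  resolution of the identity is all that a trace needs, so that orthonormal bases, coordinate frames
  and the null frames on a lightlike hypersurface can be exchanged for each other.\<close>

definition resolution :: "'a \<Rightarrow> 'i set \<Rightarrow> ('i \<Rightarrow> 'a tvec) \<Rightarrow> ('i \<Rightarrow> 'a tvec \<Rightarrow> real) \<Rightarrow> bool" where
  "resolution p I b \<beta> \<longleftrightarrow> finite I \<and> (\<forall>i\<in>I. b i \<in> T p \<and> lin_on p (\<beta> i)) \<and>
    (\<forall>v\<in>T p. v = (\<Sum>i\<in>I. \<beta> i v *\<^sub>R b i))"

lemma lin_on_add: "lin_on p L \<Longrightarrow> u \<in> T p \<Longrightarrow> v \<in> T p \<Longrightarrow> L (u + v) = L u + L v"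
  unfolding lin_on_def by (metis scaleR_one)

lemma lin_on_scale: "lin_on p L \<Longrightarrow> u \<in> T p \<Longrightarrow> L (a *\<^sub>R u) = a *\<^sub>R L u"
  unfolding lin_on_def by (metis add.right_neutral scaleR_zero_left)

lemma lin_on_0: "lin_on p L \<Longrightarrow> L 0 = 0"
  using lin_on_scale[of p L 0 0] by simp

lemma lin_on_sum:
  "lin_on p L \<Longrightarrow> (\<And>i. i \<in> I \<Longrightarrow> u i \<in> T p) \<Longrightarrow> L (\<Sum>i\<in>I. u i) = (\<Sum>i\<in>I. L (u i))"
  by (induction I rule: infinite_finite_induct) (auto simp: lin_on_0 lin_on_add)

lemma lin_onI: "(\<And>u v a b. u \<in> T p \<Longrightarrow> v \<in> T p \<Longrightarrow> L (a *\<^sub>R u + b *\<^sub>R v) = a *\<^sub>R L u + b *\<^sub>R L v) \<Longrightarrow> lin_on p L"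
  unfolding lin_on_def by blast

lemma resolutionD:
  assumes "resolution p I b \<beta>"
  shows "finite I" "\<And>i. i \<in> I \<Longrightarrow> b i \<in> T p" "\<And>i. i \<in> I \<Longrightarrow> lin_on p (\<beta> i)"
    "\<And>v. v \<in> T p \<Longrightarrow> (\<Sum>i\<in>I. \<beta> i v *\<^sub>R b i) = v"
  using assms unfolding resolution_def by auto

text \<open>Expand the values of \<open>L\<close> on one family in the other family and interchange the sums.\<close>

lemma trace_independent:
  assumes r: "resolution p I b \<beta>" and s: "resolution p J c \<gamma>"
    and L: "lin_on p L" "\<And>v. v \<in> T p \<Longrightarrow> L v \<in> T p"
  shows "(\<Sum>i\<in>I. \<beta> i (L (b i))) = (\<Sum>j\<in>J. \<gamma> j (L (c j)))"
proof -
  note r = resolutionD[OF r] and s = resolutionD[OF s]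
  have "(\<Sum>i\<in>I. \<beta> i (L (b i))) = (\<Sum>i\<in>I. \<Sum>j\<in>J. \<gamma> j (b i) * \<beta> i (L (c j)))"
  proof (rule sum.cong[OF refl])
    fix i assume i: "i \<in> I"
    have "L (b i) = L (\<Sum>j\<in>J. \<gamma> j (b i) *\<^sub>R c j)" using s(4)[OF r(2)[OF i]] by simp
    also have "\<dots> = (\<Sum>j\<in>J. \<gamma> j (b i) *\<^sub>R L (c j))"
      using s(2) L by (subst lin_on_sum[OF L(1)]) (auto simp: lin_on_scale)
    finally have "\<beta> i (L (b i)) = \<beta> i (\<Sum>j\<in>J. \<gamma> j (b i) *\<^sub>R L (c j))" by simp
    also have "\<dots> = (\<Sum>j\<in>J. \<beta> i (\<gamma> j (b i) *\<^sub>R L (c j)))"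
      using s(2) L by (intro lin_on_sum[OF r(3)[OF i]]) auto
    also have "\<dots> = (\<Sum>j\<in>J. \<gamma> j (b i) * \<beta> i (L (c j)))"
      using lin_on_scale[OF r(3)[OF i]] s(2) L by (intro sum.cong) auto
    finally show "\<beta> i (L (b i)) = (\<Sum>j\<in>J. \<gamma> j (b i) * \<beta> i (L (c j)))" .
  qed
  also have "\<dots> = (\<Sum>j\<in>J. \<Sum>i\<in>I. \<beta> i (L (c j)) * \<gamma> j (b i))"
    by (subst sum.swap) (simp add: mult.commute)
  also have "\<dots> = (\<Sum>j\<in>J. \<gamma> j (L (c j)))"
  proof (rule sum.cong[OF refl])
    fix j assume j: "j \<in> J"
    have "\<gamma> j (L (c j)) = \<gamma> j (\<Sum>i\<in>I. \<beta> i (L (c j)) *\<^sub>R b i)"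
      using r(4)[OF L(2)[OF s(2)[OF j]]] by simp
    also have "\<dots> = (\<Sum>i\<in>I. \<gamma> j (\<beta> i (L (c j)) *\<^sub>R b i))"
      using r(2) by (intro lin_on_sum[OF s(3)[OF j]]) auto
    also have "\<dots> = (\<Sum>i\<in>I. \<beta> i (L (c j)) * \<gamma> j (b i))"
      using lin_on_scale[OF s(3)[OF j]] r(2) by (intro sum.cong) auto
    finally show "(\<Sum>i\<in>I. \<beta> i (L (c j)) * \<gamma> j (b i)) = \<gamma> j (L (c j))" by simp
  qed
  finally show ?thesis .
qed

lemma resolution_orthonormal:
  assumes B: "orthonormal_basis (g p) (T p) B"
  shows "resolution p B (\<lambda>e. e) (\<lambda>e v. g p e e * g p v e)"
proof -
  have "finite B" "B \<subseteq> T p" using B by (auto simp: orthonormal_basis_def)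
  then show ?thesis
    unfolding resolution_def
    using orthonormal_expansion[OF B subset_refl]
    by (auto simp: lin_on_def g_lin subset_iff algebra_simps)
qed

lemma resolution_frame:
  assumes fr: "frame_on W y e" and p: "p \<in> W"
  shows "resolution p Basis (\<lambda>i. e i p) (\<lambda>i v. v (y i))"
proof -
  note f = frame_onD[OF fr]
  show ?thesis
    unfolding resolution_def
  proof (intro conjI ballI)
    show "lin_on p (\<lambda>v. v (y i))" for i by (simp add: lin_on_def)
    show "e i p \<in> T p" if "i \<in> Basis" for i using f(3)[OF that] by simp
    show "v = (\<Sum>i\<in>Basis. v (y i) *\<^sub>R e i p)" if "v \<in> T p" for v by (rule f(5)[OF p that])
  qed simp
qed

definition tr :: "'a \<Rightarrow> ('a tvec \<Rightarrow> 'a tvec) \<Rightarrow> real" where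
  "tr p L = metric_trace A g p (\<lambda>u v. g p (L u) v)"

lemma tr_eq:
  assumes r: "resolution p I b \<beta>" and L: "lin_on p L" "\<And>v. v \<in> T p \<Longrightarrow> L v \<in> T p"
  shows "tr p L = (\<Sum>i\<in>I. \<beta> i (L (b i)))"
proof -
  let ?B = "SOME B. orthonormal_basis (g p) (T p) B"
  have "orthonormal_basis (g p) (T p) ?B"
    using orthonormal_basis_tangent_exists by (metis someI_ex)
  from trace_independent[OF resolution_orthonormal[OF this] r L]
  show ?thesis by (simp add: tr_def metric_trace_def)
qed

lemma tr_frame:
  assumes "frame_on W y e" "p \<in> W" "lin_on p L" "\<And>v. v \<in> T p \<Longrightarrow> L v \<in> T p"
  shows "tr p L = (\<Sum>i\<in>Basis. L (e i p) (y i))"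
  by (rule tr_eq[OF resolution_frame[OF assms(1,2)] assms(3,4)])

lemma tr_cong: "(\<And>v. v \<in> T p \<Longrightarrow> L v = L' v) \<Longrightarrow> tr p L = tr p L'"
proof -
  assume *: "\<And>v. v \<in> T p \<Longrightarrow> L v = L' v"
  have "orthonormal_basis (g p) (T p) (SOME B. orthonormal_basis (g p) (T p) B)"
    using orthonormal_basis_tangent_exists by (metis someI_ex)
  then have "(SOME B. orthonormal_basis (g p) (T p) B) \<subseteq> T p"
    unfolding orthonormal_basis_def by blast
  then show ?thesis
    unfolding tr_def metric_trace_def by (intro sum.cong refl) (simp add: * subset_iff)
qed

lemma tr_add:
  assumes "lin_on p L" "\<And>v. v \<in> T p \<Longrightarrow> L v \<in> T p" "lin_on p L'" "\<And>v. v \<in> T p \<Longrightarrow> L' v \<in> T p"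
  shows "tr p (\<lambda>v. a *\<^sub>R L v + b *\<^sub>R L' v) = a * tr p L + b * tr p L'"
proof -
  obtain W y e where p: "p \<in> W" and fr: "frame_on W y e" by (rule frame_exists)
  have "lin_on p (\<lambda>v. a *\<^sub>R L v + b *\<^sub>R L' v)"
    using assms(1,3) by (simp add: lin_on_def algebra_simps)
  then have "tr p (\<lambda>v. a *\<^sub>R L v + b *\<^sub>R L' v) = (\<Sum>i\<in>Basis. (a *\<^sub>R L (e i p) + b *\<^sub>R L' (e i p)) (y i))"
    using assms by (intro tr_frame[OF fr p]) auto
  then show ?thesis
    by (simp add: tr_frame[OF fr p] assms sum.distrib sum_distrib_left)
qed

lemma tr_rank_one:
  assumes "lin_on p \<beta>" "w \<in> T p"
  shows "tr p (\<lambda>v. \<beta> v *\<^sub>R w) = \<beta> w"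
proof -
  obtain W y e where p: "p \<in> W" and fr: "frame_on W y e" by (rule frame_exists)
  note f = frame_onD[OF fr]
  have "tr p (\<lambda>v. \<beta> v *\<^sub>R w) = (\<Sum>i\<in>Basis. (\<beta> (e i p) *\<^sub>R w) (y i))"
    using assms by (intro tr_frame[OF fr p]) (auto simp: lin_on_def algebra_simps)
  also have "\<dots> = (\<Sum>i\<in>Basis. \<beta> (w (y i) *\<^sub>R e i p))"
    using f(3) by (intro sum.cong) (simp_all add: lin_on_scale[OF assms(1)] mult.commute)
  also have "\<dots> = \<beta> (\<Sum>i\<in>Basis. w (y i) *\<^sub>R e i p)"
    using f(3) by (intro lin_on_sum[OF assms(1), symmetric]) auto
  also have "\<dots> = \<beta> w" using f(5)[OF p assms(2)] by simp
  finally show ?thesis .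
qed

abbreviation "dv \<equiv> divergence A g D"

lemma cov_lin_on: "Y \<in> VF \<Longrightarrow> lin_on p (\<lambda>v. cov p v Y)"
  by (simp add: lin_on_def cov_lin)

lemma dv_tr: "dv X p = tr p (\<lambda>v. cov p v X)"
  by (simp add: divergence_def tr_def)

lemma dv_frame:
  assumes fr: "frame_on W y e" and p: "p \<in> W" and X: "X \<in> VF"
  shows "dv X p = (\<Sum>i\<in>Basis. D (e i) X p (y i))"
  unfolding dv_tr
  using frame_onD(3)[OF fr] X
  by (subst tr_frame[OF fr p]) (auto simp: cov_lin_on cov_eq intro!: sum.cong)

lemma dv_smooth: assumes X: "X \<in> VF" shows "smooth (dv X)"
proof (rule smooth_local)
  fix p
  obtain W y e where p: "p \<in> W" and fr: "frame_on W y e" by (rule frame_exists)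
  note f = frame_onD[OF fr]
  have "smooth (\<lambda>q. \<Sum>i\<in>Basis. D (e i) X q (y i))"
    using f X by (intro smooth_sum vf_smooth[OF D_vf]) auto
  then show "\<exists>W f'. open W \<and> p \<in> W \<and> smooth f' \<and> (\<forall>q\<in>W. dv X q = f' q)"
    using f(1) p dv_frame[OF fr _ X] by (intro exI[of _ W] exI[of _ "\<lambda>q. \<Sum>i\<in>Basis. D (e i) X q (y i)"]) auto
qed

lemma dv_add: assumes "X \<in> VF" "Y \<in> VF" shows "dv (X + Y) p = dv X p + dv Y p"
proof -
  obtain W y e where p: "p \<in> W" and fr: "frame_on W y e" by (rule frame_exists)
  show ?thesis
    using assms frame_onD(3)[OF fr]
    by (simp add: dv_frame[OF fr p] vf_add D_add_right sum.distrib)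
qed

lemma dv_fscale: assumes "X \<in> VF" "smooth f" shows "dv (f \<odot> X) p = f p * dv X p + X p f"
proof -
  have "dv (f \<odot> X) p = tr p (\<lambda>v. f p *\<^sub>R cov p v X + 1 *\<^sub>R (v f *\<^sub>R X p))"
    unfolding dv_tr using assms by (intro tr_cong) (simp add: cov_field_fscale)
  also have "\<dots> = f p * tr p (\<lambda>v. cov p v X) + 1 * tr p (\<lambda>v. v f *\<^sub>R X p)"
    using assms by (intro tr_add cov_lin_on) (auto simp: lin_on_def algebra_simps)
  also have "tr p (\<lambda>v. v f *\<^sub>R X p) = X p f"
    using assms by (intro tr_rank_one) (auto simp: lin_on_def)
  finally show ?thesis by (simp only: dv_tr mult_1)
qed

lemma dv_scale: assumes "X \<in> VF" shows "dv (c *\<^sub>R X) p = c * dv X p"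
  using dv_fscale[OF assms smooth_const, of c p] assms
  by (simp add: fscale_const tangent_const[OF vf_tangent])

lemma dv_diff: "X \<in> VF \<Longrightarrow> Y \<in> VF \<Longrightarrow> dv (X - Y) p = dv X p - dv Y p"
  using dv_add[of X "(-1) *\<^sub>R Y" p] dv_scale[of Y "-1" p] vf_scale[of Y "-1"] by simp

abbreviation "Ric \<equiv> ricci A g D"

lemma Ric_tr: "Ric p v w = tr p (\<lambda>u. curvature A D p u v w)"
  by (simp add: ricci_def tr_def)

lemma curvature_lin_on: "v \<in> T p \<Longrightarrow> w \<in> T p \<Longrightarrow> lin_on p (\<lambda>u. curvature A D p u v w)"
  by (simp add: lin_on_def curvature_lin1)

lemma Ric_frame:
  assumes fr: "frame_on W y e" and p: "p \<in> W" and X: "X \<in> VF" "Y \<in> VF"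
  shows "Ric p (X p) (Y p) = (\<Sum>i\<in>Basis. Rm (e i) X Y p (y i))"
  unfolding Ric_tr
  using frame_onD(3)[OF fr] X
  by (subst tr_frame[OF fr p]) (auto simp: curvature_lin_on curvature_eq intro!: sum.cong)

text \<open>Commuting the divergence past a covariant derivative costs a Ricci term. In a frame the
  derivatives of the frame fields themselves cancel, because the trace is a parallel tensor.\<close>

lemma Bochner:
  assumes X: "X \<in> VF" and Y: "Y \<in> VF"
  shows "dv (D X Y) p = X p (dv Y) + tr p (\<lambda>v. cov p (cov p v X) Y) + Ric p (X p) (Y p)"
proof -
  obtain W y e where p: "p \<in> W" and fr: "frame_on W y e" by (rule frame_exists)
  note f = frame_onD[OF fr]
  let ?G = "\<lambda>i j. D X (e j) p (y i)" and ?M = "\<lambda>i j. D (e i) Y p (y j)"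
  have s: "smooth (\<lambda>q. D (e i) Y q (y i))" if "i \<in> Basis" for i
    using f that Y vf_smooth[OF D_vf] by blast
  have s2: "smooth (\<lambda>q. \<Sum>i\<in>Basis. D (e i) Y q (y i))" by (rule smooth_sum) (rule s)
  have 1: "X p (dv Y) = (\<Sum>i\<in>Basis. X p (\<lambda>q. D (e i) Y q (y i)))"
  proof -
    have "X p (dv Y) = X p (\<lambda>q. \<Sum>i\<in>Basis. D (e i) Y q (y i))"
      by (rule tangent_local[OF vf_tangent[OF X] dv_smooth[OF Y] s2 f(1) p]) (rule dv_frame[OF fr _ Y])
    also have "\<dots> = (\<Sum>i\<in>Basis. X p (\<lambda>q. D (e i) Y q (y i)))"
      by (rule tangent_sum[OF vf_tangent[OF X] s])
    finally show ?thesis .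
  qed
  have 2: "D X (D (e i) Y) p (y i) = X p (\<lambda>q. D (e i) Y q (y i)) + (\<Sum>j\<in>Basis. ?M i j * ?G i j)"
    if i: "i \<in> Basis" for i
  proof -
    have "D X (D (e i) Y) p (y i) =
       (\<Sum>j\<in>Basis. X p (\<lambda>q. D (e i) Y q (y j)) * e j p (y i) + ?M i j * ?G i j)"
      by (subst D_right_expansion[OF fr p D_vf[OF f(3)[OF i] Y] X]) simp
    also have "\<dots> = (\<Sum>j\<in>Basis. if j = i then X p (\<lambda>q. D (e i) Y q (y j)) else 0) + (\<Sum>j\<in>Basis. ?M i j * ?G i j)"
      unfolding sum.distrib using f(4)[OF p] i by (intro arg_cong2[where f = "(+)"] sum.cong) auto
    finally show ?thesis using i by simp
  qed
  have 3: "D (D X (e i)) Y p (y i) = (\<Sum>j\<in>Basis. ?G j i * ?M j i)" if i: "i \<in> Basis" for i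
    by (subst D_left_expansion[OF fr p D_vf[OF X f(3)[OF i]] Y]) simp
  have 4: "tr p (\<lambda>v. cov p (cov p v X) Y) = (\<Sum>i\<in>Basis. D (D (e i) X) Y p (y i))"
    using f(3) X Y
    by (subst tr_frame[OF fr p]) (auto simp: lin_on_def cov_lin cov_eq intro!: sum.cong)
  have 5: "D (e i) (D X Y) p (y i) = Rm (e i) X Y p (y i) + D X (D (e i) Y) p (y i)
      + D (D (e i) X) Y p (y i) - D (D X (e i)) Y p (y i)" if i: "i \<in> Basis" for i
    using f(3)[OF i] X Y by (simp add: Rm_def torsion_free D_diff_left)
  have "dv (D X Y) p = (\<Sum>i\<in>Basis. D (e i) (D X Y) p (y i))"
    using X Y by (intro dv_frame[OF fr p]) simp
  also have "\<dots> = (\<Sum>i\<in>Basis. Rm (e i) X Y p (y i)) + (\<Sum>i\<in>Basis. X p (\<lambda>q. D (e i) Y q (y i)))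
      + (\<Sum>i\<in>Basis. \<Sum>j\<in>Basis. ?M i j * ?G i j) + (\<Sum>i\<in>Basis. D (D (e i) X) Y p (y i))
      - (\<Sum>i\<in>Basis. \<Sum>j\<in>Basis. ?G j i * ?M j i)"
    by (simp add: 5 2 3 sum.distrib sum_subtractf)
  also have "(\<Sum>i\<in>Basis. \<Sum>j\<in>Basis. ?G j i * ?M j i) = (\<Sum>i\<in>Basis. \<Sum>j\<in>Basis. ?M i j * ?G i j)"
    by (subst sum.swap) (simp add: mult.commute)
  finally show ?thesis
    by (simp add: 1 4 Ric_frame[OF fr p X Y])
qed

lemma Jacobi:
  assumes "X \<in> VF" "Y \<in> VF" "Z \<in> VF"
  shows "lie_bracket X (lie_bracket Y Z) + lie_bracket Y (lie_bracket Z X) + lie_bracket Z (lie_bracket X Y) = 0"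
proof (intro ext)
  fix p f
  show "(lie_bracket X (lie_bracket Y Z) + lie_bracket Y (lie_bracket Z X) + lie_bracket Z (lie_bracket X Y)) p f
      = (0 :: 'a vfield) p f"
  proof (cases "smooth f")
    case False
    then have "lie_bracket X (lie_bracket Y Z) p f = 0" if "X \<in> VF" "Y \<in> VF" "Z \<in> VF" for X Y Z
      using tangent_nonsmooth[OF vf_tangent[OF lie_bracket_vf[OF that(1) lie_bracket_vf[OF that(2,3)]]]] by blast
    then show ?thesis using assms by simp
  next
    case True
    have s: "smooth (\<lambda>q. X q f)" if "X \<in> VF" for X by (rule vf_smooth[OF that True])
    have s2: "smooth (\<lambda>q. X q (\<lambda>q. Y q f))" if "X \<in> VF" "Y \<in> VF" for X Y by (rule vf_smooth[OF that(1) s[OF that(2)]])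
    have "lie_bracket X (lie_bracket Y Z) p f = X p (\<lambda>q. Y q (\<lambda>q. Z q f)) - X p (\<lambda>q. Z q (\<lambda>q. Y q f))
        - Y p (\<lambda>q. Z q (\<lambda>q. X q f)) + Z p (\<lambda>q. Y q (\<lambda>q. X q f))"
      if "X \<in> VF" "Y \<in> VF" "Z \<in> VF" for X Y Z
      using tangent_diff[OF vf_tangent[OF that(1)] s2[OF that(2,3)] s2[OF that(3,2)], of p]
      by (simp add: lie_bracket_apply)
    then show ?thesis using assms by simp
  qed
qed

text \<open>Without torsion, the cyclic sum of curvatures is the cyclic sum of double brackets.\<close>

lemma Bianchi:
  assumes "X \<in> VF" "Y \<in> VF" "Z \<in> VF"
  shows "Rm X Y Z + Rm Y Z X + Rm Z X Y = 0"
proof -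
  have "Rm X Y Z + Rm Y Z X + Rm Z X Y =
      lie_bracket X (lie_bracket Y Z) + lie_bracket Y (lie_bracket Z X) + lie_bracket Z (lie_bracket X Y)"
    using assms by (simp add: Rm_def torsion_free vf_diff D_diff_left D_diff_right)
  then show ?thesis using Jacobi[OF assms] by simp
qed

text \<open>Apply the commutator of \<open>X\<close> and \<open>Y\<close> to the function \<open>g(Z,Z)\<close>; the mixed products of first
  derivatives cancel.\<close>

lemma Rm_skew:
  assumes "X \<in> VF" "Y \<in> VF" "Z \<in> VF"
  shows "g p (Rm X Y Z p) (Z p) = 0"
proof -
  have gs: "smooth (\<lambda>q. g q (D X Z q) (Z q))" if "X \<in> VF" for X
    using that assms by (intro g_smooth) auto
  have 1: "X q (\<lambda>q. g q (Z q) (Z q)) = 2 * g q (D X Z q) (Z q)" if "X \<in> VF" for X q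
    using metric_compatible[OF that assms(3,3), of q] g_sym[of "Z q" q "D X Z q"] that assms by simp
  have 2: "X q (\<lambda>q. Y q (\<lambda>q. g q (Z q) (Z q))) =
      2 * (g q (D X (D Y Z) q) (Z q) + g q (D Y Z q) (D X Z q))" if "X \<in> VF" "Y \<in> VF" for X Y q
  proof -
    have "X q (\<lambda>q. Y q (\<lambda>q. g q (Z q) (Z q))) = X q (\<lambda>q. 2 * g q (D Y Z q) (Z q))"
      by (simp add: 1[OF that(2)])
    also have "\<dots> = 2 * X q (\<lambda>q. g q (D Y Z q) (Z q))"
      by (rule tangent_scale[OF vf_tangent[OF that(1)] gs[OF that(2)]])
    finally show ?thesis using that assms by (simp add: metric_compatible)
  qed
  have "lie_bracket X Y p (\<lambda>q. g q (Z q) (Z q)) = 2 * g p (D (lie_bracket X Y) Z p) (Z p)"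
    by (rule 1) (use assms in simp)
  moreover have "lie_bracket X Y p (\<lambda>q. g q (Z q) (Z q)) =
      2 * (g p (D X (D Y Z) p) (Z p) - g p (D Y (D X Z) p) (Z p))"
    unfolding lie_bracket_apply 2[OF assms(1,2)] 2[OF assms(2,1)]
    using g_sym[of "D X Z p" p "D Y Z p"] assms by simp
  ultimately show ?thesis
    using assms by (simp add: Rm_def g_diff)
qed

text \<open>By the first Bianchi identity, the two traces differ by the trace of the curvature operator of \<open>X\<close> and
  \<open>Y\<close>, which vanishes because this operator is skew-symmetric.\<close>

lemma Ric_sym:
  assumes "X \<in> VF" "Y \<in> VF"
  shows "Ric p (X p) (Y p) = Ric p (Y p) (X p)"
proof -
  obtain B where B: "orthonormal_basis (g p) (T p) B"
    using orthonormal_basis_tangent_exists by blast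
  note r = resolution_orthonormal[OF B]
  have R: "Ric p (X p) (Y p) = (\<Sum>e\<in>B. g p e e * g p (curvature A D p e (X p) (Y p)) e)"
    if "X \<in> VF" "Y \<in> VF" for X Y
    unfolding Ric_tr using that by (intro tr_eq[OF r] curvature_lin_on) auto
  have "g p (curvature A D p e (X p) (Y p)) e = g p (curvature A D p e (Y p) (X p)) e" if "e \<in> B" for e
  proof -
    have e: "e \<in> T p" using B that by (auto simp: orthonormal_basis_def)
    let ?e = "extend_vector A p e"
    note x = extend_vector[OF e]
    have "Rm ?e X Y + Rm X Y ?e + Rm Y ?e X = 0" by (rule Bianchi) (use x assms in auto)
    moreover have "Rm Y ?e X = - Rm ?e Y X" by (rule Rm_antisym) (use x assms in auto)
    ultimately have eq: "Rm ?e X Y p = Rm ?e Y X p - Rm X Y ?e p"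
      by (simp add: fun_eq_iff algebra_simps)
    have "g p (Rm X Y ?e p) e = 0" using Rm_skew[OF assms x(1), of p] by (simp add: x(2))
    then have "g p (Rm ?e X Y p) e = g p (Rm ?e Y X p) e"
      unfolding eq using assms x(1) e by (subst g_diff) auto
    then show ?thesis
      using curvature_eq[OF x(1) assms, of p] curvature_eq[OF x(1) assms(2,1), of p] by (simp add: x(2))
  qed
  then show ?thesis using assms by (simp add: R cong: sum.cong)
qed

text \<open>Write the brackets in the Killing equation as differences of covariant derivatives; those in the
  direction of \<open>U\<close> cancel by metric compatibility.\<close>

lemma Killing_skew:
  assumes K: "killing_field A g U" and "u \<in> T p" "w \<in> T p"
  shows "g p (cov p u U) w = - g p u (cov p w U)"
proof -
  let ?X = "extend_vector A p u" and ?Y = "extend_vector A p w"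
  note x = extend_vector[OF assms(2)] and y = extend_vector[OF assms(3)]
  have U: "U \<in> VF" using K by (simp add: killing_field_def)
  have "U p (\<lambda>q. g q (?X q) (?Y q)) - g p (lie_bracket U ?X p) (?Y p) - g p (?X p) (lie_bracket U ?Y p) = 0"
    using K x(1) y(1) unfolding killing_field_def by blast
  moreover have "U p (\<lambda>q. g q (?X q) (?Y q)) = g p (D U ?X p) (?Y p) + g p (?X p) (D U ?Y p)"
    by (rule metric_compatible[OF U x(1) y(1)])
  ultimately have "g p (D ?X U p) w + g p u (D ?Y U p) = 0"
    using U x y assms by (simp add: torsion_free g_diff g_right)
  then show ?thesis
    using cov_eq[OF x(1) U, of p] cov_eq[OF y(1) U, of p] by (simp add: x(2) y(2))
qed

text \<open>The trace of a skew-symmetric endomorphism.\<close>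

lemma Killing_dv:
  assumes K: "killing_field A g U"
  shows "dv U p = 0"
proof -
  have U: "U \<in> VF" using K by (simp add: killing_field_def)
  obtain B where B: "orthonormal_basis (g p) (T p) B"
    using orthonormal_basis_tangent_exists by blast
  have "dv U p = (\<Sum>e\<in>B. g p e e * g p (cov p e U) e)"
    unfolding dv_tr using U by (intro tr_eq[OF resolution_orthonormal[OF B]] cov_lin_on) auto
  also have "\<dots> = 0"
  proof (rule sum.neutral, rule ballI)
    fix e assume "e \<in> B"
    then have e: "e \<in> T p" using B by (auto simp: orthonormal_basis_def)
    then have "g p (cov p e U) e = - g p (cov p e U) e"
      using Killing_skew[OF K e e] g_sym[OF e, of "cov p e U"] U by simp
    then show "g p e e * g p (cov p e U) e = 0" by simp
  qed
  finally show ?thesis .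
qed

lemma Killing_derivative:
  assumes K: "killing_field A g U" and "X \<in> VF" "Y \<in> VF"
  shows "U p (\<lambda>q. g q (X q) (Y q)) = g p (lie_bracket U X p) (Y p) + g p (X p) (lie_bracket U Y p)"
proof -
  have "U p (\<lambda>q. g q (X q) (Y q)) - g p (lie_bracket U X p) (Y p) - g p (X p) (lie_bracket U Y p) = 0"
    using assms unfolding killing_field_def by blast
  then show ?thesis by simp
qed

end

section \<open>Integration of compactly supported functions\<close>

lemma compact_support_subset_cbox:
  fixes K :: "'b::euclidean_space set"
  assumes "compact K"
  obtains a where "K \<subseteq> cbox (- a) a"
  using bounded_subset_cbox_symmetric[OF compact_imp_bounded[OF assms]] that by blast

lemma compact_support_integrable:
  fixes f :: "'b::euclidean_space \<Rightarrow> real"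
  assumes f: "continuous_on UNIV f" and K: "compact K" "\<And>x. x \<notin> K \<Longrightarrow> f x = 0"
  shows "f absolutely_integrable_on UNIV" "f integrable_on UNIV"
proof -
  obtain a where a: "K \<subseteq> cbox (- a) a" by (rule compact_support_subset_cbox[OF K(1)])
  have "f absolutely_integrable_on cbox (- a) a"
    using f by (intro absolutely_integrable_continuous) (rule continuous_on_subset, auto)
  then have "(\<lambda>x. if x \<in> cbox (- a) a then f x else 0) absolutely_integrable_on UNIV"
    by (simp only: absolutely_integrable_restrict_UNIV)
  moreover have "(\<lambda>x. if x \<in> cbox (- a) a then f x else 0) = f"
    using a K(2) by (auto simp: fun_eq_iff)
  ultimately show "f absolutely_integrable_on UNIV" by simp
  then show "f integrable_on UNIV" by (simp add: absolutely_integrable_on_def)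
qed

text \<open>The integral of a translate of \<open>H\<close> does not depend on the translation; differentiate it at \<open>0\<close>. Over
  the box \<open>?B\<close>, which contains the supports of all translates in question, the derivative may be taken under
  the integral sign.\<close>

lemma integral_directional_derivative:
  fixes H H' :: "'b::euclidean_space \<Rightarrow> real"
  assumes d: "\<And>x. ((\<lambda>t. H (x + t *\<^sub>R c)) has_real_derivative H' x) (at 0)"
    and H': "continuous_on UNIV H'" and cH: "continuous_on UNIV H"
    and K: "compact K" "\<And>x. x \<notin> K \<Longrightarrow> H x = 0" "\<And>x. x \<notin> K \<Longrightarrow> H' x = 0"
  shows "integral UNIV H' = 0"
proof -
  let ?K = "(\<lambda>z. fst z + snd z *\<^sub>R c) ` (K \<times> {-1..1::real})"
  have "compact ?K"
    using K(1) by (intro compact_continuous_image compact_Times continuous_intros) auto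
  then obtain a where a: "?K \<subseteq> cbox (- a) a" by (rule compact_support_subset_cbox)
  let ?B = "cbox (- a) a"
  have KB: "K \<subseteq> cbox (- a + t *\<^sub>R c) (a + t *\<^sub>R c)" if "t \<in> {-1..1}" for t
  proof
    fix x assume "x \<in> K"
    then have "x + (- t) *\<^sub>R c \<in> ?K" using that by (auto intro!: image_eqI[of _ _ "(x, - t)"])
    then have "x + (- t) *\<^sub>R c \<in> ?B" using a by blast
    then show "x \<in> cbox (- a + t *\<^sub>R c) (a + t *\<^sub>R c)"
      by (auto simp: mem_box algebra_simps)
  qed
  have const: "integral ?B (\<lambda>x. H (x + t *\<^sub>R c)) = integral UNIV H" if t: "t \<in> {-1..1}" for t
  proof -
    have "integral ?B (\<lambda>x. H (x + t *\<^sub>R c)) = integral (cbox (- a + t *\<^sub>R c) (a + t *\<^sub>R c)) H"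
      using integral_shift_cbox_plus[of "- a" a H "t *\<^sub>R c"] by (simp add: comp_def add.commute)
    also have "\<dots> = integral UNIV (\<lambda>x. if x \<in> cbox (- a + t *\<^sub>R c) (a + t *\<^sub>R c) then H x else 0)"
      by (simp only: integral_restrict_UNIV)
    also have "(\<lambda>x. if x \<in> cbox (- a + t *\<^sub>R c) (a + t *\<^sub>R c) then H x else 0) = H"
      using KB[OF t] K(2) by (auto simp: fun_eq_iff)
    finally show ?thesis .
  qed
  have dt: "((\<lambda>t. H (x + t *\<^sub>R c)) has_real_derivative H' (x + t *\<^sub>R c)) (at t)" for x t
  proof -
    have "((\<lambda>s. H ((x + t *\<^sub>R c) + (s - t) *\<^sub>R c)) has_real_derivative H' (x + t *\<^sub>R c) * 1) (at t)"
      by (rule DERIV_chain2[where f = "\<lambda>s. H ((x + t *\<^sub>R c) + s *\<^sub>R c)"])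
        (use d[of "x + t *\<^sub>R c"] in \<open>auto intro!: derivative_eq_intros\<close>)
    then show ?thesis by (simp add: algebra_simps)
  qed
  have "((\<lambda>t. integral ?B (\<lambda>x. H (x + t *\<^sub>R c))) has_real_derivative
      integral ?B (\<lambda>x. H' (x + 0 *\<^sub>R c))) (at 0 within UNIV)"
  proof (rule leibniz_rule_field_derivative)
    show "((\<lambda>t. H (x + t *\<^sub>R c)) has_real_derivative H' (x + t *\<^sub>R c)) (at t within UNIV)" for t x
      using dt by simp
    show "(\<lambda>x. H (x + t *\<^sub>R c)) integrable_on ?B" for t
      by (intro integrable_continuous continuous_on_compose2[OF cH]) (auto intro!: continuous_intros)
    show "continuous_on (UNIV \<times> ?B) (\<lambda>(t, x). H' (x + t *\<^sub>R c))"
      unfolding case_prod_unfold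
      by (intro continuous_on_compose2[OF H']) (auto intro!: continuous_intros)
  qed auto
  then have "((\<lambda>t::real. integral UNIV H) has_real_derivative integral ?B (\<lambda>x. H' (x + 0 *\<^sub>R c))) (at 0)"
    by (rule has_field_derivative_transform_within_open[where S = "{-1<..<1}"]) (auto simp: const)
  then have "integral ?B H' = 0" using DERIV_unique[OF _ DERIV_const] by force
  moreover have "integral ?B H' = integral UNIV (\<lambda>x. if x \<in> ?B then H' x else 0)"
    by (simp only: integral_restrict_UNIV)
  moreover have "(\<lambda>x. if x \<in> ?B then H' x else 0) = H'"
    using KB[of 0] K(3) by (auto simp: fun_eq_iff)
  ultimately show ?thesis by simp
qed

lemma integral_change_of_variables_real:
  fixes f :: "real^'m::{finite,wellorder} \<Rightarrow> real" and \<sigma> :: "real^'m::_ \<Rightarrow> real^'m::_"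
  assumes S: "S \<in> sets lebesgue"
    and d: "\<And>x. x \<in> S \<Longrightarrow> (\<sigma> has_derivative \<sigma>' x) (at x within S)" and inj: "inj_on \<sigma> S"
    and f: "f absolutely_integrable_on \<sigma> ` S"
  shows "integral (\<sigma> ` S) f = integral S (\<lambda>x. \<bar>det (matrix (\<sigma>' x))\<bar> * f (\<sigma> x))"
proof -
  let ?F = "\<lambda>x. vec (f x) :: real^1"
  have "?F absolutely_integrable_on \<sigma> ` S"
    using f by (simp add: absolutely_integrable_on_1_iff)
  then have "integral (\<sigma> ` S) ?F = integral S (\<lambda>x. \<bar>det (matrix (\<sigma>' x))\<bar> *\<^sub>R ?F (\<sigma> x))"
    using integral_change_of_variables[OF S d inj, of ?F] by simp
  then show ?thesis by (simp add: integral_on_1_eq vec_eq_iff)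
qed

lemma continuous_extend_by_zero:
  fixes f :: "'b::euclidean_space \<Rightarrow> real"
  assumes "open S" "continuous_on S f" "compact K" "K \<subseteq> S" "\<And>x. x \<in> S - K \<Longrightarrow> f x = 0"
  shows "continuous_on UNIV (\<lambda>x. if x \<in> S then f x else 0)" (is "continuous_on UNIV ?f")
proof -
  have "continuous_on S ?f" using assms(2) by (rule continuous_on_eq) simp
  moreover have "continuous_on (- K) ?f"
  proof -
    have "continuous_on (- K) (\<lambda>x. 0::real)" by simp
    then show ?thesis by (rule continuous_on_eq) (use assms(5) in auto)
  qed
  moreover have "open (- K)" using assms(3) compact_imp_closed by blast
  moreover have "S \<union> - K = UNIV" using assms(4) by auto
  ultimately show ?thesis using continuous_on_open_Un[of S "- K" ?f] assms(1) by simp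
qed

section \<open>Derivative of the determinant\<close>

text \<open>In the Leibniz expansion only the identity permutation contributes to the first order.\<close>

lemma det_derivative_at_identity:
  fixes M :: "real \<Rightarrow> real^'n^'n"
  assumes d: "\<And>i j. ((\<lambda>t. M t $ i $ j) has_real_derivative M' $ i $ j) (at t0)" and id: "M t0 = mat 1"
  shows "((\<lambda>t. det (M t)) has_real_derivative trace M') (at t0)"
proof -
  let ?P = "{p. p permutes (UNIV :: 'n set)}"
  have "((\<lambda>t. \<Sum>p\<in>?P. of_int (sign p) * (\<Prod>i\<in>UNIV. M t $ i $ p i)) has_real_derivative
      (\<Sum>p\<in>?P. of_int (sign p) * (\<Sum>i\<in>UNIV. M' $ i $ p i * (\<Prod>k\<in>UNIV - {i}. M t0 $ k $ p k)))) (at t0)"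
    by (intro DERIV_sum DERIV_cmult has_field_derivative_prod d)
  moreover have "(\<Sum>p\<in>?P. of_int (sign p) * (\<Sum>i\<in>UNIV. M' $ i $ p i * (\<Prod>k\<in>UNIV - {i}. M t0 $ k $ p k)))
      = (\<Sum>p\<in>?P. if p = id then trace M' else 0)"
  proof (rule sum.cong[OF refl])
    fix p assume "p \<in> ?P"
    then have p: "bij p" by (simp add: permutes_bij)
    show "of_int (sign p) * (\<Sum>i\<in>UNIV. M' $ i $ p i * (\<Prod>k\<in>UNIV - {i}. M t0 $ k $ p k))
        = (if p = id then trace M' else 0)"
    proof (cases "p = id")
      case True
      then show ?thesis by (simp add: sign_id id mat_def trace_def)
    next
      case False
      \<comment> \<open>A permutation other than the identity moves at least two points.\<close>
      have "(\<Prod>k\<in>UNIV - {i}. M t0 $ k $ p k) = 0" for i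
      proof -
        obtain k where k: "p k \<noteq> k" using False by (auto simp: fun_eq_iff)
        then have "p (p k) \<noteq> p k" using p by (metis bij_pointE)
        with k obtain l where l: "l \<noteq> i" "p l \<noteq> l" by (cases "k = i") auto
        have "M t0 $ l $ p l = 0" using l by (simp add: id mat_def)
        then show ?thesis using l by (intro prod_zero) auto
      qed
      then have "(\<Sum>i\<in>UNIV. M' $ i $ p i * (\<Prod>k\<in>UNIV - {i}. M t0 $ k $ p k)) = 0"
        by (simp only: mult_zero_right sum.neutral_const)
      then show ?thesis using False by simp
    qed
  qed
  ultimately show ?thesis
    by (simp add: det_def finite_permutations permutes_id)
qed

text \<open>Jacobi's formula; multiplication with the inverse of \<open>M t0\<close> reduces it to a curve through the identity.\<close>

lemma det_derivative:
  fixes M :: "real \<Rightarrow> real^'n^'n"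
  assumes d: "\<And>i j. ((\<lambda>t. M t $ i $ j) has_real_derivative M' $ i $ j) (at t0)" and B: "B ** M t0 = mat 1"
  shows "((\<lambda>t. det (M t)) has_real_derivative det (M t0) * trace (B ** M')) (at t0)"
proof -
  have "((\<lambda>t. det (B ** M t)) has_real_derivative trace (B ** M')) (at t0)"
    by (rule det_derivative_at_identity[where M = "\<lambda>t. B ** M t" and M' = "B ** M'" and ?t0.0 = t0, OF _ B])
      (auto simp: matrix_matrix_mult_def intro!: DERIV_sum DERIV_cmult d)
  then have "((\<lambda>t. det (M t0) * det (B ** M t)) has_real_derivative det (M t0) * trace (B ** M')) (at t0)"
    by (rule DERIV_cmult)
  moreover have "det (M t0) * det (B ** M t) = det (M t)" for t
  proof -
    have "det B * det (M t0) = 1" using B by (metis det_mul det_I)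
    then show ?thesis by (simp add: det_mul algebra_simps)
  qed
  ultimately show ?thesis by simp
qed

lemma DERIV_sqrt_abs:
  assumes "d \<noteq> 0"
  shows "((\<lambda>d. sqrt \<bar>d\<bar>) has_real_derivative sqrt \<bar>d\<bar> / (2 * d)) (at d)"
proof (cases "d > 0")
  case True
  have "(sqrt has_real_derivative sqrt d / (2 * d)) (at d)"
  proof -
    have "sqrt d / (2 * d) = (sqrt d / d) / 2" by simp
    also have "\<dots> = inverse (sqrt d) / 2"
      by (simp only: sqrt_divide_self_eq[OF less_imp_le[OF True]])
    finally show ?thesis using DERIV_real_sqrt[OF True] by (simp only:)
  qed
  then have "((\<lambda>d. sqrt \<bar>d\<bar>) has_real_derivative sqrt d / (2 * d)) (at d)"
    by (rule has_field_derivative_transform_within_open[where S = "{0<..}"]) (use True in auto)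
  then show ?thesis using True by simp
next
  case False
  then have d: "d < 0" using assms by simp
  have "((\<lambda>d. sqrt (- d)) has_real_derivative sqrt (- d) / (2 * d)) (at d)"
    using d by (auto intro!: derivative_eq_intros simp: field_simps)
  then have "((\<lambda>d. sqrt \<bar>d\<bar>) has_real_derivative sqrt (- d) / (2 * d)) (at d)"
    by (rule has_field_derivative_transform_within_open[where S = "{..<0}"]) (use d in auto)
  then show ?thesis using d by simp
qed

section \<open>The volume of a thin slab\<close>

text \<open>If \<open>G\<close> increases in the direction \<open>b\<close> at a rate between two positive constants, the region
  \<open>\<bar>G\<bar> < \<epsilon>\<close> has volume comparable to \<open>\<epsilon>\<close>: translates of it by multiples of \<open>b\<close> of length about \<open>\<epsilon>\<close>
  are disjoint, and translates of that kind cover a fixed ball.\<close>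

lemma slab_upper_bound:
  fixes G :: "'b::euclidean_space \<Rightarrow> real"
  assumes r: "r > 0" and m: "m > 0" and G: "continuous_on (ball z (2 * r)) G"
    and inc: "\<And>x t. t \<ge> 0 \<Longrightarrow> x \<in> ball z (2 * r) \<Longrightarrow> x + t *\<^sub>R b \<in> ball z (2 * r) \<Longrightarrow> m * t \<le> G (x + t *\<^sub>R b) - G x"
  obtains C where "C \<ge> 0" "\<And>\<epsilon>. \<epsilon> > 0 \<Longrightarrow> {x \<in> ball z r. \<bar>G x\<bar> < \<epsilon>} \<in> lmeasurable"
    "\<And>\<epsilon>. \<epsilon> > 0 \<Longrightarrow> measure lebesgue {x \<in> ball z r. \<bar>G x\<bar> < \<epsilon>} \<le> C * \<epsilon>"
proof -
  define \<beta> where "\<beta> = norm b + 1"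
  have \<beta>: "\<beta> > 0" by (simp add: \<beta>_def add_nonneg_pos)
  let ?V = "measure lebesgue (ball z (2 * r))"
  let ?C = "2 * \<beta> * ?V / (r * m)"
  show ?thesis
  proof (rule that[of ?C])
  show "?C \<ge> 0" using r m \<beta> by simp
  fix \<epsilon> :: real assume e: "\<epsilon> > 0"
  define E where "E = {x \<in> ball z r. \<bar>G x\<bar> < \<epsilon>}"
  have "continuous_on (ball z r) G"
    using G by (rule continuous_on_subset) (use r in auto)
  then have "open (ball z r \<inter> G -` {-\<epsilon><..<\<epsilon>})"
    by (rule continuous_open_preimage) auto
  moreover have E_eq: "E = ball z r \<inter> G -` {-\<epsilon><..<\<epsilon>}" by (auto simp: E_def)
  ultimately have "open E" by simp
  moreover have "bounded E" by (rule bounded_subset[OF bounded_ball[of z r]]) (auto simp: E_def)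
  ultimately have mE: "E \<in> lmeasurable" by (intro lmeasurable_open)
  then show "{x \<in> ball z r. \<bar>G x\<bar> < \<epsilon>} \<in> lmeasurable" by (simp only: E_def)
  \<comment> \<open>On a translation by \<open>s *\<^sub>R b\<close> the function \<open>G\<close> gains at least \<open>m * s = 2 * \<epsilon>\<close>, so that the translates of \<open>E\<close> are disjoint; those up to \<open>J\<close> stay in the larger ball.\<close>
  define s where "s = 2 * \<epsilon> / m"
  have s: "s > 0" using e m by (simp add: s_def)
  define J where "J = nat \<lfloor>r / (s * \<beta>)\<rfloor>"
  have q0: "r / (s * \<beta>) \<ge> 0" using r s \<beta> by simp
  then have J1: "real J \<le> r / (s * \<beta>)" "r / (s * \<beta>) < real J + 1"
    by (simp_all add: J_def)
  let ?T = "\<lambda>j. (+) ((real j * s) *\<^sub>R b) ` E"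
  have sub: "?T j \<subseteq> ball z (2 * r)" if "j \<le> J" for j
  proof
    fix x assume "x \<in> ?T j"
    then obtain x' where x': "x' \<in> ball z r" "x = (real j * s) *\<^sub>R b + x'" by (auto simp: E_def)
    have "real j * (s * \<beta>) \<le> real J * (s * \<beta>)"
      using that s \<beta> by (intro mult_right_mono) auto
    also have "\<dots> \<le> r" using J1(1) s \<beta> by (simp add: pos_le_divide_eq)
    finally have "real j * s * norm b + real j * s \<le> r" by (simp add: \<beta>_def algebra_simps)
    moreover have "0 \<le> real j * s" using s by simp
    moreover from this have "norm ((real j * s) *\<^sub>R b) = real j * s * norm b" by simp
    ultimately have "norm ((real j * s) *\<^sub>R b) \<le> r" by linarith
    moreover have "dist z x \<le> dist z x' + norm ((real j * s) *\<^sub>R b)"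
      using norm_triangle_ineq4[of "z - x'" "(real j * s) *\<^sub>R b"] x'(2) by (simp add: dist_norm algebra_simps)
    ultimately show "x \<in> ball z (2 * r)" using x'(1) by simp
  qed
  have disj: "disjnt (?T i) (?T j)" if "i < j" for i j
  proof (rule ccontr)
    assume "\<not> disjnt (?T i) (?T j)"
    then obtain x x' where x: "x \<in> E" "x' \<in> E" "(real i * s) *\<^sub>R b + x = (real j * s) *\<^sub>R b + x'"
      unfolding disjnt_def by auto
    then have xe: "x = x' + ((real j - real i) * s) *\<^sub>R b" by (simp add: algebra_simps)
    have "m * ((real j - real i) * s) \<le> G x - G x'"
    proof -
      have "m * ((real j - real i) * s) \<le> G (x' + ((real j - real i) * s) *\<^sub>R b) - G x'"
        by (rule inc) (use that s x(1,2) r in \<open>auto simp: xe[symmetric] E_def\<close>)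
      then show ?thesis by (simp only: xe[symmetric])
    qed
    moreover have "m * (1 * s) \<le> m * ((real j - real i) * s)"
      using that m s by (intro mult_left_mono mult_right_mono) auto
    moreover have "G x - G x' < 2 * \<epsilon>" using x by (auto simp: E_def)
    ultimately show False using m by (simp add: s_def)
  qed
  have "(real J + 1) * measure lebesgue E = (\<Sum>j\<le>J. measure lebesgue (?T j))"
    by (simp add: measure_translation)
  also have "\<dots> = measure lebesgue (\<Union>j\<le>J. ?T j)"
  proof (rule measure_UNION'[symmetric])
    show "pairwise (\<lambda>i j. disjnt (?T i) (?T j)) {..J}"
    proof (rule pairwiseI)
      fix i j :: nat assume "i \<noteq> j"
      then consider "i < j" | "j < i" by linarith
      then show "disjnt (?T i) (?T j)" 
        by cases (rule disj, assumption, rule disjnt_sym[OF disj], assumption)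
    qed
  qed (auto intro!: measurable_translation mE)
  also have "\<dots> \<le> ?V"
    using sub mE by (intro measure_mono_fmeasurable) (auto intro!: fmeasurableD measurable_translation)
  finally have "(real J + 1) * measure lebesgue E \<le> ?V" .
  moreover have "r / (s * \<beta>) * measure lebesgue E \<le> (real J + 1) * measure lebesgue E"
    using J1 by (intro mult_right_mono) auto
  ultimately have "r / (s * \<beta>) * measure lebesgue E \<le> ?V" by linarith
  then have "measure lebesgue E \<le> ?V * (s * \<beta>) / r"
    using r s \<beta> by (simp add: field_simps)
  also have "\<dots> = ?C * \<epsilon>" using m by (simp add: s_def mult.commute mult.left_commute)
  finally show "measure lebesgue {x \<in> ball z r. \<bar>G x\<bar> < \<epsilon>} \<le> ?C * \<epsilon>" by (simp only: E_def)
  qed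
qed

lemma slab_lower_bound:
  fixes G :: "'b::euclidean_space \<Rightarrow> real"
  assumes \<delta>: "\<delta> > 0" and m: "m > 0" and G: "continuous_on (ball z \<delta>) G" and z: "G z = 0"
    and inc: "\<And>x t. t \<ge> 0 \<Longrightarrow> x \<in> ball z \<delta> \<Longrightarrow> x + t *\<^sub>R b \<in> ball z \<delta> \<Longrightarrow>
      m * t \<le> G (x + t *\<^sub>R b) - G x \<and> G (x + t *\<^sub>R b) - G x \<le> M * t"
  obtains c \<epsilon>1 where "c > 0" "\<epsilon>1 > 0"
    "\<And>\<epsilon>. 0 < \<epsilon> \<Longrightarrow> \<epsilon> < \<epsilon>1 \<Longrightarrow> c * \<epsilon> \<le> measure lebesgue {x \<in> ball z \<delta>. \<bar>G x\<bar> < \<epsilon>}"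
proof -
  define \<beta> where "\<beta> = norm b + 1"
  have \<beta>: "\<beta> > 0" "norm b \<le> \<beta>" by (auto simp: \<beta>_def add_nonneg_pos)
  \<comment> \<open>All points within \<open>\<tau> *\<^sub>R b\<close> of the half ball stay in the ball; lines of this length through points near \<open>z\<close> meet the zero set of \<open>G\<close>.\<close>
  define \<tau> where "\<tau> = \<delta> / (4 * \<beta>)"
  have \<tau>: "\<tau> > 0" using \<delta> \<beta> by (simp add: \<tau>_def)
  have tb: "norm (t *\<^sub>R b) \<le> \<delta> / 4" if "\<bar>t\<bar> \<le> \<tau>" for t
  proof -
    have "\<bar>t\<bar> * norm b \<le> \<tau> * \<beta>" using that \<tau> \<beta> by (intro mult_mono) auto
    then show ?thesis using \<beta> by (simp add: \<tau>_def)
  qed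
  have near: "x + t *\<^sub>R b \<in> ball z \<delta>" if "dist z x < \<delta> / 2" "norm (t *\<^sub>R b) \<le> 3 * \<delta> / 8" for x t
  proof -
    have "dist z (x + t *\<^sub>R b) \<le> dist z x + norm (t *\<^sub>R b)"
      using norm_triangle_ineq4[of "z - x" "t *\<^sub>R b"] by (simp add: dist_norm algebra_simps)
    then show ?thesis using that \<delta> by auto
  qed
  have up: "m * \<tau> \<le> G (z + \<tau> *\<^sub>R b) - G z" "G (z + \<tau> *\<^sub>R b) - G z \<le> M * \<tau>"
    using inc[of \<tau> z] near[of z \<tau>] tb[of \<tau>] \<tau> \<delta> by auto
  have down: "m * \<tau> \<le> G z - G (z - \<tau> *\<^sub>R b)"
    using inc[of \<tau> "z - \<tau> *\<^sub>R b"] near[of z "- \<tau>"] tb[of "- \<tau>"] \<tau> \<delta> by auto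
  have mt: "m * \<tau> > 0" using m \<tau> by simp
  have M: "M > 0" using up mt \<tau> by (metis less_le_trans order_trans zero_less_mult_pos2)
  have cont: "isCont (\<lambda>x. G (x + t *\<^sub>R b)) z" if "\<bar>t\<bar> \<le> \<tau>" for t
  proof -
    have "isCont G (z + t *\<^sub>R b)"
      using G near[of z t] tb[OF that] \<delta> by (auto simp: continuous_on_eq_continuous_at)
    then show ?thesis
      by (intro isCont_o2[where f = "\<lambda>x. x + t *\<^sub>R b" and g = G]) (auto intro!: continuous_intros)
  qed
  have lim: "((\<lambda>x. G (x + t *\<^sub>R b)) \<longlongrightarrow> G (z + t *\<^sub>R b)) (nhds z)" if "\<bar>t\<bar> \<le> \<tau>" for t
    using iffD1[OF tendsto_at_iff_tendsto_nhds, of "\<lambda>x. G (x + t *\<^sub>R b)" z] cont[OF that]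
    unfolding continuous_at by simp
  have "eventually (\<lambda>x. G (x + \<tau> *\<^sub>R b) > 0) (nhds z)" "eventually (\<lambda>x. G (x + (- \<tau>) *\<^sub>R b) < 0) (nhds z)"
    using order_tendstoD(1)[OF lim[of \<tau>], of 0] order_tendstoD(2)[OF lim[of "- \<tau>"], of 0]
      up down mt \<tau> z by auto
  then have "eventually (\<lambda>x. G (x + \<tau> *\<^sub>R b) > 0 \<and> G (x + (- \<tau>) *\<^sub>R b) < 0) (nhds z)"
    by (rule eventually_conj)
  then obtain \<delta>0 where \<delta>0: "\<delta>0 > 0" "\<And>x. dist x z < \<delta>0 \<Longrightarrow> G (x + \<tau> *\<^sub>R b) > 0 \<and> G (x + (- \<tau>) *\<^sub>R b) < 0"
    unfolding eventually_nhds_metric by blast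
  define \<delta>' where "\<delta>' = min \<delta>0 (\<delta> / 2)"
  have \<delta>': "\<delta>' > 0" using \<delta>0 \<delta> by (simp add: \<delta>'_def)
  define \<epsilon>1 where "\<epsilon>1 = M * \<delta> / (4 * \<beta>)"
  have \<epsilon>1: "\<epsilon>1 > 0" using M \<delta> \<beta> by (simp add: \<epsilon>1_def)
  let ?V = "measure lebesgue (ball z \<delta>')"
  define c where "c = ?V / (4 * M * \<tau> + 5 * \<epsilon>1)"
  have den: "4 * M * \<tau> + 5 * \<epsilon>1 > 0" using M \<tau> \<epsilon>1 by (simp add: add_pos_pos)
  have "?V > 0" using \<delta>' by (simp add: content_ball_pos)
  then have c: "c > 0" using den by (simp add: c_def)
  have "c * \<epsilon> \<le> measure lebesgue {x \<in> ball z \<delta>. \<bar>G x\<bar> < \<epsilon>}" if e: "0 < \<epsilon>" "\<epsilon> < \<epsilon>1" for \<epsilon>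
  proof -
    define E where "E = {x \<in> ball z \<delta>. \<bar>G x\<bar> < \<epsilon>}"
    have "open (ball z \<delta> \<inter> G -` {-\<epsilon><..<\<epsilon>})"
      using G by (rule continuous_open_preimage) auto
    moreover have E_eq: "E = ball z \<delta> \<inter> G -` {-\<epsilon><..<\<epsilon>}" by (auto simp: E_def)
    ultimately have "open E" by simp
    moreover have "bounded E" by (rule bounded_subset[OF bounded_ball[of z \<delta>]]) (auto simp: E_def)
    ultimately have mE: "E \<in> lmeasurable" by (intro lmeasurable_open)
    \<comment> \<open>On a translation by at most \<open>s *\<^sub>R b\<close> the function \<open>G\<close> gains at most \<open>\<epsilon> / 2\<close>, so that the translates of \<open>E\<close> by multiples of \<open>s *\<^sub>R b\<close> cover a ball around \<open>z\<close>. Their number is of the order \<open>1 / \<epsilon>\<close>.\<close>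
    define s where "s = \<epsilon> / (2 * M)"
    have s: "s > 0" using e M by (simp add: s_def)
    have s\<beta>: "s * \<beta> < \<delta> / 8"
      using e M \<beta> by (simp add: s_def \<epsilon>1_def field_simps)
    define J where "J = \<lceil>\<tau> / s\<rceil> + 1"
    let ?T = "\<lambda>j::int. (+) (- (of_int j * s) *\<^sub>R b) ` E"
    have cov: "ball z \<delta>' \<subseteq> (\<Union>j\<in>{-J..J}. ?T j)"
    proof
      fix x assume x: "x \<in> ball z \<delta>'"
      then have xz: "dist z x < \<delta> / 2" and x0: "dist x z < \<delta>0" by (auto simp: \<delta>'_def dist_commute)
      have ct: "continuous_on {-\<tau>..\<tau>} (\<lambda>t. G (x + t *\<^sub>R b))"
      proof (rule continuous_on_compose2[OF G])
        show "(\<lambda>t. x + t *\<^sub>R b) ` {-\<tau>..\<tau>} \<subseteq> ball z \<delta>"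
        proof
          fix y assume "y \<in> (\<lambda>t. x + t *\<^sub>R b) ` {-\<tau>..\<tau>}"
          then obtain t where t': "t \<in> {-\<tau>..\<tau>}" "y = x + t *\<^sub>R b" by blast
          then have t: "\<bar>t\<bar> \<le> \<tau>" "y = x + t *\<^sub>R b" by auto
          then show "y \<in> ball z \<delta>" using near[OF xz, of t] tb[of t] \<delta> by auto
        qed
      qed (intro continuous_intros)
      obtain t where t: "-\<tau> \<le> t" "t \<le> \<tau>" "G (x + t *\<^sub>R b) = 0"
        using IVT'[of "\<lambda>t. G (x + t *\<^sub>R b)" "-\<tau>" 0 \<tau>] \<delta>0(2)[OF x0] ct \<tau> by auto
      define j where "j = \<lfloor>t / s\<rfloor>"
      have j: "of_int j * s \<le> t" "t < of_int j * s + s"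
      proof -
        have "of_int j \<le> t / s" "t / s < of_int j + 1" by (auto simp: j_def)
        then show "of_int j * s \<le> t" "t < of_int j * s + s" using s by (auto simp: field_simps)
      qed
      let ?x = "x + (of_int j * s) *\<^sub>R b"
      have "\<bar>of_int j * s\<bar> \<le> \<tau> + s" using j t by auto
      then have "norm ((of_int j * s) *\<^sub>R b) \<le> (\<tau> + s) * \<beta>"
        unfolding norm_scaleR using s \<tau> \<beta> by (intro mult_mono) auto
      also have "\<dots> = \<delta> / 4 + s * \<beta>" using \<beta> by (simp add: \<tau>_def algebra_simps add_divide_distrib[symmetric])
      also have "\<dots> \<le> 3 * \<delta> / 8" using s\<beta> by simp
      finally have xin: "?x \<in> ball z \<delta>" by (rule near[OF xz])
      have "\<bar>t\<bar> \<le> \<tau>" using t by auto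
      then have "norm (t *\<^sub>R b) \<le> 3 * \<delta> / 8" using tb[of t] \<delta> by linarith
      then have tin: "x + t *\<^sub>R b \<in> ball z \<delta>" by (rule near[OF xz])
      have eq: "?x + (t - of_int j * s) *\<^sub>R b = x + t *\<^sub>R b" by (simp add: algebra_simps)
      have "m * (t - of_int j * s) \<le> G (x + t *\<^sub>R b) - G ?x \<and> G (x + t *\<^sub>R b) - G ?x \<le> M * (t - of_int j * s)"
        using inc[of "t - of_int j * s" ?x] xin tin j unfolding eq by auto
      moreover have "M * (t - of_int j * s) \<le> M * s" using j M by (intro mult_left_mono) auto
      moreover have "0 \<le> m * (t - of_int j * s)" using j m by simp
      moreover have "M * s = \<epsilon> / 2" using M by (simp add: s_def)
      ultimately have "\<bar>G ?x\<bar> < \<epsilon>" using t(3) e by linarith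
      then have "?x \<in> E" using xin by (simp add: E_def)
      then have "- (of_int j * s) *\<^sub>R b + ?x \<in> ?T j" by blast
      then have "x \<in> ?T j" by (simp add: algebra_simps)
      moreover have "j \<in> {-J..J}"
      proof -
        have "t / s \<le> \<tau> / s" "- (\<tau> / s) \<le> t / s" using t s by (auto simp: field_simps)
        then show ?thesis unfolding j_def J_def by (simp add: le_floor_iff floor_le_iff) linarith
      qed
      ultimately show "x \<in> (\<Union>j\<in>{-J..J}. ?T j)" by blast
    qed
    have J0: "J \<ge> 0" using \<tau> s by (simp add: J_def) (metis add_nonneg_nonneg ceiling_mono ceiling_zero divide_nonneg_pos less_imp_le zero_le_one)
    have mT: "?T j \<in> lmeasurable" for j by (rule measurable_translation[OF mE])
    have "?V \<le> measure lebesgue (\<Union>j\<in>{-J..J}. ?T j)"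
      by (rule measure_mono_fmeasurable[OF cov _ fmeasurable.finite_UN]) (use mT in auto)
    also have "\<dots> \<le> (\<Sum>j\<in>{-J..J}. measure lebesgue (?T j))"
      by (rule measure_UNION_le) (simp, rule fmeasurableD[OF mT])
    also have "\<dots> = of_int (2 * J + 1) * measure lebesgue E"
      unfolding measure_translation using J0 by simp
    also have "\<dots> \<le> (2 * \<tau> / s + 5) * measure lebesgue E"
    proof (rule mult_right_mono)
      have "of_int \<lceil>\<tau> / s\<rceil> \<le> \<tau> / s + 1" by linarith
      moreover have "of_int (2 * J + 1) = 2 * of_int \<lceil>\<tau> / s\<rceil> + (3::real)" by (simp add: J_def)
      ultimately have "of_int (2 * J + 1) \<le> 2 * (\<tau> / s) + 5" by linarith
      then show "of_int (2 * J + 1) \<le> 2 * \<tau> / s + 5" by simp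
    qed simp
    also have "2 * \<tau> / s = 4 * M * \<tau> / \<epsilon>" using M e by (simp add: s_def field_simps)
    also have "(4 * M * \<tau> / \<epsilon> + 5) * measure lebesgue E \<le> ((4 * M * \<tau> + 5 * \<epsilon>1) / \<epsilon>) * measure lebesgue E"
      using e by (intro mult_right_mono) (auto simp: field_simps)
    finally have "c * \<epsilon> \<le> measure lebesgue E" using e den by (simp add: c_def field_simps)
    then show ?thesis by (simp only: E_def)
  qed
  with c \<epsilon>1 show ?thesis by (rule that)
qed

section \<open>The volume density of the metric\<close>

lemma sum_Basis_axis: "(\<Sum>b\<in>(Basis :: (real^'n) set). f b) = (\<Sum>i\<in>UNIV. f (axis i 1))"
proof -
  have B: "(Basis :: (real^'n) set) = (\<lambda>i. axis i 1) ` UNIV"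
    by (auto simp: Basis_vec_def)
  have "inj (\<lambda>i::'n. axis i (1::real))"
    by (auto simp: inj_def axis_eq_axis)
  then show ?thesis unfolding B by (subst sum.reindex) (simp_all add: comp_def)
qed

locale lorentz_manifold_cart = lorentz_manifold A g D
  for A :: "('a::{t2_space, second_countable_topology}, real^'n::{finite,wellorder}) chart set" and g D
begin

definition gram :: "'a set \<Rightarrow> ('a \<Rightarrow> (real,'n) vec) \<Rightarrow> 'a \<Rightarrow> ((real,'n) vec,'n) vec" where
  "gram V \<psi> q = (\<chi> i j. g q (coord_vec V \<psi> q (axis i 1)) (coord_vec V \<psi> q (axis j 1)))"

definition dens :: "'a set \<Rightarrow> ('a \<Rightarrow> (real,'n) vec) \<Rightarrow> 'a \<Rightarrow> real" where
  "dens V \<psi> q = sqrt \<bar>det (gram V \<psi> q)\<bar>"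

definition chart_integral :: "'a set \<Rightarrow> ('a \<Rightarrow> (real,'n) vec) \<Rightarrow> ('a \<Rightarrow> real) \<Rightarrow> real" where
  "chart_integral V \<psi> w =
    integral UNIV (\<lambda>z. if z \<in> \<psi> ` V then w (inv_into V \<psi> z) * dens V \<psi> (inv_into V \<psi> z) else 0)"

lemma axis_Basis [simp]: "axis i (1::real) \<in> Basis"
  by (auto simp: Basis_vec_def)

definition chart_frame :: "'a set \<Rightarrow> ('a \<Rightarrow> (real,'n) vec) \<Rightarrow> 'a set \<Rightarrow> ((real,'n) vec \<Rightarrow> 'a \<Rightarrow> real) \<Rightarrow> ((real,'n) vec \<Rightarrow> 'a vfield) \<Rightarrow> bool" where
  "chart_frame V \<psi> W y e \<longleftrightarrow> (V, \<psi>) \<in> maximal_atlas A \<and> W \<subseteq> V \<and> frame_on W y e \<and>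
    (\<forall>i\<in>Basis. \<forall>q\<in>W. e i q = coord_vec V \<psi> q i)"

lemma chart_frame_ex: "(V, \<psi>) \<in> maximal_atlas A \<Longrightarrow> p \<in> V \<Longrightarrow> \<exists>W y e. p \<in> W \<and> chart_frame V \<psi> W y e"
proof -
  assume mc: "(V, \<psi>) \<in> maximal_atlas A" and p: "p \<in> V"
  from chart_frame_exists[OF mc p] mc show ?thesis
    unfolding chart_frame_def by (elim exE conjE) (intro exI conjI)
qed

lemma chart_frameD:
  assumes "chart_frame V \<psi> W y e"
  shows "(V, \<psi>) \<in> maximal_atlas A" "W \<subseteq> V" "frame_on W y e"
    "\<And>i q. i \<in> Basis \<Longrightarrow> q \<in> W \<Longrightarrow> e i q = coord_vec V \<psi> q i"
  using assms by (simp_all add: chart_frame_def)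

lemma gram_frame:
  assumes "chart_frame V \<psi> W y e" "q \<in> W"
  shows "gram V \<psi> q $ i $ j = g q (e (axis i 1) q) (e (axis j 1) q)"
  using chart_frameD(4)[OF assms(1) _ assms(2)] by (simp add: gram_def)

lemma gram_entry_smooth:
  assumes "chart_frame V \<psi> W y e"
  shows "smooth (\<lambda>q. g q (e (axis i 1) q) (e (axis j 1) q))"
  using frame_onD(3)[OF chart_frameD(3)[OF assms]] by (intro g_smooth) auto

text \<open>A vector in the kernel of the Gram matrix is orthogonal to all coordinate vectors.\<close>

lemma det_gram_nonzero:
  assumes mc: "(V, \<psi>) \<in> maximal_atlas A" and q: "q \<in> V"
  shows "det (gram V \<psi> q) \<noteq> 0"
proof -
  obtain W y e where W: "q \<in> W" and cf: "chart_frame V \<psi> W y e"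
    using chart_frame_ex[OF assms] by blast
  note fr = chart_frameD(3)[OF cf] and f = frame_onD[OF chart_frameD(3)[OF cf]]
  have "c = 0" if c: "gram V \<psi> q *v c = 0" for c
  proof -
    let ?v = "\<Sum>i\<in>UNIV. (c $ i) *\<^sub>R e (axis i 1) q"
    have e: "e (axis i 1) q \<in> T q" for i using f(3) by simp
    have ge: "g q ?v (e (axis j 1) q) = 0" for j
    proof -
      have "g q ?v (e (axis j 1) q) = (\<Sum>i\<in>UNIV. gram V \<psi> q $ j $ i * c $ i)"
        using e by (simp add: g_bilinear gram_frame[OF cf W] g_sym[OF e e, of _ j] mult.commute)
      also have "\<dots> = (gram V \<psi> q *v c) $ j" by (simp add: matrix_vector_mult_def)
      finally show ?thesis using c by simp
    qed
    have "?v = 0"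
    proof (rule nondegenerate)
      show "?v \<in> T q" using e by (intro tangent_space_sum) auto
      fix w assume w: "w \<in> T q"
      have "w = (\<Sum>j\<in>UNIV. w (y (axis j 1)) *\<^sub>R e (axis j 1) q)"
        using f(5)[OF W w] by (simp add: sum_Basis_axis)
      then have "g q ?v w = g q ?v (\<Sum>j\<in>UNIV. w (y (axis j 1)) *\<^sub>R e (axis j 1) q)" by simp
      also have "\<dots> = (\<Sum>j\<in>UNIV. w (y (axis j 1)) * g q ?v (e (axis j 1) q))"
        using e by (subst g_right(6)) (auto intro!: tangent_space_sum sum.cong g_right(3))
      finally show "g q ?v w = 0" by (simp add: ge)
    qed
    then have "?v (y (axis j 1)) = 0" for j by simp
    moreover have "?v (y (axis j 1)) = c $ j" for j
    proof -
      have "?v (y (axis j 1)) = (\<Sum>i\<in>UNIV. c $ i * e (axis i 1) q (y (axis j 1)))" by simp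
      also have "\<dots> = (\<Sum>i\<in>UNIV. if i = j then c $ i else 0)"
        by (intro sum.cong refl) (simp add: f(4)[OF W] axis_eq_axis)
      finally have "?v (y (axis j 1)) = (\<Sum>i\<in>UNIV. if i = j then c $ i else 0)" .
      then show ?thesis by simp
    qed
    ultimately show ?thesis by (simp add: vec_eq_iff)
  qed
  then have "\<exists>B. B ** gram V \<psi> q = mat 1" by (simp add: matrix_left_invertible_ker)
  then show ?thesis by (simp only: invertible_det_nz[symmetric] invertible_left_inverse)
qed

lemma dens_pos: "(V, \<psi>) \<in> maximal_atlas A \<Longrightarrow> q \<in> V \<Longrightarrow> dens V \<psi> q > 0"
  using det_gram_nonzero by (simp add: dens_def)

lemma dens_continuous:
  assumes mc: "(V, \<psi>) \<in> maximal_atlas A"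
  shows "continuous_on V (dens V \<psi>)"
proof (rule continuous_at_imp_continuous_on, rule ballI)
  fix p assume p: "p \<in> V"
  obtain W y e where W: "p \<in> W" and cf: "chart_frame V \<psi> W y e"
    using chart_frame_ex[OF mc p] by blast
  have "continuous_on UNIV (\<lambda>q. g q (e (axis i 1) q) (e (axis j 1) q))" for i j
    by (rule smooth_continuous[OF gram_entry_smooth[OF cf]])
  then have "continuous_on UNIV (\<lambda>q. sqrt \<bar>det (\<chi> i j. g q (e (axis i 1) q) (e (axis j 1) q))\<bar>)"
    unfolding det_def by (intro continuous_intros) simp
  then have "continuous_on W (\<lambda>q. sqrt \<bar>det (\<chi> i j. g q (e (axis i 1) q) (e (axis j 1) q))\<bar>)"
    by (rule continuous_on_subset) simp
  moreover have "sqrt \<bar>det (\<chi> i j. g q (e (axis i 1) q) (e (axis j 1) q))\<bar> = dens V \<psi> q" if "q \<in> W" for q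
  proof -
    have "gram V \<psi> q = (\<chi> i j. g q (e (axis i 1) q) (e (axis j 1) q))"
      by (simp add: vec_eq_iff gram_frame[OF cf that])
    then show ?thesis by (simp add: dens_def)
  qed
  ultimately have "continuous_on W (dens V \<psi>)" by (rule continuous_on_eq)
  then show "isCont (dens V \<psi>) p"
    using frame_onD(1)[OF chart_frameD(3)[OF cf]] W by (simp add: continuous_on_eq_continuous_at)
qed

lemma chart_line_derivative:
  assumes f: "smooth f" and mc: "(V, \<psi>) \<in> maximal_atlas A" and q: "q \<in> V"
  shows "((\<lambda>t. f (inv_into V \<psi> (\<psi> q + t *\<^sub>R c))) has_real_derivative coord_vec V \<psi> q c f) (at 0)"
proof -
  let ?D = "frechet_derivative (\<lambda>x. f (inv_into V \<psi> x)) (at (\<psi> q))"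
  note d = smooth_in_chart_has_derivative[OF f mc q]
  have "((\<lambda>t::real. \<psi> q + t *\<^sub>R c) has_derivative (\<lambda>t. t *\<^sub>R c)) (at 0)"
    by (auto intro!: derivative_eq_intros)
  moreover have "((\<lambda>x. f (inv_into V \<psi> x)) has_derivative ?D) (at (\<psi> q + 0 *\<^sub>R c))" using d by simp
  ultimately have "((\<lambda>t. f (inv_into V \<psi> (\<psi> q + t *\<^sub>R c))) has_derivative (\<lambda>t. ?D (t *\<^sub>R c))) (at 0)"
    by (rule has_derivative_compose)
  moreover have "(\<lambda>t. ?D (t *\<^sub>R c)) = (*) (?D c)"
    using linear_scale[OF has_derivative_linear[OF d]] by (auto simp: fun_eq_iff)
  ultimately show ?thesis
    using f by (simp add: has_field_derivative_def coord_vec_def)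
qed

lemma chart_line_eventually:
  assumes mc: "(V, \<psi>) \<in> maximal_atlas A" and W: "open W" "W \<subseteq> V" "q \<in> W"
  shows "\<exists>\<delta>>0. \<forall>t. \<bar>t\<bar> < \<delta> \<longrightarrow> \<psi> q + t *\<^sub>R c \<in> \<psi> ` W \<and> inv_into V \<psi> (\<psi> q + t *\<^sub>R c) \<in> W"
proof -
  have "open (\<psi> ` W)" by (rule chart_open_subset_image[OF mc W(1,2)])
  moreover have "\<psi> q \<in> \<psi> ` W" using W(3) by blast
  ultimately obtain r where r: "r > 0" "ball (\<psi> q) r \<subseteq> \<psi> ` W" by (meson openE)
  let ?\<delta> = "r / (norm c + 1)"
  have n: "norm c + 1 > 0" by (simp add: add_nonneg_pos)
  have "\<psi> q + t *\<^sub>R c \<in> \<psi> ` W \<and> inv_into V \<psi> (\<psi> q + t *\<^sub>R c) \<in> W" if t: "\<bar>t\<bar> < ?\<delta>" for t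
  proof -
    have "\<bar>t\<bar> * norm c \<le> \<bar>t\<bar> * (norm c + 1)" by (intro mult_left_mono) auto
    also have "\<dots> < r" using t n by (simp add: pos_less_divide_eq)
    finally have "\<psi> q + t *\<^sub>R c \<in> ball (\<psi> q) r" by (simp add: dist_norm)
    then obtain q' where q': "q' \<in> W" "\<psi> q + t *\<^sub>R c = \<psi> q'" using r by blast
    then show ?thesis using W(2) chart_inv[OF mc, of q'] by auto
  qed
  then show ?thesis using r n by (intro exI[of _ ?\<delta>]) simp
qed

text \<open>The contracted Christoffel symbol \<open>\<Gamma>\<^sup>a\<^sub>i\<^sub>a\<close> of the frame.\<close>

definition christoffel_trace :: "((real,'n) vec \<Rightarrow> 'a \<Rightarrow> real) \<Rightarrow> ((real,'n) vec \<Rightarrow> 'a vfield) \<Rightarrow> (real,'n) vec \<Rightarrow> 'a \<Rightarrow> real" where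
  "christoffel_trace y e i q = (\<Sum>a\<in>Basis. D (e i) (e a) q (y a))"

text \<open>The logarithmic derivative of the density is the contracted connection: differentiate the
  Gram determinant by Jacobi's formula and insert the metric compatibility of the connection.\<close>

lemma dens_derivative:
  assumes cf: "chart_frame V \<psi> W y e" and q: "q \<in> W" and i: "i \<in> Basis"
  shows "((\<lambda>t. dens V \<psi> (inv_into V \<psi> (\<psi> q + t *\<^sub>R i))) has_real_derivative
    dens V \<psi> q * christoffel_trace y e i q) (at 0)"
proof -
  note mc = chart_frameD(1)[OF cf] and fr = chart_frameD(3)[OF cf]
  note f = frame_onD[OF fr]
  have qV: "q \<in> V" using q chart_frameD(2)[OF cf] by blast
  let ?u = "\<lambda>t. inv_into V \<psi> (\<psi> q + t *\<^sub>R i)" and ?E = "\<lambda>a. e (axis a 1)"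
  let ?G = "gram V \<psi> q"
  define C :: "((real,'n) vec,'n) vec" where "C = (\<chi> a k. D (e i) (?E a) q (y (axis k 1)))"
  have eV: "?E a \<in> VF" for a using f(3) by simp
  have u0: "?u 0 = q" using chart_inv[OF mc qV] by simp
  have exp: "D (e i) (?E a) q = (\<Sum>k\<in>UNIV. C $ a $ k *\<^sub>R ?E k q)" for a
    using f(5)[OF q, of "D (e i) (?E a) q"] eV f(3)[OF i] by (simp add: C_def sum_Basis_axis)
  have t: "?E k q \<in> T q" for k using eV by simp
  have d: "((\<lambda>t. gram V \<psi> (?u t) $ a $ b) has_real_derivative (C ** ?G + ?G ** transpose C) $ a $ b) (at 0)" for a b
  proof -
    let ?f = "\<lambda>q. g q (?E a q) (?E b q)"
    have "((\<lambda>t. ?f (?u t)) has_real_derivative coord_vec V \<psi> q i ?f) (at 0)"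
      by (rule chart_line_derivative[OF gram_entry_smooth[OF cf] mc qV])
    moreover have "coord_vec V \<psi> q i ?f = (C ** ?G + ?G ** transpose C) $ a $ b"
    proof -
      have "coord_vec V \<psi> q i ?f = e i q ?f" using chart_frameD(4)[OF cf i q] by simp
      also have "\<dots> = g q (D (e i) (?E a) q) (?E b q) + g q (?E a q) (D (e i) (?E b) q)"
        by (rule metric_compatible[OF f(3)[OF i] eV eV])
      also have "\<dots> = (\<Sum>k\<in>UNIV. C $ a $ k * g q (?E k q) (?E b q)) + (\<Sum>k\<in>UNIV. C $ b $ k * g q (?E a q) (?E k q))"
        unfolding exp using t by (simp add: g_bilinear)
      finally show ?thesis
        by (simp add: matrix_matrix_mult_def transpose_def gram_frame[OF cf q] mult.commute)
    qed
    ultimately have dF: "((\<lambda>t. ?f (?u t)) has_real_derivative (C ** ?G + ?G ** transpose C) $ a $ b) (at 0)" by simp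
    obtain \<delta> where \<delta>: "\<delta> > 0" "\<forall>t. \<bar>t\<bar> < \<delta> \<longrightarrow> \<psi> q + t *\<^sub>R i \<in> \<psi> ` W \<and> ?u t \<in> W"
      using chart_line_eventually[OF mc f(1) chart_frameD(2)[OF cf] q, of i] by (elim exE conjE) (rule that)
    have eq: "?f (?u t) = gram V \<psi> (?u t) $ a $ b" if "t \<in> {-\<delta><..<\<delta>}" for t
      using \<delta>(2) that by (intro gram_frame[OF cf, symmetric]) auto
    show ?thesis
    proof (rule has_field_derivative_transform_within_open[where S = "{-\<delta><..<\<delta>}", OF dF])
      show "0 \<in> {-\<delta><..<\<delta>}" using \<delta>(1) by simp
    qed (rule open_greaterThanLessThan, rule eq)
  qed
  obtain B where B: "B ** ?G = mat 1"
    using det_gram_nonzero[OF mc qV] invertible_det_nz[of ?G] invertible_left_inverse[of ?G] by auto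
  then have B': "?G ** B = mat 1" by (simp add: matrix_left_right_inverse)
  have "((\<lambda>t. det (gram V \<psi> (?u t))) has_real_derivative
      det (gram V \<psi> (?u 0)) * trace (B ** (C ** ?G + ?G ** transpose C))) (at 0)"
    by (rule det_derivative[where M = "\<lambda>t. gram V \<psi> (?u t)" and M' = "C ** ?G + ?G ** transpose C"
        and ?t0.0 = 0 and B = B]) (rule d, simp only: u0 B)
  moreover have "trace (B ** (C ** ?G + ?G ** transpose C)) = 2 * trace C"
  proof -
    have "trace (B ** (C ** ?G)) = trace ((C ** ?G) ** B)" by (rule trace_mul_sym)
    also have "(C ** ?G) ** B = C" using B' by (simp add: matrix_mul_assoc[symmetric])
    finally have 1: "trace (B ** (C ** ?G)) = trace C" .
    have "B ** (?G ** transpose C) = transpose C" using B by (simp add: matrix_mul_assoc)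
    then have 2: "trace (B ** (?G ** transpose C)) = trace C" by (simp add: trace_def transpose_def)
    show ?thesis using 1 2 by (simp add: matrix_add_ldistrib trace_add)
  qed
  ultimately have dd: "((\<lambda>t. det (gram V \<psi> (?u t))) has_real_derivative det ?G * (2 * trace C)) (at 0)"
    by (simp add: chart_inv[OF mc qV])
  have ds: "((\<lambda>d. sqrt \<bar>d\<bar>) has_real_derivative sqrt \<bar>det ?G\<bar> / (2 * det ?G)) (at (det (gram V \<psi> (?u 0))))"
    using DERIV_sqrt_abs[OF det_gram_nonzero[OF mc qV]] by (simp add: chart_inv[OF mc qV])
  have "((\<lambda>t. sqrt \<bar>det (gram V \<psi> (?u t))\<bar>) has_real_derivative
      sqrt \<bar>det ?G\<bar> / (2 * det ?G) * (det ?G * (2 * trace C))) (at 0)"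
    by (rule DERIV_chain2[where f = "\<lambda>d. sqrt \<bar>d\<bar>" and g = "\<lambda>t. det (gram V \<psi> (?u t))", OF ds dd])
  moreover have "trace C = christoffel_trace y e i q"
    by (simp add: trace_def C_def christoffel_trace_def sum_Basis_axis)
  ultimately show ?thesis
    using det_gram_nonzero[OF mc qV] by (simp add: dens_def[abs_def])
qed

lemma coordinate_fields_commute:
  assumes cf: "chart_frame V \<psi> W y e" and q: "q \<in> W" and ij: "i \<in> Basis" "j \<in> Basis"
  shows "D (e i) (e j) q = D (e j) (e i) q"
proof -
  note f = frame_onD[OF chart_frameD(3)[OF cf]]
  have z: "e i q (\<lambda>q. e j q (y k)) = 0" if "i \<in> Basis" "j \<in> Basis" "k \<in> Basis" for i j k
  proof -
    have "e i q (\<lambda>q. e j q (y k)) = e i q (\<lambda>q. if j = k then 1 else 0)"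
      by (rule tangent_local[OF _ vf_smooth _ f(1) q]) (use f that in auto)
    then show ?thesis using f(3)[OF that(1)] by (simp add: tangent_const[OF vf_tangent])
  qed
  have v: "lie_bracket (e i) (e j) q \<in> T q" using f(3) ij by simp
  have "lie_bracket (e i) (e j) q (y k) = 0" if "k \<in> Basis" for k
    unfolding lie_bracket_apply using z ij that by simp
  then have "lie_bracket (e i) (e j) q = 0"
    using f(5)[OF q v] by simp
  then show ?thesis using f(3) ij by (simp add: torsion_free)
qed

lemma dv_coordinates:
  assumes cf: "chart_frame V \<psi> W y e" and q: "q \<in> W" and X: "X \<in> VF"
  shows "dv X q = (\<Sum>i\<in>Basis. e i q (\<lambda>q. X q (y i)) + X q (y i) * christoffel_trace y e i q)"
proof -
  note fr = chart_frameD(3)[OF cf] note f = frame_onD[OF fr]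
  have "D (e i) X q (y i) = e i q (\<lambda>q. X q (y i)) + (\<Sum>a\<in>Basis. X q (y a) * D (e a) (e i) q (y i))"
    if i: "i \<in> Basis" for i
  proof -
    have "D (e i) X q (y i) = (\<Sum>a\<in>Basis. e i q (\<lambda>q. X q (y a)) * e a q (y i))
        + (\<Sum>a\<in>Basis. X q (y a) * D (e i) (e a) q (y i))"
      by (subst D_right_expansion[OF fr q X f(3)[OF i]]) (simp add: sum.distrib)
    also have "(\<Sum>a\<in>Basis. e i q (\<lambda>q. X q (y a)) * e a q (y i)) =
        (\<Sum>a\<in>Basis. if a = i then e i q (\<lambda>q. X q (y a)) else 0)"
      using f(4)[OF q] i by (intro sum.cong) auto
    also have "\<dots> = e i q (\<lambda>q. X q (y i))" using i by simp
    also have "(\<Sum>a\<in>Basis. X q (y a) * D (e i) (e a) q (y i)) = (\<Sum>a\<in>Basis. X q (y a) * D (e a) (e i) q (y i))"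
      using coordinate_fields_commute[OF cf q i] by (intro sum.cong) auto
    finally show ?thesis .
  qed
  then have "dv X q = (\<Sum>i\<in>Basis. e i q (\<lambda>q. X q (y i))) + (\<Sum>i\<in>Basis. \<Sum>a\<in>Basis. X q (y a) * D (e a) (e i) q (y i))"
    by (simp add: dv_frame[OF fr q X] sum.distrib)
  also have "(\<Sum>i\<in>Basis. \<Sum>a\<in>Basis. X q (y a) * D (e a) (e i) q (y i)) =
      (\<Sum>a\<in>Basis. X q (y a) * christoffel_trace y e a q)"
    by (subst sum.swap) (simp add: christoffel_trace_def sum_distrib_left)
  finally show ?thesis by (simp add: sum.distrib)
qed

lemma chart_integrand_continuous:
  assumes mc: "(V, \<psi>) \<in> maximal_atlas A" and W: "open W" "W \<subseteq> V"
    and w: "continuous_on W w" and K: "compact K" "K \<subseteq> W" "\<And>q. q \<in> W - K \<Longrightarrow> w q = 0"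
  shows "continuous_on UNIV (\<lambda>z. if z \<in> \<psi> ` W then w (inv_into V \<psi> z) else 0 :: real)"
    "compact (\<psi> ` K)"
proof -
  have inj: "inj_on \<psi> V" by (rule chart_inj[OF mc])
  show ck: "compact (\<psi> ` K)"
    using chart_cont[OF mc] K W by (intro compact_continuous_image) (auto intro: continuous_on_subset)
  show "continuous_on UNIV (\<lambda>z. if z \<in> \<psi> ` W then w (inv_into V \<psi> z) else 0 :: real)"
  proof (rule continuous_extend_by_zero[OF chart_open_subset_image[OF mc W] _ ck])
    have sub: "inv_into V \<psi> ` \<psi> ` W \<subseteq> W" using W(2) chart_inv[OF mc] by auto
    have "continuous_on (\<psi> ` W) (inv_into V \<psi>)"
      using chart_inv_cont[OF mc] W(2) by (rule_tac continuous_on_subset) auto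
    then show "continuous_on (\<psi> ` W) (\<lambda>z. w (inv_into V \<psi> z))"
      by (rule continuous_on_compose2[OF w _ sub])
    show "\<psi> ` K \<subseteq> \<psi> ` W" using K(2) by blast
    fix z assume z: "z \<in> \<psi> ` W - \<psi> ` K"
    then obtain q where q: "q \<in> W" "z = \<psi> q" by blast
    then have "q \<notin> K" using z by blast
    then show "w (inv_into V \<psi> z) = 0" using q K(3) chart_inv[OF mc, of q] W(2) by auto
  qed
qed

lemma dv_outside_support:
  assumes X: "X \<in> VF" and K: "closed K" "\<And>q. q \<notin> K \<Longrightarrow> X q = 0" and q: "q \<notin> K"
  shows "dv X q = 0"
proof -
  have "cov q v X = cov q v 0" if v: "v \<in> T q" for v
  proof (rule cov_local[OF v X vf_0])
    show "X q = (0 :: 'a vfield) q" using K(2) q by simp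
    fix f assume f: "smooth f"
    show "v (\<lambda>q. X q f) = v (\<lambda>q. (0 :: 'a vfield) q f)"
      by (rule tangent_local[OF v vf_smooth[OF X f] vf_smooth[OF vf_0 f], of "- K"]) (use K q in auto)
  qed
  then have "dv X q = tr q (\<lambda>v. cov q v 0)" unfolding dv_tr by (rule tr_cong)
  also have "\<dots> = dv (0 *\<^sub>R X) q" by (simp add: dv_tr)
  finally show ?thesis using dv_scale[OF X, of 0 q] by simp
qed

text \<open>By the formula for the derivative of the density, the divergence times the density is the sum of
  the partial derivatives of the components times the density. Each of them integrates to \<open>0\<close>.\<close>

lemma chart_integral_dv:
  assumes cf: "chart_frame V \<psi> W y e" and X: "X \<in> VF"
    and K: "compact K" "K \<subseteq> W" "\<And>q. q \<notin> K \<Longrightarrow> X q = 0"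
  shows "chart_integral V \<psi> (dv X) = 0"
proof -
  note mc = chart_frameD(1)[OF cf] and WV = chart_frameD(2)[OF cf] and fr = chart_frameD(3)[OF cf]
  note f = frame_onD[OF fr]
  let ?u = "inv_into V \<psi>"
  define h where "h = (\<lambda>i q. X q (y i) * dens V \<psi> q)"
  define h' where "h' = (\<lambda>i q. (e i q (\<lambda>q. X q (y i)) + X q (y i) * christoffel_trace y e i q) * dens V \<psi> q)"
  define H where "H = (\<lambda>i z. if z \<in> \<psi> ` W then h i (?u z) else 0)"
  define H' where "H' = (\<lambda>i z. if z \<in> \<psi> ` W then h' i (?u z) else 0)"
  have cd: "continuous_on W (dens V \<psi>)"
    using dens_continuous[OF mc] WV by (rule continuous_on_subset)
  have sX: "smooth (\<lambda>q. X q (y i))" if "i \<in> Basis" for i using vf_smooth[OF X f(2)[OF that]] .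
  have seX: "smooth (\<lambda>q. e i q (\<lambda>q. X q (y i)))" if "i \<in> Basis" for i
    by (rule vf_smooth[OF f(3)[OF that] sX[OF that]])
  have sc: "smooth (christoffel_trace y e i)" if "i \<in> Basis" for i
    unfolding christoffel_trace_def[abs_def]
    by (intro smooth_sum vf_smooth[OF D_vf]) (use f that in auto)
  have cW: "continuous_on W k" if "smooth k" for k
    using smooth_continuous[OF that] by (rule continuous_on_subset) simp
  have z0: "X q (y i) = 0" if "q \<in> W - K" for q i using K(3) that by simp
  have z1: "e i q (\<lambda>q. X q (y i)) = 0" if "q \<in> W - K" "i \<in> Basis" for q i
  proof -
    have "e i q (\<lambda>q. X q (y i)) = e i q (\<lambda>q. 0)"
      by (rule tangent_local[OF vf_tangent[OF f(3)[OF that(2)]] sX[OF that(2)] smooth_const, of "- K"])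
        (use K that compact_imp_closed[OF K(1)] in auto)
    then show ?thesis using f(3)[OF that(2)] by (simp add: tangent_const[OF vf_tangent])
  qed
  have ch: "continuous_on W (h i)" if "i \<in> Basis" for i
    unfolding h_def by (rule continuous_on_mult[OF cW[OF sX[OF that]] cd])
  have ch': "continuous_on W (h' i)" if "i \<in> Basis" for i
    unfolding h'_def
    by (rule continuous_on_mult[OF continuous_on_add[OF cW[OF seX[OF that]]
          continuous_on_mult[OF cW[OF sX[OF that]] cW[OF sc[OF that]]]] cd])
  have h0: "h i q = 0" "h' i q = 0" if "q \<in> W - K" "i \<in> Basis" for i q
    using z0[OF that(1)] z1[OF that] by (simp_all add: h_def h'_def)
  have int0: "integral UNIV (H' i) = 0" if i: "i \<in> Basis" for i
  proof (rule integral_directional_derivative[where H = "H i" and c = i and K = "\<psi> ` K"])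
    show "continuous_on UNIV (H i)" unfolding H_def
      by (rule chart_integrand_continuous(1)[OF mc f(1) WV ch[OF i] K(1,2)]) (rule h0[OF _ i])
    show "continuous_on UNIV (H' i)" unfolding H'_def
      by (rule chart_integrand_continuous(1)[OF mc f(1) WV ch'[OF i] K(1,2)]) (rule h0[OF _ i])
    show "compact (\<psi> ` K)"
      by (rule chart_integrand_continuous(2)[OF mc f(1) WV ch[OF i] K(1,2)]) (rule h0[OF _ i])
    have z: "H i z = 0 \<and> H' i z = 0" if z: "z \<notin> \<psi> ` K" for z
    proof (cases "z \<in> \<psi> ` W")
      case True
      then obtain q where q: "q \<in> W" "z = \<psi> q" by blast
      then have "?u z = q" "q \<in> W - K" using WV chart_inv[OF mc, of q] z by auto
      then show ?thesis using h0[of q i] i by (simp add: H_def H'_def)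
    qed (simp add: H_def H'_def)
    then show "H i z = 0" "H' i z = 0" if "z \<notin> \<psi> ` K" for z using that by auto
    fix z
    show "((\<lambda>t. H i (z + t *\<^sub>R i)) has_real_derivative H' i z) (at 0)"
    proof (cases "z \<in> \<psi> ` W")
      case True
      then obtain q where q: "q \<in> W" "z = \<psi> q" by blast
      have qV: "q \<in> V" using q WV by blast
      have uz: "?u z = q" using q chart_inv[OF mc qV] by simp
      have "((\<lambda>t. X (?u (\<psi> q + t *\<^sub>R i)) (y i)) has_real_derivative e i q (\<lambda>q. X q (y i))) (at 0)"
        using chart_line_derivative[OF sX[OF i] mc qV, of i] chart_frameD(4)[OF cf i q(1)] by simp
      from DERIV_mult[OF this dens_derivative[OF cf q(1) i]]
      have "((\<lambda>t. h i (?u (\<psi> q + t *\<^sub>R i))) has_real_derivative h' i q) (at 0)"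
        by (simp add: h_def h'_def chart_inv[OF mc qV] algebra_simps)
      then have dh: "((\<lambda>t. h i (?u (z + t *\<^sub>R i))) has_real_derivative H' i z) (at 0)"
        using True by (simp add: q(2) H'_def chart_inv[OF mc qV])
      obtain \<delta> where \<delta>: "\<delta> > 0" "\<forall>t. \<bar>t\<bar> < \<delta> \<longrightarrow> \<psi> q + t *\<^sub>R i \<in> \<psi> ` W \<and> ?u (\<psi> q + t *\<^sub>R i) \<in> W"
        using chart_line_eventually[OF mc f(1) WV q(1), of i] by (elim exE conjE) (rule that)
      have eq: "h i (?u (z + t *\<^sub>R i)) = H i (z + t *\<^sub>R i)" if "t \<in> {-\<delta><..<\<delta>}" for t
      proof -
        have "\<psi> q + t *\<^sub>R i \<in> \<psi> ` W" using \<delta>(2) that by (simp add: abs_less_iff)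
        then show ?thesis unfolding H_def q(2) by (simp only: if_True)
      qed
      show ?thesis
      proof (rule has_field_derivative_transform_within_open[where S = "{-\<delta><..<\<delta>}", OF dh])
        show "0 \<in> {-\<delta><..<\<delta>}" using \<delta>(1) by simp
      qed (rule open_greaterThanLessThan, rule eq)
    next
      case False
      have "closed (\<psi> ` K)" using \<open>compact (\<psi> ` K)\<close> by (rule compact_imp_closed)
      then have o: "open ((\<lambda>t::real. z + t *\<^sub>R i) -` (- \<psi> ` K))"
        by (intro continuous_open_vimage open_Compl) (auto intro!: continuous_intros)
      have "z \<notin> \<psi> ` K" using False K(2) by blast
      have "((\<lambda>t::real. 0::real) has_real_derivative 0) (at 0)" by simp
      then have "((\<lambda>t. H i (z + t *\<^sub>R i)) has_real_derivative 0) (at 0)"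
        by (rule has_field_derivative_transform_within_open[OF _ o]) (use \<open>z \<notin> \<psi> ` K\<close> z in auto)
      then show ?thesis using False by (simp add: H'_def)
    qed
  qed
  have iH': "H' i integrable_on UNIV" if i: "i \<in> Basis" for i
  proof -
    have c: "continuous_on UNIV (H' i)" unfolding H'_def
      by (rule chart_integrand_continuous(1)[OF mc f(1) WV ch'[OF i] K(1,2)]) (rule h0[OF _ i])
    have ck: "compact (\<psi> ` K)"
      by (rule chart_integrand_continuous(2)[OF mc f(1) WV ch'[OF i] K(1,2)]) (rule h0[OF _ i])
    have "H' i z = 0" if z: "z \<notin> \<psi> ` K" for z
    proof (cases "z \<in> \<psi> ` W")
      case True
      then obtain q where q: "q \<in> W" "z = \<psi> q" by blast
      then have "?u z = q" "q \<in> W - K" using WV chart_inv[OF mc, of q] z by auto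
      then show ?thesis using h0[of q i] i by (simp add: H'_def)
    qed (simp add: H'_def)
    then show ?thesis by (rule compact_support_integrable(2)[OF c ck])
  qed
  have "(if z \<in> \<psi> ` V then dv X (?u z) * dens V \<psi> (?u z) else 0) = (\<Sum>i\<in>Basis. H' i z)" for z
  proof (cases "z \<in> \<psi> ` W")
    case True
    then obtain q where q: "q \<in> W" "z = \<psi> q" by blast
    then have qV: "q \<in> V" "?u z = q" using WV chart_inv[OF mc, of q] by auto
    have "(\<Sum>i\<in>Basis. H' i z) = dv X q * dens V \<psi> q"
      unfolding dv_coordinates[OF cf q(1) X] sum_distrib_right
      using True qV(2) by (simp add: H'_def h'_def)
    then show ?thesis using qV q(2) by auto
  next
    case False
    then have "(\<Sum>i\<in>Basis. H' i z) = 0" by (simp add: H'_def)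
    moreover have "dv X (?u z) = 0" if "z \<in> \<psi> ` V"
    proof -
      obtain q where q: "q \<in> V" "z = \<psi> q" using \<open>z \<in> \<psi> ` V\<close> by blast
      then have "q \<notin> K" using False K(2) by blast
      moreover have "?u z = q" using q chart_inv[OF mc q(1)] by simp
      ultimately show ?thesis using dv_outside_support[OF X compact_imp_closed[OF K(1)] K(3)] by simp
    qed
    ultimately show ?thesis by simp
  qed
  then have "chart_integral V \<psi> (dv X) = integral UNIV (\<lambda>z. \<Sum>i\<in>Basis. H' i z)"
    unfolding chart_integral_def by presburger
  also have "\<dots> = (\<Sum>i\<in>Basis. integral UNIV (H' i))"
    by (rule integral_sum) (simp_all add: iH')
  also have "\<dots> = 0" using int0 by simp
  finally show ?thesis .
qed

lemma coord_vec_change: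
  assumes mc: "(V, \<psi>) \<in> maximal_atlas A" and md: "(V', \<psi>') \<in> maximal_atlas A" and q: "q \<in> V" "q \<in> V'"
    and d: "((\<lambda>x. \<psi>' (inv_into V \<psi> x)) has_derivative \<sigma>) (at (\<psi> q))"
  shows "coord_vec V \<psi> q c = coord_vec V' \<psi>' q (\<sigma> c)"
proof
  fix f
  show "coord_vec V \<psi> q c f = coord_vec V' \<psi>' q (\<sigma> c) f"
  proof (cases "smooth f")
    case True
    let ?D = "frechet_derivative (\<lambda>x. f (inv_into V' \<psi>' x)) (at (\<psi>' q))"
    have "((\<lambda>x. f (inv_into V' \<psi>' x)) has_derivative ?D) (at (\<psi>' (inv_into V \<psi> (\<psi> q))))"
      using smooth_in_chart_has_derivative[OF True md q(2)] chart_inv[OF mc q(1)] by simp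
    from has_derivative_compose[OF d this]
    have d1: "((\<lambda>x. f (inv_into V' \<psi>' (\<psi>' (inv_into V \<psi> x)))) has_derivative (\<lambda>x. ?D (\<sigma> x))) (at (\<psi> q))" .
    have o: "open (\<psi> ` (V \<inter> V'))"
      using chart_open[OF mc] chart_open[OF md] by (intro chart_open_subset_image[OF mc]) auto
    have "((\<lambda>x. f (inv_into V \<psi> x)) has_derivative (\<lambda>x. ?D (\<sigma> x))) (at (\<psi> q))"
    proof (rule has_derivative_transform_within_open[OF d1 o])
      show "\<psi> q \<in> \<psi> ` (V \<inter> V')" using q by blast
      fix x assume "x \<in> \<psi> ` (V \<inter> V')"
      then obtain p where p: "p \<in> V" "p \<in> V'" "x = \<psi> p" by blast
      then show "f (inv_into V' \<psi>' (\<psi>' (inv_into V \<psi> x))) = f (inv_into V \<psi> x)"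
        using chart_inv[OF mc p(1)] chart_inv[OF md p(2)] by simp
    qed
    from coord_vec_eq[OF True mc q(1) this] show ?thesis using True by (simp add: coord_vec_def)
  qed (simp add: coord_vec_def)
qed

lemma dens_change:
  assumes mc: "(V, \<psi>) \<in> maximal_atlas A" and md: "(V', \<psi>') \<in> maximal_atlas A" and q: "q \<in> V" "q \<in> V'"
    and d: "((\<lambda>x. \<psi>' (inv_into V \<psi> x)) has_derivative \<sigma>) (at (\<psi> q))"
  shows "dens V \<psi> q = \<bar>det (matrix \<sigma>)\<bar> * dens V' \<psi>' q"
proof -
  let ?J = "matrix \<sigma>" and ?E = "\<lambda>k. coord_vec V' \<psi>' q (axis k 1)"
  have lin: "linear (coord_vec V' \<psi>' q)" by (rule coord_vec_linear[OF md q(2)])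
  have t: "?E k \<in> T q" for k by (rule coord_vec_tangent[OF md q(2)])
  have exp: "coord_vec V \<psi> q (axis a 1) = (\<Sum>k\<in>UNIV. ?J $ k $ a *\<^sub>R ?E k)" for a
  proof -
    have "\<sigma> (axis a 1) = (\<Sum>k\<in>UNIV. (\<sigma> (axis a 1) $ k) *\<^sub>R axis k 1)"
      by (subst basis_expansion[symmetric]) (simp add: scalar_mult_eq_scaleR)
    then have "coord_vec V' \<psi>' q (\<sigma> (axis a 1)) = coord_vec V' \<psi>' q (\<Sum>k\<in>UNIV. (\<sigma> (axis a 1) $ k) *\<^sub>R axis k 1)"
      by (rule arg_cong)
    also have "\<dots> = (\<Sum>k\<in>UNIV. (\<sigma> (axis a 1) $ k) *\<^sub>R ?E k)"
      by (simp only: linear_sum[OF lin] linear_scale[OF lin])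
    finally show ?thesis
      by (simp only: coord_vec_change[OF mc md q d] matrix_def vec_lambda_beta)
  qed
  have "gram V \<psi> q $ a $ b = (transpose ?J ** gram V' \<psi>' q ** ?J) $ a $ b" for a b
  proof -
    have "gram V \<psi> q $ a $ b = (\<Sum>l\<in>UNIV. \<Sum>k\<in>UNIV. ?J $ k $ a * (?J $ l $ b * g q (?E k) (?E l)))"
      using t by (simp add: gram_def exp g_bilinear sum_distrib_left mult.left_commute)
    also have "\<dots> = (transpose ?J ** gram V' \<psi>' q ** ?J) $ a $ b"
      by (simp add: matrix_matrix_mult_def transpose_def gram_def sum_distrib_right sum_distrib_left algebra_simps)
    finally show ?thesis .
  qed
  then have "gram V \<psi> q = transpose ?J ** gram V' \<psi>' q ** ?J" by (simp add: vec_eq_iff)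
  then have "\<bar>det (gram V \<psi> q)\<bar> = \<bar>det ?J\<bar>\<^sup>2 * \<bar>det (gram V' \<psi>' q)\<bar>"
    by (simp add: det_mul abs_mult power2_eq_square)
  then show ?thesis by (simp add: dens_def real_sqrt_mult)
qed

text \<open>Since the density changes by the Jacobian determinant, this is the transformation formula for
  integrals.\<close>

lemma chart_integral_change:
  assumes mc: "(V, \<psi>) \<in> maximal_atlas A" and md: "(V', \<psi>') \<in> A"
    and w: "continuous_on UNIV w" and K: "compact K" "K \<subseteq> V \<inter> V'" "\<And>q. q \<notin> K \<Longrightarrow> w q = 0"
  shows "chart_integral V \<psi> w = chart_integral V' \<psi>' w"
proof -
  note md' = atlas_subset_maximal[OF md]
  let ?W = "V \<inter> V'" and ?u = "inv_into V \<psi>" and ?u' = "inv_into V' \<psi>'"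
  let ?\<sigma> = "\<lambda>x. \<psi>' (?u x)" and ?f = "\<lambda>x. w (?u' x) * dens V' \<psi>' (?u' x)"
  have oW: "open ?W" using chart_open[OF mc] chart_open[OF md'] by auto
  have oS: "open (\<psi> ` ?W)" by (rule chart_open_subset_image[OF mc oW]) auto
  have oS': "open (\<psi>' ` ?W)" by (rule chart_open_subset_image[OF md' oW]) auto
  have "C_infinity_on (\<psi> ` ?W) ?\<sigma>"
    using mc md unfolding maximal_atlas_def compatible_def by (auto simp: comp_def)
  note d = C_infinity_on_has_derivative[OF this]
  have img: "?\<sigma> ` \<psi> ` ?W = \<psi>' ` ?W"
    using chart_inv[OF mc] by (auto simp: image_iff)
  have inj: "inj_on ?\<sigma> (\<psi> ` ?W)"
  proof (rule inj_onI)
    fix x x' assume "x \<in> \<psi> ` ?W" "x' \<in> \<psi> ` ?W" and eq: "?\<sigma> x = ?\<sigma> x'"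
    then obtain p p' where p: "p \<in> ?W" "x = \<psi> p" "p' \<in> ?W" "x' = \<psi> p'" by blast
    then have "\<psi>' p = \<psi>' p'" using eq chart_inv[OF mc, of p] chart_inv[OF mc, of p'] by simp
    then have "p = p'" using chart_inj[OF md'] p by (auto dest: inj_onD)
    then show "x = x'" using p by simp
  qed
  have cw: "continuous_on ?W (\<lambda>q. w q * dens V' \<psi>' q)"
    using w dens_continuous[OF md'] by (intro continuous_on_mult) (auto intro: continuous_on_subset)
  have zero: "w q * dens V' \<psi>' q = 0" if "q \<in> ?W - K" for q using K(3) that by simp
  note ci = chart_integrand_continuous[OF md' oW _ cw K(1,2) zero]
  have zK: "(if z \<in> \<psi>' ` ?W then ?f z else 0) = 0" if z: "z \<notin> \<psi>' ` K" for z
  proof (cases "z \<in> \<psi>' ` ?W")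
    case True
    then obtain q where q: "q \<in> V'" "q \<in> V" "z = \<psi>' q" by blast
    then have "?u' z = q" "q \<notin> K" using chart_inv[OF md' q(1)] z by auto
    then show ?thesis using K(3) by simp
  qed auto
  have "(\<lambda>z. if z \<in> \<psi>' ` ?W then ?f z else 0) absolutely_integrable_on UNIV"
    by (rule compact_support_integrable(1)[OF ci(1) ci(2) zK]) auto
  then have fi: "?f absolutely_integrable_on ?\<sigma> ` \<psi> ` ?W"
    unfolding img by (simp only: absolutely_integrable_restrict_UNIV)
  have "chart_integral V' \<psi>' w = integral UNIV (\<lambda>z. if z \<in> \<psi>' ` ?W then ?f z else 0)"
    unfolding chart_integral_def
  proof (rule integral_cong)
    fix z
    show "(if z \<in> \<psi>' ` V' then ?f z else 0) = (if z \<in> \<psi>' ` ?W then ?f z else 0)"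
    proof (cases "z \<in> \<psi>' ` V' - \<psi>' ` ?W")
      case True
      then obtain q where q: "q \<in> V'" "z = \<psi>' q" "q \<notin> V" by blast
      then have "?u' z = q" "q \<notin> K" using chart_inv[OF md' q(1)] K(2) by auto
      then show ?thesis using K(3) by simp
    qed auto
  qed
  also have "\<dots> = integral (?\<sigma> ` \<psi> ` ?W) ?f" unfolding img by (simp only: integral_restrict_UNIV)
  also have "\<dots> = integral (\<psi> ` ?W) (\<lambda>x. \<bar>det (matrix (frechet_derivative ?\<sigma> (at x)))\<bar> * ?f (?\<sigma> x))"
    by (rule integral_change_of_variables_real[OF _ _ inj fi])
      (use oS d in \<open>auto intro: has_derivative_at_withinI\<close>)
  also have "\<dots> = integral (\<psi> ` ?W) (\<lambda>x. w (?u x) * dens V \<psi> (?u x))"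
  proof (rule integral_cong)
    fix x assume x: "x \<in> \<psi> ` ?W"
    then obtain q where q: "q \<in> V" "q \<in> V'" "x = \<psi> q" by blast
    have u: "?u x = q" using chart_inv[OF mc q(1)] q(3) by simp
    have "dens V \<psi> q = \<bar>det (matrix (frechet_derivative ?\<sigma> (at x)))\<bar> * dens V' \<psi>' q"
      using d[OF x] by (intro dens_change[OF mc md' q(1,2)]) (simp only: q(3))
    then show "\<bar>det (matrix (frechet_derivative ?\<sigma> (at x)))\<bar> * ?f (?\<sigma> x) = w (?u x) * dens V \<psi> (?u x)"
      by (simp add: u chart_inv[OF md' q(2)])
  qed
  also have "\<dots> = integral UNIV (\<lambda>z. if z \<in> \<psi> ` ?W then w (?u z) * dens V \<psi> (?u z) else 0)"
    by (simp only: integral_restrict_UNIV)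
  also have "\<dots> = chart_integral V \<psi> w"
    unfolding chart_integral_def
  proof (rule integral_cong)
    fix z
    show "(if z \<in> \<psi> ` ?W then w (?u z) * dens V \<psi> (?u z) else 0) =
        (if z \<in> \<psi> ` V then w (?u z) * dens V \<psi> (?u z) else 0)"
    proof (cases "z \<in> \<psi> ` V - \<psi> ` ?W")
      case True
      then obtain q where q: "q \<in> V" "z = \<psi> q" "q \<notin> V'" by blast
      then have "?u z = q" "q \<notin> K" using chart_inv[OF mc q(1)] K(2) by auto
      then show ?thesis using K(3) by simp
    qed auto
  qed
  finally show ?thesis by simp
qed

end

section \<open>Stokes' theorem on a compact hypersurface\<close>

context smooth_manifold
begin

text \<open>The coordinate vectors are directional derivatives and obey the chain rule; they span the tangent
  space.\<close>

lemma tangent_compose: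
  assumes v: "v \<in> tangent_space A p" and f: "smooth f" and hf: "smooth (\<lambda>q. h (f q))"
    and h: "(h has_real_derivative h') (at (f p))"
  shows "v (\<lambda>q. h (f q)) = h' * v f"
proof -
  obtain V \<psi> where c: "(V, \<psi>) \<in> A" "p \<in> V" using chart_covers .
  note mc = atlas_subset_maximal[OF c(1)]
  obtain W y e where W: "p \<in> W" and fr: "frame_on W y e" and e: "\<forall>i\<in>Basis. \<forall>q\<in>W. e i q = coord_vec V \<psi> q i"
    using chart_frame_exists[OF mc c(2)] by (elim exE conjE) (rule that)
  have vi: "coord_vec V \<psi> p i (\<lambda>q. h (f q)) = h' * coord_vec V \<psi> p i f" for i
  proof -
    note d = smooth_in_chart_has_derivative[OF f mc c(2)]
    have "(h has_derivative (*) h') (at (f (inv_into V \<psi> (\<psi> p))))"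
      using h chart_inv[OF mc c(2)] by (simp add: has_field_derivative_def)
    from has_derivative_compose[OF d this] coord_vec_eq[OF hf mc c(2)] f
    show ?thesis by (simp add: coord_vec_def)
  qed
  have "v (\<lambda>q. h (f q)) = (\<Sum>i\<in>Basis. v (y i) *\<^sub>R coord_vec V \<psi> p i) (\<lambda>q. h (f q))"
    using frame_onD(5)[OF fr W v] e W by simp
  also have "\<dots> = h' * (\<Sum>i\<in>Basis. v (y i) *\<^sub>R coord_vec V \<psi> p i) f"
    by (simp add: vi sum_distrib_left mult.left_commute)
  also have "(\<Sum>i\<in>Basis. v (y i) *\<^sub>R coord_vec V \<psi> p i) = v"
    using frame_onD(5)[OF fr W v] e W by simp
  finally show ?thesis .
qed

lemma tangent_vanishing:
  assumes "v \<in> tangent_space A p" "smooth f" "open W" "p \<in> W" "\<And>q. q \<in> W \<Longrightarrow> f q = c"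
  shows "v f = 0"
  using tangent_local[OF assms(1,2) smooth_const assms(3,4), of c] assms(5) tangent_const[OF assms(1)] by auto

end

lemma compact_nonzero_bounded_below:
  fixes f :: "'b::topological_space \<Rightarrow> real"
  assumes "compact Q" "continuous_on Q f" "\<And>q. q \<in> Q \<Longrightarrow> f q \<noteq> 0"
  shows "\<exists>\<epsilon>>0. \<forall>q\<in>Q. \<epsilon> \<le> \<bar>f q\<bar>"
proof (cases "Q = {}")
  case False
  have "continuous_on Q (\<lambda>q. \<bar>f q\<bar>)" using assms(2) by (intro continuous_intros)
  then obtain q where q: "q \<in> Q" "\<forall>q'\<in>Q. \<bar>f q\<bar> \<le> \<bar>f q'\<bar>"
    using continuous_attains_inf[OF assms(1) False] by blast
  then show ?thesis using assms(3)[OF q(1)] by (intro exI[of _ "\<bar>f q\<bar>"]) auto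
qed (auto intro!: exI[of _ 1])

definition hat :: "real \<Rightarrow> real" where
  "hat s = flat 0 (1 - s\<^sup>2)"

lemma C_infinity_on_hat: "C_infinity_on UNIV hat"
proof -
  have "C_infinity_on UNIV (\<lambda>s::real. 1 + (- 1) *\<^sub>R (s *\<^sub>R s))"
    by (intro C_infinity_on_add C_infinity_on_scaleR C_infinity_on_const open_UNIV
        C_infinity_on_bounded_linear bounded_linear_ident)
  from C_infinity_on_compose[OF open_UNIV open_UNIV _ this C_infinity_on_flat[of 0]]
  show ?thesis by (simp add: hat_def[abs_def] power2_eq_square)
qed

lemma hat_nonneg: "0 \<le> hat s"
  by (simp add: hat_def flat_nonneg)

lemma hat_le_1: "hat s \<le> 1"
  by (simp add: hat_def flat_def)

lemma hat_eq_0: "1 \<le> \<bar>s\<bar> \<Longrightarrow> hat s = 0"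
  by (simp add: hat_def flat_def) (metis abs_le_square_iff abs_one diff_le_0_iff_le not_le one_power2)

lemma hat_lower: "\<bar>s\<bar> \<le> 1/2 \<Longrightarrow> exp (- (4/3)) \<le> hat s"
proof -
  assume "\<bar>s\<bar> \<le> 1/2"
  then have "s\<^sup>2 \<le> (1/2)\<^sup>2" by (metis abs_le_square_iff abs_of_nonneg zero_le_divide_1_iff zero_le_numeral)
  then have s: "3/4 \<le> 1 - s\<^sup>2" by (simp add: power2_eq_square)
  then have "inverse (1 - s\<^sup>2) \<le> inverse (3/4)" by (intro le_imp_inverse_le) auto
  then show ?thesis using s by (simp add: hat_def flat_def)
qed

context lorentz_manifold_cart
begin

definition csupp :: "'a set \<Rightarrow> ('a \<Rightarrow> real) \<Rightarrow> bool" where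
  "csupp V w \<longleftrightarrow> continuous_on UNIV w \<and> (\<exists>K. compact K \<and> K \<subseteq> V \<and> (\<forall>q. q \<notin> K \<longrightarrow> w q = 0))"

lemma chart_integrand_props:
  assumes mc: "(V, \<psi>) \<in> maximal_atlas A" and w: "csupp V w"
  defines "F \<equiv> \<lambda>z. if z \<in> \<psi> ` V then w (inv_into V \<psi> z) * dens V \<psi> (inv_into V \<psi> z) else 0"
  shows "F integrable_on UNIV" "continuous_on UNIV F" "\<exists>K. compact K \<and> (\<forall>z. z \<notin> K \<longrightarrow> F z = 0)"
proof -
  obtain K where K: "compact K" "K \<subseteq> V" "\<And>q. q \<notin> K \<Longrightarrow> w q = 0"
    using w unfolding csupp_def by blast
  have c: "continuous_on V (\<lambda>q. w q * dens V \<psi> q)"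
    using w dens_continuous[OF mc] by (intro continuous_on_mult) (auto simp: csupp_def intro: continuous_on_subset)
  have z: "w q * dens V \<psi> q = 0" if "q \<in> V - K" for q using K(3) that by simp
  note ci = chart_integrand_continuous[OF mc chart_open[OF mc] subset_refl c K(1,2) z]
  show cF: "continuous_on UNIV F" unfolding F_def by (rule ci(1))
  have ck: "compact (\<psi> ` K)" by (rule ci(2))
  have F0: "F x = 0" if x: "x \<notin> \<psi> ` K" for x
  proof (cases "x \<in> \<psi> ` V")
    case True
    then obtain q where q: "q \<in> V" "x = \<psi> q" by blast
    then have "inv_into V \<psi> x = q" "q \<notin> K" using chart_inv[OF mc q(1)] x by auto
    then show ?thesis using K(3) by (simp add: F_def)
  qed (simp add: F_def)
  show "F integrable_on UNIV" by (rule compact_support_integrable(2)[OF cF ck F0])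
  show "\<exists>K. compact K \<and> (\<forall>z. z \<notin> K \<longrightarrow> F z = 0)" using ck F0 by blast
qed

lemma chart_integral_add:
  assumes mc: "(V, \<psi>) \<in> maximal_atlas A" and w: "csupp V w" "csupp V w'"
  shows "chart_integral V \<psi> (\<lambda>q. w q + w' q) = chart_integral V \<psi> w + chart_integral V \<psi> w'"
proof -
  note i = chart_integrand_props(1)[OF mc w(1)] chart_integrand_props(1)[OF mc w(2)]
  show ?thesis
    unfolding chart_integral_def integral_add[OF i, symmetric]
    by (rule integral_cong) (simp add: distrib_right)
qed

lemma csupp_0 [simp]: "csupp V (\<lambda>q. 0)"
  unfolding csupp_def by (auto intro!: exI[of _ "{}"])

lemma csupp_add: assumes "csupp V w" "csupp V w'" shows "csupp V (\<lambda>q. w q + w' q)"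
proof -
  obtain K K' where "compact K" "K \<subseteq> V" "\<And>q. q \<notin> K \<Longrightarrow> w q = 0" "compact K'" "K' \<subseteq> V" "\<And>q. q \<notin> K' \<Longrightarrow> w' q = 0"
    using assms unfolding csupp_def by blast
  then show ?thesis
    using assms unfolding csupp_def by (intro conjI exI[of _ "K \<union> K'"] continuous_on_add) auto
qed

lemma csupp_sum: "(\<And>i. i \<in> I \<Longrightarrow> csupp V (w i)) \<Longrightarrow> csupp V (\<lambda>q. \<Sum>i\<in>I. w i q)"
  by (induction I rule: infinite_finite_induct) (auto intro: csupp_add)

lemma csupp_mult: assumes "csupp V w" "smooth u" shows "csupp V (\<lambda>q. w q * u q)" "csupp V (\<lambda>q. u q * w q)"
proof -
  obtain K where "compact K" "K \<subseteq> V" "\<And>q. q \<notin> K \<Longrightarrow> w q = 0" using assms unfolding csupp_def by blast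
  then show "csupp V (\<lambda>q. w q * u q)" "csupp V (\<lambda>q. u q * w q)"
    using assms smooth_continuous[OF assms(2)] unfolding csupp_def
    by (auto intro!: exI[of _ K] continuous_on_mult)
qed

lemma chart_integral_0: "chart_integral V \<psi> (\<lambda>q. 0) = 0"
  by (simp add: chart_integral_def cong: if_cong)

lemma chart_integral_sum:
  assumes mc: "(V, \<psi>) \<in> maximal_atlas A" and w: "\<And>i. i \<in> I \<Longrightarrow> csupp V (w i)"
  shows "chart_integral V \<psi> (\<lambda>q. \<Sum>i\<in>I. w i q) = (\<Sum>i\<in>I. chart_integral V \<psi> (w i))"
  using w
proof (induction I rule: infinite_finite_induct)
  case (insert i I)
  then show ?case
    using chart_integral_add[OF mc, of "w i" "\<lambda>q. \<Sum>i\<in>I. w i q"] csupp_sum[of I V w] by simp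
qed (simp_all add: chart_integral_0)

text \<open>Cut \<open>X\<close> into the pieces \<open>\<eta> \<odot> X\<close>, each supported in a single chart, where the divergence integrates to
  \<open>0\<close>. What remains are the integrals of the functions \<open>X \<eta>\<close>; after transformation to a common chart they
  cancel, because the \<open>\<eta>\<close> sum up to a constant on the support of \<open>X\<close>.\<close>

lemma divergence_theorem:
  fixes P :: "'i set" and V :: "'i \<Rightarrow> 'a set" and \<psi> :: "'i \<Rightarrow> 'a \<Rightarrow> (real,'n) vec" and \<eta> :: "'i \<Rightarrow> 'a \<Rightarrow> real"
  assumes P: "finite P"
    and ch: "\<And>i. i \<in> P \<Longrightarrow> (V i, \<psi> i) \<in> A" "\<And>i. i \<in> P \<Longrightarrow> chart_frame (V i) (\<psi> i) (W i) (y i) (e i)"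
    and \<eta>: "\<And>i. i \<in> P \<Longrightarrow> smooth (\<eta> i)" "\<And>i. i \<in> P \<Longrightarrow> compact (K i)" "\<And>i. i \<in> P \<Longrightarrow> K i \<subseteq> W i"
      "\<And>i q. i \<in> P \<Longrightarrow> q \<notin> K i \<Longrightarrow> \<eta> i q = 0"
    and N: "open N" "\<And>q. q \<in> N \<Longrightarrow> (\<Sum>i\<in>P. \<eta> i q) = 1"
    and X: "X \<in> VF" and K': "K' \<subseteq> N" "\<And>q. q \<notin> K' \<Longrightarrow> X q = 0"
  shows "(\<Sum>i\<in>P. chart_integral (V i) (\<psi> i) (\<lambda>q. \<eta> i q * dv X q)) = 0"
proof -
  have mc: "(V i, \<psi> i) \<in> maximal_atlas A" if "i \<in> P" for i using ch(1)[OF that] by (rule atlas_subset_maximal)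
  have KV: "K i \<subseteq> V i" if "i \<in> P" for i using \<eta>(3)[OF that] chart_frameD(2)[OF ch(2)[OF that]] by blast
  have cs: "csupp (V i) (\<eta> i)" if "i \<in> P" for i
    unfolding csupp_def using smooth_continuous[OF \<eta>(1)[OF that]] \<eta>(2,4)[OF that] KV[OF that] by blast
  have sX: "smooth (\<lambda>q. X q (\<eta> i))" if "i \<in> P" for i using vf_smooth[OF X \<eta>(1)[OF that]] .
  have X0: "X q (\<eta> i) = 0" if i: "i \<in> P" and q: "q \<notin> K i" for i q
    by (rule tangent_vanishing[OF vf_tangent[OF X] \<eta>(1)[OF i], where W = "- K i" and c = 0])
      (use compact_imp_closed[OF \<eta>(2)[OF i]] q \<eta>(4)[OF i] in auto)
  have csX: "csupp (V i) (\<lambda>q. X q (\<eta> i))" if "i \<in> P" for i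
    unfolding csupp_def using smooth_continuous[OF sX[OF that]] \<eta>(2)[OF that] KV[OF that] X0[OF that] by blast
  have 1: "chart_integral (V i) (\<psi> i) (\<lambda>q. \<eta> i q * dv X q) + chart_integral (V i) (\<psi> i) (\<lambda>q. X q (\<eta> i)) = 0"
    if i: "i \<in> P" for i
  proof -
    have "chart_integral (V i) (\<psi> i) (dv (\<eta> i \<odot> X)) = 0"
      by (rule chart_integral_dv[OF ch(2)[OF i] vf_fscale[OF \<eta>(1)[OF i] X] \<eta>(2)[OF i] \<eta>(3)[OF i]])
        (simp add: \<eta>(4)[OF i])
    moreover have "dv (\<eta> i \<odot> X) = (\<lambda>q. \<eta> i q * dv X q + X q (\<eta> i))"
      using dv_fscale[OF X \<eta>(1)[OF i]] by (rule ext)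
    ultimately show ?thesis
      using chart_integral_add[OF mc[OF i] csupp_mult(1)[OF cs[OF i] dv_smooth[OF X]] csX[OF i]] by simp
  qed
  have 2: "chart_integral (V i) (\<psi> i) (\<lambda>q. X q (\<eta> i)) =
      (\<Sum>j\<in>P. chart_integral (V j) (\<psi> j) (\<lambda>q. \<eta> j q * X q (\<eta> i)))" if i: "i \<in> P" for i
  proof -
    have "X q (\<eta> i) = (\<Sum>j\<in>P. \<eta> j q * X q (\<eta> i))" for q
    proof (cases "q \<in> K'")
      case True
      then show ?thesis using K'(1) N(2) by (auto simp: sum_distrib_right[symmetric])
    next
      case False
      then show ?thesis using K'(2) by simp
    qed
    then have "chart_integral (V i) (\<psi> i) (\<lambda>q. X q (\<eta> i)) =
        chart_integral (V i) (\<psi> i) (\<lambda>q. \<Sum>j\<in>P. \<eta> j q * X q (\<eta> i))" by simp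
    also have "\<dots> = (\<Sum>j\<in>P. chart_integral (V i) (\<psi> i) (\<lambda>q. \<eta> j q * X q (\<eta> i)))"
      by (rule chart_integral_sum[OF mc[OF i]]) (rule csupp_mult(2)[OF csX[OF i] \<eta>(1)])
    also have "\<dots> = (\<Sum>j\<in>P. chart_integral (V j) (\<psi> j) (\<lambda>q. \<eta> j q * X q (\<eta> i)))"
    proof (rule sum.cong[OF refl])
      fix j assume j: "j \<in> P"
      show "chart_integral (V i) (\<psi> i) (\<lambda>q. \<eta> j q * X q (\<eta> i)) =
          chart_integral (V j) (\<psi> j) (\<lambda>q. \<eta> j q * X q (\<eta> i))"
      proof (rule chart_integral_change[OF mc[OF i] ch(1)[OF j]])
        show "continuous_on UNIV (\<lambda>q. \<eta> j q * X q (\<eta> i))"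
          by (rule smooth_continuous[OF smooth_mult[OF \<eta>(1)[OF j] sX[OF i]]])
        show "compact (K i \<inter> K j)" by (rule compact_Int[OF \<eta>(2)[OF i] \<eta>(2)[OF j]])
        show "K i \<inter> K j \<subseteq> V i \<inter> V j" using KV[OF i] KV[OF j] by blast
        show "\<eta> j q * X q (\<eta> i) = 0" if "q \<notin> K i \<inter> K j" for q
          using that X0[OF i] \<eta>(4)[OF j] by auto
      qed
    qed
    finally show ?thesis .
  qed
  have 3: "(\<Sum>i\<in>P. chart_integral (V j) (\<psi> j) (\<lambda>q. \<eta> j q * X q (\<eta> i))) = 0" if j: "j \<in> P" for j
  proof -
    have "(\<Sum>i\<in>P. \<eta> j q * X q (\<eta> i)) = 0" for q
    proof (cases "q \<in> K'")
      case True
      have "X q (\<lambda>q. \<Sum>i\<in>P. \<eta> i q) = 0"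
        by (rule tangent_vanishing[OF vf_tangent[OF X] smooth_sum[OF \<eta>(1)] N(1), where c = 1])
          (use True K'(1) N(2) in auto)
      then show ?thesis
        using tangent_sum[where I = P and f = \<eta>, OF vf_tangent[OF X, of q] \<eta>(1)] by (simp add: sum_distrib_left[symmetric])
    next
      case False
      then show ?thesis using K'(2) by simp
    qed
    then have "chart_integral (V j) (\<psi> j) (\<lambda>q. \<Sum>i\<in>P. \<eta> j q * X q (\<eta> i)) = 0"
      by (simp add: chart_integral_0)
    moreover have "chart_integral (V j) (\<psi> j) (\<lambda>q. \<Sum>i\<in>P. \<eta> j q * X q (\<eta> i)) =
        (\<Sum>i\<in>P. chart_integral (V j) (\<psi> j) (\<lambda>q. \<eta> j q * X q (\<eta> i)))"
      by (rule chart_integral_sum[OF mc[OF j]]) (rule csupp_mult(1)[OF cs[OF j] sX])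
    ultimately show ?thesis by simp
  qed
  have "(\<Sum>i\<in>P. chart_integral (V i) (\<psi> i) (\<lambda>q. \<eta> i q * dv X q)) =
      - (\<Sum>i\<in>P. chart_integral (V i) (\<psi> i) (\<lambda>q. X q (\<eta> i)))"
    unfolding sum_negf[symmetric] by (rule sum.cong[OF refl]) (rule eq_neg_iff_add_eq_0[THEN iffD2, OF 1])
  also have "(\<Sum>i\<in>P. chart_integral (V i) (\<psi> i) (\<lambda>q. X q (\<eta> i))) =
      (\<Sum>j\<in>P. \<Sum>i\<in>P. chart_integral (V j) (\<psi> j) (\<lambda>q. \<eta> j q * X q (\<eta> i)))"
    by (subst sum.swap) (simp add: 2)
  also have "\<dots> = 0" using 3 by simp
  finally show ?thesis by simp
qed

text \<open>Take for \<open>b\<close> the coordinates of \<open>v\<close>. On a small ball the derivative of \<open>F\<close> in this direction stays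
  between two positive constants; apply the mean value theorem.\<close>

lemma local_increase:
  assumes mc: "(V, \<psi>) \<in> maximal_atlas A" and p: "p \<in> V" "p \<in> W" "open W"
    and F: "smooth F" and v: "v \<in> T p" "v F > 0"
  shows "\<exists>r m M b. r > 0 \<and> m > 0 \<and> ball (\<psi> p) (2 * r) \<subseteq> \<psi> ` (V \<inter> W) \<and>
    (\<forall>x t. t \<ge> 0 \<longrightarrow> x \<in> ball (\<psi> p) (2 * r) \<longrightarrow> x + t *\<^sub>R b \<in> ball (\<psi> p) (2 * r) \<longrightarrow>
      m * t \<le> F (inv_into V \<psi> (x + t *\<^sub>R b)) - F (inv_into V \<psi> x) \<and>
      F (inv_into V \<psi> (x + t *\<^sub>R b)) - F (inv_into V \<psi> x) \<le> M * t)"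
proof -
  let ?G = "\<lambda>x. F (inv_into V \<psi> x)"
  obtain U y e where U: "p \<in> U" and cf: "chart_frame V \<psi> U y e" using chart_frame_ex[OF mc p(1)] by blast
  note fr = chart_frameD(3)[OF cf]
  define b where "b = (\<Sum>i\<in>Basis. v (y i) *\<^sub>R i)"
  note lin = coord_vec_linear[OF mc p(1)]
  have "coord_vec V \<psi> p b = (\<Sum>i\<in>Basis. v (y i) *\<^sub>R coord_vec V \<psi> p i)"
    unfolding b_def by (simp only: linear_sum[OF lin] linear_scale[OF lin])
  also have "\<dots> = (\<Sum>i\<in>Basis. v (y i) *\<^sub>R e i p)" using chart_frameD(4)[OF cf _ U] by simp
  also have "\<dots> = v" by (rule frame_onD(5)[OF fr U v(1), symmetric])
  finally have cb: "coord_vec V \<psi> p b = v" .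
  let ?d = "\<lambda>x. frechet_derivative ?G (at x) b"
  have G: "C_infinity_on (\<psi> ` V) ?G" by (rule smooth_in_chart[OF F mc])
  have cd: "continuous_on (\<psi> ` V) ?d" by (rule C_infinity_on_continuous_on[OF C_infinity_on_frechet[OF G]])
  have dp: "?d (\<psi> p) = v F" using F cb[symmetric] by (simp add: coord_vec_def)
  define m where "m = v F / 2"
  have m: "m > 0" using v by (simp add: m_def)
  have o: "open (\<psi> ` (V \<inter> W))"
    using chart_open[OF mc] p by (intro chart_open_subset_image[OF mc]) auto
  have "continuous_on (\<psi> ` (V \<inter> W)) ?d" using cd by (rule continuous_on_subset) auto
  then have "open (\<psi> ` (V \<inter> W) \<inter> ?d -` {m<..<3 * m})" using o by (intro continuous_open_preimage) auto
  moreover have "\<psi> p \<in> \<psi> ` (V \<inter> W) \<inter> ?d -` {m<..<3 * m}" using p dp m by (auto simp: m_def)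
  ultimately obtain R where R: "R > 0" "ball (\<psi> p) R \<subseteq> \<psi> ` (V \<inter> W) \<inter> ?d -` {m<..<3 * m}"
    by (meson openE)
  define r where "r = R / 2"
  have r: "r > 0" "2 * r = R" using R by (auto simp: r_def)
  have "m * t \<le> ?G (x + t *\<^sub>R b) - ?G x \<and> ?G (x + t *\<^sub>R b) - ?G x \<le> 3 * m * t"
    if t: "t \<ge> 0" and x: "x \<in> ball (\<psi> p) R" and xt: "x + t *\<^sub>R b \<in> ball (\<psi> p) R" for x t
  proof (cases "t = 0")
    case False
    have seg: "x + s *\<^sub>R b \<in> ball (\<psi> p) R" if s: "0 \<le> s" "s \<le> t" for s
    proof -
      have "x + s *\<^sub>R b = (1 - s / t) *\<^sub>R x + (s / t) *\<^sub>R (x + t *\<^sub>R b)"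
        using False by (simp add: algebra_simps)
      also have "\<dots> \<in> ball (\<psi> p) R"
        by (rule convexD[OF convex_ball x xt]) (use s t False in auto)
      finally show ?thesis .
    qed
    have "((\<lambda>s. ?G (x + s *\<^sub>R b)) has_real_derivative ?d (x + s *\<^sub>R b)) (at s)" if s: "0 \<le> s" "s \<le> t" for s
    proof -
      have inV: "x + s *\<^sub>R b \<in> \<psi> ` V" using seg[OF s] R(2) by blast
      note d = C_infinity_on_has_derivative[OF G inV]
      have "((\<lambda>s::real. x + s *\<^sub>R b) has_derivative (\<lambda>s. s *\<^sub>R b)) (at s)"
        by (auto intro!: derivative_eq_intros)
      from has_derivative_compose[OF this d]
      have "((\<lambda>s. ?G (x + s *\<^sub>R b)) has_derivative (\<lambda>u. frechet_derivative ?G (at (x + s *\<^sub>R b)) (u *\<^sub>R b))) (at s)" .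
      moreover have "(\<lambda>u. frechet_derivative ?G (at (x + s *\<^sub>R b)) (u *\<^sub>R b)) = (*) (?d (x + s *\<^sub>R b))"
        using linear_scale[OF has_derivative_linear[OF d]] by (auto simp: fun_eq_iff)
      ultimately show ?thesis by (simp add: has_field_derivative_def)
    qed
    then obtain s where s: "0 < s" "s < t" "?G (x + t *\<^sub>R b) - ?G (x + 0 *\<^sub>R b) = (t - 0) * ?d (x + s *\<^sub>R b)"
      using MVT2[of 0 t "\<lambda>s. ?G (x + s *\<^sub>R b)" "\<lambda>s. ?d (x + s *\<^sub>R b)"] t False by auto
    have "?d (x + s *\<^sub>R b) \<in> {m<..<3 * m}" using seg[of s] s R(2) by fastforce
    then show ?thesis using s t by (simp add: mult.commute mult_left_mono)
  qed simp
  then show ?thesis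
    using r m R(2) by (intro exI[of _ r] exI[of _ m] exI[of _ "3 * m"] exI[of _ b] conjI) auto
qed

end

context lorentz_manifold_cart
begin

text \<open>Integrate the divergence of \<open>Y\<close>, cut off to the slab \<open>\<bar>F\<bar> < \<epsilon>\<close>. Since \<open>Y\<close> is tangent to the level sets
  of \<open>F\<close>, the cut-off produces no further term, and the integral is \<open>0\<close>. If the divergence were positive at
  some point of \<open>S\<close>, then a neighbourhood of this point would contribute at least a fixed multiple of \<open>\<epsilon>\<close>.
  The negative part of the divergence tends to \<open>0\<close> near \<open>S\<close>, and the volume of the slab is of order \<open>\<epsilon>\<close>, so
  its contribution is smaller.\<close>

lemma Stokes_positivity_cart:
  assumes S: "compact S" and F: "smooth F" "\<And>q. q \<in> S \<Longrightarrow> F q = 0"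
    and Z: "Z \<in> VF" "\<And>q. q \<in> S \<Longrightarrow> Z q F > 0"
    and N: "open N" "S \<subseteq> N" "\<And>q. q \<in> N \<Longrightarrow> F q = 0 \<Longrightarrow> q \<in> S"
    and Y: "Y \<in> VF" "\<And>q. Y q F = 0"
    and pos: "\<And>q. q \<in> S \<Longrightarrow> dv Y q \<ge> 0" and p0: "p0 \<in> S"
  shows "dv Y p0 = 0"
proof (rule ccontr)
  assume "dv Y p0 \<noteq> 0"
  then have d0: "dv Y p0 > 0" using pos[OF p0] by simp
  let ?d = "dv Y"
  have sd: "smooth ?d" by (rule dv_smooth[OF Y(1)])
  define slab where "slab = (\<lambda>V (\<psi> :: 'a \<Rightarrow> (real,'n) vec) p r m M (b :: (real,'n) vec). r > 0 \<and> m > 0 \<and> ball (\<psi> p) (2 * r) \<subseteq> \<psi> ` (V \<inter> N) \<and>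
    (\<forall>x t. t \<ge> 0 \<longrightarrow> x \<in> ball (\<psi> p) (2 * r) \<longrightarrow> x + t *\<^sub>R b \<in> ball (\<psi> p) (2 * r) \<longrightarrow>
      m * t \<le> F (inv_into V \<psi> (x + t *\<^sub>R b)) - F (inv_into V \<psi> x) \<and>
      F (inv_into V \<psi> (x + t *\<^sub>R b)) - F (inv_into V \<psi> x) \<le> M * t))"
  have "\<forall>p\<in>S. \<exists>V \<psi> W y e r m M b. (V, \<psi>) \<in> A \<and> p \<in> W \<and> chart_frame V \<psi> W y e \<and> slab V \<psi> p r m M b"
  proof
    fix p assume p: "p \<in> S"
    obtain V \<psi> where c: "(V, \<psi>) \<in> A" "p \<in> V" using chart_covers .
    note mc = atlas_subset_maximal[OF c(1)]
    have "\<exists>r m M b. slab V \<psi> p r m M b"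
      unfolding slab_def
      by (rule local_increase[OF mc c(2) _ N(1) F(1) vf_tangent[OF Z(1)] Z(2)[OF p]]) (use N(2) p in blast)
    with c(1) chart_frame_ex[OF mc c(2)]
    show "\<exists>V \<psi> W y e r m M b. (V, \<psi>) \<in> A \<and> p \<in> W \<and> chart_frame V \<psi> W y e \<and> slab V \<psi> p r m M b"
      by (elim exE conjE) (intro exI conjI)
  qed
  then obtain V \<psi> W y e r m M b where dat:
    "\<forall>p\<in>S. (V p, \<psi> p) \<in> A \<and> p \<in> W p \<and> chart_frame (V p) (\<psi> p) (W p) (y p) (e p) \<and>
      slab (V p) (\<psi> p) p (r p) (m p) (M p) (b p)"
    unfolding bchoice_iff by (elim exE)
  have c: "(V p, \<psi> p) \<in> A" and mc: "(V p, \<psi> p) \<in> maximal_atlas A" and pW: "p \<in> W p"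
    and cf: "chart_frame (V p) (\<psi> p) (W p) (y p) (e p)"
    and sl: "slab (V p) (\<psi> p) p (r p) (m p) (M p) (b p)" if "p \<in> S" for p
    using dat that atlas_subset_maximal by blast+
  have WV: "W p \<subseteq> V p" and oW: "open (W p)" if "p \<in> S" for p
    using chart_frameD(2,3)[OF cf[OF that]] frame_onD(1) by blast+
  have rm: "r p > 0" "m p > 0" and bN: "ball (\<psi> p p) (2 * r p) \<subseteq> \<psi> p ` (V p \<inter> N)" if "p \<in> S" for p
    using sl[OF that] unfolding slab_def by blast+
  define G where "G = (\<lambda>p x. F (inv_into (V p) (\<psi> p) x))"
  have inc: "m p * t \<le> G p (x + t *\<^sub>R b p) - G p x" "G p (x + t *\<^sub>R b p) - G p x \<le> M p * t"
    if "p \<in> S" "t \<ge> 0" "x \<in> ball (\<psi> p p) (2 * r p)" "x + t *\<^sub>R b p \<in> ball (\<psi> p p) (2 * r p)" for p x t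
    using sl[OF that(1)] that unfolding slab_def G_def by blast+
  have cG: "continuous_on (ball (\<psi> p p) (2 * r p)) (G p)" if "p \<in> S" for p
    unfolding G_def
    by (rule continuous_on_subset[OF C_infinity_on_continuous_on[OF smooth_in_chart[OF F(1) mc[OF that]]]])
      (use bN[OF that] in blast)
  define U where "U = (\<lambda>p. W p \<inter> (V p \<inter> \<psi> p -` ball (\<psi> p p) (r p)))"
  have oU: "open (U p)" and pU: "p \<in> U p" if "p \<in> S" for p
    unfolding U_def using open_Int[OF oW[OF that] chart_open_preimage[OF mc[OF that] open_ball]]
      pW[OF that] WV[OF that] rm[OF that]
    by auto
  have UN: "U p \<subseteq> N" if p: "p \<in> S" for p
  proof
    fix q assume q: "q \<in> U p"
    then have qV: "q \<in> V p" and "\<psi> p q \<in> ball (\<psi> p p) (2 * r p)" using rm[OF p] by (auto simp: U_def)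
    then obtain q' where "q' \<in> V p" "q' \<in> N" "\<psi> p q = \<psi> p q'" using bN[OF p] by blast
    then show "q \<in> N" using inj_onD[OF chart_inj[OF mc[OF p]], of q q'] qV by simp
  qed
  obtain P \<eta> \<theta> N0 N' K' where P: "finite P" "P \<subseteq> S"
    and \<eta>: "\<And>p. p \<in> P \<Longrightarrow> smooth (\<eta> p)" "\<And>p q. p \<in> P \<Longrightarrow> 0 \<le> \<eta> p q"
      "\<And>p. p \<in> P \<Longrightarrow> \<exists>K. compact K \<and> K \<subseteq> U p \<and> (\<forall>q. q \<notin> K \<longrightarrow> \<eta> p q = 0)"
    and N0: "open N0" "\<And>q. q \<in> N0 \<Longrightarrow> (\<Sum>p\<in>P. \<eta> p q) = 1"
    and \<theta>: "smooth \<theta>" "\<And>q. 0 \<le> \<theta> q" "\<And>q. \<theta> q \<le> 1" "open N'" "S \<subseteq> N'" "\<And>q. q \<in> N' \<Longrightarrow> \<theta> q = 1"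
      "compact K'" "K' \<subseteq> N0" "\<And>q. q \<notin> K' \<Longrightarrow> \<theta> q = 0"
    by (rule partition_of_unity[OF S oU pU], assumption, assumption) (rule that)
  have "\<forall>p\<in>P. \<exists>K. compact K \<and> K \<subseteq> U p \<and> (\<forall>q. q \<notin> K \<longrightarrow> \<eta> p q = 0)" using \<eta>(3) by simp
  then obtain K where K: "\<forall>p\<in>P. compact (K p) \<and> K p \<subseteq> U p \<and> (\<forall>q. q \<notin> K p \<longrightarrow> \<eta> p q = 0)"
    unfolding bchoice_iff by (elim exE)
  have PS: "p \<in> S" if "p \<in> P" for p using P that by blast
  have K1: "compact (K p)" "K p \<subseteq> U p" "\<And>q. q \<notin> K p \<Longrightarrow> \<eta> p q = 0" if "p \<in> P" for p
    using K that by blast+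
  have K'N: "K' \<subseteq> N"
  proof
    fix q assume "q \<in> K'"
    then have "(\<Sum>p\<in>P. \<eta> p q) = 1" using N0(2) \<theta>(8) by blast
    then have "\<not> (\<forall>p\<in>P. \<eta> p q = 0)" by force
    then obtain p where "p \<in> P" "\<eta> p q \<noteq> 0" by blast
    then show "q \<in> N" using K1(2,3) UN PS by blast
  qed
  have cF: "continuous_on UNIV F" by (rule smooth_continuous[OF F(1)])
  \<comment> \<open>Away from \<open>S\<close>, where the cut-off \<open>\<theta>\<close> varies, \<open>F\<close> stays away from \<open>0\<close>.\<close>
  obtain \<epsilon>0 where \<epsilon>0: "\<epsilon>0 > 0" "\<And>q. q \<in> K' - N' \<Longrightarrow> \<epsilon>0 \<le> \<bar>F q\<bar>"
  proof -
    have "compact (K' - N')" using \<theta>(4,7) by (simp add: compact_diff)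
    then have "\<exists>\<epsilon>>0. \<forall>q\<in>K' - N'. \<epsilon> \<le> \<bar>F q\<bar>"
      by (rule compact_nonzero_bounded_below) (use cF continuous_on_subset N(3) K'N \<theta>(5) in blast)+
    then show ?thesis using that by blast
  qed
  define u where "u = (\<lambda>\<epsilon> q. \<theta> q * hat (F q / \<epsilon>))"
  have zero: "(\<Sum>p\<in>P. chart_integral (V p) (\<psi> p) (\<lambda>q. \<eta> p q * (u \<epsilon> q * ?d q))) = 0"
    if e: "0 < \<epsilon>" "\<epsilon> < \<epsilon>0" for \<epsilon>
  proof -
    have sF: "smooth (\<lambda>q. F q / \<epsilon>)" using smooth_mult[OF F(1) smooth_const[of "1 / \<epsilon>"]] by simp
    have sh: "smooth (\<lambda>q. hat (F q / \<epsilon>))"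
      by (rule smooth_compose[OF sF open_UNIV _ C_infinity_on_hat]) simp
    have su: "smooth (u \<epsilon>)" unfolding u_def by (rule smooth_mult[OF \<theta>(1) sh])
    have Yu: "Y q (u \<epsilon>) = 0" for q
    proof -
      have "hat differentiable (at (F q / \<epsilon>))"
        using C_infinity_on_has_derivative[OF C_infinity_on_hat, of "F q / \<epsilon>"] by (auto simp: differentiable_def)
      then obtain h' where "(hat has_real_derivative h') (at (F q / \<epsilon>))"
        unfolding real_differentiable_def by (elim exE)
      from tangent_compose[OF vf_tangent[OF Y(1)] sF sh this]
      have "Y q (\<lambda>q. hat (F q / \<epsilon>)) = h' * Y q (\<lambda>q. F q / \<epsilon>)" .
      also have "Y q (\<lambda>q. F q / \<epsilon>) = 0"
        using tangent_scale[OF vf_tangent[OF Y(1)] F(1), of q "1 / \<epsilon>"] Y(2) by simp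
      finally have Yh: "Y q (\<lambda>q. hat (F q / \<epsilon>)) = 0" by simp
      have "hat (F q / \<epsilon>) = 0 \<or> Y q \<theta> = 0"
      proof (cases "q \<in> K' - N'")
        case True
        then have "\<epsilon> \<le> \<bar>F q\<bar>" using \<epsilon>0(2)[OF True] e by simp
        then have "1 \<le> \<bar>F q / \<epsilon>\<bar>" using e by simp
        then show ?thesis using hat_eq_0 by blast
      next
        case False
        then consider "q \<in> N'" | "q \<in> - K'" by blast
        then show ?thesis
        proof cases
          case 1
          then show ?thesis using tangent_vanishing[OF vf_tangent[OF Y(1)] \<theta>(1,4) _ \<theta>(6)] by blast
        next
          case 2
          have "open (- K')" using \<theta>(7) compact_imp_closed by blast
          then show ?thesis using 2 tangent_vanishing[OF vf_tangent[OF Y(1)] \<theta>(1) _ 2, where c = 0] \<theta>(9) by blast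
        qed
      qed
      then show ?thesis
        unfolding u_def using tangent_mult[OF vf_tangent[OF Y(1)] \<theta>(1) sh, of q] Yh by auto
    qed
    have dvu: "dv (u \<epsilon> \<odot> Y) q = u \<epsilon> q * ?d q" for q
      using dv_fscale[OF Y(1) su, of q] Yu by simp
    have "(\<Sum>p\<in>P. chart_integral (V p) (\<psi> p) (\<lambda>q. \<eta> p q * dv (u \<epsilon> \<odot> Y) q)) = 0"
    proof (rule divergence_theorem[OF P(1) c cf \<eta>(1) K1(1) _ K1(3) N0 vf_fscale[OF su Y(1)] \<theta>(8)])
      show "K p \<subseteq> W p" if "p \<in> P" for p using K1(2)[OF that] by (auto simp: U_def)
      show "(u \<epsilon> \<odot> Y) q = 0" if "q \<notin> K'" for q using \<theta>(9)[OF that] by (simp add: u_def)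
    qed (use PS in auto)
    then show ?thesis by (simp only: dvu)
  qed
  define k where "k = (\<lambda>p z. if z \<in> \<psi> p ` V p then (\<eta> p (inv_into (V p) (\<psi> p) z) * \<theta> (inv_into (V p) (\<psi> p) z)) *
      dens (V p) (\<psi> p) (inv_into (V p) (\<psi> p) z) else 0)"
  have cs: "csupp (V p) (\<lambda>q. \<eta> p q * \<theta> q)" if p: "p \<in> P" for p
    unfolding csupp_def
    using smooth_continuous[OF smooth_mult[OF \<eta>(1)[OF p] \<theta>(1)]] K1[OF p]
    by (intro conjI exI[of _ "K p"]) (auto simp: U_def)
  have ck: "continuous_on UNIV (k p)" if p: "p \<in> P" for p
    unfolding k_def by (rule chart_integrand_props(2)[OF mc[OF PS[OF p]] cs[OF p]])
  have k0: "0 \<le> k p z" if p: "p \<in> P" for p z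
  proof (cases "z \<in> \<psi> p ` V p")
    case True
    then have "inv_into (V p) (\<psi> p) z \<in> V p" by (rule inv_into_into)
    then have "0 \<le> dens (V p) (\<psi> p) (inv_into (V p) (\<psi> p) z)"
      using dens_pos[OF mc[OF PS[OF p]]] less_imp_le by blast
    then show ?thesis using \<eta>(2)[OF p] \<theta>(2) by (simp add: k_def)
  qed (simp add: k_def)
  have kout: "k p z = 0" if p: "p \<in> P" and z: "z \<notin> ball (\<psi> p p) (r p)" for p z
  proof (cases "z \<in> \<psi> p ` V p")
    case True
    then obtain q where q: "q \<in> V p" "z = \<psi> p q" by blast
    then have "q \<notin> K p" using z K1(2)[OF p] by (auto simp: U_def)
    then show ?thesis using q chart_inv[OF mc[OF PS[OF p]] q(1)] K1(3)[OF p] by (simp add: k_def)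
  qed (simp add: k_def)
  have "\<forall>p\<in>P. \<exists>B. \<forall>z. k p z \<le> B"
  proof
    fix p assume p: "p \<in> P"
    obtain Q where Q: "compact Q" "\<And>z. z \<notin> Q \<Longrightarrow> k p z = 0"
      using chart_integrand_props(3)[OF mc[OF PS[OF p]] cs[OF p]] unfolding k_def by blast
    have "compact (k p ` Q)"
      using Q(1) ck[OF p] by (intro compact_continuous_image) (auto intro: continuous_on_subset)
    then obtain B where "\<And>x. x \<in> k p ` Q \<Longrightarrow> norm x \<le> B" using compact_imp_bounded bounded_iff by metis
    then have "k p z \<le> max B 0" for z using Q(2)[of z] by (cases "z \<in> Q") fastforce+
    then show "\<exists>B. \<forall>z. k p z \<le> B" by blast
  qed
  then have "\<exists>B. \<forall>p\<in>P. \<forall>z. k p z \<le> B p" by (rule bchoice)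
  then obtain B where "\<forall>p\<in>P. \<forall>z. k p z \<le> B p" by (elim exE)
  then have B: "k p z \<le> B p" if "p \<in> P" for p z using that by simp
  have B0: "B p \<ge> 0" if "p \<in> P" for p using k0[OF that] B[OF that] order_trans by blast
  have "\<forall>p\<in>P. \<exists>C\<ge>0. \<forall>\<epsilon>>0. {x \<in> ball (\<psi> p p) (r p). \<bar>G p x\<bar> < \<epsilon>} \<in> lmeasurable \<and>
      measure lebesgue {x \<in> ball (\<psi> p p) (r p). \<bar>G p x\<bar> < \<epsilon>} \<le> C * \<epsilon>"
  proof
    fix p assume p: "p \<in> P"
    obtain C where "C \<ge> 0" "\<And>\<epsilon>. \<epsilon> > 0 \<Longrightarrow> {x \<in> ball (\<psi> p p) (r p). \<bar>G p x\<bar> < \<epsilon>} \<in> lmeasurable"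
      "\<And>\<epsilon>. \<epsilon> > 0 \<Longrightarrow> measure lebesgue {x \<in> ball (\<psi> p p) (r p). \<bar>G p x\<bar> < \<epsilon>} \<le> C * \<epsilon>"
      by (rule slab_upper_bound[OF rm[OF PS[OF p]] cG[OF PS[OF p]] inc(1)[OF PS[OF p]]], assumption, assumption, assumption)
        (rule that)
    then show "\<exists>C\<ge>0. \<forall>\<epsilon>>0. {x \<in> ball (\<psi> p p) (r p). \<bar>G p x\<bar> < \<epsilon>} \<in> lmeasurable \<and>
      measure lebesgue {x \<in> ball (\<psi> p p) (r p). \<bar>G p x\<bar> < \<epsilon>} \<le> C * \<epsilon>" by (intro exI[of _ C]) simp
  qed
  then have "\<exists>C. \<forall>p\<in>P. C p \<ge> 0 \<and> (\<forall>\<epsilon>>0. {x \<in> ball (\<psi> p p) (r p). \<bar>G p x\<bar> < \<epsilon>} \<in> lmeasurable \<and>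
      measure lebesgue {x \<in> ball (\<psi> p p) (r p). \<bar>G p x\<bar> < \<epsilon>} \<le> C p * \<epsilon>)" by (rule bchoice)
  then obtain C where C': "\<forall>p\<in>P. C p \<ge> 0 \<and> (\<forall>\<epsilon>>0. {x \<in> ball (\<psi> p p) (r p). \<bar>G p x\<bar> < \<epsilon>} \<in> lmeasurable \<and>
      measure lebesgue {x \<in> ball (\<psi> p p) (r p). \<bar>G p x\<bar> < \<epsilon>} \<le> C p * \<epsilon>)" by (elim exE)
  have C: "C p \<ge> 0" if "p \<in> P" for p using C' that by simp
  have C2: "{x \<in> ball (\<psi> p p) (r p). \<bar>G p x\<bar> < \<epsilon>} \<in> lmeasurable"
    "measure lebesgue {x \<in> ball (\<psi> p p) (r p). \<bar>G p x\<bar> < \<epsilon>} \<le> C p * \<epsilon>" if "p \<in> P" "\<epsilon> > 0" for p \<epsilon>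
    using C' that by simp_all
  \<comment> \<open>The positive value of the divergence is seen in the chart of some \<open>p1\<close>, as \<open>\<eta> p1 p0 > 0\<close>.\<close>
  have p0N: "p0 \<in> N0" "\<theta> p0 = 1"
  proof -
    show 1: "\<theta> p0 = 1" using \<theta>(5,6) p0 by blast
    then show "p0 \<in> N0" using \<theta>(8) \<theta>(9)[of p0] by (cases "p0 \<in> K'") auto
  qed
  obtain p1 where p1: "p1 \<in> P" "\<eta> p1 p0 > 0"
  proof -
    have "\<not> (\<forall>p\<in>P. \<eta> p p0 = 0)" using N0(2)[OF p0N(1)] by force
    then obtain p where "p \<in> P" "\<eta> p p0 \<noteq> 0" by blast
    then show ?thesis using that[of p] \<eta>(2)[of p p0] by simp
  qed
  note p1S = PS[OF p1(1)] note mc1 = mc[OF p1S]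
  let ?u1 = "inv_into (V p1) (\<psi> p1)" and ?z0 = "\<psi> p1 p0"
  have p0U: "p0 \<in> U p1" using K1(2)[OF p1(1)] K1(3)[OF p1(1), of p0] p1(2) by (cases "p0 \<in> K p1") auto
  then have p0V: "p0 \<in> V p1" and z0: "?z0 \<in> ball (\<psi> p1 p1) (r p1)" by (auto simp: U_def)
  \<comment> \<open>The integrand in this chart, apart from the factor \<open>hat\<close>.\<close>
  define \<phi> where "\<phi> = (\<lambda>z. k p1 z * ?d (?u1 z))"
  have bV: "ball (\<psi> p1 p1) (2 * r p1) \<subseteq> \<psi> p1 ` V p1" using bN[OF p1S] by blast
  have sub: "ball (\<psi> p1 p1) (r p1) \<subseteq> ball (\<psi> p1 p1) (2 * r p1)" using rm[OF p1S] by auto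
  have cd: "continuous_on (\<psi> p1 ` V p1) (\<lambda>z. ?d (?u1 z))"
    by (rule C_infinity_on_continuous_on[OF smooth_in_chart[OF sd mc1]])
  have c\<phi>: "continuous_on (ball (\<psi> p1 p1) (r p1)) \<phi>"
    unfolding \<phi>_def using ck[OF p1(1)] cd bV sub
    by (intro continuous_on_mult) (auto intro: continuous_on_subset)
  have "?u1 ?z0 = p0" by (rule chart_inv[OF mc1 p0V])
  then have "\<phi> ?z0 > 0"
    using p1(2) p0N(2) d0 dens_pos[OF mc1 p0V] p0V by (simp add: \<phi>_def k_def)
  define a where "a = \<phi> ?z0 / 2"
  have a: "a > 0" "\<phi> ?z0 > a" using \<open>\<phi> ?z0 > 0\<close> by (auto simp: a_def)
  have "open (ball (\<psi> p1 p1) (r p1) \<inter> \<phi> -` {a<..})"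
    using c\<phi> by (rule continuous_open_preimage) auto
  moreover have "?z0 \<in> ball (\<psi> p1 p1) (r p1) \<inter> \<phi> -` {a<..}" using z0 a by auto
  ultimately obtain \<delta> where \<delta>: "\<delta> > 0" "ball ?z0 \<delta> \<subseteq> ball (\<psi> p1 p1) (r p1) \<inter> \<phi> -` {a<..}" by (rule openE)
  have Gz0: "G p1 ?z0 = 0" using chart_inv[OF mc1 p0V] F(2)[OF p0] by (simp add: G_def)
  obtain cc \<epsilon>1 where cc: "cc > 0" "\<epsilon>1 > 0"
    "\<And>\<epsilon>. 0 < \<epsilon> \<Longrightarrow> \<epsilon> < \<epsilon>1 \<Longrightarrow> cc * \<epsilon> \<le> measure lebesgue {x \<in> ball ?z0 \<delta>. \<bar>G p1 x\<bar> < \<epsilon>}"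
  proof (rule slab_lower_bound[where G = "G p1" and z = "?z0", OF \<delta>(1) rm(2)[OF p1S] _ Gz0])
    have sub2: "ball ?z0 \<delta> \<subseteq> ball (\<psi> p1 p1) (2 * r p1)" using \<delta>(2) sub by blast
    show "continuous_on (ball ?z0 \<delta>) (G p1)" using cG[OF p1S] sub2 by (rule continuous_on_subset)
    show "m p1 * t \<le> G p1 (x + t *\<^sub>R b p1) - G p1 x \<and> G p1 (x + t *\<^sub>R b p1) - G p1 x \<le> M p1 * t"
      if "0 \<le> t" "x \<in> ball ?z0 \<delta>" "x + t *\<^sub>R b p1 \<in> ball ?z0 \<delta>" for x t
      using inc[OF p1S that(1)] that sub2 by (simp add: subset_iff)
  qed (rule that)
  define h0 where "h0 = exp (- (4/3::real))"
  have h0: "h0 > 0" by (simp add: h0_def)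
  define Ct where "Ct = (\<Sum>p\<in>P. B p * C p)"
  have Ct: "Ct \<ge> 0" unfolding Ct_def using B0 C by (intro sum_nonneg) auto
  \<comment> \<open>Chosen such that a divergence of at least \<open>- \<mu>\<close> contributes to the slab no less than minus half of what the neighbourhood of \<open>p0\<close> contributes.\<close>
  define \<mu> where "\<mu> = a * h0 * cc / (4 * (Ct + 1))"
  have \<mu>: "\<mu> > 0" using a h0 cc(1) Ct by (simp add: \<mu>_def)
  obtain \<epsilon>2 where \<epsilon>2: "\<epsilon>2 > 0" "\<And>q. q \<in> K' \<Longrightarrow> \<bar>F q\<bar> < \<epsilon>2 \<Longrightarrow> ?d q \<ge> - \<mu>"
  proof -
    have "closed {q. ?d q \<le> - \<mu>}"
      using smooth_continuous[OF sd] by (intro closed_Collect_le continuous_on_const)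
    then have "compact (K' \<inter> {q. ?d q \<le> - \<mu>})" using \<theta>(7) by (rule compact_Int_closed[rotated])
    then have "\<exists>\<epsilon>>0. \<forall>q\<in>K' \<inter> {q. ?d q \<le> - \<mu>}. \<epsilon> \<le> \<bar>F q\<bar>"
    proof (rule compact_nonzero_bounded_below)
      show "continuous_on (K' \<inter> {q. ?d q \<le> - \<mu>}) F" using cF by (rule continuous_on_subset) simp
      fix q assume q: "q \<in> K' \<inter> {q. ?d q \<le> - \<mu>}"
      show "F q \<noteq> 0"
      proof
        assume "F q = 0"
        then have "q \<in> S" using N(3) K'N q by blast
        then show False using pos[of q] q \<mu> by simp
      qed
    qed
    then obtain \<epsilon> where "\<epsilon> > 0" "\<forall>q\<in>K' \<inter> {q. ?d q \<le> - \<mu>}. \<epsilon> \<le> \<bar>F q\<bar>" by blast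
    then show ?thesis by (intro that[of \<epsilon>]) (auto simp: not_le[symmetric])
  qed
  define \<epsilon> where "\<epsilon> = min (min \<epsilon>0 \<epsilon>1) \<epsilon>2 / 2"
  have e: "\<epsilon> > 0" "\<epsilon> < \<epsilon>0" "\<epsilon> / 2 < \<epsilon>1" "\<epsilon> < \<epsilon>2"
    using \<epsilon>0(1) cc(2) \<epsilon>2(1) by (auto simp: \<epsilon>_def min_def)
  define E where "E = (\<lambda>p. {x \<in> ball (\<psi> p p) (r p). \<bar>G p x\<bar> < \<epsilon>})"
  define E' where "E' = {x \<in> ball ?z0 \<delta>. \<bar>G p1 x\<bar> < \<epsilon> / 2}"
  define J where "J = (\<lambda>p z. if z \<in> \<psi> p ` V p then (\<lambda>q. \<eta> p q * (u \<epsilon> q * ?d q)) (inv_into (V p) (\<psi> p) z) *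
      dens (V p) (\<psi> p) (inv_into (V p) (\<psi> p) z) else 0)"
  have Jk: "J p z = k p z * (hat (G p z / \<epsilon>) * ?d (inv_into (V p) (\<psi> p) z))" for p z
    by (simp add: J_def k_def u_def G_def)
  have JI: "chart_integral (V p) (\<psi> p) (\<lambda>q. \<eta> p q * (u \<epsilon> q * ?d q)) = integral UNIV (J p)" for p
    by (simp only: chart_integral_def J_def)
  have Ji: "J p integrable_on UNIV" if p: "p \<in> P" for p
  proof -
    have sh: "smooth (\<lambda>q. hat (F q / \<epsilon>))"
    proof (rule smooth_compose[OF _ open_UNIV _ C_infinity_on_hat])
      show "smooth (\<lambda>q. F q / \<epsilon>)" using smooth_mult[OF F(1) smooth_const[of "1 / \<epsilon>"]] by simp
    qed simp
    have "csupp (V p) (\<lambda>q. (\<eta> p q * \<theta> q) * (hat (F q / \<epsilon>) * ?d q))"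
      by (rule csupp_mult(1)[OF cs[OF p] smooth_mult[OF sh sd]])
    then have "csupp (V p) (\<lambda>q. \<eta> p q * (u \<epsilon> q * ?d q))" by (simp add: u_def algebra_simps)
    from chart_integrand_props(1)[OF mc[OF PS[OF p]] this] show ?thesis by (simp only: J_def)
  qed
  have Jlow: "- (\<mu> * B p) * indicator (E p) z \<le> J p z" if p: "p \<in> P" for p z
  proof (cases "k p z = 0 \<or> \<epsilon> \<le> \<bar>G p z\<bar>")
    case True
    then have "J p z = 0"
    proof
      assume "\<epsilon> \<le> \<bar>G p z\<bar>"
      then have "1 \<le> \<bar>G p z / \<epsilon>\<bar>" using e(1) by simp
      then show "J p z = 0" by (simp add: Jk hat_eq_0)
    qed (simp add: Jk)
    then show ?thesis using \<mu> B0[OF p] by (auto simp: indicator_def)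
  next
    case False
    then have zb: "z \<in> ball (\<psi> p p) (r p)" using kout[OF p] by blast
    then have zE: "z \<in> E p" using False by (simp add: E_def)
    have zV: "z \<in> \<psi> p ` V p" using False by (auto simp: k_def split: if_splits)
    let ?q = "inv_into (V p) (\<psi> p) z"
    have "\<theta> ?q \<noteq> 0" using False zV by (auto simp: k_def)
    then have "?q \<in> K'" using \<theta>(9) by blast
    moreover have "\<bar>F ?q\<bar> < \<epsilon>2" using False e(4) by (simp add: G_def)
    ultimately have d: "?d ?q \<ge> - \<mu>" by (rule \<epsilon>2(2))
    have "hat (G p z / \<epsilon>) * ?d ?q \<ge> - \<mu>"
    proof -
      have "hat (G p z / \<epsilon>) * (- \<mu>) \<le> hat (G p z / \<epsilon>) * ?d ?q" by (rule mult_left_mono[OF d hat_nonneg])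
      moreover have "hat (G p z / \<epsilon>) * \<mu> \<le> 1 * \<mu>" by (rule mult_right_mono[OF hat_le_1]) (use \<mu> in simp)
      ultimately show ?thesis by simp
    qed
    then have "k p z * (- \<mu>) \<le> J p z" unfolding Jk by (rule mult_left_mono[OF _ k0[OF p]])
    moreover have "k p z * \<mu> \<le> B p * \<mu>" by (rule mult_right_mono[OF B[OF p]]) (use \<mu> in simp)
    ultimately show ?thesis using zE by (simp add: mult.commute)
  qed
  have Em: "E p \<in> lmeasurable" "measure lebesgue (E p) \<le> C p * \<epsilon>" if "p \<in> P" for p
    using C2[OF that e(1)] by (simp_all add: E_def)
  have iE: "(\<lambda>z. c * indicator Q z) integrable_on UNIV" "integral UNIV (\<lambda>z. c * indicator Q z) = c * measure lebesgue Q"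
    if "Q \<in> lmeasurable" for c and Q :: "(real,'n) vec set"
    using that integrable_on_indicator[of Q UNIV] lmeasure_integral_UNIV[OF that]
    by (auto intro: integrable_on_mult_right)
  have low: "- (\<mu> * (B p * C p) * \<epsilon>) \<le> integral UNIV (J p)" if p: "p \<in> P" for p
  proof -
    have "\<mu> * B p * measure lebesgue (E p) \<le> \<mu> * B p * (C p * \<epsilon>)"
      using \<mu> B0[OF p] Em(2)[OF p] by (intro mult_left_mono) auto
    moreover have "integral UNIV (\<lambda>z. - (\<mu> * B p) * indicator (E p) z) \<le> integral UNIV (J p)"
      by (rule integral_le[OF iE(1)[OF Em(1)[OF p]] Ji[OF p]]) (rule Jlow[OF p])
    ultimately show ?thesis unfolding iE(2)[OF Em(1)[OF p]] by (simp add: algebra_simps)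
  qed
  have E'm: "E' \<in> lmeasurable"
  proof -
    have sub2: "ball ?z0 \<delta> \<subseteq> ball (\<psi> p1 p1) (2 * r p1)" using \<delta>(2) sub by blast
    have "open (ball ?z0 \<delta> \<inter> G p1 -` {- (\<epsilon>/2)<..<\<epsilon>/2})"
      using continuous_on_subset[OF cG[OF p1S] sub2] by (rule continuous_open_preimage) auto
    moreover have "E' = ball ?z0 \<delta> \<inter> G p1 -` {- (\<epsilon>/2)<..<\<epsilon>/2}" by (auto simp: E'_def)
    moreover have "bounded E'" by (rule bounded_subset[OF bounded_ball[of ?z0 \<delta>]]) (auto simp: E'_def)
    ultimately show ?thesis by (metis lmeasurable_open)
  qed
  have high: "a * h0 * (cc * (\<epsilon> / 2)) - \<mu> * (B p1 * C p1) * \<epsilon> \<le> integral UNIV (J p1)"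
  proof -
    have Jh: "a * h0 * indicator E' z + - (\<mu> * B p1) * indicator (E p1) z \<le> J p1 z" for z
    proof (cases "z \<in> E'")
      case False
      then show ?thesis using Jlow[OF p1(1), of z] by simp
    next
      case True
      then have z: "z \<in> ball ?z0 \<delta>" "\<bar>G p1 z\<bar> < \<epsilon> / 2" by (auto simp: E'_def)
      then have "\<phi> z > a" using \<delta>(2) by blast
      moreover have "h0 \<le> hat (G p1 z / \<epsilon>)"
        unfolding h0_def by (rule hat_lower) (use z(2) e(1) in \<open>simp add: abs_divide divide_le_eq\<close>)
      ultimately have "a * h0 \<le> \<phi> z * hat (G p1 z / \<epsilon>)" using a h0 by (intro mult_mono) auto
      also have "\<dots> = J p1 z" by (simp add: Jk \<phi>_def algebra_simps)
      finally have "a * h0 \<le> J p1 z" .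
      moreover have "- (\<mu> * B p1) * indicator (E p1) z \<le> 0" using \<mu> B0[OF p1(1)] by (auto simp: indicator_def)
      ultimately show ?thesis using True by simp
    qed
    have "integral UNIV (\<lambda>z. a * h0 * indicator E' z + - (\<mu> * B p1) * indicator (E p1) z) \<le> integral UNIV (J p1)"
      by (rule integral_le[OF integrable_add[OF iE(1)[OF E'm] iE(1)[OF Em(1)[OF p1(1)]]] Ji[OF p1(1)]]) (rule Jh)
    then have "a * h0 * measure lebesgue E' + - (\<mu> * B p1) * measure lebesgue (E p1) \<le> integral UNIV (J p1)"
      by (simp only: integral_add[OF iE(1)[OF E'm] iE(1)[OF Em(1)[OF p1(1)]]] iE(2)[OF E'm] iE(2)[OF Em(1)[OF p1(1)]])
    moreover have "\<mu> * B p1 * measure lebesgue (E p1) \<le> \<mu> * B p1 * (C p1 * \<epsilon>)"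
      using \<mu> B0[OF p1(1)] Em(2)[OF p1(1)] by (intro mult_left_mono) auto
    moreover have "a * h0 * (cc * (\<epsilon> / 2)) \<le> a * h0 * measure lebesgue E'"
      using cc(3)[of "\<epsilon> / 2"] e a h0 unfolding E'_def by (intro mult_left_mono) auto
    ultimately show ?thesis by (simp add: algebra_simps)
  qed
  have "a * h0 * (cc * (\<epsilon> / 2)) - \<mu> * Ct * \<epsilon> \<le> (\<Sum>p\<in>P. integral UNIV (J p))"
  proof -
    have "(\<Sum>p\<in>P - {p1}. - (\<mu> * (B p * C p) * \<epsilon>)) \<le> (\<Sum>p\<in>P - {p1}. integral UNIV (J p))"
      using low by (intro sum_mono) auto
    moreover have "\<mu> * Ct * \<epsilon> = \<mu> * (B p1 * C p1) * \<epsilon> + (\<Sum>p\<in>P - {p1}. \<mu> * (B p * C p) * \<epsilon>)"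
      unfolding Ct_def sum_distrib_left sum_distrib_right by (rule sum.remove[OF P(1) p1(1)])
    ultimately show ?thesis
      using high by (simp add: sum.remove[OF P(1) p1(1)] sum_negf)
  qed
  also have "\<dots> = 0" using zero[OF e(1,2)] by (simp only: JI)
  finally have "a * h0 * cc / 2 * \<epsilon> \<le> \<mu> * Ct * \<epsilon>" by simp
  then have "a * h0 * cc / 2 \<le> \<mu> * Ct" using e(1) by simp
  also have "\<mu> * Ct \<le> \<mu> * (Ct + 1)" using \<mu> by simp
  also have "\<mu> * (Ct + 1) = a * h0 * cc / 4"
  proof -
    have "Ct + 1 \<noteq> 0" using Ct by simp
    then show ?thesis unfolding \<mu>_def by (metis divide_divide_eq_left nonzero_eq_divide_eq)
  qed
  finally show False using a h0 cc(1) by simp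
qed

end

section \<open>Independence of the model space\<close>

text \<open>The densities above are defined by determinants of matrices, for charts in spaces \<open>real ^ 'n\<close>. Indexing by the standard basis
  carries the charts in an arbitrary Euclidean space into such a space, and none of the geometric notions
  changes, since all of them are defined through the algebra of smooth functions.\<close>

typedef (overloaded) ('e::euclidean_space) basis_index = "Basis :: 'e set"
  using nonempty_Basis by blast

instance basis_index :: (euclidean_space) finite
proof
  have "(UNIV :: 'a basis_index set) = Abs_basis_index ` Basis"
    using Rep_basis_index Rep_basis_index_inverse by (metis UNIV_eq_I image_eqI)
  then show "finite (UNIV :: 'a basis_index set)" by (metis finite_Basis finite_imageI)
qed

text \<open>An arbitrary enumeration; it only serves to order the indices.\<close>

definition basis_number :: "'e::euclidean_space basis_index \<Rightarrow> nat" where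
  "basis_number = (SOME f. inj f)"

lemma inj_basis_number: "inj basis_number"
proof -
  have "\<exists>f :: 'a basis_index \<Rightarrow> nat. inj f"
    using finite_imp_inj_to_nat_seg[OF finite[of UNIV]] by blast
  then show ?thesis unfolding basis_number_def by (rule someI_ex)
qed

instantiation basis_index :: (euclidean_space) wellorder
begin

definition less_eq_basis_index :: "'a basis_index \<Rightarrow> 'a basis_index \<Rightarrow> bool" where
  "less_eq_basis_index i j \<longleftrightarrow> basis_number i \<le> basis_number j"

definition less_basis_index :: "'a basis_index \<Rightarrow> 'a basis_index \<Rightarrow> bool" where
  "less_basis_index i j \<longleftrightarrow> basis_number i < basis_number j"

instance
proof
  fix P :: "'a basis_index \<Rightarrow> bool" and a
  assume *: "\<And>i. (\<And>j. j < i \<Longrightarrow> P j) \<Longrightarrow> P i"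
  show "P a"
  proof (induction a rule: measure_induct_rule[of basis_number])
    case (less i)
    then show ?case using *[of i] by (simp add: less_basis_index_def)
  qed
next
  fix i j :: "'a basis_index"
  assume "i \<le> j" "j \<le> i"
  then have "basis_number i = basis_number j" by (simp add: less_eq_basis_index_def)
  then show "i = j" by (rule injD[OF inj_basis_number])
qed (auto simp: less_eq_basis_index_def less_basis_index_def)

end

definition to_cart :: "'e::euclidean_space \<Rightarrow> real ^ 'e basis_index" where
  "to_cart x = (\<chi> i. x \<bullet> Rep_basis_index i)"

definition of_cart :: "real ^ 'e basis_index \<Rightarrow> 'e::euclidean_space" where
  "of_cart v = (\<Sum>i\<in>UNIV. v $ i *\<^sub>R Rep_basis_index i)"

lemma of_cart_to_cart [simp]: "of_cart (to_cart x) = x"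
proof -
  have "bij_betw Rep_basis_index (UNIV :: 'a basis_index set) Basis"
    unfolding bij_betw_def using type_definition.Rep_range[OF type_definition_basis_index]
    by (auto intro!: injI simp: Rep_basis_index_inject)
  then have "of_cart (to_cart x) = (\<Sum>b\<in>Basis. (x \<bullet> b) *\<^sub>R b)"
    unfolding of_cart_def to_cart_def by (simp add: sum.reindex_bij_betw[where g = "\<lambda>b. (x \<bullet> b) *\<^sub>R b"])
  then show ?thesis by (simp add: euclidean_representation)
qed

lemma to_cart_of_cart [simp]: "to_cart (of_cart v) = v"
proof (rule vec_eq_iff[THEN iffD2, rule_format])
  fix j
  have "of_cart v \<bullet> Rep_basis_index j = (\<Sum>i\<in>UNIV. v $ i * (if i = j then 1 else 0))"
    unfolding of_cart_def inner_sum_left inner_scaleR_left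
    by (rule sum.cong) (simp_all add: inner_Basis[OF Rep_basis_index Rep_basis_index] Rep_basis_index_inject)
  then show "to_cart (of_cart v) $ j = v $ j" by (simp add: to_cart_def if_distrib cong: if_cong)
qed

lemma linear_to_cart: "bounded_linear to_cart"
  unfolding linear_conv_bounded_linear[symmetric]
  by (rule linearI) (simp_all add: to_cart_def vec_eq_iff inner_add_left)

lemma linear_of_cart: "bounded_linear of_cart"
  unfolding linear_conv_bounded_linear[symmetric]
  by (rule linearI) (simp_all add: of_cart_def scaleR_left_distrib sum.distrib scaleR_sum_right)

lemma open_to_cart_image: assumes "open S" shows "open (to_cart ` S)"
proof -
  have "to_cart ` S = of_cart -` S" by (auto intro: image_eqI[of _ to_cart "of_cart _"])
  moreover have "continuous_on UNIV of_cart" using linear_of_cart by (rule bounded_linear.continuous_on) (rule continuous_on_id)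
  ultimately show ?thesis using open_vimage[OF assms] by metis
qed

lemma C_infinity_on_to_cart:
  fixes f :: "'e::euclidean_space \<Rightarrow> 'b::real_normed_vector"
  assumes "open S"
  shows "C_infinity_on (to_cart ` S) (\<lambda>x. f (of_cart x)) \<longleftrightarrow> C_infinity_on S f"
proof
  assume "C_infinity_on S f"
  then show "C_infinity_on (to_cart ` S) (\<lambda>x. f (of_cart x))"
    by (rule C_infinity_on_compose[OF open_to_cart_image[OF assms] assms _ C_infinity_on_bounded_linear[OF linear_of_cart], rotated])
      auto
next
  assume "C_infinity_on (to_cart ` S) (\<lambda>x. f (of_cart x))"
  then have "C_infinity_on S (\<lambda>x. f (of_cart (to_cart x)))"
    by (rule C_infinity_on_compose[OF assms open_to_cart_image[OF assms] _ C_infinity_on_bounded_linear[OF linear_to_cart], rotated])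
      auto
  then show "C_infinity_on S f" by simp
qed

lemma inv_into_to_cart: "inv_into V (to_cart \<circ> \<psi>) = inv_into V \<psi> \<circ> of_cart"
proof
  fix x
  have "to_cart (\<psi> q) = x \<longleftrightarrow> \<psi> q = of_cart x" for q by auto
  then show "inv_into V (to_cart \<circ> \<psi>) x = (inv_into V \<psi> \<circ> of_cart) x" by (simp add: inv_into_def)
qed

definition cart_atlas :: "('a, 'e::euclidean_space) chart set \<Rightarrow> ('a, real ^ 'e basis_index) chart set" where
  "cart_atlas A = (\<lambda>(V, \<psi>). (V, to_cart \<circ> \<psi>)) ` A"

context smooth_manifold
begin

lemma smooth_atlas_cart: "smooth_atlas (cart_atlas A)"
  unfolding smooth_atlas_def
proof (intro conjI ballI)
  have "(\<Union>c\<in>cart_atlas A. fst c) = (\<Union>c\<in>A. fst c)" by (force simp: cart_atlas_def)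
  then show "(\<Union>c\<in>cart_atlas A. fst c) = UNIV" using smooth_atlas by (simp add: smooth_atlas_def)
next
  fix c assume "c \<in> cart_atlas A"
  then obtain V \<psi> where c: "(V, \<psi>) \<in> A" "c = (V, to_cart \<circ> \<psi>)" by (auto simp: cart_atlas_def)
  note mc = atlas_subset_maximal[OF c(1)]
  have "homeomorphism V (\<psi> ` V) \<psi> (inv_into V \<psi>)"
    using is_chart_maximal[OF mc] by (simp add: is_chart_def)
  moreover have "homeomorphism (\<psi> ` V) (to_cart ` \<psi> ` V) to_cart of_cart"
    by (rule homeomorphismI)
      (auto intro!: linear_continuous_on linear_to_cart linear_of_cart)
  ultimately have "homeomorphism V (to_cart ` \<psi> ` V) (to_cart \<circ> \<psi>) (inv_into V \<psi> \<circ> of_cart)"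
    by (rule homeomorphism_compose)
  then show "is_chart c"
    unfolding c(2) is_chart_def
    using chart_open[OF mc] open_to_cart_image[OF chart_open_image[OF mc]]
    by (simp add: inv_into_to_cart image_comp)
next
  fix c d assume "c \<in> cart_atlas A" "d \<in> cart_atlas A"
  then obtain V \<psi> W \<phi> where c: "(V, \<psi>) \<in> A" "c = (V, to_cart \<circ> \<psi>)" and d: "(W, \<phi>) \<in> A" "d = (W, to_cart \<circ> \<phi>)"
    by (auto simp: cart_atlas_def)
  have key: "C_infinity_on ((to_cart \<circ> \<psi>) ` (V \<inter> W)) ((to_cart \<circ> \<phi>) \<circ> inv_into V (to_cart \<circ> \<psi>))"
    if "(V, \<psi>) \<in> A" "(W, \<phi>) \<in> A" for V \<psi> W \<phi>
  proof -
    note mc = atlas_subset_maximal[OF that(1)] atlas_subset_maximal[OF that(2)]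
    have "compatible (V, \<psi>) (W, \<phi>)" using smooth_atlas that by (simp add: smooth_atlas_def)
    then have 1: "C_infinity_on (\<psi> ` (V \<inter> W)) (\<lambda>x. \<phi> (inv_into V \<psi> x))" by (simp add: compatible_def comp_def)
    have o: "open (\<psi> ` (V \<inter> W))"
      using chart_open[OF mc(1)] chart_open[OF mc(2)] by (intro chart_open_subset_image[OF mc(1)]) auto
    have "C_infinity_on (\<psi> ` (V \<inter> W)) (\<lambda>x. to_cart (\<phi> (inv_into V \<psi> x)))"
      by (rule C_infinity_on_compose[OF o open_UNIV subset_UNIV 1 C_infinity_on_bounded_linear[OF linear_to_cart]])
    then have "C_infinity_on (to_cart ` \<psi> ` (V \<inter> W)) (\<lambda>x. to_cart (\<phi> (inv_into V \<psi> (of_cart x))))"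
      using C_infinity_on_to_cart[OF o, of "\<lambda>x. to_cart (\<phi> (inv_into V \<psi> x))"] by blast
    then show ?thesis unfolding inv_into_to_cart by (simp add: comp_def image_image)
  qed
  show "compatible c d"
    unfolding c(2) d(2) compatible_def using key[OF c(1) d(1)] key[OF d(1) c(1)] by (simp add: Int_commute)
qed

lemma smooth_functions_cart: "smooth_functions (cart_atlas A) = smooth_functions A"
proof -
  have "C_infinity_on ((to_cart \<circ> \<psi>) ` V) (f \<circ> inv_into V (to_cart \<circ> \<psi>)) \<longleftrightarrow> C_infinity_on (\<psi> ` V) (f \<circ> inv_into V \<psi>)"
    if "(V, \<psi>) \<in> A" for V \<psi> and f :: "'a \<Rightarrow> real"
    unfolding inv_into_to_cart using C_infinity_on_to_cart[OF chart_open_image[OF atlas_subset_maximal[OF that]]]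
    by (simp only: comp_def image_image[symmetric, of to_cart \<psi>])
  then show ?thesis
    unfolding smooth_functions_def cart_atlas_def by (auto simp: case_prod_beta)
qed

lemma tangent_space_cart: "tangent_space (cart_atlas A) = tangent_space A"
  unfolding tangent_space_def smooth_functions_cart ..

lemma vector_fields_cart: "vector_fields (cart_atlas A) = vector_fields A"
  unfolding vector_fields_def smooth_functions_cart tangent_space_cart ..

end

context lorentz_manifold
begin

lemma lorentz_manifold_cart_atlas: "lorentz_manifold_cart (cart_atlas A) g D"
proof (intro lorentz_manifold_cart.intro lorentz_manifold.intro smooth_manifold.intro lorentz_manifold_axioms.intro)
  show "smooth_atlas (cart_atlas A)" by (rule smooth_atlas_cart)
  show "lorentzian_metric (cart_atlas A) g"
    using metric unfolding lorentzian_metric_def smooth_functions_cart tangent_space_cart vector_fields_cart .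
  show "levi_civita_connection (cart_atlas A) g D"
    using levi_civita unfolding levi_civita_connection_def affine_connection_def smooth_functions_cart vector_fields_cart .
qed

lemma divergence_cart: "divergence (cart_atlas A) g D = dv"
  unfolding divergence_def[abs_def] metric_trace_def[abs_def] cov_deriv_def[abs_def] extend_vector_def[abs_def]
    tangent_space_cart vector_fields_cart ..

theorem Stokes_positivity:
  assumes S: "compact S" and F: "smooth F" "\<And>q. q \<in> S \<Longrightarrow> F q = 0"
    and Z: "Z \<in> VF" "\<And>q. q \<in> S \<Longrightarrow> Z q F > 0"
    and N: "open N" "S \<subseteq> N" "\<And>q. q \<in> N \<Longrightarrow> F q = 0 \<Longrightarrow> q \<in> S"
    and Y: "Y \<in> VF" "\<And>q. Y q F = 0"
    and pos: "\<And>q. q \<in> S \<Longrightarrow> dv Y q \<ge> 0" and p0: "p0 \<in> S"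
  shows "dv Y p0 = 0"
  using lorentz_manifold_cart.Stokes_positivity_cart[OF lorentz_manifold_cart_atlas, of S F Z N Y p0] assms
  unfolding divergence_cart smooth_functions_cart vector_fields_cart by blast

end

section \<open>Hypersurfaces\<close>

context smooth_manifold
begin

lemma partition_on:
  assumes S: "compact S" and W': "\<forall>p\<in>S. open (W p) \<and> p \<in> W p"
  shows "\<exists>P \<eta>. finite P \<and> P \<subseteq> S \<and> (\<forall>p\<in>P. smooth (\<eta> p) \<and> (\<forall>q. 0 \<le> \<eta> p q) \<and> (\<forall>q. q \<notin> W p \<longrightarrow> \<eta> p q = 0)) \<and>
    (\<forall>q\<in>S. (\<Sum>p\<in>P. \<eta> p q) = 1)"
proof -
  have W: "\<And>p. p \<in> S \<Longrightarrow> open (W p)" "\<And>p. p \<in> S \<Longrightarrow> p \<in> W p" using W' by simp_all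
  obtain P \<eta> \<theta> N N' K' where P: "finite P" "P \<subseteq> S"
    and \<eta>: "\<And>p. p \<in> P \<Longrightarrow> smooth (\<eta> p)" "\<And>p q. p \<in> P \<Longrightarrow> 0 \<le> \<eta> p q"
      "\<And>p. p \<in> P \<Longrightarrow> \<exists>K. compact K \<and> K \<subseteq> W p \<and> (\<forall>q. q \<notin> K \<longrightarrow> \<eta> p q = 0)"
    and N: "open N" "\<And>q. q \<in> N \<Longrightarrow> (\<Sum>p\<in>P. \<eta> p q) = 1"
    and \<theta>: "smooth \<theta>" "\<And>q. 0 \<le> \<theta> q" "\<And>q. \<theta> q \<le> 1" "open N'" "S \<subseteq> N'" "\<And>q. q \<in> N' \<Longrightarrow> \<theta> q = 1"
      "compact K'" "K' \<subseteq> N" "\<And>q. q \<notin> K' \<Longrightarrow> \<theta> q = 0"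
    by (rule partition_of_unity[OF S W], assumption, assumption) (rule that)
  have "q \<in> N" if q: "q \<in> S" for q
  proof -
    have "\<theta> q = 1" using \<theta>(5,6) q by blast
    then show ?thesis using \<theta>(8) \<theta>(9)[of q] by (cases "q \<in> K'") auto
  qed
  moreover have "\<eta> p q = 0" if p: "p \<in> P" and q: "q \<notin> W p" for p q
  proof -
    obtain K where "K \<subseteq> W p" "\<forall>q. q \<notin> K \<longrightarrow> \<eta> p q = 0" using \<eta>(3)[OF p] by (elim exE conjE)
    then show ?thesis using q by blast
  qed
  ultimately show ?thesis
    using P \<eta>(1,2) N(2) by (intro exI[of _ P] exI[of _ \<eta>]) simp
qed

text \<open>Glue the local extensions with a partition of unity.\<close>

lemma extend_function:
  assumes S: "compact S" and h: "h \<in> smooth_functions_of A S"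
  shows "\<exists>h'. smooth h' \<and> (\<forall>q\<in>S. h' q = h q)"
proof -
  have "\<forall>p\<in>S. \<exists>W f. open W \<and> p \<in> W \<and> smooth f \<and> (\<forall>q\<in>S \<inter> W. h q = f q)"
    using h by (simp add: smooth_functions_of_def)
  then obtain W f where Wf: "\<forall>p\<in>S. open (W p) \<and> p \<in> W p \<and> smooth (f p) \<and> (\<forall>q\<in>S \<inter> W p. h q = f p q)"
    unfolding bchoice_iff by (elim exE)
  then have W: "\<forall>p\<in>S. open (W p) \<and> p \<in> W p" by simp
  obtain P \<eta> where P: "finite P" "P \<subseteq> S"
    and \<eta>: "\<forall>p\<in>P. smooth (\<eta> p) \<and> (\<forall>q. 0 \<le> \<eta> p q) \<and> (\<forall>q. q \<notin> W p \<longrightarrow> \<eta> p q = 0)" "\<forall>q\<in>S. (\<Sum>p\<in>P. \<eta> p q) = 1"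
    using partition_on[OF S W] by (elim exE conjE)
  let ?h = "\<lambda>q. \<Sum>p\<in>P. \<eta> p q * f p q"
  have "smooth ?h"
    using \<eta>(1) Wf P(2) by (intro smooth_sum smooth_mult) auto
  moreover have "?h q = h q" if q: "q \<in> S" for q
  proof -
    have "?h q = (\<Sum>p\<in>P. \<eta> p q * h q)"
    proof (rule sum.cong[OF refl])
      fix p assume p: "p \<in> P"
      show "\<eta> p q * f p q = \<eta> p q * h q"
      proof (cases "q \<in> W p")
        case True
        then have "h q = f p q" using Wf q p P(2) by blast
        then show ?thesis by simp
      next
        case False
        then have "\<eta> p q = 0" using \<eta>(1) p by blast
        then show ?thesis by simp
      qed
    qed
    also have "\<dots> = h q" using \<eta>(2) q by (simp add: sum_distrib_right[symmetric])
    finally show ?thesis .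
  qed
  ultimately show ?thesis by blast
qed

text \<open>In a local frame the coefficients of the field are smooth functions on \<open>S\<close>, and these extend.\<close>

lemma extend_field:
  assumes S: "compact S" and X: "X \<in> vector_fields_of A S"
  shows "\<exists>X'\<in>vector_fields A. \<forall>q\<in>S. X' q = X q"
proof -
  have "\<forall>p\<in>S. \<exists>W Y. open W \<and> p \<in> W \<and> Y \<in> vector_fields A \<and> (\<forall>q\<in>S \<inter> W. X q = Y q)"
  proof
    fix p assume p: "p \<in> S"
    obtain W y e where W: "p \<in> W" and fr: "frame_on W y e" by (rule frame_exists)
    note f = frame_onD[OF fr]
    have "\<forall>i\<in>Basis. \<exists>c. smooth c \<and> (\<forall>q\<in>S. c q = X q (y i))"
      using extend_function[OF S] X f(2) by (simp add: vector_fields_of_def)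
    then obtain c where c: "\<forall>i\<in>Basis. smooth (c i) \<and> (\<forall>q\<in>S. c i q = X q (y i))"
      unfolding bchoice_iff by (elim exE)
    let ?Y = "\<Sum>i\<in>Basis. c i \<odot> e i"
    have "?Y \<in> vector_fields A" using c f(3) by (intro vf_sum vf_fscale) auto
    moreover have "X q = ?Y q" if q: "q \<in> S \<inter> W" for q
    proof -
      have "X q \<in> tangent_space A q" using X q by (simp add: vector_fields_of_def tangent_space_of_def)
      then have "X q = (\<Sum>i\<in>Basis. X q (y i) *\<^sub>R e i q)" using f(5) q by blast
      also have "\<dots> = (\<Sum>i\<in>Basis. c i q *\<^sub>R e i q)" using c q by (intro sum.cong) auto
      finally show ?thesis by (simp add: fscale_apply)
    qed
    ultimately show "\<exists>W Y. open W \<and> p \<in> W \<and> Y \<in> vector_fields A \<and> (\<forall>q\<in>S \<inter> W. X q = Y q)"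
      using W f(1) by (intro exI[of _ W] exI[of _ ?Y] conjI ballI)
  qed
  then obtain W Y where WY: "\<forall>p\<in>S. open (W p) \<and> p \<in> W p \<and> Y p \<in> vector_fields A \<and> (\<forall>q\<in>S \<inter> W p. X q = Y p q)"
    unfolding bchoice_iff by (elim exE)
  then have W: "\<forall>p\<in>S. open (W p) \<and> p \<in> W p" by simp
  obtain P \<eta> where P: "finite P" "P \<subseteq> S"
    and \<eta>: "\<forall>p\<in>P. smooth (\<eta> p) \<and> (\<forall>q. 0 \<le> \<eta> p q) \<and> (\<forall>q. q \<notin> W p \<longrightarrow> \<eta> p q = 0)" "\<forall>q\<in>S. (\<Sum>p\<in>P. \<eta> p q) = 1"
    using partition_on[OF S W] by (elim exE conjE)
  let ?X = "\<Sum>p\<in>P. \<eta> p \<odot> Y p"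
  have "?X \<in> vector_fields A" using \<eta>(1) WY P(2) by (intro vf_sum vf_fscale) auto
  moreover have "?X q = X q" if q: "q \<in> S" for q
  proof -
    have "?X q = (\<Sum>p\<in>P. \<eta> p q *\<^sub>R Y p q)" by (simp add: fscale_apply)
    also have "\<dots> = (\<Sum>p\<in>P. \<eta> p q *\<^sub>R X q)"
    proof (rule sum.cong[OF refl])
      fix p assume p: "p \<in> P"
      show "\<eta> p q *\<^sub>R Y p q = \<eta> p q *\<^sub>R X q"
      proof (cases "q \<in> W p")
        case True
        then have "X q = Y p q" using WY q p P(2) by blast
        then show ?thesis by simp
      next
        case False
        then have "\<eta> p q = 0" using \<eta>(1) p by blast
        then show ?thesis by simp
      qed
    qed
    also have "\<dots> = (\<Sum>p\<in>P. \<eta> p q) *\<^sub>R X q" by (simp add: scaleR_sum_left)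
    also have "\<dots> = X q" using \<eta>(2) q by simp
    finally show ?thesis .
  qed
  ultimately show ?thesis by blast
qed

lemma extend_reciprocal:
  assumes S: "compact S" and u: "smooth u" "\<And>q. q \<in> S \<Longrightarrow> u q > 0"
  shows "\<exists>\<zeta>. smooth \<zeta> \<and> (\<forall>q\<in>S. \<zeta> q * u q = 1)"
proof -
  let ?W = "{q. 0 < u q}"
  have o: "open ?W" using smooth_continuous[OF u(1)] by (intro open_Collect_less continuous_on_const)
  then have W: "\<forall>p\<in>S. open ?W \<and> p \<in> ?W" using u(2) by simp
  obtain P \<eta> where P: "finite P" "P \<subseteq> S"
    and \<eta>: "\<forall>p\<in>P. smooth (\<eta> p) \<and> (\<forall>q. 0 \<le> \<eta> p q) \<and> (\<forall>q. q \<notin> ?W \<longrightarrow> \<eta> p q = 0)" "\<forall>q\<in>S. (\<Sum>p\<in>P. \<eta> p q) = (1::real)"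
    using partition_on[OF S W] by (elim exE conjE)
  define \<sigma> where "\<sigma> = (\<lambda>q. \<Sum>p\<in>P. \<eta> p q)"
  have \<sigma>: "smooth \<sigma>" "\<And>q. \<sigma> q \<ge> 0" "\<And>q. q \<notin> ?W \<Longrightarrow> \<sigma> q = 0" "\<And>q. q \<in> S \<Longrightarrow> \<sigma> q = 1"
    unfolding \<sigma>_def using \<eta> by (auto intro!: smooth_sum sum_nonneg sum.neutral)
  \<comment> \<open>Agrees with \<open>u\<close> on \<open>S\<close> and is positive everywhere.\<close>
  let ?u = "\<lambda>q. \<sigma> q * u q + (1 - \<sigma> q) * (1 - \<sigma> q)"
  have su: "smooth ?u" using \<sigma>(1) u(1) by (intro smooth_add smooth_mult smooth_diff smooth_const)
  have pos: "?u q > 0" for q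
  proof (cases "\<sigma> q = 0")
    case False
    then have "\<sigma> q * u q > 0" using \<sigma>(2,3)[of q] by (intro mult_pos_pos) auto
    then show ?thesis by (intro add_pos_nonneg) auto
  qed simp
  have "smooth (\<lambda>q. inverse (?u q))"
    by (rule smooth_compose[OF su _ _ C_infinity_on_inverse]) (use pos in \<open>auto simp: open_Collect_less\<close>)
  moreover have "inverse (?u q) * u q = 1" if "q \<in> S" for q
    using \<sigma>(4)[OF that] u(2)[OF that] by simp
  ultimately show ?thesis by blast
qed

text \<open>In the slice chart, the line in the direction of \<open>w\<close> runs within \<open>S\<close>.\<close>

lemma slice_tangent:
  assumes mc: "(V, \<psi>) \<in> maximal_atlas A" and p: "p \<in> V" "p \<in> S"
    and sl: "\<psi> ` (V \<inter> S) = \<psi> ` V \<inter> {x. b \<bullet> x = 0}" and w: "b \<bullet> w = 0"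
  shows "coord_vec V \<psi> p w \<in> tangent_space_of A S p"
proof -
  have "coord_vec V \<psi> p w f = 0" if f: "smooth f" "\<forall>q\<in>S. f q = 0" for f
  proof -
    let ?G = "\<lambda>x. f (inv_into V \<psi> x)" and ?c = "\<lambda>t :: real. \<psi> p + t *\<^sub>R w"
    note d = smooth_in_chart_has_derivative[OF f(1) mc p(1)]
    have "(?c has_derivative (\<lambda>t. t *\<^sub>R w)) (at 0)" by (auto intro!: derivative_eq_intros)
    moreover have "(?G has_derivative frechet_derivative ?G (at (\<psi> p))) (at (?c 0))" using d by simp
    ultimately have 1: "((\<lambda>t. ?G (?c t)) has_derivative (\<lambda>t. frechet_derivative ?G (at (\<psi> p)) (t *\<^sub>R w))) (at 0)"
      by (rule has_derivative_compose)
    have bp: "b \<bullet> \<psi> p = 0" using sl p by blast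
    have cc: "continuous_on UNIV ?c" by (intro continuous_intros)
    have "open (?c -` (\<psi> ` V))" using open_vimage[OF chart_open_image[OF mc] cc] .
    moreover have "0 \<in> ?c -` (\<psi> ` V)" using p by simp
    moreover have "?G (?c t) = 0" if "t \<in> ?c -` (\<psi> ` V)" for t
    proof -
      have "?c t \<in> \<psi> ` V \<inter> {x. b \<bullet> x = 0}" using that bp w by (simp add: inner_add_right)
      then have "?c t \<in> \<psi> ` (V \<inter> S)" unfolding sl .
      then obtain q where "q \<in> V" "q \<in> S" "?c t = \<psi> q" by blast
      then show ?thesis using f(2) chart_inv[OF mc] by simp
    qed
    ultimately have "((\<lambda>t. ?G (?c t)) has_derivative (\<lambda>t. 0)) (at 0)"
      by (intro has_derivative_transform_within_open[OF has_derivative_const[of 0 "at 0"], of "?c -` (\<psi> ` V)"]) simp_all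
    from has_derivative_unique[OF this 1] have "(\<lambda>t. 0) = (\<lambda>t. frechet_derivative ?G (at (\<psi> p)) (t *\<^sub>R w))" .
    from fun_cong[OF this, of 1] show ?thesis using f(1) by (simp add: coord_vec_def)
  qed
  then show ?thesis unfolding tangent_space_of_def using coord_vec_tangent[OF mc p(1)] by simp
qed

text \<open>The coordinate that vanishes on the slice, multiplied with a bump.\<close>

lemma slice_function:
  assumes mc: "(V, \<psi>) \<in> maximal_atlas A" and p: "p \<in> V" "p \<in> S"
    and sl: "\<psi> ` (V \<inter> S) = \<psi> ` V \<inter> {x. b \<bullet> x = 0}"
  shows "\<exists>f. smooth f \<and> (\<forall>q\<in>S. f q = 0) \<and> (\<forall>w. coord_vec V \<psi> p w f = b \<bullet> w)"
proof -
  obtain W y e where W: "p \<in> W" "W \<subseteq> V" and fr: "frame_on W y e" and y: "\<forall>i\<in>Basis. \<forall>q\<in>W. y i q = \<psi> q \<bullet> i"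
    using chart_frame_exists[OF mc p(1)] by (elim exE conjE)
  note fD = frame_onD[OF fr]
  obtain \<eta> N K where \<eta>: "smooth \<eta>" "\<And>q. 0 \<le> \<eta> q" "\<And>q. \<eta> q \<le> (1::real)" "open N" "p \<in> N" "N \<subseteq> K"
    "\<And>q. q \<in> N \<Longrightarrow> \<eta> q = 1" "compact K" "K \<subseteq> W" "\<And>q. q \<notin> K \<Longrightarrow> \<eta> q = 0"
    by (rule bump_exists'[OF W(1) fD(1)]) (rule that)
  let ?y = "\<lambda>q. \<Sum>i\<in>Basis. (b \<bullet> i) * y i q"
  let ?f = "\<lambda>q. \<eta> q * ?y q"
  have yb: "?y q = b \<bullet> \<psi> q" if "q \<in> W" for q
    using y that unfolding euclidean_inner[of b "\<psi> q"] by simp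
  have sf: "smooth ?f" using \<eta>(1) fD(2) by (intro smooth_mult smooth_sum smooth_const) auto
  moreover have "?f q = 0" if q: "q \<in> S" for q
  proof (cases "q \<in> W")
    case True
    then have "\<psi> q \<in> \<psi> ` (V \<inter> S)" using W(2) q by blast
    then show ?thesis unfolding sl using yb[OF True] by simp
  next
    case False
    then have "q \<notin> K" using \<eta>(9) by blast
    then show ?thesis using \<eta>(10) by simp
  qed
  moreover have "coord_vec V \<psi> p w ?f = b \<bullet> w" for w
  proof (rule coord_vec_eq[OF sf mc p(1)])
    have o: "open (\<psi> ` N)" using \<eta>(4,6,9) W(2) by (intro chart_open_subset_image[OF mc]) auto
    have "((\<lambda>x. b \<bullet> x) has_derivative (\<lambda>x. b \<bullet> x)) (at (\<psi> p))" by (auto intro!: derivative_eq_intros)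
    then show "((\<lambda>x. ?f (inv_into V \<psi> x)) has_derivative (\<lambda>x. b \<bullet> x)) (at (\<psi> p))"
    proof (rule has_derivative_transform_within_open[OF _ o])
      show "\<psi> p \<in> \<psi> ` N" using \<eta>(5) by blast
      fix x assume "x \<in> \<psi> ` N"
      then obtain q where q: "q \<in> N" "x = \<psi> q" by blast
      have "q \<in> W" using q(1) \<eta>(6,9) by blast
      moreover have "inv_into V \<psi> x = q" using chart_inv[OF mc] q(2) calculation W(2) by blast
      ultimately show "b \<bullet> x = ?f (inv_into V \<psi> x)" using yb \<eta>(7)[OF q(1)] q(2) by simp
    qed
  qed
  ultimately show ?thesis by blast
qed

lemma tangent_coord_vec:
  assumes mc: "(V, \<psi>) \<in> maximal_atlas A" and p: "p \<in> V" and v: "v \<in> tangent_space A p"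
  shows "\<exists>w. v = coord_vec V \<psi> p w"
proof -
  obtain W y e where W: "p \<in> W" and fr: "frame_on W y e" and e: "\<forall>i\<in>Basis. \<forall>q\<in>W. e i q = coord_vec V \<psi> q i"
    using chart_frame_exists[OF mc p] by (elim exE conjE)
  note lin = coord_vec_linear[OF mc p]
  have "v = (\<Sum>i\<in>Basis. v (y i) *\<^sub>R e i p)" by (rule frame_onD(5)[OF fr W v])
  also have "\<dots> = (\<Sum>i\<in>Basis. v (y i) *\<^sub>R coord_vec V \<psi> p i)" using e W by simp
  also have "\<dots> = coord_vec V \<psi> p (\<Sum>i\<in>Basis. v (y i) *\<^sub>R i)"
    by (simp only: linear_sum[OF lin] linear_scale[OF lin])
  finally show ?thesis by blast
qed

lemma hypersurface_slice:
  assumes "hypersurface A S" "p \<in> S"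
  shows "\<exists>V \<psi> b. (V, \<psi>) \<in> maximal_atlas A \<and> p \<in> V \<and> b \<noteq> 0 \<and> \<psi> ` (V \<inter> S) = \<psi> ` V \<inter> {x. b \<bullet> x = 0}"
proof -
  obtain c where c: "c \<in> maximal_atlas A"
    "case c of (U, \<phi>) \<Rightarrow> p \<in> U \<and> (\<exists>b. b \<noteq> 0 \<and> \<phi> ` (U \<inter> S) = \<phi> ` U \<inter> {x. b \<bullet> x = 0})"
    using assms unfolding hypersurface_def by blast
  then show ?thesis by (cases c) auto
qed

text \<open>The vectors annihilated by the slice coordinate are represented by directions within the slice.\<close>

lemma hypersurface_defining_function:
  assumes S: "hypersurface A S" and p: "p \<in> S"
  shows "\<exists>f v. smooth f \<and> (\<forall>q\<in>S. f q = 0) \<and> v \<in> tangent_space A p \<and> v f \<noteq> 0 \<and>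
    tangent_space_of A S p = {v \<in> tangent_space A p. v f = 0}"
proof -
  obtain V \<psi> b where c: "(V, \<psi>) \<in> maximal_atlas A" "p \<in> V" "b \<noteq> 0" "\<psi> ` (V \<inter> S) = \<psi> ` V \<inter> {x. b \<bullet> x = 0}"
    using hypersurface_slice[OF S p] by (elim exE conjE)
  obtain f where f: "smooth f" "\<forall>q\<in>S. f q = 0" "\<forall>w. coord_vec V \<psi> p w f = b \<bullet> w"
    using slice_function[OF c(1,2) p c(4)] by (elim exE conjE)
  have "v \<in> tangent_space_of A S p" if v: "v \<in> tangent_space A p" "v f = 0" for v
  proof -
    obtain w where w: "v = coord_vec V \<psi> p w" using tangent_coord_vec[OF c(1,2) v(1)] by (elim exE)
    then have "b \<bullet> w = 0" using f(3) v(2) by simp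
    then show ?thesis unfolding w by (rule slice_tangent[OF c(1,2) p c(4)])
  qed
  then have "tangent_space_of A S p = {v \<in> tangent_space A p. v f = 0}"
    using f(1,2) by (auto simp: tangent_space_of_def)
  moreover have "coord_vec V \<psi> p b f \<noteq> 0" using f(3) c(3) by simp
  ultimately show ?thesis
    using f(1,2) coord_vec_tangent[OF c(1,2), of b]
    by (intro exI[of _ f] exI[of _ "coord_vec V \<psi> p b"]) simp
qed

text \<open>In a slice chart, by Rolle's theorem: a further zero would give a critical point on the segment
  that joins it with its orthogonal projection to the hyperplane.\<close>

lemma zero_set_near_hypersurface:
  assumes S: "hypersurface A S" and p: "p \<in> S"
    and F: "smooth F" "\<And>q. q \<in> S \<Longrightarrow> F q = 0" and v: "v \<in> tangent_space A p" "v F \<noteq> 0"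
  shows "\<exists>N. open N \<and> p \<in> N \<and> (\<forall>q\<in>N. F q = 0 \<longrightarrow> q \<in> S)"
proof -
  obtain V \<psi> b where mc: "(V, \<psi>) \<in> maximal_atlas A" and c: "p \<in> V" "b \<noteq> 0" and sl: "\<psi> ` (V \<inter> S) = \<psi> ` V \<inter> {x. b \<bullet> x = 0}"
    using hypersurface_slice[OF S p] by (elim exE conjE)
  note lin = coord_vec_linear[OF mc c(1)]
  let ?G = "\<lambda>x. F (inv_into V \<psi> x)"
  define dG where "dG = (\<lambda>x. frechet_derivative ?G (at x) b)"
  have bb: "b \<bullet> b > 0" using c(2) by simp
  have "dG (\<psi> p) \<noteq> 0"
  proof
    assume "dG (\<psi> p) = 0"
    then have 0: "coord_vec V \<psi> p b F = 0" using F(1) by (simp add: coord_vec_def dG_def)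
    obtain w where w: "v = coord_vec V \<psi> p w" using tangent_coord_vec[OF mc c(1) v(1)] by (elim exE)
    define s where "s = (b \<bullet> w) / (b \<bullet> b)"
    have "b \<bullet> (w - s *\<^sub>R b) = 0" using bb by (simp add: s_def inner_diff_right)
    then have "coord_vec V \<psi> p (w - s *\<^sub>R b) F = 0"
      using slice_tangent[OF mc c(1) p sl] F by (simp add: tangent_space_of_def)
    then have "v F = 0"
      using 0 unfolding w linear_diff[OF lin] linear_scale[OF lin] by simp
    then show False using v(2) by simp
  qed
  have G: "C_infinity_on (\<psi> ` V) ?G" by (rule smooth_in_chart[OF F(1) mc])
  have cd: "continuous_on (\<psi> ` V) dG"
    unfolding dG_def by (rule C_infinity_on_continuous_on[OF C_infinity_on_frechet[OF G]])
  have "open (\<psi> ` V \<inter> dG -` (- {0}))"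
    using cd chart_open_image[OF mc] by (rule continuous_open_preimage) auto
  moreover have "\<psi> p \<in> \<psi> ` V \<inter> dG -` (- {0})" using c(1) \<open>dG (\<psi> p) \<noteq> 0\<close> by simp
  ultimately obtain r where r: "r > 0" "ball (\<psi> p) r \<subseteq> \<psi> ` V \<inter> dG -` (- {0})" by (rule openE)
  have bp: "b \<bullet> \<psi> p = 0" using sl p c(1) by blast
  define N where "N = V \<inter> \<psi> -` ball (\<psi> p) r"
  have "open N" unfolding N_def by (rule chart_open_preimage[OF mc open_ball])
  moreover have "p \<in> N" using c(1) r(1) by (simp add: N_def)
  moreover have "q \<in> S" if q: "q \<in> N" "F q = 0" for q
  proof -
    have qV: "q \<in> V" and x: "\<psi> q \<in> ball (\<psi> p) r" using q(1) by (auto simp: N_def)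
    define s where "s = (b \<bullet> \<psi> q) / (b \<bullet> b)"
    define x0 where "x0 = \<psi> q - s *\<^sub>R b"
    have x0b: "b \<bullet> x0 = 0" using bb by (simp add: s_def x0_def inner_diff_right)
    have sb: "s * (b \<bullet> b) = b \<bullet> \<psi> q" using bb by (simp add: s_def)
    have "(norm (x0 - \<psi> p))\<^sup>2 \<le> (norm (\<psi> q - \<psi> p))\<^sup>2"
    proof -
      have "\<psi> q - \<psi> p = (x0 - \<psi> p) + s *\<^sub>R b" by (simp add: x0_def)
      moreover have "(x0 - \<psi> p) \<bullet> (s *\<^sub>R b) = 0" using x0b bp by (simp add: inner_diff_right inner_diff_left inner_commute[of _ b])
      ultimately have "(norm (\<psi> q - \<psi> p))\<^sup>2 = (norm (x0 - \<psi> p))\<^sup>2 + (norm (s *\<^sub>R b))\<^sup>2"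
        by (metis norm_add_Pythagorean orthogonal_def)
      then show ?thesis by simp
    qed
    then have "norm (x0 - \<psi> p) \<le> norm (\<psi> q - \<psi> p)" by (rule power2_le_imp_le) simp
    then have x0: "x0 \<in> ball (\<psi> p) r" using x by (simp add: dist_norm norm_minus_commute)
    have seg: "x0 + t *\<^sub>R (s *\<^sub>R b) \<in> ball (\<psi> p) r" if "0 \<le> t" "t \<le> 1" for t
    proof -
      have "x0 + t *\<^sub>R (s *\<^sub>R b) = (1 - t) *\<^sub>R x0 + t *\<^sub>R \<psi> q" by (simp add: x0_def algebra_simps)
      then show ?thesis using convexD[OF convex_ball x0 x, of "1 - t" t] that by simp
    qed
    have der: "((\<lambda>t. ?G (x0 + t *\<^sub>R (s *\<^sub>R b))) has_real_derivative s * dG (x0 + t *\<^sub>R (s *\<^sub>R b))) (at t)"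
      if t: "0 \<le> t" "t \<le> 1" for t
    proof -
      let ?z = "x0 + t *\<^sub>R (s *\<^sub>R b)"
      have "?z \<in> \<psi> ` V" using seg[OF t] r(2) by blast
      then have d: "(?G has_derivative frechet_derivative ?G (at ?z)) (at ?z)"
        using C_infinity_on_has_derivative[OF G] by blast
      have "((\<lambda>t. x0 + t *\<^sub>R (s *\<^sub>R b)) has_derivative (\<lambda>h. h *\<^sub>R (s *\<^sub>R b))) (at t)"
        by (auto intro!: derivative_eq_intros)
      from has_derivative_compose[OF this d]
      have "((\<lambda>t. ?G (x0 + t *\<^sub>R (s *\<^sub>R b))) has_derivative (\<lambda>h. frechet_derivative ?G (at ?z) (h *\<^sub>R (s *\<^sub>R b)))) (at t)" .
      moreover have "frechet_derivative ?G (at ?z) (h *\<^sub>R (s *\<^sub>R b)) = s * dG ?z * h" for h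
        using linear_scale[OF has_derivative_linear[OF d]] by (simp add: dG_def)
      ultimately show ?thesis by (simp add: has_field_derivative_def)
    qed
    have "x0 \<in> \<psi> ` V \<inter> {x. b \<bullet> x = 0}" using x0 r(2) x0b by blast
    then have "x0 \<in> \<psi> ` (V \<inter> S)" unfolding sl .
    then obtain q0 where "q0 \<in> V" "q0 \<in> S" "x0 = \<psi> q0" by blast
    then have G0: "?G x0 = 0" using F(2) chart_inv[OF mc] by simp
    have G1: "?G (x0 + 1 *\<^sub>R (s *\<^sub>R b)) = 0" using chart_inv[OF mc qV] q(2) by (simp add: x0_def)
    have "\<exists>z. 0 < z \<and> z < 1 \<and> ?G (x0 + 1 *\<^sub>R (s *\<^sub>R b)) - ?G (x0 + 0 *\<^sub>R (s *\<^sub>R b)) =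
        (1 - 0) * (s * dG (x0 + z *\<^sub>R (s *\<^sub>R b)))"
      by (rule MVT2[where f = "\<lambda>t. ?G (x0 + t *\<^sub>R (s *\<^sub>R b))"]) (simp, rule der)
    then obtain z where z: "0 < z" "z < 1" "s * dG (x0 + z *\<^sub>R (s *\<^sub>R b)) = 0" using G0 G1 by auto
    have "dG (x0 + z *\<^sub>R (s *\<^sub>R b)) \<noteq> 0" using seg[of z] z r(2) by auto
    then have "s = 0" using z by simp
    then have "\<psi> q = \<psi> q0" using \<open>x0 = \<psi> q0\<close> by (simp add: x0_def)
    then have "q = q0" using inj_onD[OF chart_inj[OF mc]] qV \<open>q0 \<in> V\<close> by blast
    then show "q \<in> S" using \<open>q0 \<in> S\<close> by simp
  qed
  ultimately show ?thesis by blast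
qed

end

section \<open>Lightlike hypersurfaces and timelike vectors\<close>

context lorentz_manifold
begin

lemma g_expansion:
  assumes B: "orthonormal_basis (g p) (T p) B" and "x \<in> T p" "y \<in> T p"
  shows "g p x y = (\<Sum>e\<in>B. g p e e * (g p x e * g p y e))"
proof -
  have BT: "B \<subseteq> T p" using B by (simp add: orthonormal_basis_def)
  have "g p x y = g p (\<Sum>e\<in>B. (g p e e * g p x e) *\<^sub>R e) y"
    using orthonormal_expansion[OF B subset_refl assms(2)] by simp
  also have "\<dots> = (\<Sum>e\<in>B. g p ((g p e e * g p x e) *\<^sub>R e) y)"
    using BT assms(3) by (intro g_sum) auto
  also have "\<dots> = (\<Sum>e\<in>B. g p e e * (g p x e * g p y e))"
    using BT assms(3) by (intro sum.cong) (auto simp: g_scale g_sym[of y p])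
  finally show ?thesis .
qed

text \<open>The reversed Cauchy--Schwarz argument: a vector orthogonal to a timelike one has a time component
  smaller than the length of its spatial part.\<close>

lemma timelike_orthogonal:
  assumes u: "u \<in> T p" "g p u u < 0" and v: "v \<in> T p" "g p u v = 0"
  shows "0 \<le> g p v v" "g p v v = 0 \<Longrightarrow> v = 0"
proof -
  obtain B where B: "orthonormal_basis (g p) (T p) B" "card {e\<in>B. g p e e = -1} = 1"
    using orthonormal_basis_tangent_exists[of p] by (elim exE conjE)
  obtain e0 where e0: "{e\<in>B. g p e e = -1} = {e0}" using B(2) by (rule card_1_singletonE)
  have fB: "finite B" and BT: "B \<subseteq> T p" and eps: "\<And>e. e \<in> B \<Longrightarrow> g p e e = 1 \<or> g p e e = -1"
    using B(1) by (auto simp: orthonormal_basis_def)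
  have e0B: "e0 \<in> B" and e0e: "g p e0 e0 = -1" using e0 by blast+
  have e1: "g p e e = 1" if "e \<in> B - {e0}" for e
    using eps[of e] e0 that by blast
  let ?B = "B - {e0}"
  have split: "g p x y = (\<Sum>e\<in>?B. g p x e * g p y e) - g p x e0 * g p y e0" if "x \<in> T p" "y \<in> T p" for x y
  proof -
    have "g p x y = g p e0 e0 * (g p x e0 * g p y e0) + (\<Sum>e\<in>?B. g p e e * (g p x e * g p y e))"
      unfolding g_expansion[OF B(1) that] by (rule sum.remove[OF fB e0B])
    also have "(\<Sum>e\<in>?B. g p e e * (g p x e * g p y e)) = (\<Sum>e\<in>?B. g p x e * g p y e)"
      by (rule sum.cong[OF refl]) (simp only: e1 mult_1_left)
    finally show ?thesis using e0e by simp
  qed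
  define a b where "a = g p u" and "b = g p v"
  define a2 b2 where "a2 = (\<Sum>e\<in>?B. (a e)\<^sup>2)" and "b2 = (\<Sum>e\<in>?B. (b e)\<^sup>2)"
  have a0: "a2 < (a e0)\<^sup>2"
    using split[OF u(1) u(1)] u(2) by (simp add: a2_def a_def power2_eq_square)
  have ab: "a e0 * b e0 = (\<Sum>e\<in>?B. a e * b e)"
    using split[OF u(1) v(1)] v(2) by (simp add: a_def b_def)
  have bb: "g p v v = b2 - (b e0)\<^sup>2"
    using split[OF v(1) v(1)] by (simp add: b2_def b_def power2_eq_square)
  have CS: "(a e0)\<^sup>2 * (b e0)\<^sup>2 \<le> a2 * b2"
    using Cauchy_Schwarz_ineq_sum[of a b ?B] unfolding ab[symmetric] a2_def b2_def power_mult_distrib .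
  have b0: "b2 \<ge> 0" unfolding b2_def by (simp add: sum_nonneg)
  have "a2 \<ge> 0" unfolding a2_def by (simp add: sum_nonneg)
  then have a1: "(a e0)\<^sup>2 > 0" using a0 by linarith
  have strict: "(b e0)\<^sup>2 < b2" if "b2 > 0"
  proof -
    have "(a e0)\<^sup>2 * (b e0)\<^sup>2 < (a e0)\<^sup>2 * b2"
      by (rule le_less_trans[OF CS mult_strict_right_mono[OF a0 that]])
    then show ?thesis using a1 by (simp only: mult_less_cancel_left_pos)
  qed
  have zero: "b e = 0" if "b2 = 0" "e \<in> B" for e
  proof (cases "e = e0")
    case True
    have "(a e0)\<^sup>2 * (b e0)\<^sup>2 \<le> 0" using CS that(1) by simp
    then show ?thesis using a1 True by (simp add: mult_le_0_iff)
  next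
    case False
    then show ?thesis using that fB by (simp add: b2_def sum_nonneg_eq_0_iff)
  qed
  show "0 \<le> g p v v"
  proof (cases "b2 = 0")
    case True
    then show ?thesis using zero[OF True e0B] bb by simp
  next
    case False
    then show ?thesis using strict bb b0 by simp
  qed
  assume "g p v v = 0"
  then have "b2 = 0" using strict bb b0 by (cases "b2 = 0") auto
  then have "g p v e = 0" if "e \<in> B" for e using zero that by (simp add: b_def)
  then have "(\<Sum>e\<in>B. (g p e e * g p v e) *\<^sub>R e) = 0" by simp
  then show "v = 0" using orthonormal_expansion[OF B(1) subset_refl v(1)] by simp
qed

text \<open>Subtract the multiple of \<open>k\<close> that makes \<open>v\<close> orthogonal to the timelike vector \<open>u\<close>; this does not change
  \<open>g p v v\<close>.\<close>

lemma null_orthogonal: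
  assumes u: "u \<in> T p" "g p u u < 0" and k: "k \<in> T p" "k \<noteq> 0" "g p k k = 0"
  shows "g p k u \<noteq> 0"
    and "v \<in> T p \<Longrightarrow> g p v k = 0 \<Longrightarrow> 0 \<le> g p v v"
    and "v \<in> T p \<Longrightarrow> g p v k = 0 \<Longrightarrow> g p v v = 0 \<Longrightarrow> v = (g p v u / g p k u) *\<^sub>R k"
proof -
  show ku: "g p k u \<noteq> 0"
    using timelike_orthogonal(2)[OF u k(1)] k g_sym[OF u(1) k(1)] by auto
  assume v: "v \<in> T p" "g p v k = 0"
  let ?a = "g p v u / g p k u"
  let ?w = "v - ?a *\<^sub>R k"
  have w: "?w \<in> T p" using v(1) k(1) by simp
  have wu: "g p u ?w = 0" using v(1) k(1) u(1) ku g_sym[of u p v] g_sym[of u p k] by (simp add: g_bilinear)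
  have ww: "g p ?w ?w = g p v v"
    using v k g_sym[OF v(1) k(1)] by (simp add: g_bilinear)
  show "0 \<le> g p v v" using timelike_orthogonal(1)[OF u w wu] ww by simp
  assume "g p v v = 0"
  then have "?w = 0" using timelike_orthogonal(2)[OF u w wu] ww by simp
  then show "v = ?a *\<^sub>R k" by simp
qed

text \<open>A maximal orthonormal subset spans: otherwise normalize the part of a vector that is orthogonal to
  it. Sizes are bounded, since orthonormal sets are independent.\<close>

lemma orthonormal_basis_exists:
  assumes W: "W \<subseteq> T p" "0 \<in> W" "\<And>a b v w. v \<in> W \<Longrightarrow> w \<in> W \<Longrightarrow> a *\<^sub>R v + b *\<^sub>R w \<in> W"
    and pos: "\<And>w. w \<in> W \<Longrightarrow> w \<noteq> 0 \<Longrightarrow> g p w w > 0"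
  shows "\<exists>B. orthonormal_basis (g p) W B"
proof -
  define on where "on B \<longleftrightarrow> finite B \<and> B \<subseteq> W \<and> (\<forall>e\<in>B. g p e e = 1) \<and> (\<forall>e\<in>B. \<forall>e'\<in>B. e \<noteq> e' \<longrightarrow> g p e e' = 0)" for B
  obtain B0 where B0: "orthonormal_basis (g p) (T p) B0" using orthonormal_basis_tangent_exists[of p] by (elim exE conjE)
  have sumW: "(\<Sum>e\<in>I. c e *\<^sub>R e) \<in> W" if "finite I" "I \<subseteq> W" for I c
    using that by (induction I rule: finite_induct) (use W(2) W(3)[of _ _ _ 1] in auto)
  have coeff: "g p (\<Sum>e\<in>B. c e *\<^sub>R e) e' = c e'" if "on B" "e' \<in> B" for B c e'
  proof -
    have B: "finite B" "B \<subseteq> T p" using that W(1) by (auto simp: on_def)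
    have "g p (\<Sum>e\<in>B. c e *\<^sub>R e) e' = (\<Sum>e\<in>B. g p (c e *\<^sub>R e) e')"
      using B that(2) by (intro g_sum) auto
    also have "\<dots> = (\<Sum>e\<in>B. if e = e' then c e else 0)"
    proof (rule sum.cong[OF refl])
      fix e assume e: "e \<in> B"
      then have "g p (c e *\<^sub>R e) e' = c e * g p e e'" using B that(2) by (intro g_scale) auto
      then show "g p (c e *\<^sub>R e) e' = (if e = e' then c e else 0)" using that e by (auto simp: on_def)
    qed
    also have "\<dots> = c e'" using B(1) that(2) by simp
    finally show ?thesis .
  qed
  have bound: "card B < Suc (card B0)" if onB: "on B" for B
  proof -
    have "independent B"
    proof
      assume "dependent B"
      moreover have "finite B" using onB by (simp add: on_def)
      ultimately have "\<exists>c. (\<exists>e\<in>B. c e \<noteq> 0) \<and> (\<Sum>e\<in>B. c e *\<^sub>R e) = 0"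
        by (simp only: real_vector.dependent_finite)
      then obtain c e where c: "e \<in> B" "c e \<noteq> 0" "(\<Sum>e\<in>B. c e *\<^sub>R e) = 0" by (elim exE conjE bexE)
      then have "g p 0 e = c e" using coeff[OF onB c(1), of c] by simp
      moreover have "e \<in> T p" using c(1) onB W(1) by (auto simp: on_def)
      ultimately show False using c(2) g_0 by simp
    qed
    moreover have "B \<subseteq> span B0"
    proof
      fix v assume "v \<in> B"
      then have "v \<in> T p" using onB W(1) by (auto simp: on_def)
      then have "v = (\<Sum>e\<in>B0. (g p e e * g p v e) *\<^sub>R e)" by (rule orthonormal_expansion[OF B0 subset_refl])
      also have "\<dots> \<in> span B0" by (intro span_sum span_scale span_base)
      finally show "v \<in> span B0" .
    qed
    moreover have "finite B0" using B0 by (simp add: orthonormal_basis_def)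
    ultimately show ?thesis using real_vector.independent_span_bound[of B0 B] by simp
  qed
  have "on {}" by (simp add: on_def)
  then obtain B where B: "on B" "\<And>B'. on B' \<Longrightarrow> card B' \<le> card B"
    using ex_has_greatest_nat[of on "{}" card "Suc (card B0)"] bound by blast
  have BW: "finite B" "B \<subseteq> W" using B(1) by (auto simp: on_def)
  have "w = (\<Sum>e\<in>B. g p w e *\<^sub>R e)" if w: "w \<in> W" for w
  proof (rule ccontr)
    assume ne: "w \<noteq> (\<Sum>e\<in>B. g p w e *\<^sub>R e)"
    let ?s = "\<Sum>e\<in>B. g p w e *\<^sub>R e"
    define w' where "w' = w - ?s"
    have w': "w' \<in> W" "w' \<noteq> 0"
      using W(3)[OF w sumW[OF BW, of "g p w"], of 1 "-1"] ne by (simp_all add: w'_def)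
    have wT: "w' \<in> T p" "w \<in> T p" "?s \<in> T p" using w'(1) w sumW[OF BW, of "g p w"] W(1) by auto
    have orth: "g p w' e = 0" if "e \<in> B" for e
    proof -
      have "e \<in> T p" using that BW W(1) by blast
      then show ?thesis using coeff[OF B(1) that, of "g p w"] wT unfolding w'_def by (simp add: g_diff)
    qed
    define n where "n = (1 / sqrt (g p w' w')) *\<^sub>R w'"
    have gp: "g p w' w' > 0" by (rule pos[OF w'])
    have nW: "n \<in> W" using W(3)[OF w'(1) w'(1), of "1 / sqrt (g p w' w')" 0] by (simp add: n_def)
    then have nT: "n \<in> T p" using W(1) by blast
    have nn: "g p n n = 1" using wT(1) gp by (simp add: n_def g_bilinear)
    have ne: "g p n e = 0" "g p e n = 0" if "e \<in> B" for e
    proof -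
      have eT: "e \<in> T p" using that BW W(1) by blast
      show "g p n e = 0" using orth[OF that] wT(1) eT by (simp add: n_def g_scale)
      then show "g p e n = 0" using g_sym[OF eT nT] by simp
    qed
    have "n \<notin> B" using ne(1)[of n] nn by auto
    moreover have "on (insert n B)" using B(1) nW nn ne by (auto simp: on_def)
    ultimately show False using B(2)[of "insert n B"] BW(1) by simp
  qed
  then have "\<exists>c. w = (\<lambda>f. \<Sum>e\<in>B. c e * e f)" if "w \<in> W" for w
    using that by (intro exI[of _ "g p w"]) (auto simp: fun_eq_iff)
  then show ?thesis
    using B(1) by (intro exI[of _ B]) (simp add: orthonormal_basis_def on_def)
qed

text \<open>The null vector \<open>k\<close> is orthogonal to the degenerate direction, which is null, too; so the two are
  proportional and the tangent space lies in the orthogonal complement of \<open>k\<close>. Both have codimension one.\<close>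

lemma lightlike_tangent_space:
  assumes S: "lightlike_hypersurface A g S" and p: "p \<in> S" and u: "u \<in> T p" "g p u u < 0"
    and k: "k \<in> tangent_space_of A S p" "k \<noteq> 0" "g p k k = 0"
  shows "tangent_space_of A S p = {v \<in> T p. g p v k = 0}"
proof -
  obtain f \<nu> where f: "smooth f" "\<nu> \<in> T p" "\<nu> f \<noteq> 0" "tangent_space_of A S p = {v \<in> T p. v f = 0}"
    using hypersurface_defining_function[of S p] S p by (auto simp: lightlike_hypersurface_def)
  obtain n where n: "n \<in> tangent_space_of A S p" "n \<noteq> tzero" "\<forall>w\<in>tangent_space_of A S p. g p n w = 0"
    using S p unfolding lightlike_hypersurface_def by blast
  have kT: "k \<in> T p" and nT: "n \<in> T p" using k(1) n(1) f(4) by auto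
  have nk: "g p n k = 0" "g p n n = 0" using n k(1) by auto
  define a where "a = g p n u / g p k u"
  have na: "n = a *\<^sub>R k" unfolding a_def by (rule null_orthogonal(3)[OF u kT k(2,3) nT nk])
  then have a: "a \<noteq> 0" using n(2) by (auto simp: tvec_ops)
  have perp: "g p w k = 0" if "w \<in> tangent_space_of A S p" for w
  proof -
    have wT: "w \<in> T p" using that f(4) by simp
    have "a * g p k w = 0" using n(3) that na g_scale[OF kT wT, of a] by simp
    then show ?thesis using a g_sym[OF kT wT] by simp
  qed
  define s where "s = g p \<nu> k / \<nu> f"
  have gk: "g p v k = s * v f" if v: "v \<in> T p" for v
  proof -
    let ?w = "v - (v f / \<nu> f) *\<^sub>R \<nu>"
    have "?w \<in> tangent_space_of A S p" using v f(2,3) unfolding f(4) by simp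
    then have "g p ?w k = 0" by (rule perp)
    then show ?thesis using v f(2) kT by (simp add: g_bilinear s_def)
  qed
  have "s \<noteq> 0"
  proof
    assume "s = 0"
    then have "g p u k = 0" using gk[OF u(1)] by simp
    then show False using null_orthogonal(1)[OF u kT k(2,3)] g_sym[OF u(1) kT] by simp
  qed
  then show ?thesis unfolding f(4) using gk by auto
qed

text \<open>Local defining functions, with signs chosen such that \<open>U\<close> increases them, are glued with a partition of
  unity; since all of them vanish on \<open>S\<close>, no derivatives of the partition appear in \<open>U F\<close> there.\<close>

lemma defining_function_exists:
  assumes S: "compact S" "hypersurface A S" and U: "U \<in> VF" "\<And>p. p \<in> S \<Longrightarrow> U p \<notin> tangent_space_of A S p"
  shows "\<exists>F N. smooth F \<and> (\<forall>q\<in>S. F q = 0 \<and> U q F > 0) \<and> open N \<and> S \<subseteq> N \<and> (\<forall>q\<in>N. F q = 0 \<longrightarrow> q \<in> S)"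
proof -
  have "\<forall>p\<in>S. \<exists>f. smooth f \<and> (\<forall>q\<in>S. f q = 0) \<and> U p f > 0"
  proof
    fix p assume p: "p \<in> S"
    obtain f where f: "smooth f" "\<forall>q\<in>S. f q = 0" "tangent_space_of A S p = {v \<in> T p. v f = 0}"
      using hypersurface_defining_function[OF S(2) p] by (elim exE conjE)
    have "U p f \<noteq> 0" using U(2)[OF p] f(3) vf_tangent[OF U(1)] by auto
    then consider "U p f > 0" | "U p (\<lambda>q. - 1 * f q) > 0"
      using tangent_scale[OF vf_tangent[OF U(1)] f(1), of p "-1"] by (cases "U p f > 0") auto
    then show "\<exists>f. smooth f \<and> (\<forall>q\<in>S. f q = 0) \<and> U p f > 0"
    proof cases
      case 1
      then show ?thesis using f(1,2) by (intro exI[of _ f] conjI)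
    next
      case 2
      moreover have "smooth (\<lambda>q. - 1 * f q)" by (rule smooth_mult[OF smooth_const f(1)])
      ultimately show ?thesis using f(2) by (intro exI[of _ "\<lambda>q. - 1 * f q"] conjI) simp_all
    qed
  qed
  then obtain f where f: "\<forall>p\<in>S. smooth (f p) \<and> (\<forall>q\<in>S. f p q = 0) \<and> U p (f p) > 0"
    unfolding bchoice_iff by (elim exE)
  have sU: "smooth (\<lambda>q. U q (f p))" if "p \<in> S" for p using f that by (intro vf_smooth[OF U(1)]) simp
  have "open {q. 0 < U q (f p)}" if "p \<in> S" for p
    using smooth_continuous[OF sU[OF that]] by (intro open_Collect_less continuous_on_const)
  then have W: "\<forall>p\<in>S. open {q. 0 < U q (f p)} \<and> p \<in> {q. 0 < U q (f p)}" using f by simp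
  obtain P \<eta> where P: "finite P" "P \<subseteq> S"
    and \<eta>: "\<forall>p\<in>P. smooth (\<eta> p) \<and> (\<forall>q. 0 \<le> \<eta> p q) \<and> (\<forall>q. q \<notin> {q. 0 < U q (f p)} \<longrightarrow> \<eta> p q = 0)"
      "\<forall>q\<in>S. (\<Sum>p\<in>P. \<eta> p q) = (1::real)"
    using partition_on[OF S(1) W] by (elim exE conjE)
  define F where "F = (\<lambda>q. \<Sum>p\<in>P. \<eta> p q * f p q)"
  have sF: "smooth F" unfolding F_def using \<eta>(1) f P(2) by (intro smooth_sum smooth_mult) auto
  have F0: "F q = 0" if "q \<in> S" for q
    unfolding F_def using f P(2) that by (intro sum.neutral) auto
  have UF: "U q F > 0" if q: "q \<in> S" for q
  proof -
    have "U q F = (\<Sum>p\<in>P. U q (\<lambda>q. \<eta> p q * f p q))"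
      unfolding F_def using \<eta>(1) f P(2) by (intro tangent_sum[OF vf_tangent[OF U(1)]] smooth_mult) auto
    also have "\<dots> = (\<Sum>p\<in>P. \<eta> p q * U q (f p))"
    proof (rule sum.cong[OF refl])
      fix p assume p: "p \<in> P"
      then have "smooth (\<eta> p)" "smooth (f p)" "f p q = 0" using \<eta>(1) f P(2) q by auto
      then show "U q (\<lambda>q. \<eta> p q * f p q) = \<eta> p q * U q (f p)"
        using tangent_mult[OF vf_tangent[OF U(1)], of "\<eta> p" "f p" q] by simp
    qed
    also have "\<dots> > 0"
    proof -
      have \<eta>1: "0 \<le> \<eta> p q" "\<eta> p q \<noteq> 0 \<Longrightarrow> 0 < U q (f p)" if "p \<in> P" for p
        using \<eta>(1) that by blast+
      have nn: "0 \<le> \<eta> p q * U q (f p)" if "p \<in> P" for p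
        using \<eta>1[OF that] by (cases "\<eta> p q = 0") auto
      have "\<not> (\<forall>p\<in>P. \<eta> p q = 0)" using \<eta>(2) q by force
      then obtain p where p: "p \<in> P" "\<eta> p q \<noteq> 0" by blast
      then have "0 < \<eta> p q * U q (f p)" using \<eta>1[OF p(1)] by simp
      then show ?thesis by (rule sum_pos2[OF P(1) p(1) _ nn])
    qed
    finally show ?thesis .
  qed
  have "\<forall>p\<in>S. \<exists>N. open N \<and> p \<in> N \<and> (\<forall>q\<in>N. F q = 0 \<longrightarrow> q \<in> S)"
  proof
    fix p assume p: "p \<in> S"
    show "\<exists>N. open N \<and> p \<in> N \<and> (\<forall>q\<in>N. F q = 0 \<longrightarrow> q \<in> S)"
      by (rule zero_set_near_hypersurface[OF S(2) p sF F0 vf_tangent[OF U(1)]]) (use UF[OF p] in simp_all)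
  qed
  then obtain N where N: "\<forall>p\<in>S. open (N p) \<and> p \<in> N p \<and> (\<forall>q\<in>N p. F q = 0 \<longrightarrow> q \<in> S)"
    unfolding bchoice_iff by (elim exE)
  define N' where "N' = (\<Union>p\<in>S. N p)"
  have N': "open N'" "S \<subseteq> N'" "\<forall>q\<in>N'. F q = 0 \<longrightarrow> q \<in> S"
    unfolding N'_def using N by blast+
  have "\<forall>q\<in>S. F q = 0 \<and> U q F > 0" using F0 UF by simp
  with sF N' show ?thesis by (intro exI[of _ F] exI[of _ N'] conjI)
qed

end

section \<open>Divergence along a lightlike hypersurface transversal to a Killing field\<close>

text \<open>\<open>F\<close> is a defining function of \<open>S\<close> that increases along \<open>U\<close>. The null field \<open>k\<close> is extended to the manifold in
  such a way that it is invariant, to first order along \<open>S\<close>, under the flow of \<open>U\<close>.\<close>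

locale Killing_lightlike = lorentz_manifold A g D
  for A :: "('a::{t2_space, second_countable_topology}, 'e::euclidean_space) chart set"
    and g :: "'a metric" and D :: "'a connection" +
  fixes U k :: "'a vfield" and S :: "'a set" and F :: "'a \<Rightarrow> real" and N :: "'a set" and c :: real
  assumes killing: "killing_field A g U" and timelike_U: "timelike g U"
    and compact_S: "compact S"
    and F_smooth: "smooth F" and F_0: "\<And>q. q \<in> S \<Longrightarrow> F q = 0" and UF_pos: "\<And>q. q \<in> S \<Longrightarrow> U q F > 0"
    and N: "open N" "S \<subseteq> N" "\<And>q. q \<in> N \<Longrightarrow> F q = 0 \<Longrightarrow> q \<in> S"
    and k_vf: "k \<in> VF" and c_pos: "c > 0"
    and k_null: "\<And>q. q \<in> S \<Longrightarrow> g q (k q) (k q) = 0" and U_k: "\<And>q. q \<in> S \<Longrightarrow> g q (U q) (k q) = c"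
    and bracket_U_k: "\<And>q. q \<in> S \<Longrightarrow> lie_bracket U k q = 0"
    and tangent_S: "\<And>q. q \<in> S \<Longrightarrow> tangent_space_of A S q = {v \<in> T q. g q v (k q) = 0}"
begin

lemma U_vf: "U \<in> VF"
  using killing by (simp add: killing_field_def)

lemmas kU_tangent [simp] = vf_tangent[OF k_vf] vf_tangent[OF U_vf]

lemma k_U: "q \<in> S \<Longrightarrow> g q (k q) (U q) = c"
  using U_k g_sym[of "k q" q "U q"] by simp

lemma derivative_tangential:
  assumes "p \<in> S" "v \<in> T p" "g p v (k p) = 0" "smooth f" "\<And>q. q \<in> S \<Longrightarrow> f q = 0"
  shows "v f = 0"
proof -
  have "v \<in> tangent_space_of A S p" using assms(2,3) tangent_S[OF assms(1)] by simp
  then show ?thesis using assms(4,5) by (simp add: tangent_space_of_def)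
qed

lemma transversal_part:
  assumes "p \<in> S" "v \<in> T p"
  shows "v - (g p v (k p) / c) *\<^sub>R U p \<in> T p" "g p (v - (g p v (k p) / c) *\<^sub>R U p) (k p) = 0"
  using assms U_k[OF assms(1)] c_pos by (simp_all add: g_bilinear)

text \<open>A multiple of \<open>U\<close> makes \<open>v\<close> tangent to \<open>S\<close>.\<close>

lemma derivative_normal:
  assumes p: "p \<in> S" and v: "v \<in> T p" and f: "smooth f" "\<And>q. q \<in> S \<Longrightarrow> f q = 0"
  shows "v f = g p v (k p) / c * U p f"
  using derivative_tangential[OF p transversal_part[OF p v] f] by simp

lemma bracket_self: "lie_bracket X X = 0"
  by (intro ext) (simp add: lie_bracket_apply)

lemma U_along:
  assumes "p \<in> S" "X \<in> VF"
  shows "U p (\<lambda>q. g q (X q) (k q)) = g p (lie_bracket U X p) (k p)"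
  using Killing_derivative[OF killing assms(2) k_vf, of p] bracket_U_k[OF assms(1)] assms
  by (simp add: g_bilinear)

text \<open>The divergence of \<open>X\<close> on \<open>S\<close> with respect to the volume form that contraction of the ambient one
  with \<open>U\<close> induces.\<close>

definition divS :: "'a vfield \<Rightarrow> 'a \<Rightarrow> real" where
  "divS X p = dv X p - U p (\<lambda>q. g q (X q) (k q)) / c"

text \<open>Subtracting a multiple of \<open>U\<close>, which is free of divergence, turns a field tangent to \<open>S\<close> into one that
  is tangent to all level sets of \<open>F\<close>.\<close>

lemma divS_nonneg_imp_zero:
  assumes X: "X \<in> VF" and tang: "\<And>q. q \<in> S \<Longrightarrow> g q (X q) (k q) = 0"
    and pos: "\<And>q. q \<in> S \<Longrightarrow> divS X q \<ge> 0" and p: "p \<in> S"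
  shows "divS X p = 0"
proof -
  let ?Y = "(\<lambda>q. U q F) \<odot> X - (\<lambda>q. X q F) \<odot> U"
  have sm: "smooth (\<lambda>q. U q F)" "smooth (\<lambda>q. X q F)"
    using vf_smooth[OF U_vf F_smooth] vf_smooth[OF X F_smooth] .
  have Y: "?Y \<in> VF" by (intro vf_diff vf_fscale sm X U_vf)
  have YF: "?Y q F = 0" for q by (simp add: fscale_apply)
  have dY: "dv ?Y q = U q F * divS X q" if q: "q \<in> S" for q
  proof -
    have "dv ?Y q = U q F * dv X q + X q (\<lambda>q. U q F) - (X q F * dv U q + U q (\<lambda>q. X q F))"
      using dv_diff[OF vf_fscale[OF sm(1) X] vf_fscale[OF sm(2) U_vf]] dv_fscale[OF X sm(1)] dv_fscale[OF U_vf sm(2)]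
      by simp
    also have "\<dots> = U q F * dv X q - lie_bracket U X q F"
      using Killing_dv[OF killing] by (simp add: lie_bracket_apply)
    also have "lie_bracket U X q F = g q (lie_bracket U X q) (k q) / c * U q F"
      using derivative_normal[OF q vf_tangent[OF lie_bracket_vf[OF U_vf X]] F_smooth F_0] .
    finally have e: "dv ?Y q = U q F * dv X q - g q (lie_bracket U X q) (k q) / c * U q F" .
    show ?thesis unfolding e divS_def U_along[OF q X] by (simp add: right_diff_distrib)
  qed
  have "dv ?Y p = 0"
  proof (rule Stokes_positivity[where F = F and Z = U and N = N and S = S])
    show "dv ?Y q \<ge> 0" if "q \<in> S" for q
      unfolding dY[OF that] using UF_pos[OF that] pos[OF that] by simp
  qed (fact compact_S F_smooth F_0 U_vf UF_pos N Y YF p)+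
  then show ?thesis unfolding dY[OF p] using UF_pos[OF p] by simp
qed

lemma divS_add:
  assumes "X \<in> VF" "Y \<in> VF"
  shows "divS (X + Y) p = divS X p + divS Y p"
proof -
  have "(\<lambda>q. g q ((X + Y) q) (k q)) = (\<lambda>q. g q (X q) (k q) + g q (Y q) (k q))"
    using assms by (simp add: g_add)
  then show ?thesis
    unfolding divS_def dv_add[OF assms]
    by (simp add: tangent_add[OF vf_tangent[OF U_vf]] g_smooth assms k_vf add_divide_distrib)
qed

lemma divS_fscale_k:
  assumes p: "p \<in> S" and f: "smooth f"
  shows "divS (f \<odot> k) p = f p * dv k p + k p f"
proof -
  have "U p (\<lambda>q. g q (k q) (k q)) = 0"
    using U_along[OF p k_vf] bracket_U_k[OF p] by (simp add: g_bilinear)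
  moreover have "(\<lambda>q. g q ((f \<odot> k) q) (k q)) = (\<lambda>q. f q * g q (k q) (k q))"
    by (simp add: fscale_apply g_scale)
  ultimately have "U p (\<lambda>q. g q ((f \<odot> k) q) (k q)) = 0"
    using tangent_mult[OF vf_tangent[OF U_vf] f g_smooth[OF k_vf k_vf], of p] k_null[OF p] by simp
  then show ?thesis unfolding divS_def dv_fscale[OF k_vf f] by simp
qed


section \<open>Geometry of the null field along the hypersurface\<close>

text \<open>The function is constant along \<open>S\<close>, and along \<open>U\<close> because \<open>U\<close> preserves the metric and \<open>k\<close>. This second-order
  vanishing of \<open>g(k,k)\<close> is the reason for choosing the extension of \<open>k\<close> invariant.\<close>

lemma derivative_k_k:
  assumes p: "p \<in> S" and v: "v \<in> T p"
  shows "v (\<lambda>q. g q (k q) (k q)) = 0"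
proof -
  have "U p (\<lambda>q. g q (k q) (k q)) = 0"
    using U_along[OF p k_vf] bracket_U_k[OF p] by (simp add: g_bilinear)
  then show ?thesis using derivative_normal[OF p v g_smooth[OF k_vf k_vf] k_null] by simp
qed

lemma cov_k_k:
  assumes p: "p \<in> S" and v: "v \<in> T p"
  shows "g p (cov p v k) (k p) = 0"
  using derivative_k_k[OF p v] cov_metric[OF v k_vf k_vf] g_sym[of "k p" p "cov p v k"] v k_vf by simp

lemma derivative_U_k:
  assumes p: "p \<in> S" and v: "v \<in> T p"
  shows "v (\<lambda>q. g q (U q) (k q)) = 0"
proof -
  let ?f = "\<lambda>q. g q (U q) (k q) - c"
  have s: "smooth (\<lambda>q. g q (U q) (k q))" by (rule g_smooth[OF U_vf k_vf])
  have sf: "smooth ?f" by (rule smooth_diff[OF s smooth_const])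
  have eq: "w ?f = w (\<lambda>q. g q (U q) (k q))" if "w \<in> T p" for w
    using tangent_diff[OF that s smooth_const, of c] tangent_const[OF that] by simp
  have "U p (\<lambda>q. g q (U q) (k q)) = 0"
    using U_along[OF p U_vf] by (simp add: bracket_self g_bilinear)
  then show ?thesis using derivative_normal[OF p v sf] U_k eq[OF v] eq[OF vf_tangent[OF U_vf]] by simp
qed

lemma cov_U_k: assumes p: "p \<in> S" shows "cov p (U p) k = cov p (k p) U"
  using torsion_free[OF U_vf k_vf, THEN fun_cong, of p] bracket_U_k[OF p] cov_eq[OF U_vf k_vf] cov_eq[OF k_vf U_vf]
  by simp

text \<open>On \<open>S\<close> the one-form dual to \<open>k\<close> is a multiple of \<open>dF\<close>, and this makes it closed on the tangent spaces of
  \<open>S\<close>; in the direction of \<open>U\<close> the invariance under the Killing flow does.\<close>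

lemma cov_k_symmetric_tangential:
  assumes p: "p \<in> S" and v: "v \<in> T p" "g p v (k p) = 0" and w: "w \<in> T p" "g p w (k p) = 0"
  shows "g p (cov p v k) w = g p (cov p w k) v"
proof -
  have "\<exists>\<zeta>. smooth \<zeta> \<and> (\<forall>q\<in>S. \<zeta> q * U q F = 1)"
    by (rule extend_reciprocal[OF compact_S vf_smooth[OF U_vf F_smooth] UF_pos])
  then obtain \<zeta> where \<zeta>: "smooth \<zeta>" "\<forall>q\<in>S. \<zeta> q * U q F = 1" by (elim exE conjE)
  define \<theta> where "\<theta> = (\<lambda>Y q. g q (Y q) (k q) - c * (\<zeta> q * Y q F))"
  have s\<theta>: "smooth (\<lambda>q. g q (Y q) (k q))" "smooth (\<lambda>q. \<zeta> q * Y q F)" "smooth (\<lambda>q. c * (\<zeta> q * Y q F))" if "Y \<in> VF" for Y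
  proof -
    show "smooth (\<lambda>q. g q (Y q) (k q))" by (rule g_smooth[OF that k_vf])
    show "smooth (\<lambda>q. \<zeta> q * Y q F)" by (rule smooth_mult[OF \<zeta>(1) vf_smooth[OF that F_smooth]])
    then show "smooth (\<lambda>q. c * (\<zeta> q * Y q F))" by (rule smooth_mult[OF smooth_const])
  qed
  have \<theta>0: "\<theta> Y q = 0" if "Y \<in> VF" "q \<in> S" for Y q
  proof -
    have "Y q F = g q (Y q) (k q) / c * U q F"
      by (rule derivative_normal[OF that(2) vf_tangent[OF that(1)] F_smooth F_0])
    then have "c * (\<zeta> q * Y q F) = g q (Y q) (k q) * (\<zeta> q * U q F)" using c_pos by simp
    then show ?thesis using \<zeta>(2) that(2) by (simp add: \<theta>_def)
  qed
  have wF: "w F = 0" if "w \<in> T p" "g p w (k p) = 0" for w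
    by (rule derivative_tangential[OF p that F_smooth F_0])
  have key: "g p (cov p (X p) k) (Y p) = c * (\<zeta> p * X p (\<lambda>q. Y q F)) - g p (k p) (D X Y p)"
    if X: "X \<in> VF" "g p (X p) (k p) = 0" and Y: "Y \<in> VF" "g p (Y p) (k p) = 0" for X Y
  proof -
    note Xp = vf_tangent[OF X(1), of p]
    have "smooth (\<theta> Y)" unfolding \<theta>_def by (rule smooth_diff[OF s\<theta>(1,3)[OF Y(1)]])
    then have "X p (\<theta> Y) = 0" by (rule derivative_tangential[OF p Xp X(2)]) (rule \<theta>0[OF Y(1)])
    moreover have "X p (\<theta> Y) = X p (\<lambda>q. g q (Y q) (k q)) - c * X p (\<lambda>q. \<zeta> q * Y q F)"
      unfolding \<theta>_def using tangent_diff[OF Xp s\<theta>(1,3)[OF Y(1)]] tangent_scale[OF Xp s\<theta>(2)[OF Y(1)]] by simp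
    moreover have "X p (\<lambda>q. \<zeta> q * Y q F) = \<zeta> p * X p (\<lambda>q. Y q F)"
      using tangent_mult[OF Xp \<zeta>(1) vf_smooth[OF Y(1) F_smooth]] wF[OF vf_tangent[OF Y(1)] Y(2)] by simp
    moreover have "X p (\<lambda>q. g q (Y q) (k q)) = g p (k p) (D X Y p) + g p (cov p (X p) k) (Y p)"
      using cov_metric[OF Xp Y(1) k_vf] cov_eq[OF X(1) Y(1)] g_sym[of "k p" p "D X Y p"]
        g_sym[of "Y p" p "cov p (X p) k"] X Y k_vf by simp
    ultimately show ?thesis by simp
  qed
  let ?X = "extend_vector A p v" and ?Y = "extend_vector A p w"
  note x = extend_vector[OF v(1)] and y = extend_vector[OF w(1)]
  have br: "lie_bracket ?X ?Y \<in> VF" using x y by simp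
  have b1: "lie_bracket ?X ?Y p F = ?X p (\<lambda>q. ?Y q F) - ?Y p (\<lambda>q. ?X q F)" by (rule lie_bracket_apply)
  have b2: "g p (k p) (lie_bracket ?X ?Y p) = g p (k p) (D ?X ?Y p) - g p (k p) (D ?Y ?X p)"
    using x(1) y(1) by (simp add: torsion_free g_right)
  have "g p (k p) (lie_bracket ?X ?Y p) = c * (\<zeta> p * lie_bracket ?X ?Y p F)"
    using \<theta>0[OF br p] g_sym[OF vf_tangent[OF br] vf_tangent[OF k_vf]] by (simp add: \<theta>_def)
  then show ?thesis
    using key[of ?X ?Y] key[of ?Y ?X] x y v w b1 b2 by (simp add: algebra_simps)
qed

lemma cov_k_symmetric_U:
  assumes p: "p \<in> S" and v: "v \<in> T p"
  shows "g p (cov p v k) (U p) = g p v (cov p (U p) k)"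
proof -
  have "0 = g p (cov p v U) (k p) + g p (U p) (cov p v k)"
    using derivative_U_k[OF p v] cov_metric[OF v U_vf k_vf] by simp
  also have "g p (cov p v U) (k p) = - g p v (cov p (U p) k)"
    using Killing_skew[OF killing v vf_tangent[OF k_vf]] cov_U_k[OF p] by simp
  finally show ?thesis using g_sym[of "U p" p "cov p v k"] v k_vf by simp
qed

lemma cov_k_symmetric:
  assumes p: "p \<in> S" and v: "v \<in> T p" and w: "w \<in> T p"
  shows "g p (cov p v k) w = g p v (cov p w k)"
proof -
  define a b where "a = g p v (k p) / c" and "b = g p w (k p) / c"
  define v' w' where "v' = v - a *\<^sub>R U p" and "w' = w - b *\<^sub>R U p"
  have v': "v' \<in> T p" "g p v' (k p) = 0" and w': "w' \<in> T p" "g p w' (k p) = 0"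
    unfolding v'_def w'_def a_def b_def by (rule transversal_part[OF p v] transversal_part[OF p w])+
  have eq: "v = v' + a *\<^sub>R U p" "w = w' + b *\<^sub>R U p" by (simp_all add: v'_def w'_def)
  note sv = cov_k_symmetric_U[OF p v'(1)] and sw = cov_k_symmetric_U[OF p w'(1)]
  have "g p (cov p v' k) w' = g p v' (cov p w' k)"
    using cov_k_symmetric_tangential[OF p v' w'] g_sym[of v' p "cov p w' k"] v' w' k_vf by simp
  moreover have "g p (cov p (U p) k) w' = g p (U p) (cov p w' k)"
    using sw g_sym[of w' p "cov p (U p) k"] g_sym[of "U p" p "cov p w' k"] w' k_vf by simp
  moreover have "g p (cov p (U p) k) (U p) = g p (U p) (cov p (U p) k)"
    using k_vf by (intro g_sym) simp_all
  ultimately show ?thesis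
    unfolding eq using v' w' k_vf sv
    by (simp add: cov_add cov_scale g_add g_scale g_right)
qed

text \<open>By symmetry, \<open>g(\<nabla>\<^sub>k k, w) = g(k, \<nabla>\<^sub>w k)\<close>.\<close>

lemma cov_k_geodesic: assumes p: "p \<in> S" shows "cov p (k p) k = 0"
proof (rule nondegenerate)
  show "g p (cov p (k p) k) w = 0" if w: "w \<in> T p" for w
    using cov_k_symmetric[OF p _ w, of "k p"] cov_k_k[OF p w] g_sym[of "k p" p "cov p w k"] w k_vf by simp
qed (simp add: k_vf)

definition screen_at :: "'a \<Rightarrow> 'a tvec set" where
  "screen_at p = {v \<in> T p. g p v (k p) = 0 \<and> g p v (U p) = 0}"

lemma screen_basis:
  assumes B: "orthonormal_basis (g p) (screen_at p) B" and e: "e \<in> B"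
  shows "e \<in> T p" "g p e (k p) = 0" "g p e (U p) = 0" "g p e e = 1"
proof -
  have e': "e \<in> screen_at p" using B e by (auto simp: orthonormal_basis_def)
  then show *: "e \<in> T p" "g p e (k p) = 0" "g p e (U p) = 0" by (simp_all add: screen_at_def)
  have "0 \<le> g p e e"
    using timelike_orthogonal(1)[OF vf_tangent[OF U_vf] _ *(1)] timelike_U *(3) g_sym[OF *(1) vf_tangent[OF U_vf]]
    by (simp add: timelike_def)
  then show "g p e e = 1" using B e by (auto simp: orthonormal_basis_def)
qed

lemma screen_basis_exists: "\<exists>B. orthonormal_basis (g p) (screen_at p) B"
proof (rule orthonormal_basis_exists)
  show "0 < g p w w" if "w \<in> screen_at p" "w \<noteq> 0" for w
  proof -
    have w: "w \<in> T p" "g p (U p) w = 0" using that g_sym[of w p "U p"] by (auto simp: screen_at_def)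
    have U: "g p (U p) (U p) < 0" using timelike_U by (simp add: timelike_def)
    show ?thesis using timelike_orthogonal[OF vf_tangent[OF U_vf] U w] that(2) by fastforce
  qed
qed (auto simp: screen_at_def g_bilinear)

text \<open>Subtracting suitable multiples of \<open>k\<close> and \<open>U\<close> from \<open>v\<close> leaves a vector of the screen.\<close>

lemma screen_expansion:
  assumes p: "p \<in> S" and B: "orthonormal_basis (g p) (screen_at p) B" and v: "v \<in> T p"
  defines "b \<equiv> g p v (k p) / c"
  defines "a \<equiv> (g p v (U p) - b * g p (U p) (U p)) / c"
  shows "v = (\<Sum>e\<in>B. g p v e *\<^sub>R e) + a *\<^sub>R k p + b *\<^sub>R U p"
proof -
  let ?w = "v - a *\<^sub>R k p - b *\<^sub>R U p"
  have w: "?w \<in> T p" using v by simp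
  have "?w \<in> screen_at p"
    unfolding screen_at_def using w v c_pos k_null[OF p] U_k[OF p] k_U[OF p]
    by (simp add: g_bilinear a_def b_def)
  then have "?w = (\<Sum>e\<in>B. (g p e e * g p ?w e) *\<^sub>R e)"
    by (rule orthonormal_expansion[OF B, rotated]) (auto simp: screen_at_def)
  also have "\<dots> = (\<Sum>e\<in>B. g p v e *\<^sub>R e)"
  proof (rule sum.cong[OF refl])
    fix e assume e: "e \<in> B"
    note eb = screen_basis[OF B e]
    have "g p (k p) e = 0" "g p (U p) e = 0"
      using eb g_sym[OF eb(1) vf_tangent[OF k_vf]] g_sym[OF eb(1) vf_tangent[OF U_vf]] by simp_all
    then have "g p ?w e = g p v e" using v eb(1) by (simp add: g_bilinear)
    then show "(g p e e * g p ?w e) *\<^sub>R e = g p v e *\<^sub>R e" using eb(4) by simp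
  qed
  finally show ?thesis by (simp add: algebra_simps)
qed

lemma screen_trace:
  assumes p: "p \<in> S" and B: "orthonormal_basis (g p) (screen_at p) B"
    and L: "lin_on p L" "\<And>v. v \<in> T p \<Longrightarrow> L v \<in> T p" and Lk: "L (k p) = 0"
  shows "tr p L = (\<Sum>e\<in>B. g p (L e) e) + g p (L (U p)) (k p) / c"
proof -
  have fB: "finite B" using B by (simp add: orthonormal_basis_def)
  define b where "b = (\<lambda>v. g p v (k p) / c)"
  define a where "a = (\<lambda>v. (g p v (U p) - b v * g p (U p) (U p)) / c)"
  define \<beta> where "\<beta> = (\<lambda>e v. if e = k p then a v else if e = U p then b v else g p v e)"
  have kU: "k p \<noteq> U p" using k_null[OF p] U_k[OF p] c_pos by auto
  have kB: "k p \<notin> B" using screen_basis(4)[OF B, of "k p"] k_null[OF p] by auto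
  have UB: "U p \<notin> B" using screen_basis(2)[OF B, of "U p"] U_k[OF p] c_pos by auto
  have \<beta>B: "\<beta> e = (\<lambda>v. g p v e)" if "e \<in> B" for e using that kB UB by (auto simp: \<beta>_def)
  have \<beta>k: "\<beta> (k p) = a" "\<beta> (U p) = b" using kU by (auto simp: \<beta>_def)
  let ?I = "insert (k p) (insert (U p) B)"
  have res: "resolution p ?I (\<lambda>e. e) \<beta>"
    unfolding resolution_def
  proof (intro conjI ballI)
    show "finite ?I" using fB by simp
    show "i \<in> T p" if "i \<in> ?I" for i using that screen_basis(1)[OF B] by auto
    have lg: "lin_on p (\<lambda>v. g p v x)" if "x \<in> T p" for x
      using that by (intro lin_onI) (simp add: g_lin)
    have lb: "lin_on p b"
      by (rule lin_onI) (simp add: b_def g_lin add_divide_distrib)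
    have la: "lin_on p a"
    proof (rule lin_onI)
      fix x y r s assume xy: "x \<in> T p" "y \<in> T p"
      have "b (r *\<^sub>R x + s *\<^sub>R y) = r * b x + s * b y" using lb xy by (simp add: lin_on_def)
      then show "a (r *\<^sub>R x + s *\<^sub>R y) = r *\<^sub>R a x + s *\<^sub>R a y"
        unfolding a_def using xy c_pos by (simp add: g_lin field_simps)
    qed
    show "lin_on p (\<beta> i)" if i: "i \<in> ?I" for i
    proof -
      consider "i = k p" | "i = U p" | "i \<in> B" using i by blast
      then show ?thesis
        by cases (simp_all add: \<beta>k \<beta>B la lb lg screen_basis(1)[OF B])
    qed
    show "v = (\<Sum>i\<in>?I. \<beta> i v *\<^sub>R i)" if v: "v \<in> T p" for v
    proof -
      have "(\<Sum>i\<in>?I. \<beta> i v *\<^sub>R i) = a v *\<^sub>R k p + (b v *\<^sub>R U p + (\<Sum>i\<in>B. \<beta> i v *\<^sub>R i))"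
        using fB kB UB kU by (simp add: \<beta>k)
      also have "(\<Sum>i\<in>B. \<beta> i v *\<^sub>R i) = (\<Sum>e\<in>B. g p v e *\<^sub>R e)"
        by (rule sum.cong[OF refl]) (simp add: \<beta>B)
      also have "a v *\<^sub>R k p + (b v *\<^sub>R U p + (\<Sum>e\<in>B. g p v e *\<^sub>R e)) =
          (\<Sum>e\<in>B. g p v e *\<^sub>R e) + a v *\<^sub>R k p + b v *\<^sub>R U p"
        by (simp only: add_ac)
      also have "\<dots> = v" unfolding a_def b_def by (rule screen_expansion[OF p B v, symmetric])
      finally show ?thesis by (rule sym)
    qed
  qed
  have "tr p L = (\<Sum>i\<in>?I. \<beta> i (L i))" by (rule tr_eq[OF res L])
  also have "\<dots> = a (L (k p)) + (b (L (U p)) + (\<Sum>e\<in>B. \<beta> e (L e)))"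
    using fB kB UB kU by (simp add: \<beta>k)
  also have "(\<Sum>e\<in>B. \<beta> e (L e)) = (\<Sum>e\<in>B. g p (L e) e)"
    by (rule sum.cong[OF refl]) (simp add: \<beta>B)
  also have "a (L (k p)) = 0" using Lk by (simp add: a_def b_def g_bilinear)
  finally show ?thesis by (simp add: b_def)
qed

lemma dv_k_screen:
  assumes p: "p \<in> S" and B: "orthonormal_basis (g p) (screen_at p) B"
  shows "dv k p = (\<Sum>e\<in>B. g p (cov p e k) e)"
  unfolding dv_tr
  using screen_trace[OF p B cov_lin_on[OF k_vf]] cov_k_geodesic[OF p] cov_k_k[OF p] k_vf by simp

lemma tr_cov_k_squared:
  assumes p: "p \<in> S" and B: "orthonormal_basis (g p) (screen_at p) B"
  shows "tr p (\<lambda>v. cov p (cov p v k) k) = (\<Sum>e\<in>B. g p (cov p e k) (cov p e k))"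
proof -
  have "tr p (\<lambda>v. cov p (cov p v k) k) =
      (\<Sum>e\<in>B. g p (cov p (cov p e k) k) e) + g p (cov p (cov p (U p) k) k) (k p) / c"
    by (rule screen_trace[OF p B])
      (auto intro!: lin_onI simp: k_vf cov_lin cov_k_geodesic[OF p] cov_0)
  also have "g p (cov p (cov p (U p) k) k) (k p) = 0" using k_vf by (intro cov_k_k[OF p]) simp
  also have "(\<Sum>e\<in>B. g p (cov p (cov p e k) k) e) = (\<Sum>e\<in>B. g p (cov p e k) (cov p e k))"
    using screen_basis(1)[OF B] k_vf by (intro sum.cong[OF refl] cov_k_symmetric[OF p]) simp_all
  finally show ?thesis by simp
qed

text \<open>In an orthonormal basis the trace pairs the matrix of a symmetric with the one of a skew-symmetric
  form.\<close>

lemma tr_symmetric_skew: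
  assumes L: "lin_on p L" "\<And>v. v \<in> T p \<Longrightarrow> L v \<in> T p" and M: "lin_on p M" "\<And>v. v \<in> T p \<Longrightarrow> M v \<in> T p"
    and sym: "\<And>v w. v \<in> T p \<Longrightarrow> w \<in> T p \<Longrightarrow> g p (L v) w = g p v (L w)"
    and skew: "\<And>v w. v \<in> T p \<Longrightarrow> w \<in> T p \<Longrightarrow> g p (M v) w = - g p v (M w)"
  shows "tr p (\<lambda>v. M (L v)) = 0"
proof -
  obtain B where B: "orthonormal_basis (g p) (T p) B" using orthonormal_basis_tangent_exists[of p] by (elim exE conjE)
  have BT: "e \<in> T p" if "e \<in> B" for e using that B by (auto simp: orthonormal_basis_def)
  have lin: "lin_on p (\<lambda>v. M (L v))"
    using L M by (auto intro!: lin_onI simp: lin_on_def)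
  define G where "G = (\<lambda>e f. g p e e * (g p f f * (g p (L e) f * g p (M e) f)))"
  have "tr p (\<lambda>v. M (L v)) = (\<Sum>e\<in>B. g p e e * g p (M (L e)) e)"
    by (rule tr_eq[OF resolution_orthonormal[OF B] lin]) (simp add: L M)
  also have "\<dots> = (\<Sum>e\<in>B. - (\<Sum>f\<in>B. G e f))"
  proof (rule sum.cong[OF refl])
    fix e assume e: "e \<in> B"
    have "g p (M (L e)) e = - g p (L e) (M e)" using BT[OF e] L by (simp add: skew)
    also have "g p (L e) (M e) = (\<Sum>f\<in>B. g p f f * (g p (L e) f * g p (M e) f))"
      using BT[OF e] L M by (intro g_expansion[OF B]) simp_all
    finally show "g p e e * g p (M (L e)) e = - (\<Sum>f\<in>B. G e f)" by (simp add: G_def sum_distrib_left)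
  qed
  also have "\<dots> = - (\<Sum>e\<in>B. \<Sum>f\<in>B. G e f)" by (simp add: sum_negf)
  finally have 1: "tr p (\<lambda>v. M (L v)) = - (\<Sum>e\<in>B. \<Sum>f\<in>B. G e f)" .
  have skewG: "G f e = - G e f" if "e \<in> B" "f \<in> B" for e f
  proof -
    note ef = BT[OF that(1)] BT[OF that(2)]
    have "g p (L f) e = g p (L e) f" using sym[OF ef(2,1)] g_sym[of f p "L e"] ef L by simp
    moreover have "g p (M f) e = - g p (M e) f" using skew[OF ef(2,1)] g_sym[of f p "M e"] ef M by simp
    ultimately show ?thesis by (simp add: G_def)
  qed
  have "(\<Sum>e\<in>B. \<Sum>f\<in>B. G e f) = (\<Sum>e\<in>B. \<Sum>f\<in>B. G f e)" by (rule sum.swap)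
  also have "\<dots> = (\<Sum>e\<in>B. \<Sum>f\<in>B. - G e f)" by (rule sum.cong[OF refl sum.cong[OF refl skewG]])
  also have "\<dots> = - (\<Sum>e\<in>B. \<Sum>f\<in>B. G e f)" by (simp only: sum_negf)
  finally show ?thesis using 1 by linarith
qed

text \<open>This is the Bochner formula for \<open>\<nabla>\<^sub>k k\<close>. Its divergence vanishes on \<open>S\<close>: there \<open>\<nabla>\<^sub>k k = 0\<close>, so only the
  derivative in the direction of \<open>U\<close> can contribute, namely by its product with \<open>k\<close>. This is half the derivative of
  \<open>U g(k,k)\<close> in the direction of \<open>k\<close>, and \<open>U g(k,k)\<close> is zero on \<open>S\<close>.\<close>

lemma Raychaudhuri:
  assumes p: "p \<in> S" and B: "orthonormal_basis (g p) (screen_at p) B"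
  shows "k p (dv k) + (\<Sum>e\<in>B. g p (cov p e k) (cov p e k)) + Ric p (k p) (k p) = 0"
proof -
  let ?V = "D k k" and ?h = "\<lambda>q. g q (k q) (k q)"
  have V: "?V \<in> VF" using k_vf by simp
  have V0: "?V q = 0" if "q \<in> S" for q
    using cov_eq[OF k_vf k_vf, of q] cov_k_geodesic[OF that] by simp
  define w where "w = cov p (U p) ?V"
  have wT: "w \<in> T p" unfolding w_def using V by simp
  have covV: "cov p v ?V = (g p v (k p) / c) *\<^sub>R w" if v: "v \<in> T p" for v
  proof -
    let ?v = "v - (g p v (k p) / c) *\<^sub>R U p"
    note v' = transversal_part[OF p v]
    have "cov p ?v ?V = cov p ?v 0"
    proof (rule cov_local[OF v'(1) V vf_0])
      show "?V p = 0 p" using V0[OF p] by simp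
      fix f assume f: "smooth f"
      have "?v (\<lambda>q. ?V q f) = 0"
        by (rule derivative_tangential[OF p v' vf_smooth[OF V f]]) (simp add: V0)
      then show "?v (\<lambda>q. ?V q f) = ?v (\<lambda>q. (0 :: 'a vfield) q f)" using tangent_const[OF v'(1), of 0] by simp
    qed
    also have "\<dots> = 0" unfolding cov_deriv_def D_0_right[OF extend_vector(1)[OF v'(1)]] by (simp add: fun_eq_iff)
    finally show ?thesis using v V by (simp add: cov_diff cov_scale w_def)
  qed
  have lin: "lin_on p (\<lambda>v. g p v (k p) / c)"
    by (auto intro!: lin_onI simp: g_bilinear add_divide_distrib)
  have "dv ?V p = tr p (\<lambda>v. (g p v (k p) / c) *\<^sub>R w)"
    unfolding dv_tr by (rule tr_cong) (rule covV)
  also have "\<dots> = g p w (k p) / c" by (rule tr_rank_one[OF lin wT])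
  also have "g p w (k p) = 0"
  proof -
    have half: "(\<lambda>q. g q (?V q) (k q)) = (\<lambda>q. 1/2 * k q ?h)"
    proof
      fix q
      show "g q (?V q) (k q) = 1/2 * k q ?h"
        using metric_compatible[OF k_vf k_vf k_vf, of q] g_sym[of "k q" q "?V q"] V by simp
    qed
    have sh: "smooth ?h" by (rule g_smooth[OF k_vf k_vf])
    have "U p (\<lambda>q. g q (?V q) (k q)) = g p w (k p) + g p (?V p) (cov p (U p) k)"
      unfolding w_def by (rule cov_metric[OF vf_tangent[OF U_vf] V k_vf])
    then have "g p w (k p) = U p (\<lambda>q. g q (?V q) (k q))"
      using V0[OF p] k_vf by (simp add: g_bilinear)
    also have "\<dots> = 1/2 * U p (\<lambda>q. k q ?h)"
      unfolding half by (rule tangent_scale[OF vf_tangent[OF U_vf] vf_smooth[OF k_vf sh]])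
    also have "U p (\<lambda>q. k q ?h) = lie_bracket U k p ?h + k p (\<lambda>q. U q ?h)" by (simp add: lie_bracket_apply)
    also have "lie_bracket U k p ?h = 0" using bracket_U_k[OF p] by simp
    also have "k p (\<lambda>q. U q ?h) = 0"
      by (rule derivative_tangential[OF p vf_tangent[OF k_vf] k_null[OF p] vf_smooth[OF U_vf sh]])
        (simp add: derivative_k_k)
    finally show ?thesis by simp
  qed
  finally show ?thesis using Bochner[OF k_vf k_vf, of p] tr_cov_k_squared[OF p B] by simp
qed

text \<open>The Bochner formula again; \<open>\<nabla>k\<close> is symmetric and \<open>\<nabla>U\<close> skew-symmetric.\<close>

lemma dv_cov_k_U: assumes p: "p \<in> S" shows "dv (D k U) p = Ric p (k p) (U p)"
proof -
  have "tr p (\<lambda>v. cov p (cov p v k) U) = 0"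
  proof (rule tr_symmetric_skew[where L = "\<lambda>v. cov p v k" and M = "\<lambda>v. cov p v U"])
    show "g p (cov p v U) w = - g p v (cov p w U)" if "v \<in> T p" "w \<in> T p" for v w
      by (rule Killing_skew[OF killing that])
    show "g p (cov p v k) w = g p v (cov p w k)" if "v \<in> T p" "w \<in> T p" for v w
      by (rule cov_k_symmetric[OF p that])
  qed (simp_all only: cov_lin_on k_vf U_vf cov_tangent)
  moreover have "dv U = (\<lambda>q. 0)" using Killing_dv[OF killing] by (intro ext)
  ultimately show ?thesis using Bochner[OF k_vf U_vf, of p] tangent_const[OF vf_tangent[OF k_vf], of p 0] by simp
qed

end

section \<open>The length of a timelike Killing field\<close>

context lorentz_manifold
begin

lemma Ric_lin:
  assumes X: "X \<in> VF" and Y: "Y \<in> VF" and Z: "Z \<in> VF"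
  shows "Ric p (a *\<^sub>R X p + b *\<^sub>R Y p) (Z p) = a * Ric p (X p) (Z p) + b * Ric p (Y p) (Z p)"
proof -
  obtain W y e where p: "p \<in> W" and fr: "frame_on W y e" by (rule frame_exists)
  note f = frame_onD[OF fr]
  let ?XY = "(\<lambda>q. a) \<odot> X + (\<lambda>q. b) \<odot> Y"
  have XY: "?XY \<in> VF" by (intro vf_add vf_fscale smooth_const X Y)
  have Rm: "Rm (e i) Z ?XY p (y i) = a * Rm (e i) Z X p (y i) + b * Rm (e i) Z Y p (y i)" if "i \<in> Basis" for i
    using Rm_add3[OF f(3)[OF that] Z vf_fscale[OF smooth_const X] vf_fscale[OF smooth_const Y], of a b]
      Rm_fscale3[OF f(3)[OF that] Z X smooth_const, of a] Rm_fscale3[OF f(3)[OF that] Z Y smooth_const, of b]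
    by (simp add: fscale_apply)
  have "Ric p (a *\<^sub>R X p + b *\<^sub>R Y p) (Z p) = Ric p (?XY p) (Z p)" by (simp add: fscale_apply)
  also have "\<dots> = Ric p (Z p) (?XY p)" by (rule Ric_sym[OF XY Z])
  also have "\<dots> = (\<Sum>i\<in>Basis. a * Rm (e i) Z X p (y i) + b * Rm (e i) Z Y p (y i))"
    unfolding Ric_frame[OF fr p Z XY] by (rule sum.cong[OF refl Rm])
  also have "\<dots> = a * Ric p (Z p) (X p) + b * Ric p (Z p) (Y p)"
    unfolding Ric_frame[OF fr p Z X] Ric_frame[OF fr p Z Y] by (simp add: sum.distrib sum_distrib_left)
  finally show ?thesis using Ric_sym[OF Z X] Ric_sym[OF Z Y] by simp
qed

definition speed :: "'a vfield \<Rightarrow> 'a \<Rightarrow> real" where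
  "speed U = (\<lambda>q. sqrt (- g q (U q) (U q)))"

lemma speed_pos: "timelike g U \<Longrightarrow> speed U q > 0"
  by (simp add: speed_def timelike_def)

lemma speed_squared: "timelike g U \<Longrightarrow> g q (U q) (U q) = - (speed U q * speed U q)"
proof -
  assume "timelike g U"
  then have "g q (U q) (U q) < 0" by (simp add: timelike_def)
  then show ?thesis by (simp add: speed_def)
qed

lemma smooth_ln_speed:
  assumes U: "U \<in> VF" "timelike g U"
  shows "smooth (\<lambda>q. ln (speed U q))"
proof -
  have s: "smooth (\<lambda>q. - g q (U q) (U q))" by (rule smooth_uminus[OF g_smooth[OF U(1) U(1)]])
  have "smooth (\<lambda>q. ln (- g q (U q) (U q)))"
    by (rule smooth_compose[OF s _ _ C_infinity_on_ln])
      (use U(2) in \<open>auto simp: timelike_def open_Collect_less\<close>)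
  then have "smooth (\<lambda>q. 1/2 * ln (- g q (U q) (U q)))" by (rule smooth_mult[OF smooth_const])
  moreover have "1/2 * ln (- g q (U q) (U q)) = ln (speed U q)" for q
  proof -
    have "- g q (U q) (U q) > 0" using U(2) by (simp add: timelike_def)
    then show ?thesis unfolding speed_def by (subst ln_sqrt) simp_all
  qed
  ultimately show ?thesis by (simp only:)
qed

lemma smooth_exp: "smooth f \<Longrightarrow> smooth (\<lambda>q. exp (f q))"
  by (rule smooth_compose[OF _ open_UNIV _ C_infinity_on_exp]) simp_all

lemma exp_ln_speed: "timelike g U \<Longrightarrow> speed U = (\<lambda>q. exp (ln (speed U q)))"
  using speed_pos by (intro ext) simp

lemma smooth_speed: "U \<in> VF \<Longrightarrow> timelike g U \<Longrightarrow> smooth (speed U)"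
  using smooth_exp[OF smooth_ln_speed] exp_ln_speed by metis

lemma smooth_speed_inverse:
  assumes "U \<in> VF" "timelike g U"
  shows "smooth (\<lambda>q. 1 / speed U q)"
proof -
  have "smooth (\<lambda>q. exp (- ln (speed U q)))" by (rule smooth_exp[OF smooth_uminus[OF smooth_ln_speed[OF assms]]])
  moreover have "exp (- ln (speed U q)) = 1 / speed U q" for q
    using speed_pos[OF assms(2)] by (simp add: exp_minus inverse_eq_divide)
  ultimately show ?thesis by (simp only:)
qed

lemma derivative_speed:
  assumes "U \<in> VF" "timelike g U" and v: "v \<in> T p"
  shows "v (speed U) = speed U p * v (\<lambda>q. ln (speed U q))"
proof -
  note s = smooth_ln_speed[OF assms(1,2)]
  have "v (\<lambda>q. exp (ln (speed U q))) = exp (ln (speed U p)) * v (\<lambda>q. ln (speed U q))"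
    by (rule tangent_compose[OF v s smooth_exp[OF s] DERIV_exp])
  then show ?thesis using exp_ln_speed[OF assms(2)] by metis
qed

text \<open>Differentiate \<open>g(U,U) = - \<bar>U\<bar>\<^sup>2\<close> in the direction of \<open>v\<close>, and move the covariant derivative to the other slot
  by skew-symmetry.\<close>

lemma Killing_acceleration:
  assumes K: "killing_field A g U" and U: "timelike g U" and v: "v \<in> T p"
  shows "g p (D U U p) v = speed U p * speed U p * v (\<lambda>q. ln (speed U q))"
proof -
  have UV: "U \<in> VF" using K by (simp add: killing_field_def)
  note ss = smooth_speed[OF UV U]
  have "v (\<lambda>q. g q (U q) (U q)) = v (\<lambda>q. (-1) * (speed U q * speed U q))"
    by (simp add: speed_squared[OF U])
  also have "\<dots> = (-1) * v (\<lambda>q. speed U q * speed U q)" by (rule tangent_scale[OF v smooth_mult[OF ss ss]])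
  also have "v (\<lambda>q. speed U q * speed U q) = 2 * (speed U p * v (speed U))"
    unfolding tangent_mult[OF v ss ss] by simp
  also have "v (speed U) = speed U p * v (\<lambda>q. ln (speed U q))" by (rule derivative_speed[OF UV U v])
  finally have "v (\<lambda>q. g q (U q) (U q)) = - 2 * (speed U p * speed U p * v (\<lambda>q. ln (speed U q)))" by simp
  moreover have "v (\<lambda>q. g q (U q) (U q)) = - 2 * g p (D U U p) v"
  proof -
    have "v (\<lambda>q. g q (U q) (U q)) = g p (cov p v U) (U p) + g p (U p) (cov p v U)" by (rule cov_metric[OF v UV UV])
    moreover have "g p (U p) (cov p v U) = g p (cov p v U) (U p)" using v UV by (intro g_sym) simp_all
    moreover have "g p (cov p v U) (U p) = - g p v (cov p (U p) U)" using v UV by (intro Killing_skew[OF K]) simp_all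
    moreover have "g p v (cov p (U p) U) = g p (D U U p) v" using v UV cov_eq[OF UV UV] by (simp add: g_sym)
    ultimately show ?thesis by simp
  qed
  ultimately show ?thesis by simp
qed

definition speed_gradient :: "'a vfield \<Rightarrow> 'a vfield" where
  "speed_gradient U = (\<lambda>q. 1 / speed U q * (1 / speed U q)) \<odot> D U U"

lemma speed_gradient_vf:
  assumes "U \<in> VF" "timelike g U"
  shows "speed_gradient U \<in> VF"
  unfolding speed_gradient_def
  by (intro vf_fscale smooth_mult smooth_speed_inverse D_vf assms)

lemma speed_gradient:
  assumes K: "killing_field A g U" and U: "timelike g U" and v: "v \<in> T p"
  shows "g p (speed_gradient U p) v = v (\<lambda>q. ln (speed U q))"
proof -
  have UV: "U \<in> VF" using K by (simp add: killing_field_def)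
  have "g p (speed_gradient U p) v = 1 / speed U p * (1 / speed U p) * g p (D U U p) v"
    unfolding speed_gradient_def fscale_apply using v UV by (intro g_scale) simp_all
  then show ?thesis unfolding Killing_acceleration[OF assms] using speed_pos[OF U, of p] by simp
qed

lemma gradient_ln_speed:
  assumes K: "killing_field A g U" and U: "timelike g U"
  shows "gradient A g (\<lambda>q. ln (speed U q)) = speed_gradient U"
proof
  fix p
  have UV: "U \<in> VF" using K by (simp add: killing_field_def)
  have G: "speed_gradient U p \<in> T p" by (rule vf_tangent[OF speed_gradient_vf[OF UV U]])
  show "gradient A g (\<lambda>q. ln (speed U q)) p = speed_gradient U p"
    unfolding gradient_def
  proof (rule the_equality)
    show "speed_gradient U p \<in> T p \<and> (\<forall>w\<in>T p. g p (speed_gradient U p) w = w (\<lambda>q. ln (speed U q)))"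
      using G speed_gradient[OF assms] by simp
    fix v assume v: "v \<in> T p \<and> (\<forall>w\<in>T p. g p v w = w (\<lambda>q. ln (speed U q)))"
    have "v - speed_gradient U p = 0"
    proof (rule nondegenerate)
      show "v - speed_gradient U p \<in> T p" using v G by simp
      show "g p (v - speed_gradient U p) w = 0" if "w \<in> T p" for w
        using v G that speed_gradient[OF assms that] by (simp add: g_diff)
    qed
    then show "v = speed_gradient U p" by simp
  qed
qed

end


section \<open>Vanishing of the second fundamental form\<close>

context Killing_lightlike
begin

abbreviation "\<psi> \<equiv> (\<lambda>q. ln (speed U q))"

lemma \<psi>_smooth: "smooth \<psi>"
  by (rule smooth_ln_speed[OF U_vf timelike_U])

lemma k_\<psi>_smooth: "smooth (\<lambda>q. k q \<psi>)"
  by (rule vf_smooth[OF k_vf \<psi>_smooth])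

lemma cov_U_perp: "g p (cov p v U) v = 0" if "v \<in> T p" for p v
  using Killing_skew[OF killing that that] g_sym[OF that, of "cov p v U"] that U_vf by simp

lemma U_\<psi>: "U p \<psi> = 0"
  using Killing_acceleration[OF killing timelike_U vf_tangent[OF U_vf], of p] cov_U_perp[OF vf_tangent[OF U_vf], of p]
    cov_eq[OF U_vf U_vf, of p] speed_pos[OF timelike_U, of p] by auto

text \<open>The divergence along \<open>S\<close> of \<open>\<bar>U\<bar> k\<close> is \<open>\<bar>U\<bar>\<close> times this function, so it cannot have a sign without vanishing.\<close>

lemma expansion_zero:
  assumes sign: "(\<forall>q\<in>S. dv k q + k q \<psi> \<ge> 0) \<or> (\<forall>q\<in>S. dv k q + k q \<psi> \<le> 0)" and p: "p \<in> S"
  shows "dv k p + k p \<psi> = 0"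
proof -
  have div: "divS ((\<lambda>q. s * speed U q) \<odot> k) q = speed U q * (s * (dv k q + k q \<psi>))" if q: "q \<in> S" for q s
  proof -
    note ss = smooth_speed[OF U_vf timelike_U]
    have "divS ((\<lambda>q. s * speed U q) \<odot> k) q = s * speed U q * dv k q + k q (\<lambda>q. s * speed U q)"
      by (rule divS_fscale_k[OF q smooth_mult[OF smooth_const ss]])
    also have "k q (\<lambda>q. s * speed U q) = s * (speed U q * k q \<psi>)"
      using tangent_scale[OF vf_tangent[OF k_vf] ss] derivative_speed[OF U_vf timelike_U vf_tangent[OF k_vf]] by simp
    finally show ?thesis by (simp only: distrib_left mult.assoc mult.left_commute[of s])
  qed
  have "\<exists>s. s \<noteq> 0 \<and> (\<forall>q\<in>S. s * (dv k q + k q \<psi>) \<ge> 0)"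
    using sign
  proof
    assume "\<forall>q\<in>S. dv k q + k q \<psi> \<le> 0"
    then have le: "dv k q + k q \<psi> \<le> 0" if "q \<in> S" for q using that by (rule bspec)
    have "0 \<le> (-1) * (dv k q + k q \<psi>)" if "q \<in> S" for q
      by (rule mult_nonpos_nonpos[OF _ le[OF that]]) simp
    then have "\<forall>q\<in>S. (-1) * (dv k q + k q \<psi>) \<ge> 0" by (rule ballI)
    then show ?thesis by (intro exI[of _ "-1"] conjI, simp)
  qed (auto intro: exI[of _ 1])
  then obtain s where s: "s \<noteq> 0" "\<forall>q\<in>S. s * (dv k q + k q \<psi>) \<ge> 0" by (elim exE conjE)
  let ?X = "(\<lambda>q. s * speed U q) \<odot> k"
  have "divS ?X p = 0"
  proof (rule divS_nonneg_imp_zero[OF _ _ _ p])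
    show "?X \<in> VF" by (intro vf_fscale smooth_mult smooth_const smooth_speed U_vf timelike_U k_vf)
    show "g q (?X q) (k q) = 0" if "q \<in> S" for q using k_null[OF that] by (simp add: fscale_apply g_scale)
    show "divS ?X q \<ge> 0" if "q \<in> S" for q
      unfolding div[OF that] using less_imp_le[OF speed_pos[OF timelike_U]] bspec[OF s(2) that] by (rule mult_nonneg_nonneg)
  qed
  then show ?thesis unfolding div[OF p] using s(1) speed_pos[OF timelike_U, of p] by simp
qed

text \<open>The gradient of \<open>\<psi>\<close>, made tangent to \<open>S\<close> along \<open>U\<close>. Since \<open>\<psi>\<close> is invariant under \<open>U\<close>, the correction does not
  contribute to the divergence along \<open>S\<close>, which is the Laplacian of \<open>\<psi>\<close>.\<close>

definition potential_part :: "'a vfield" where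
  "potential_part = speed_gradient U - (\<lambda>q. 1 / c * k q \<psi>) \<odot> U"

lemma potential_part_vf: "potential_part \<in> VF"
  unfolding potential_part_def
  by (intro vf_diff vf_fscale smooth_mult smooth_const k_\<psi>_smooth U_vf speed_gradient_vf timelike_U)

lemma g_potential_part: "g q (potential_part q) (k q) = k q \<psi> * (1 - 1 / c * g q (U q) (k q))"
  unfolding potential_part_def
  using speed_gradient[OF killing timelike_U vf_tangent[OF k_vf], of q] vf_tangent[OF speed_gradient_vf[OF U_vf timelike_U], of q]
  by (simp add: fscale_apply g_diff g_scale algebra_simps)

lemma divS_potential_part:
  assumes p: "p \<in> S"
  shows "divS potential_part p = laplacian A g D \<psi> p"
proof -
  note Ut = vf_tangent[OF U_vf, of p]
  have Uk\<psi>: "U p (\<lambda>q. k q \<psi>) = 0"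
  proof -
    have "U p (\<lambda>q. k q \<psi>) = lie_bracket U k p \<psi> + k p (\<lambda>q. U q \<psi>)" by (simp add: lie_bracket_apply)
    then show ?thesis using bracket_U_k[OF p] U_\<psi> tangent_const[OF vf_tangent[OF k_vf]] by simp
  qed
  have s\<beta>: "smooth (\<lambda>q. 1 / c * k q \<psi>)" by (rule smooth_mult[OF smooth_const k_\<psi>_smooth])
  have U\<beta>: "U p (\<lambda>q. 1 / c * k q \<psi>) = 0" unfolding tangent_scale[OF Ut k_\<psi>_smooth] Uk\<psi> by simp
  have "dv potential_part p = dv (speed_gradient U) p"
    unfolding potential_part_def
    using dv_diff[OF speed_gradient_vf[OF U_vf timelike_U] vf_fscale[OF s\<beta> U_vf]] dv_fscale[OF U_vf s\<beta>]
      U\<beta> Killing_dv[OF killing] by simp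
  moreover have "U p (\<lambda>q. g q (potential_part q) (k q)) = 0"
  proof -
    have sU: "smooth (\<lambda>q. g q (U q) (k q))" by (rule g_smooth[OF U_vf k_vf])
    have s1: "smooth (\<lambda>q. 1 / c * g q (U q) (k q))" by (rule smooth_mult[OF smooth_const sU])
    have "U p (\<lambda>q. 1 - 1 / c * g q (U q) (k q)) = 0"
      unfolding tangent_diff[OF Ut smooth_const s1] tangent_scale[OF Ut sU] derivative_U_k[OF p Ut] tangent_const[OF Ut]
      by simp
    then show ?thesis
      unfolding g_potential_part
      using tangent_mult[OF Ut k_\<psi>_smooth smooth_diff[OF smooth_const s1], of 1] Uk\<psi> by simp
  qed
  ultimately show ?thesis
    unfolding divS_def laplacian_def gradient_ln_speed[OF killing timelike_U] by simp
qed

text \<open>The three fields \<open>\<bar>U\<bar>\<^sup>2 (k \<psi>) k\<close>, \<open>\<surd>2 \<nabla>\<^sub>k U\<close> and the tangential part of the gradient of \<open>\<psi>\<close> are tangent to \<open>S\<close>.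
  The divergence of their sum along \<open>S\<close> is \<open>\<bar>U\<bar>\<^sup>2 ((k \<psi>)\<^sup>2 + tr (\<nabla>k)\<^sup>2)\<close> plus the curvature expression that is
  nonnegative by assumption. Hence all these terms vanish, in particular \<open>tr (\<nabla>k)\<^sup>2\<close>, which is a sum of squares
  over the screen.\<close>

theorem totally_geodesic_null_field:
  assumes sign: "(\<forall>q\<in>S. dv k q + k q \<psi> \<ge> 0) \<or> (\<forall>q\<in>S. dv k q + k q \<psi> \<le> 0)"
    and curv: "\<And>q. q \<in> S \<Longrightarrow> 0 \<le> speed U q * speed U q * Ric q (k q) (k q) + sqrt 2 * Ric q (k q) (U q) + laplacian A g D \<psi> q"
    and p: "p \<in> S" and v: "v \<in> T p" "g p v (k p) = 0" and w: "w \<in> T p" "g p w (k p) = 0"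
  shows "g p (cov p v k) w = 0"
proof -
  have exp0: "dv k q = - k q \<psi>" if "q \<in> S" for q using expansion_zero[OF sign that] by simp
  define shear where "shear = (\<lambda>q. tr q (\<lambda>v. cov q (cov q v k) k))"
  have shear_nonneg: "shear q \<ge> 0" if q: "q \<in> S" for q
  proof -
    obtain B where B: "orthonormal_basis (g q) (screen_at q) B" using screen_basis_exists[of q] by (elim exE)
    have "0 \<le> g q (cov q e k) (cov q e k)" if "e \<in> B" for e
    proof (rule null_orthogonal(2)[OF vf_tangent[OF U_vf] _ vf_tangent[OF k_vf] _ k_null[OF q]])
      show "g q (U q) (U q) < 0" using timelike_U by (simp add: timelike_def)
      show "k q \<noteq> 0" using k_U[OF q] c_pos g_0[OF vf_tangent[OF U_vf]] by auto
    qed (use screen_basis(1)[OF B that] k_vf cov_k_k[OF q] in simp_all)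
    then show ?thesis unfolding shear_def tr_cov_k_squared[OF q B] by (rule sum_nonneg)
  qed
  \<comment> \<open>By Raychaudhuri, as \<open>dv k = - k \<psi>\<close> can be differentiated along \<open>k\<close>.\<close>
  have focus: "k q (\<lambda>q. k q \<psi>) = shear q + Ric q (k q) (k q)" if q: "q \<in> S" for q
  proof -
    obtain B where B: "orthonormal_basis (g q) (screen_at q) B" using screen_basis_exists[of q] by (elim exE)
    note sd = dv_smooth[OF k_vf] and kt = vf_tangent[OF k_vf, of q]
    have "k q (\<lambda>q. dv k q + k q \<psi>) = 0"
      by (rule derivative_tangential[OF q kt k_null[OF q] smooth_add[OF sd k_\<psi>_smooth]]) (simp add: exp0)
    then have "k q (dv k) + k q (\<lambda>q. k q \<psi>) = 0" using tangent_add[OF kt sd k_\<psi>_smooth] by simp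
    then show ?thesis using Raychaudhuri[OF q B] unfolding shear_def tr_cov_k_squared[OF q B] by simp
  qed
  define \<phi> where "\<phi> = (\<lambda>q. speed U q * speed U q * k q \<psi>)"
  note ss = smooth_speed[OF U_vf timelike_U]
  have s\<phi>: "smooth \<phi>" unfolding \<phi>_def by (intro smooth_mult ss k_\<psi>_smooth)
  have k\<phi>: "k q \<phi> = 2 * (speed U q * speed U q) * (k q \<psi> * k q \<psi>) + speed U q * speed U q * k q (\<lambda>q. k q \<psi>)" for q
    unfolding \<phi>_def tangent_mult[OF vf_tangent[OF k_vf] smooth_mult[OF ss ss] k_\<psi>_smooth]
      tangent_mult[OF vf_tangent[OF k_vf] ss ss] derivative_speed[OF U_vf timelike_U vf_tangent[OF k_vf]]
    by (simp add: algebra_simps)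
  have DkU: "D k U \<in> VF" using k_vf U_vf by simp
  have gDkU: "g q (D k U q) (k q) = 0" for q
    using cov_U_perp[OF vf_tangent[OF k_vf]] cov_eq[OF k_vf U_vf] by simp
  let ?X1 = "\<phi> \<odot> k" and ?X2 = "sqrt 2 *\<^sub>R D k U"
  let ?X = "?X1 + ?X2 + potential_part"
  have V1: "?X1 \<in> VF" and V2: "?X2 \<in> VF" by (intro vf_fscale s\<phi> k_vf vf_scale DkU)+
  have g2: "g q (?X2 q) (k q) = 0" for q using gDkU DkU by (simp add: g_scale)
  have d2: "divS ?X2 q = sqrt 2 * Ric q (k q) (U q)" if q: "q \<in> S" for q
    unfolding divS_def g2 tangent_const[OF vf_tangent[OF U_vf]] dv_scale[OF DkU] dv_cov_k_U[OF q] by simp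
  have divX: "divS ?X q = speed U q * speed U q * (k q \<psi> * k q \<psi>) + speed U q * speed U q * shear q +
      (speed U q * speed U q * Ric q (k q) (k q) + sqrt 2 * Ric q (k q) (U q) + laplacian A g D \<psi> q)"
    if q: "q \<in> S" for q
    unfolding divS_add[OF vf_add[OF V1 V2] potential_part_vf] divS_add[OF V1 V2] divS_fscale_k[OF q s\<phi>] d2[OF q]
      divS_potential_part[OF q] k\<phi> focus[OF q] exp0[OF q]
    by (simp add: \<phi>_def algebra_simps)
  have sp: "speed U q * speed U q > 0" for q using speed_pos[OF timelike_U] by simp
  have terms: "0 \<le> speed U q * speed U q * (k q \<psi> * k q \<psi>)" "q \<in> S \<Longrightarrow> 0 \<le> speed U q * speed U q * shear q" for q
    using sp[of q] shear_nonneg[of q] by simp_all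
  have "divS ?X p = 0"
  proof (rule divS_nonneg_imp_zero[OF _ _ _ p])
    show "?X \<in> VF" by (intro vf_add V1 V2 potential_part_vf)
    show "g q (?X q) (k q) = 0" if q: "q \<in> S" for q
    proof -
      have "g q (?X q) (k q) = g q (?X1 q) (k q) + g q (?X2 q) (k q) + g q (potential_part q) (k q)"
        using vf_tangent[OF V1, of q] vf_tangent[OF V2, of q] vf_tangent[OF potential_part_vf, of q]
        by (simp only: plus_fun_apply g_add tangent_space_add kU_tangent)
      moreover have "g q (?X1 q) (k q) = 0" using k_null[OF q] by (simp add: fscale_apply g_scale)
      moreover have "g q (potential_part q) (k q) = 0" unfolding g_potential_part using U_k[OF q] c_pos by simp
      ultimately show ?thesis using g2 by simp
    qed
    show "divS ?X q \<ge> 0" if q: "q \<in> S" for q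
      unfolding divX[OF q] using terms(1)[of q] terms(2)[OF q] curv[OF q] by simp
  qed
  then have "speed U p * speed U p * shear p = 0"
    unfolding divX[OF p] using terms(1)[of p] terms(2)[OF p] curv[OF p] by linarith
  then have shear0: "shear p = 0" using sp[of p] by auto
  obtain B where B: "orthonormal_basis (g p) (screen_at p) B" using screen_basis_exists[of p] by (elim exE)
  have fB: "finite B" using B by (simp add: orthonormal_basis_def)
  have Up: "g p (U p) (U p) < 0" using timelike_U by (simp add: timelike_def)
  have kp: "k p \<noteq> 0" using k_U[OF p] c_pos g_0[OF vf_tangent[OF U_vf]] by auto
  have e0: "g p (cov p e k) w = 0" if e: "e \<in> B" for e
  proof -
    have AT: "cov p e k \<in> T p" "g p (cov p e k) (k p) = 0" if "e \<in> B" for e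
      using screen_basis(1)[OF B that] k_vf cov_k_k[OF p] by simp_all
    note no = null_orthogonal[OF vf_tangent[OF U_vf] Up vf_tangent[OF k_vf] kp k_null[OF p]]
    have "(\<Sum>e\<in>B. g p (cov p e k) (cov p e k)) = 0" using shear0 by (simp add: shear_def tr_cov_k_squared[OF p B])
    then have "g p (cov p e k) (cov p e k) = 0"
      using sum_nonneg_eq_0_iff[OF fB, of "\<lambda>e. g p (cov p e k) (cov p e k)"] no(2)[OF AT] e by simp
    then have "cov p e k = (g p (cov p e k) (U p) / g p (k p) (U p)) *\<^sub>R k p" by (rule no(3)[OF AT[OF e]])
    then obtain a where "cov p e k = a *\<^sub>R k p" by (rule that)
    then show ?thesis using w g_sym[OF w(1) vf_tangent[OF k_vf]] by (simp add: g_scale)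
  qed
  have vexp: "v = (\<Sum>e\<in>B. g p v e *\<^sub>R e) + (g p v (U p) / c) *\<^sub>R k p"
    using screen_expansion[OF p B v(1)] v(2) by simp
  have eT: "g p v e *\<^sub>R e \<in> T p" if "e \<in> B" for e using screen_basis(1)[OF B that] by simp
  have "cov p v k = cov p ((\<Sum>e\<in>B. g p v e *\<^sub>R e) + (g p v (U p) / c) *\<^sub>R k p) k" using vexp by (rule arg_cong)
  also have "\<dots> = cov p (\<Sum>e\<in>B. g p v e *\<^sub>R e) k + (g p v (U p) / c) *\<^sub>R cov p (k p) k"
    using eT k_vf by (simp add: cov_add cov_scale)
  also have "cov p (\<Sum>e\<in>B. g p v e *\<^sub>R e) k = (\<Sum>e\<in>B. g p v e *\<^sub>R cov p e k)"
    using eT screen_basis(1)[OF B] k_vf by (simp add: cov_sum cov_scale)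
  finally have "cov p v k = (\<Sum>e\<in>B. g p v e *\<^sub>R cov p e k)" by (simp only: cov_k_geodesic[OF p] scaleR_zero_right add_0_right)
  then have "g p (cov p v k) w = (\<Sum>e\<in>B. g p (g p v e *\<^sub>R cov p e k) w)"
    using screen_basis(1)[OF B] k_vf w(1) by (simp add: g_sum)
  also have "\<dots> = 0"
    using screen_basis(1)[OF B] k_vf w(1) e0 by (intro sum.neutral) (simp add: g_scale)
  finally show ?thesis .
qed

end

context lorentz_manifold
begin

text \<open>Correct \<open>X\<close> by a multiple of its bracket with \<open>U\<close> whose factor vanishes on \<open>S\<close> and has derivative \<open>-1\<close> along
  \<open>U\<close> there.\<close>

lemma adapted_null_field:
  assumes S: "compact S" and U: "U \<in> VF" and F: "smooth F" "\<And>q. q \<in> S \<Longrightarrow> F q = 0" "\<And>q. q \<in> S \<Longrightarrow> U q F > 0"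
    and X: "X \<in> VF"
  shows "\<exists>k\<in>VF. \<forall>q\<in>S. k q = X q \<and> lie_bracket U k q = 0"
proof -
  have "\<exists>\<zeta>. smooth \<zeta> \<and> (\<forall>q\<in>S. \<zeta> q * U q F = 1)"
    by (rule extend_reciprocal[OF S vf_smooth[OF U F(1)] F(3)])
  then obtain \<zeta> where \<zeta>: "smooth \<zeta>" "\<forall>q\<in>S. \<zeta> q * U q F = 1" by (elim exE conjE)
  let ?Z = "lie_bracket U X"
  let ?f = "\<lambda>q. (-1) * (F q * \<zeta> q)"
  have Z: "?Z \<in> VF" by (rule lie_bracket_vf[OF U X])
  have sF: "smooth (\<lambda>q. F q * \<zeta> q)" by (rule smooth_mult[OF F(1) \<zeta>(1)])
  have sf: "smooth ?f" by (rule smooth_mult[OF smooth_const sF])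
  have "X + ?f \<odot> ?Z \<in> VF" by (intro vf_add vf_fscale X Z sf)
  moreover have "(X + ?f \<odot> ?Z) q = X q \<and> lie_bracket U (X + ?f \<odot> ?Z) q = 0" if q: "q \<in> S" for q
  proof
    show "(X + ?f \<odot> ?Z) q = X q" using F(2)[OF q] by (simp add: fscale_apply fun_eq_iff)
    note Ut = vf_tangent[OF U, of q]
    have "U q ?f = -1"
      unfolding tangent_scale[OF Ut sF] tangent_mult[OF Ut F(1) \<zeta>(1)] using F(2)[OF q] bspec[OF \<zeta>(2) q] by simp
    moreover have "lie_bracket U (X + ?f \<odot> ?Z) q = ?Z q + (?f q *\<^sub>R lie_bracket U ?Z q + U q ?f *\<^sub>R ?Z q)"
      unfolding bracket_add_right[OF U X vf_fscale[OF sf Z]] bracket_fscale_right[OF U Z sf]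
      by (simp only: plus_fun_apply fscale_apply)
    ultimately show "lie_bracket U (X + ?f \<odot> ?Z) q = 0" using F(2)[OF q] by (simp add: fun_eq_iff)
  qed
  ultimately show ?thesis by (intro bexI[of _ "X + ?f \<odot> ?Z"] ballI)
qed

end

theorem theorem6p5:
  fixes A :: "('a::{t2_space, second_countable_topology}, 'e::euclidean_space) chart set"
    and g :: "'a metric" and D :: "'a connection"
    and U E \<xi> X\<^sub>0 N :: "'a vfield"
    and S :: "'a set" and lam :: "'a \<Rightarrow> real"
  assumes "lorentzian_manifold A g"
    and "levi_civita_connection A g D"
    and "killing_field A g U" and "timelike g U"
    and "compact S" and "lightlike_hypersurface A g S"
    and "lam = (\<lambda>p. sqrt (- g p (U p) (U p)))"
    and "E = (\<lambda>p. tscale (1 / lam p) (U p))"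
    and "\<xi> \<in> vector_fields_of A S"
    and "\<forall>p\<in>S. \<xi> p \<noteq> tzero \<and> g p (\<xi> p) (\<xi> p) = 0"
    and "\<forall>p\<in>S. g p (\<xi> p) (E p) = 1 / sqrt 2"
    and "\<forall>p\<in>S. X\<^sub>0 p = perp_part (g p) (E p) (\<xi> p)"
    and "\<forall>p\<in>S. N p = symmetric_wrt (g p) (E p) (tscale (-1) (\<xi> p))"
    and "(\<forall>p\<in>S. lightlike_mean_curvature A g D S E \<xi> p - g p (gradient A g (\<lambda>q. ln (lam q)) p) (\<xi> p) \<ge> 0) \<or>
         (\<forall>p\<in>S. lightlike_mean_curvature A g D S E \<xi> p - g p (gradient A g (\<lambda>q. ln (lam q)) p) (\<xi> p) \<le> 0)"
    and "\<forall>p\<in>S. 0 \<le> ricci A g D p (N p) (\<xi> p) + laplacian A g D (\<lambda>q. ln (lam q)) p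
           - 4 * g p (cov_deriv A D p (X\<^sub>0 p) E) (cov_deriv A D p (X\<^sub>0 p) E)"
  shows "totally_geodesic A g D S \<xi>"
proof -
  interpret lorentz_manifold A g D
    using assms(1,2) by unfold_locales (simp_all add: lorentzian_manifold_def)
  note K = assms(3) and tl = assms(4) and cS = assms(5)
  have hS: "hypersurface A S" using assms(6) by (simp add: lightlike_hypersurface_def)
  have U: "U \<in> VF" using K by (simp add: killing_field_def)
  have lam: "lam = speed U" using assms(7) by (simp add: speed_def)
  have lpos: "lam q > 0" for q unfolding lam by (rule speed_pos[OF tl])
  have Udef: "g q (U q) (U q) < 0" for q using tl by (simp add: timelike_def)
  have Ut: "U q \<in> T q" for q by (rule vf_tangent[OF U])
  have Eq: "E q = (1 / lam q) *\<^sub>R U q" for q using assms(8) by (simp add: tvec_ops)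
  have EV: "E \<in> VF"
  proof -
    have "E = (\<lambda>q. 1 / lam q) \<odot> U" by (rule ext) (simp only: Eq fscale_apply)
    then show ?thesis using vf_fscale[OF smooth_speed_inverse[OF U tl] U] by (simp only: lam)
  qed
  have gUU: "g q (U q) (U q) = - (lam q * lam q)" for q unfolding lam by (rule speed_squared[OF tl])
  have gEE: "g q (E q) (E q) = -1" for q
    unfolding Eq using gUU[of q] lpos[of q] Ut[of q] by (simp add: g_scale g_right)
  obtain \<xi>' where \<xi>': "\<xi>' \<in> VF" "\<forall>q\<in>S. \<xi>' q = \<xi> q" using extend_field[OF cS assms(9)] by (elim bexE)
  have \<xi>T: "\<xi> q \<in> T q" if "q \<in> S" for q using bspec[OF \<xi>'(2) that] vf_tangent[OF \<xi>'(1), of q] by simp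
  have \<xi>S: "\<xi> q \<in> tangent_space_of A S q" if "q \<in> S" for q using assms(9) that by (simp add: vector_fields_of_def)
  have \<xi>0: "\<xi> q \<noteq> 0" "g q (\<xi> q) (\<xi> q) = 0" if "q \<in> S" for q using bspec[OF assms(10) that] by (simp_all add: tvec_ops)
  have \<xi>E: "g q (\<xi> q) (E q) = 1 / sqrt 2" if "q \<in> S" for q by (rule bspec[OF assms(11) that])
  have \<xi>U: "g q (\<xi> q) (U q) = lam q / sqrt 2" if "q \<in> S" for q
    using \<xi>E[OF that] lpos[of q] \<xi>T[OF that] Ut[of q] unfolding Eq by (simp add: g_right field_simps)
  have TS: "tangent_space_of A S q = {v \<in> T q. g q v (\<xi> q) = 0}" if q: "q \<in> S" for q
    by (rule lightlike_tangent_space[OF assms(6) q Ut Udef \<xi>S[OF q] \<xi>0[OF q]])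
  have UT: "U q \<notin> tangent_space_of A S q" if q: "q \<in> S" for q
    unfolding TS[OF q] using \<xi>U[OF q] lpos[of q] g_sym[OF \<xi>T[OF q] Ut] by simp
  have "\<exists>F N. smooth F \<and> (\<forall>q\<in>S. F q = 0 \<and> U q F > 0) \<and> open N \<and> S \<subseteq> N \<and> (\<forall>q\<in>N. F q = 0 \<longrightarrow> q \<in> S)"
    by (rule defining_function_exists[OF cS hS U UT])
  then obtain F N0 where F: "smooth F" "\<forall>q\<in>S. F q = 0 \<and> U q F > 0" and N0: "open N0" "S \<subseteq> N0" "\<forall>q\<in>N0. F q = 0 \<longrightarrow> q \<in> S"
    by (elim exE conjE)
  have F0: "F q = 0" and UF: "U q F > 0" if "q \<in> S" for q using bspec[OF F(2) that] by simp_all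
  let ?k0 = "(\<lambda>q. 1 / lam q) \<odot> \<xi>'"
  have k0: "?k0 \<in> VF" unfolding lam by (rule vf_fscale[OF smooth_speed_inverse[OF U tl] \<xi>'(1)])
  have "\<exists>k\<in>VF. \<forall>q\<in>S. k q = ?k0 q \<and> lie_bracket U k q = 0"
    by (rule adapted_null_field[OF cS U F(1) F0 UF k0])
  then obtain k where k: "k \<in> VF" "\<forall>q\<in>S. k q = ?k0 q \<and> lie_bracket U k q = 0"
    by (elim bexE)
  have kq: "k q = (1 / lam q) *\<^sub>R \<xi> q" if "q \<in> S" for q
    using bspec[OF k(2) that] bspec[OF \<xi>'(2) that] by (simp add: fscale_apply)
  have \<xi>k: "\<xi> q = lam q *\<^sub>R k q" if "q \<in> S" for q unfolding kq[OF that] using lpos[of q] by (simp add: fun_eq_iff)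
  have perp: "g q v (k q) = 0 \<longleftrightarrow> g q v (\<xi> q) = 0" if "q \<in> S" "v \<in> T q" for q v
    unfolding kq[OF that(1)] using that \<xi>T lpos[of q] by (simp add: g_right)
  interpret H: Killing_lightlike A g D U k S F N0 "1 / sqrt 2"
  proof
    show "g q (k q) (k q) = 0" if "q \<in> S" for q
      unfolding kq[OF that] using \<xi>0[OF that] \<xi>T[OF that] by (simp add: g_scale g_right)
    show "g q (U q) (k q) = 1 / sqrt 2" if "q \<in> S" for q
      unfolding kq[OF that] using \<xi>U[OF that] \<xi>T[OF that] Ut[of q] lpos[of q] g_sym[OF \<xi>T[OF that] Ut] by (simp add: g_right)
    show "lie_bracket U k q = 0" if "q \<in> S" for q using bspec[OF k(2) that] by simp
    show "tangent_space_of A S q = {v \<in> T q. g q v (k q) = 0}" if "q \<in> S" for q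
      unfolding TS[OF that] using perp[OF that] by blast
    show "q \<in> S" if "q \<in> N0" "F q = 0" for q using N0(3) that by blast
  qed (use K tl cS F(1) F0 UF N0(1,2) k(1) in simp_all)
  have along: "g q (cov_deriv_along A D S q v \<xi>) w = lam q * g q (cov q v k) w"
    if q: "q \<in> S" and v: "v \<in> T q" "g q v (k q) = 0" and w: "w \<in> T q" "g q w (k q) = 0" for q v w
  proof -
    let ?X = "SOME X. X \<in> VF \<and> (\<forall>q\<in>S. X q = \<xi> q)"
    have "?X \<in> VF \<and> (\<forall>q\<in>S. ?X q = \<xi> q)"
      by (rule someI[of "\<lambda>X. X \<in> VF \<and> (\<forall>q\<in>S. X q = \<xi> q)" \<xi>']) (use \<xi>' in simp)
    then have X: "?X \<in> VF" "\<forall>q\<in>S. ?X q = \<xi> q" by simp_all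
    have lk: "lam \<odot> k \<in> VF" unfolding lam by (rule vf_fscale[OF smooth_speed[OF U tl] k(1)])
    have eq: "?X r = (lam \<odot> k) r" if "r \<in> S" for r
      using bspec[OF X(2) that] \<xi>k[OF that] by (simp only: fscale_apply)
    have "cov q v ?X = cov q v (lam \<odot> k)"
    proof (rule cov_local[OF v(1) X(1) lk eq[OF q]])
      fix f assume f: "smooth f"
      have s: "smooth (\<lambda>q. ?X q f)" "smooth (\<lambda>q. (lam \<odot> k) q f)" using vf_smooth[OF X(1) f] vf_smooth[OF lk f] .
      have "v (\<lambda>q. ?X q f - (lam \<odot> k) q f) = 0"
        by (rule H.derivative_tangential[OF q v smooth_diff[OF s]]) (simp only: eq diff_self)
      then show "v (\<lambda>q. ?X q f) = v (\<lambda>q. (lam \<odot> k) q f)" unfolding tangent_diff[OF v(1) s] by simp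
    qed
    also have "\<dots> = v lam *\<^sub>R k q + lam q *\<^sub>R cov q v k"
      unfolding lam by (rule cov_field_fscale[OF v(1) k(1) smooth_speed[OF U tl]])
    finally have "g q (cov q v ?X) w = v lam * g q (k q) w + lam q * g q (cov q v k) w"
      using v w k(1) by (simp only: g_add g_scale tangent_space_scale cov_tangent H.kU_tangent)
    then show ?thesis
      unfolding cov_deriv_along_def using w g_sym[OF w(1) H.kU_tangent(1)] by simp
  qed
  have mean: "lightlike_mean_curvature A g D S E \<xi> q = - lam q * dv k q" if q: "q \<in> S" for q
  proof -
    have "screen A g S E q = H.screen_at q"
    proof -
      have "g q v (E q) = 0 \<longleftrightarrow> g q v (U q) = 0" if "v \<in> T q" for v
        unfolding Eq using that Ut[of q] lpos[of q] by (simp add: g_right)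
      then show ?thesis unfolding screen_def H.screen_at_def H.tangent_S[OF q] by blast
    qed
    moreover define B where "B = (SOME B. orthonormal_basis (g q) (H.screen_at q) B)"
    ultimately have 1: "lightlike_mean_curvature A g D S E \<xi> q = (\<Sum>e\<in>B. second_fundamental_form A g D S \<xi> (\<lambda>_. e) (\<lambda>_. e) q)"
      unfolding lightlike_mean_curvature_def by simp
    have B: "orthonormal_basis (g q) (H.screen_at q) B"
      unfolding B_def by (rule someI_ex[OF H.screen_basis_exists])
    have "second_fundamental_form A g D S \<xi> (\<lambda>_. e) (\<lambda>_. e) q = - lam q * g q (cov q e k) e" if "e \<in> B" for e
      unfolding second_fundamental_form_def
      using along[OF q] H.screen_basis(1,2)[OF B that] by simp
    then show ?thesis
      unfolding 1 H.dv_k_screen[OF q B] sum_distrib_left by (intro sum.cong refl)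
  qed
  have ln_lam: "(\<lambda>q. ln (lam q)) = (\<lambda>q. ln (speed U q))" by (simp only: lam)
  have grad: "g q (gradient A g (\<lambda>q. ln (lam q)) q) (\<xi> q) = lam q * k q (\<lambda>q. ln (speed U q))" if q: "q \<in> S" for q
    unfolding ln_lam gradient_ln_speed[OF K tl] speed_gradient[OF K tl \<xi>T[OF q]]
    using \<xi>k[OF q] by simp
  have i: "lightlike_mean_curvature A g D S E \<xi> q - g q (gradient A g (\<lambda>q. ln (lam q)) q) (\<xi> q) =
      - (lam q * (dv k q + k q (\<lambda>q. ln (speed U q))))" if "q \<in> S" for q
    unfolding mean[OF that] grad[OF that] by (simp add: distrib_left)
  have sign: "(\<forall>q\<in>S. dv k q + k q (\<lambda>q. ln (speed U q)) \<ge> 0) \<or> (\<forall>q\<in>S. dv k q + k q (\<lambda>q. ln (speed U q)) \<le> 0)"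
    using assms(14)
  proof
    assume *: "\<forall>p\<in>S. lightlike_mean_curvature A g D S E \<xi> p - g p (gradient A g (\<lambda>q. ln (lam q)) p) (\<xi> p) \<ge> 0"
    have "dv k q + k q (\<lambda>q. ln (speed U q)) \<le> 0" if "q \<in> S" for q
      using bspec[OF * that] lpos[of q] unfolding i[OF that] by (simp only: neg_0_le_iff_le mult_le_0_iff) linarith
    then show ?thesis by blast
  next
    assume *: "\<forall>p\<in>S. lightlike_mean_curvature A g D S E \<xi> p - g p (gradient A g (\<lambda>q. ln (lam q)) p) (\<xi> p) \<le> 0"
    have "dv k q + k q (\<lambda>q. ln (speed U q)) \<ge> 0" if "q \<in> S" for q
      using bspec[OF * that] lpos[of q] unfolding i[OF that] by (simp only: neg_le_0_iff_le zero_le_mult_iff) linarith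
    then show ?thesis by blast
  qed
  have curv: "0 \<le> speed U q * speed U q * Ric q (k q) (k q) + sqrt 2 * Ric q (k q) (U q) + laplacian A g D (\<lambda>q. ln (speed U q)) q"
    if q: "q \<in> S" for q
  proof -
    have Nq: "N q = (sqrt 2 / lam q) *\<^sub>R U q + lam q *\<^sub>R k q"
    proof -
      have gm: "g q (- \<xi> q) (E q) = - (1 / sqrt 2)" using g_uminus[OF \<xi>T[OF q] vf_tangent[OF EV]] \<xi>E[OF q] by simp
      have m: "tscale (-1) (\<xi> q) = - \<xi> q" by (simp add: tscale_def fun_eq_iff)
      have r: "1 / sqrt 2 + 1 / sqrt 2 = sqrt (2::real)" by (simp add: real_div_sqrt)
      have "N q = (1 / sqrt 2) *\<^sub>R E q - (- \<xi> q - (1 / sqrt 2) *\<^sub>R E q)"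
        using bspec[OF assms(13) q] gm unfolding symmetric_wrt_def perp_part_def m by (simp add: tvec_ops)
      also have "\<dots> = (1 / sqrt 2 + 1 / sqrt 2) *\<^sub>R E q + \<xi> q" by (simp only: scaleR_add_left) simp
      also have "\<dots> = sqrt 2 *\<^sub>R E q + \<xi> q" unfolding r ..
      finally show ?thesis unfolding Eq \<xi>k[OF q] by simp
    qed
    have lk: "lam \<odot> k \<in> VF" unfolding lam by (rule vf_fscale[OF smooth_speed[OF U tl] k(1)])
    have Ric_right: "Ric q (X q) (lam q *\<^sub>R k q) = lam q * Ric q (X q) (k q)" if X: "X \<in> VF" for X
    proof -
      have "Ric q (X q) (lam q *\<^sub>R k q) = Ric q (X q) ((lam \<odot> k) q)" by (simp only: fscale_apply)
      also have "\<dots> = Ric q (lam q *\<^sub>R k q + 0 *\<^sub>R k q) (X q)" unfolding Ric_sym[OF X lk] by (simp add: fscale_apply)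
      also have "\<dots> = lam q * Ric q (k q) (X q)" using Ric_lin[OF k(1) k(1) X, where a = "lam q" and b = 0] by simp
      finally show ?thesis using Ric_sym[OF X k(1)] by simp
    qed
    have "Ric q (N q) (\<xi> q) = (sqrt 2 / lam q) * Ric q (U q) (lam q *\<^sub>R k q) + lam q * Ric q (k q) (lam q *\<^sub>R k q)"
      unfolding Nq \<xi>k[OF q] using Ric_lin[OF U k(1) lk] by (simp only: fscale_apply)
    also have "\<dots> = sqrt 2 * Ric q (k q) (U q) + lam q * lam q * Ric q (k q) (k q)"
      unfolding Ric_right[OF U] Ric_right[OF k(1)] Ric_sym[OF U k(1)] using lpos[of q] by simp
    finally have ric: "Ric q (N q) (\<xi> q) = sqrt 2 * Ric q (k q) (U q) + lam q * lam q * Ric q (k q) (k q)" .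
    have ET: "E q \<in> T q" by (rule vf_tangent[OF EV])
    have "X\<^sub>0 q \<in> T q"
      unfolding bspec[OF assms(12) q] perp_part_def tvec_ops using \<xi>T[OF q] ET by simp
    then have a: "cov q (X\<^sub>0 q) E \<in> T q" and a': "X\<^sub>0 q \<in> T q" using EV by simp_all
    have "X\<^sub>0 q (\<lambda>q. g q (E q) (E q)) = 0" unfolding gEE by (rule tangent_const[OF a'])
    then have "g q (E q) (cov q (X\<^sub>0 q) E) = 0"
      unfolding cov_metric[OF a' EV EV] using g_sym[OF a ET] by simp
    then have "0 \<le> g q (cov q (X\<^sub>0 q) E) (cov q (X\<^sub>0 q) E)"
      using gEE[of q] by (intro timelike_orthogonal(1)[OF ET _ a]) simp_all
    then show ?thesis using bspec[OF assms(15) q] unfolding ric ln_lam lam by simp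
  qed
  show ?thesis
    unfolding totally_geodesic_def
  proof (intro ballI)
    fix V W p assume V: "V \<in> vector_fields_of A S" and W: "W \<in> vector_fields_of A S" and p: "p \<in> S"
    have "V p \<in> tangent_space_of A S p" "W p \<in> tangent_space_of A S p"
      using V W p by (simp_all add: vector_fields_of_def)
    then have vw: "V p \<in> T p" "g p (V p) (k p) = 0" "W p \<in> T p" "g p (W p) (k p) = 0"
      unfolding H.tangent_S[OF p] by simp_all
    have "g p (cov p (V p) k) (W p) = 0" by (rule H.totally_geodesic_null_field[OF sign curv p vw])
    then show "second_fundamental_form A g D S \<xi> V W p = 0"
      unfolding second_fundamental_form_def along[OF p vw] by simp
  qed
qed

end
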